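(* (1) For any free-connex acyclic conjunctive regular path query (CRPQ) $Q$, the contraction width satisfies $\mathsf{cw}(Q)=0$. (2) Any free-connex acyclic CRPQ $Q$ can be evaluated over edge-labeled graphs $G=(V,E,\Sigma)$ in $$\mathcal{O}\big(|E| + |E|\cdot \mathsf{OUT}_c^{1/2} + \mathsf{OUT}\big)$$ data complexity, where $\mathsf{OUT}$ is the size of the output of $Q$ over $G$ and $\mathsf{OUT}_c$ is the maximum size of the calibrated output of any RPQ in $Q$. That is, for every fixed free-connex acyclic CRPQ $Q$ there is an algorithm that, given any edge-labeled graph $G=(V,E,\Sigma)$, computes the output of $Q$ over $G$ within this time bound, where the constant hidden in $\mathcal{O}(\cdot)$ may depend on $Q$ but not on $G$.
   Context: **Graphs.** An edge-labeled graph is $G=(V,E,\Sigma)$ with $V$ a finite set of vertices, $\Sigma$ a finite alphabet, and $E\subseteq V\times\Sigma\times V$ a set of directed labeled edges. Every vertex is assumed to have at least one incident edge. A path from $u$ to $v$ is a sequence of vertices $u=w_0,w_1,\ldots,w_k=v$ and symbols $\sigma_1,\ldots,\sigma_k$, $k\ge 0$, with $(w_{i-1},\sigma_i,w_i)\in E$ for all $i\in\{1,\ldots,k\}$; its label is the string $\sigma_1\cdots\sigma_k$. **Queries.** A regular path query (RPQ) over $\Sigma$ is a regular expression $r$ over $\Sigma$ with language $L(r)$. A CRPQ has the form $Q(\boldsymbol F)=r_1(X_1,Y_1)\wedge\cdots\wedge r_n(X_n,Y_n)$, where each $r_i$ is an RPQ, each $r_i(X_i,Y_i)$ is called an atom,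 $\mathrm{vars}(Q)=\{X_i,Y_i\mid i\in\{1,\ldots,n\}\}$, $\mathrm{free}(Q)=\boldsymbol F\subseteq \mathrm{vars}(Q)$ are the free variables, and $\mathrm{bound}(Q)=\mathrm{vars}(Q)\setminus\mathrm{free}(Q)$ are the bound variables. The conjunction of atoms is the body of $Q$. The output of $Q$ over $G$ is the set of all mappings $\mu:\mathrm{free}(Q)\to V$ that extend to a mapping $\mu':\mathrm{vars}(Q)\to V$ such that for every $i$, $G$ has a path from $\mu'(X_i)$ to $\mu'(Y_i)$ labeled by a string in $L(r_i)$. The calibrated output of the RPQ $r_i$ in atom $r_i(X_i,Y_i)$ of $Q$ is the projection of the output of $Q$ over $G$ onto the free variables among $X_i,Y_i$; if both variables are bound, the calibrated output is taken to be empty. **Acyclicity.** The query graph $G_Q$ of $Q$ is the undirected multigraph with vertex set $\mathrm{vars}(Q)$ and one edge $\{X_i,Y_i\}$ per atom. $Q$ is acyclic if $G_Q$ is a forest (no cycles, self-loops or parallel edges). An acyclic $Q$ is free-connex if in each tree of $G_Q$ the free variables occurring in that tree form a connected subtree. **Contracted query graph.** For a cycle-free undirected graph $H=(V_H,E_H)$, two elimination operations are defined. (i) A vertex $u$ of degree 2 with neighbors $v_1\neq v_2$: remove $u$ and the edges $\{u,v_1\},\{u,v_2\}$ and add the edge $\{v_1,v_2\}$. (ii) A vertex $u$ of degree 1 with neighbor $v$: remove $u$ and the edge $\{u,v\}$, and also remove $v$ if $v$ has no neighbor other than $u$. Let $\mathrm{eliminate}(H,u)$ be the resulting graph. An elimination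 order for an acyclic CRPQ $Q$ is a sequence $(X_1,\ldots,X_k)$ of bound variables for which there are graphs $G_0=G_Q$ and $G_i=\mathrm{eliminate}(G_{i-1},X_i)$ for $i\in\{1,\ldots,k\}$ such that all bound variables in $G_k$ have degree at least 3. The graph $G_k$ does not depend on the elimination order; it is called the contracted query graph of $Q$ and denoted $\mathsf{cg}(Q)$. **Contraction width.** A tree decomposition of $Q$ is a pair $\mathcal T=(T,\chi)$ with $T$ a tree and $\chi:V(T)\to 2^{\mathrm{vars}(Q)}$ such that for every atom $r(X,Y)$ there is $t$ with $X,Y\in\chi(t)$, and for every variable $X$ the set $\{t\mid X\in\chi(t)\}$ is a non-empty connected subtree of $T$. The sets $\chi(t)$ are the bags. $\mathcal T$ is free-connex if $T$ contains a connected subtree such that the union of the bags in it is exactly $\mathrm{free}(Q)$; $\mathsf{FTD}(Q)$ is the set of free-connex tree decompositions of $Q$. The CRPQ $Q_{\mathcal B}$ induced by a bag $\mathcal B$ has the same body as $Q$ and free variables $\mathrm{free}(Q)\cap\mathcal B$. Define $$\mathsf{cw}(Q)=\min_{\mathcal T\in\mathsf{FTD}(Q)}\mathsf{cw}(\mathcal T),\qquad \mathsf{cw}(\mathcal T)=\max_{\mathcal B\in\mathrm{bags}(\mathcal T)}|\mathrm{bound}(\mathsf{cg}(Q_{\mathcal B}))|,$$ where $\mathrm{bound}(\mathsf{cg}(Q_{\mathcal B}))$ is the set of bound variables of $Q_{\mathcal B}$ that occur as vertices in $\mathsf{cg}(Q_{\mathcal B})$. **Computational model.** Data complexity: the query is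 fixed and of constant size. The RAM model is used; each materialized relation over $V$ is assumed to be stored in a data structure that supports constant-time tuple lookup and constant-delay enumeration of its tuples. *)

theory Defs
  imports Complex_Main "HOL-Library.FuncSet" "HOL-Library.Extended_Nat"
begin

section \<open>Edge-labeled graphs and conjunctive regular path queries\<close>

record ('v, 'a) lgraph =
  verts :: "'v set"
  edges :: "('v \<times> 'a \<times> 'v) set"
  alphabet :: "'a set"

definition edge_labeled_graph :: "('v, 'a) lgraph \<Rightarrow> bool" where
  "edge_labeled_graph G \<longleftrightarrow>
     finite (verts G) \<and> finite (alphabet G) \<and>
     edges G \<subseteq> verts G \<times> alphabet G \<times> verts G \<and>
     (\<forall>u\<in>verts G. \<exists>(x, a, y)\<in>edges G. u = x \<or> u = y)"

definition has_path :: "('v, 'a) lgraph \<Rightarrow> 'v \<Rightarrow> 'a list \<Rightarrow> 'v \<Rightarrow> bool" where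
  "has_path G u w v \<longleftrightarrow>
     (\<exists>ws. length ws = Suc (length w) \<and> set ws \<subseteq> verts G \<and>
           ws ! 0 = u \<and> ws ! length w = v \<and>
           (\<forall>i<length w. (ws ! i, w ! i, ws ! Suc i) \<in> edges G))"

datatype 'a rexp =
    REmpty
  | REps
  | RSym 'a
  | RAlt "'a rexp" "'a rexp"
  | RCat "'a rexp" "'a rexp"
  | RStar "'a rexp"

primrec lang :: "'a rexp \<Rightarrow> 'a list set" where
  "lang REmpty = {}"
| "lang REps = {[]}"
| "lang (RSym a) = {[a]}"
| "lang (RAlt r s) = lang r \<union> lang s"
| "lang (RCat r s) = {u @ v | u v. u \<in> lang r \<and> v \<in> lang s}"
| "lang (RStar r) = {concat ws | ws. set ws \<subseteq> lang r}"

text \<open>The body is a list, so that repeated atoms count as parallel edges of the query graph.\<close>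

record ('x, 'a) crpq =
  body :: "('x \<times> 'a rexp \<times> 'x) list"
  free :: "'x set"

definition vars :: "('x, 'a) crpq \<Rightarrow> 'x set" where
  "vars Q = (\<Union>(X, r, Y)\<in>set (body Q). {X, Y})"

definition bound :: "('x, 'a) crpq \<Rightarrow> 'x set" where
  "bound Q = vars Q - free Q"

definition is_crpq :: "('x, 'a) crpq \<Rightarrow> bool" where
  "is_crpq Q \<longleftrightarrow> free Q \<subseteq> vars Q"

definition query_output :: "('x, 'a) crpq \<Rightarrow> ('v, 'a) lgraph \<Rightarrow> ('x \<Rightarrow> 'v) set" where
  "query_output Q G =
     {\<mu> \<in> free Q \<rightarrow>\<^sub>E verts G.
        \<exists>\<mu>' \<in> vars Q \<rightarrow>\<^sub>E verts G.
          (\<forall>X\<in>free Q. \<mu>' X = \<mu> X) \<and>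
          (\<forall>(X, r, Y)\<in>set (body Q). \<exists>w\<in>lang r. has_path G (\<mu>' X) w (\<mu>' Y))}"

definition calibrated_output ::
    "('x, 'a) crpq \<Rightarrow> ('v, 'a) lgraph \<Rightarrow> 'x \<times> 'a rexp \<times> 'x \<Rightarrow> ('x \<Rightarrow> 'v) set" where
  "calibrated_output Q G = (\<lambda>(X, r, Y).
     if free Q \<inter> {X, Y} = {} then {}
     else (\<lambda>\<mu>. restrict \<mu> (free Q \<inter> {X, Y})) ` query_output Q G)"

definition OUT :: "('x, 'a) crpq \<Rightarrow> ('v, 'a) lgraph \<Rightarrow> nat" where
  "OUT Q G = card (query_output Q G)"

text \<open>The inserted 0 only matters for a query without atoms.\<close>

definition OUT\<^sub>c :: "('x, 'a) crpq \<Rightarrow> ('v, 'a) lgraph \<Rightarrow> nat" where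
  "OUT\<^sub>c Q G = Max (insert 0 ((\<lambda>A. card (calibrated_output Q G A)) ` set (body Q)))"


section \<open>Undirected graphs\<close>

record 'x ugraph =
  nodes :: "'x set"
  links :: "'x set set"

definition neighbors :: "'x ugraph \<Rightarrow> 'x \<Rightarrow> 'x set" where
  "neighbors H u = {v \<in> nodes H. {u, v} \<in> links H}"

definition degree :: "'x ugraph \<Rightarrow> 'x \<Rightarrow> nat" where
  "degree H u = card (neighbors H u)"

definition connected_in :: "'x ugraph \<Rightarrow> 'x set \<Rightarrow> bool" where
  "connected_in H S \<longleftrightarrow>
     S \<subseteq> nodes H \<and>
     (\<forall>u\<in>S. \<forall>v\<in>S. (u, v) \<in> {(a, b). a \<in> S \<and> b \<in> S \<and> {a, b} \<in> links H}\<^sup>*)"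

definition component_of :: "'x ugraph \<Rightarrow> 'x \<Rightarrow> 'x set" where
  "component_of H u =
     {v. (u, v) \<in> {(a, b). a \<in> nodes H \<and> b \<in> nodes H \<and> {a, b} \<in> links H}\<^sup>*}"

definition components :: "'x ugraph \<Rightarrow> 'x set set" where
  "components H = component_of H ` nodes H"

definition is_cycle :: "'x ugraph \<Rightarrow> 'x list \<Rightarrow> bool" where
  "is_cycle H vs \<longleftrightarrow>
     length vs \<ge> 3 \<and> distinct vs \<and> set vs \<subseteq> nodes H \<and>
     (\<forall>i<length vs. {vs ! i, vs ! (Suc i mod length vs)} \<in> links H)"

definition is_tree :: "'x ugraph \<Rightarrow> bool" where
  "is_tree T \<longleftrightarrow>
     finite (nodes T) \<and> nodes T \<noteq> {} \<and>
     (\<forall>e\<in>links T. e \<subseteq> nodes T \<and> card e = 2) \<and>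
     connected_in T (nodes T) \<and> (\<nexists>vs. is_cycle T vs)"


section \<open>Acyclicity and the contracted query graph\<close>

text \<open>
  The simple graph underlying the query multigraph. Self-loops and parallel edges of the
  multigraph are excluded separately in the definition of acyclicity.
\<close>

definition query_graph :: "('x, 'a) crpq \<Rightarrow> 'x ugraph" where
  "query_graph Q = \<lparr>nodes = vars Q, links = (\<lambda>(X, r, Y). {X, Y}) ` set (body Q)\<rparr>"

definition acyclic_crpq :: "('x, 'a) crpq \<Rightarrow> bool" where
  "acyclic_crpq Q \<longleftrightarrow>
     (\<forall>(X, r, Y)\<in>set (body Q). X \<noteq> Y) \<and>
     distinct (map (\<lambda>(X, r, Y). {X, Y}) (body Q)) \<and>
     (\<nexists>vs. is_cycle (query_graph Q) vs)"

definition free_connex :: "('x, 'a) crpq \<Rightarrow> bool" where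
  "free_connex Q \<longleftrightarrow>
     acyclic_crpq Q \<and>
     (\<forall>C\<in>components (query_graph Q). connected_in (query_graph Q) (free Q \<inter> C))"

inductive eliminates :: "'x ugraph \<Rightarrow> 'x \<Rightarrow> 'x ugraph \<Rightarrow> bool" where
  deg2: "\<lbrakk>u \<in> nodes H; neighbors H u = {v1, v2}; v1 \<noteq> v2\<rbrakk> \<Longrightarrow>
    eliminates H u
      \<lparr>nodes = nodes H - {u}, links = links H - {{u, v1}, {u, v2}} \<union> {{v1, v2}}\<rparr>"
| deg1_keep: "\<lbrakk>u \<in> nodes H; neighbors H u = {v}; neighbors H v \<noteq> {u}\<rbrakk> \<Longrightarrow>
    eliminates H u \<lparr>nodes = nodes H - {u}, links = links H - {{u, v}}\<rparr>"
| deg1_drop: "\<lbrakk>u \<in> nodes H; neighbors H u = {v}; neighbors H v = {u}\<rbrakk> \<Longrightarrow>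
    eliminates H u \<lparr>nodes = nodes H - {u, v}, links = links H - {{u, v}}\<rparr>"

text \<open>\<open>elimination_order Q Xs H\<close>: \<open>Xs\<close> is an elimination order for \<open>Q\<close> whose last graph is \<open>H\<close>.\<close>

definition elimination_order :: "('x, 'a) crpq \<Rightarrow> 'x list \<Rightarrow> 'x ugraph \<Rightarrow> bool" where
  "elimination_order Q Xs H \<longleftrightarrow>
     set Xs \<subseteq> bound Q \<and>
     (\<exists>Gs. length Gs = Suc (length Xs) \<and> Gs ! 0 = query_graph Q \<and>
        (\<forall>i<length Xs. eliminates (Gs ! i) (Xs ! i) (Gs ! Suc i)) \<and>
        Gs ! length Xs = H) \<and>
     (\<forall>X\<in>bound Q \<inter> nodes H. degree H X \<ge> 3)"

text \<open>
  Meaningful for acyclic queries only; for these the last graph does not depend on the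
  elimination order, so the choice is immaterial.
\<close>

definition cg :: "('x, 'a) crpq \<Rightarrow> 'x ugraph" where
  "cg Q = (SOME H. \<exists>Xs. elimination_order Q Xs H)"


section \<open>Contraction width\<close>

text \<open>Finite trees over \<^typ>\<open>nat\<close> represent all finite trees up to isomorphism.\<close>

type_synonym 'x tree_decomp = "nat ugraph \<times> (nat \<Rightarrow> 'x set)"

definition tree_decomposition :: "('x, 'a) crpq \<Rightarrow> 'x tree_decomp \<Rightarrow> bool" where
  "tree_decomposition Q = (\<lambda>(T, \<chi>).
     is_tree T \<and>
     (\<forall>t\<in>nodes T. \<chi> t \<subseteq> vars Q) \<and>
     (\<forall>(X, r, Y)\<in>set (body Q). \<exists>t\<in>nodes T. X \<in> \<chi> t \<and> Y \<in> \<chi> t) \<and>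
     (\<forall>X\<in>vars Q. {t \<in> nodes T. X \<in> \<chi> t} \<noteq> {} \<and> connected_in T {t \<in> nodes T. X \<in> \<chi> t}))"

definition FTD :: "('x, 'a) crpq \<Rightarrow> 'x tree_decomp set" where
  "FTD Q = {(T, \<chi>). tree_decomposition Q (T, \<chi>) \<and>
     (\<exists>S. S \<noteq> {} \<and> connected_in T S \<and> (\<Union>t\<in>S. \<chi> t) = free Q)}"

definition induced_query :: "('x, 'a) crpq \<Rightarrow> 'x set \<Rightarrow> ('x, 'a) crpq" where
  "induced_query Q B = \<lparr>body = body Q, free = free Q \<inter> B\<rparr>"

definition cw_decomp :: "('x, 'a) crpq \<Rightarrow> 'x tree_decomp \<Rightarrow> nat" where
  "cw_decomp Q = (\<lambda>(T, \<chi>).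
     Max ((\<lambda>B. card (bound (induced_query Q B) \<inter> nodes (cg (induced_query Q B)))) ` \<chi> ` nodes T))"

text \<open>
  With values in \<^typ>\<open>enat\<close> the infimum is the minimum if a free-connex tree decomposition
  exists, and \<open>\<infinity>\<close> otherwise.
\<close>

definition cw :: "('x, 'a) crpq \<Rightarrow> enat" where
  "cw Q = (INF D\<in>FTD Q. enat (cw_decomp Q D))"


section \<open>Random access machine\<close>

text \<open>
  A uniform-cost RAM: a program uses finitely many registers and one infinite memory of natural
  numbers, which is zero outside the input. The only arithmetic is addition and truncated
  subtraction; in particular there is no unit-cost multiplication. Indirect addressing into the
  zero-initialised memory provides constant-time lookup tables without initialisation cost.
  Control flow is structured; translating it to jumps changes running times by a constant
  factor only. \<open>Emit rs\<close> appends the tuple of the contents of \<open>rs\<close> to the output.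
\<close>

type_synonym reg = nat

datatype prog =
    Skip
  | Const reg nat
  | Add reg reg reg
  | Sub reg reg reg
  | Load reg reg
  | Store reg reg
  | Emit "reg list"
  | Seq prog prog
  | IfNZ reg prog prog
  | WhileNZ reg prog

record ram =
  regs :: "reg \<Rightarrow> nat"
  mem :: "nat \<Rightarrow> nat"
  out :: "nat list list"

abbreviation set_reg :: "ram \<Rightarrow> reg \<Rightarrow> nat \<Rightarrow> ram" where
  "set_reg s x n \<equiv> s\<lparr>regs := (regs s)(x := n)\<rparr>"

text \<open>\<open>exec p s t s'\<close>: started in \<open>s\<close>, program \<open>p\<close> halts in \<open>s'\<close> after \<open>t\<close> steps.\<close>

inductive exec :: "prog \<Rightarrow> ram \<Rightarrow> nat \<Rightarrow> ram \<Rightarrow> bool" where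
  Skip: "exec Skip s 1 s"
| Const: "exec (Const x n) s 1 (set_reg s x n)"
| Add: "exec (Add x y z) s 1 (set_reg s x (regs s y + regs s z))"
| Sub: "exec (Sub x y z) s 1 (set_reg s x (regs s y - regs s z))"
| Load: "exec (Load x y) s 1 (set_reg s x (mem s (regs s y)))"
| Store: "exec (Store x y) s 1 (s\<lparr>mem := (mem s)(regs s x := regs s y)\<rparr>)"
| Emit: "exec (Emit rs) s (1 + length rs) (s\<lparr>out := out s @ [map (regs s) rs]\<rparr>)"
| Seq: "\<lbrakk>exec p s t s'; exec q s' t' s''\<rbrakk> \<Longrightarrow> exec (Seq p q) s (t + t') s''"
| IfTrue: "\<lbrakk>regs s x \<noteq> 0; exec p s t s'\<rbrakk> \<Longrightarrow> exec (IfNZ x p q) s (1 + t) s'"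
| IfFalse: "\<lbrakk>regs s x = 0; exec q s t s'\<rbrakk> \<Longrightarrow> exec (IfNZ x p q) s (1 + t) s'"
| WhileFalse: "regs s x = 0 \<Longrightarrow> exec (WhileNZ x p) s 1 s"
| WhileTrue: "\<lbrakk>regs s x \<noteq> 0; exec p s t s'; exec (WhileNZ x p) s' t' s''\<rbrakk> \<Longrightarrow>
    exec (WhileNZ x p) s (1 + t + t') s''"

text \<open>
  Vertices and symbols are numbers. The input is the number of edges followed by the edges in an
  arbitrary order, three cells per edge; the vertices are those incident to an edge.
\<close>

definition encode_edges :: "(nat \<times> nat \<times> nat) list \<Rightarrow> nat list" where
  "encode_edges es = length es # concat (map (\<lambda>(u, a, v). [u, a, v]) es)"

definition initial :: "nat list \<Rightarrow> ram" where
  "initial w = \<lparr>regs = (\<lambda>_. 0), mem = (\<lambda>i. if i < length w then w ! i else 0), out = []\<rparr>"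

text \<open>
  Started on the edge list \<open>es\<close>, the program halts after \<open>t\<close> steps, having emitted every output
  mapping exactly once, as the tuple of its values on the list \<open>Xs\<close> of the free variables.
\<close>

definition computes_output ::
    "prog \<Rightarrow> ('x, nat) crpq \<Rightarrow> 'x list \<Rightarrow> (nat, nat) lgraph \<Rightarrow> (nat \<times> nat \<times> nat) list \<Rightarrow> nat \<Rightarrow> bool"
  where
  "computes_output p Q Xs G es t \<longleftrightarrow>
     (\<exists>s. exec p (initial (encode_edges es)) t s \<and> distinct (out s) \<and>
          set (out s) = (\<lambda>\<mu>. map \<mu> Xs) ` query_output Q G)"

end

theory Submission
  imports Defs "HOL-Library.Multiset"
begin

text \<open>
  A forest whose free vertices meet every tree in a connected set can be rooted so that the parent
  of a free vertex is free. The bags \<open>{X, parent of X}\<close> form a free-connex tree decomposition; each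
  has at most two elements, and a nonempty forest with at most two leaves has no vertex of degree
  at least 3, so nothing bound survives the eliminations.

  For the evaluation, atoms become reachability questions in the product of the graph with the
  disjoint union of the automata of all atoms and of their reversals. Two passes of linear-time
  semijoins along the rooted forest remove all values that do not occur in a solution. After that,
  the relation between a free variable and its free parent is exactly a set of pairs extendable to
  output tuples, hence of size \<open>R \<le> OUT\<^sub>c\<close>. It is computed in time \<open>O(|E| R\<^sup>1\<^sup>/\<^sup>2)\<close>: propagate up to
  \<open>D\<close> different targets backwards to every node, and double \<open>D\<close> until at most \<open>D\<close> values of the
  parent are heavy, that is, see at least \<open>D\<close> targets. If this fails for \<open>D\<close>, then \<open>D * D \<le> R\<close>. Light
  values have their complete list of partners, and the lists of the heavy values result from
  propagating these at most \<open>D\<close> values forwards. Finally the output is enumerated from the root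
  along the lists, without dead ends.
\<close>

section \<open>An array language with a cost counter\<close>

text \<open>The size \<open>OUT\<^sub>c\<close> is unknown in advance and the machine can neither
  multiply nor take roots. So the threshold must be found by doubling, and the time bound speaks of
  some \<open>d\<close> with \<open>d = 1\<close> or \<open>d * d \<le> 4 * R\<close> instead of a
  computed root. Truncation does no harm because tags are passed on along every edge: if a node
  holds \<open>D\<close> different tags, so do all nodes below it, and a node that ends with fewer
  than \<open>D\<close> tags has lost none. The reversed automata are there because predecessors
  must be searched while adjacency lists are only read forwards. A virtual root joins the trees of
  the forest: the values of an ordinary root then form a binary relation like all others, and a tree
  without solutions empties the whole result through the root. Termination and time are handled
  together by keeping the clock in the state, where invariants can weigh it against a
  potential.\<close>

datatype ex = Lit nat | Var nat | Plus ex ex | Minus ex ex | Scale nat ex | Rd nat ex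

datatype cm = Pass | Asg nat ex (infix "::=" 62) | Sto nat ex ex | Put "nat list"
  | Sq cm cm (infixr ";;" 60) | Cond ex cm cm | Loop ex cm

record st =
  rg :: "nat \<Rightarrow> nat"
  ar :: "nat \<Rightarrow> nat \<Rightarrow> nat"
  ou :: "nat list list"
  tm :: nat

primrec val :: "st \<Rightarrow> ex \<Rightarrow> nat" where
  "val s (Lit n) = n"
| "val s (Var x) = rg s x"
| "val s (Plus e f) = val s e + val s f"
| "val s (Minus e f) = val s e - val s f"
| "val s (Scale k e) = k * val s e"
| "val s (Rd a e) = ar s a (val s e)"

definition tick :: "st \<Rightarrow> st" where "tick s = s\<lparr>tm := Suc (tm s)\<rparr>"

lemma tick_simps [simp]: "rg (tick s) = rg s" "ar (tick s) = ar s" "ou (tick s) = ou s"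
  "tm (tick s) = Suc (tm s)"
  by (auto simp: tick_def)

definition upd_reg :: "nat \<Rightarrow> nat \<Rightarrow> st \<Rightarrow> st" where
  "upd_reg x n s = s\<lparr>rg := (rg s)(x := n), tm := Suc (tm s)\<rparr>"

definition upd_arr :: "nat \<Rightarrow> nat \<Rightarrow> nat \<Rightarrow> st \<Rightarrow> st" where
  "upd_arr a i n s = s\<lparr>ar := (ar s)(a := (ar s a)(i := n)), tm := Suc (tm s)\<rparr>"

definition upd_out :: "nat list \<Rightarrow> st \<Rightarrow> st" where
  "upd_out ns s = s\<lparr>ou := ou s @ [ns], tm := Suc (tm s)\<rparr>"

lemma upd_simps [simp]:
  "rg (upd_reg x n s) = (rg s)(x := n)" "ar (upd_reg x n s) = ar s" "ou (upd_reg x n s) = ou s"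
  "tm (upd_reg x n s) = Suc (tm s)"
  "rg (upd_arr a i n s) = rg s" "ar (upd_arr a i n s) = (ar s)(a := (ar s a)(i := n))"
  "ou (upd_arr a i n s) = ou s" "tm (upd_arr a i n s) = Suc (tm s)"
  "rg (upd_out ns s) = rg s" "ar (upd_out ns s) = ar s" "ou (upd_out ns s) = ou s @ [ns]"
  "tm (upd_out ns s) = Suc (tm s)"
  by (auto simp: upd_reg_def upd_arr_def upd_out_def)

text \<open>The clock is part of the state, so that assertions can relate it to registers and
  arrays. An expression of any size costs a single tick: the program text is fixed, and compilation
  pays for this by a constant factor.\<close>

inductive run :: "cm \<Rightarrow> st \<Rightarrow> st \<Rightarrow> bool" where
  Pass: "run Pass s (tick s)"
| Asg: "run (x ::= e) s (upd_reg x (val s e) s)"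
| Sto: "run (Sto a e f) s (upd_arr a (val s e) (val s f) s)"
| Put: "run (Put xs) s (upd_out (map (rg s) xs) s)"
| Sq: "run p s s' \<Longrightarrow> run q s' s'' \<Longrightarrow> run (p ;; q) s s''"
| CondT: "val s e \<noteq> 0 \<Longrightarrow> run p (tick s) s' \<Longrightarrow> run (Cond e p q) s s'"
| CondF: "val s e = 0 \<Longrightarrow> run q (tick s) s' \<Longrightarrow> run (Cond e p q) s s'"
| LoopF: "val s e = 0 \<Longrightarrow> run (Loop e p) s (tick s)"
| LoopT: "val s e \<noteq> 0 \<Longrightarrow> run p (tick s) s' \<Longrightarrow> run (Loop e p) s' s'' \<Longrightarrow> run (Loop e p) s s''"

inductive_cases run_PassE: "run Pass s s'"
inductive_cases run_AsgE: "run (x ::= e) s s'"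
inductive_cases run_StoE: "run (Sto a e f) s s'"
inductive_cases run_PutE: "run (Put xs) s s'"
inductive_cases run_SqE: "run (p ;; q) s s'"
inductive_cases run_CondE: "run (Cond e p q) s s'"

definition wp :: "cm \<Rightarrow> (st \<Rightarrow> bool) \<Rightarrow> st \<Rightarrow> bool" where
  "wp p Q s \<longleftrightarrow> (\<exists>s'. run p s s' \<and> Q s')"

lemma wp_simps [simp]:
  "wp Pass Q s = Q (tick s)"
  "wp (x ::= e) Q s = Q (upd_reg x (val s e) s)"
  "wp (Sto a e f) Q s = Q (upd_arr a (val s e) (val s f) s)"
  "wp (Put xs) Q s = Q (upd_out (map (rg s) xs) s)"
  "wp (p ;; q) Q s = wp p (wp q Q) s"
  "wp (Cond e p q) Q s = (if val s e \<noteq> 0 then wp p Q (tick s) else wp q Q (tick s))"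
  unfolding wp_def
  by (blast intro: run.Pass elim: run_PassE, blast intro: run.Asg elim: run_AsgE,
      blast intro: run.Sto elim: run_StoE, blast intro: run.Put elim: run_PutE,
      blast intro: run.Sq elim: run_SqE,
      cases "val s e = 0", auto intro: run.CondT run.CondF elim: run_CondE)

lemma wp_mono: "wp p P s \<Longrightarrow> (\<And>s'. P s' \<Longrightarrow> Q s') \<Longrightarrow> wp p Q s"
  unfolding wp_def by blast

text \<open>The variant \<open>\<phi>\<close> doubles as the time bound when the invariant relates it to \<^const>\<open>tm\<close>.\<close>

lemma wp_Loop:
  fixes \<phi> :: "st \<Rightarrow> nat"
  assumes "I s"
    and "\<And>s. I s \<Longrightarrow> val s e \<noteq> 0 \<Longrightarrow> wp p (\<lambda>s'. I s' \<and> \<phi> s' < \<phi> s) (tick s)"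
    and "\<And>s. I s \<Longrightarrow> val s e = 0 \<Longrightarrow> Q (tick s)"
  shows "wp (Loop e p) Q s"
  using assms(1)
proof (induction "\<phi> s" arbitrary: s rule: less_induct)
  case less
  show ?case
  proof (cases "val s e = 0")
    case True
    then show ?thesis using assms(3) less.prems by (auto simp: wp_def intro: run.LoopF)
  next
    case False
    with assms(2)[OF less.prems] obtain s' where s': "run p (tick s) s'" "I s'" "\<phi> s' < \<phi> s"
      by (auto simp: wp_def)
    from less.hyps[OF s'(3,2)] s'(1) False show ?thesis
      by (auto simp: wp_def intro: run.LoopT)
  qed
qed

section \<open>Frame conditions\<close>

primrec wreg :: "cm \<Rightarrow> nat set" where
  "wreg Pass = {}"
| "wreg (x ::= e) = {x}"
| "wreg (Sto a e f) = {}"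
| "wreg (Put xs) = {}"
| "wreg (p ;; q) = wreg p \<union> wreg q"
| "wreg (Cond e p q) = wreg p \<union> wreg q"
| "wreg (Loop e p) = wreg p"

primrec warr :: "cm \<Rightarrow> nat set" where
  "warr Pass = {}"
| "warr (x ::= e) = {}"
| "warr (Sto a e f) = {a}"
| "warr (Put xs) = {}"
| "warr (p ;; q) = warr p \<union> warr q"
| "warr (Cond e p q) = warr p \<union> warr q"
| "warr (Loop e p) = warr p"

primrec puts :: "cm \<Rightarrow> bool" where
  "puts Pass = False"
| "puts (x ::= e) = False"
| "puts (Sto a e f) = False"
| "puts (Put xs) = True"
| "puts (p ;; q) = (puts p \<or> puts q)"
| "puts (Cond e p q) = (puts p \<or> puts q)"
| "puts (Loop e p) = puts p"

definition same :: "cm \<Rightarrow> st \<Rightarrow> st \<Rightarrow> bool" where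
  "same p s s' \<longleftrightarrow> (\<forall>x. x \<notin> wreg p \<longrightarrow> rg s' x = rg s x) \<and>
     (\<forall>a. a \<notin> warr p \<longrightarrow> ar s' a = ar s a) \<and> (\<not> puts p \<longrightarrow> ou s' = ou s)"

lemma run_same: "run p s s' \<Longrightarrow> same p s s'"
  by (induction rule: run.induct) (auto simp: same_def)

text \<open>Whatever a command does not write syntactically is known to be unchanged after it. This
  keeps registers and arrays of other phases out of the invariants.\<close>

lemma wp_same:
  assumes "wp p P s" and "\<And>s'. P s' \<Longrightarrow> same p s s' \<Longrightarrow> Q s'"
  shows "wp p Q s"
  using assms unfolding wp_def by (blast dest: run_same)

lemma same_reg: "same p s s' \<Longrightarrow> x \<notin> wreg p \<Longrightarrow> rg s' x = rg s x"
  and same_arr: "same p s s' \<Longrightarrow> a \<notin> warr p \<Longrightarrow> ar s' a = ar s a"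
  and same_out: "same p s s' \<Longrightarrow> \<not> puts p \<Longrightarrow> ou s' = ou s"
  by (auto simp: same_def)

section \<open>Translation to the random access machine\<close>

text \<open>Register 0 holds the first address \<open>B\<close> after the input, program variables live in the odd
  registers and temporaries in the other even ones. Cell \<open>i\<close> of array \<open>a > 0\<close> is stored at address
  \<open>B + K * i + a\<close>; array 0 is the input.\<close>

abbreviation tmp :: "nat \<Rightarrow> nat" where "tmp j \<equiv> 2 * j + 2"

abbreviation vreg :: "nat \<Rightarrow> nat" where "vreg x \<equiv> 2 * x + 1"

text \<open>The only products ever required have a factor from the program text, namely the number
  of interleaved arrays or of automaton states; they unfold to repeated addition.\<close>

primrec addn :: "nat \<Rightarrow> nat \<Rightarrow> nat \<Rightarrow> prog" where
  "addn x y 0 = Const x 0"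
| "addn x y (Suc k) = Seq (addn x y k) (Add x x y)"

text \<open>The temporaries act as a stack: code at level \<open>j\<close> leaves all lower ones
  intact, so pending operands survive. For array 0 the three subtractions replace an index
  \<open>a\<close> by \<open>a - (a - (B - 1))\<close>, that is \<open>min a (B - 1)\<close>. A read
  beyond the input thus yields its last cell and never a cell of another array.\<close>

primrec cex :: "nat \<Rightarrow> ex \<Rightarrow> nat \<Rightarrow> prog" where
  "cex K (Lit n) j = Const (tmp j) n"
| "cex K (Var x) j = Seq (Const (tmp j) 0) (Add (tmp j) (vreg x) (tmp j))"
| "cex K (Plus e f) j = Seq (cex K e j) (Seq (cex K f (Suc j)) (Add (tmp j) (tmp j) (tmp (Suc j))))"
| "cex K (Minus e f) j = Seq (cex K e j) (Seq (cex K f (Suc j)) (Sub (tmp j) (tmp j) (tmp (Suc j))))"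
| "cex K (Scale k e) j = Seq (cex K e (Suc j)) (addn (tmp j) (tmp (Suc j)) k)"
| "cex K (Rd a e) j =
     (if a = 0 then
        Seq (cex K e j) (Seq (Const (tmp (Suc j)) 1) (Seq (Sub (tmp (Suc j)) 0 (tmp (Suc j)))
          (Seq (Sub (tmp (Suc j)) (tmp j) (tmp (Suc j))) (Seq (Sub (tmp j) (tmp j) (tmp (Suc j)))
             (Load (tmp j) (tmp j))))))
      else
        Seq (cex K e (Suc j)) (Seq (addn (tmp j) (tmp (Suc j)) K) (Seq (Const (tmp (Suc j)) a)
          (Seq (Add (tmp j) (tmp j) (tmp (Suc j))) (Seq (Add (tmp j) (tmp j) 0)
             (Load (tmp j) (tmp j)))))))"

primrec ecost :: "nat \<Rightarrow> ex \<Rightarrow> nat" where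
  "ecost K (Lit n) = 1"
| "ecost K (Var x) = 2"
| "ecost K (Plus e f) = ecost K e + (ecost K f + 1)"
| "ecost K (Minus e f) = ecost K e + (ecost K f + 1)"
| "ecost K (Scale k e) = ecost K e + (k + 1)"
| "ecost K (Rd a e) = ecost K e + K + 6"

primrec earr :: "ex \<Rightarrow> nat set" where
  "earr (Lit n) = {}"
| "earr (Var x) = {}"
| "earr (Plus e f) = earr e \<union> earr f"
| "earr (Minus e f) = earr e \<union> earr f"
| "earr (Scale k e) = earr e"
| "earr (Rd a e) = insert a (earr e)"

text \<open>Even registers other than 0 are left unconstrained, so temporaries may hold garbage
  between commands. The clamped index makes array 0 independent of everything stored behind the
  input.\<close>

definition sim :: "nat \<Rightarrow> nat \<Rightarrow> st \<Rightarrow> ram \<Rightarrow> bool" where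
  "sim K B a s \<longleftrightarrow> 0 < B \<and> regs s 0 = B \<and> (\<forall>x. regs s (vreg x) = rg a x) \<and>
     (\<forall>i. ar a 0 i = mem s (min i (B - 1))) \<and>
     (\<forall>j i. 0 < j \<longrightarrow> j < K \<longrightarrow> mem s (B + K * i + j) = ar a j i) \<and> out s = ou a"

definition keeps :: "nat \<Rightarrow> ram \<Rightarrow> ram \<Rightarrow> bool" where
  "keeps j s s' \<longleftrightarrow> mem s' = mem s \<and> out s' = out s \<and>
     (\<forall>r. (\<forall>i\<ge>j. r \<noteq> tmp i) \<longrightarrow> regs s' r = regs s r)"

lemma keeps_trans: "keeps j s s' \<Longrightarrow> keeps j' s' s'' \<Longrightarrow> j \<le> j' \<Longrightarrow> keeps j s s''"
  by (auto simp: keeps_def)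

lemma keeps_sim:
  assumes "sim K B a s" "keeps j s s'"
  shows "sim K B a s'"
proof -
  have "\<forall>i\<ge>j. vreg x \<noteq> tmp i" for x by presburger
  then have "regs s' (vreg x) = regs s (vreg x)" for x
    using assms(2) unfolding keeps_def by blast
  moreover have "regs s' 0 = regs s 0" using assms(2) by (simp add: keeps_def)
  ultimately show ?thesis using assms by (simp add: sim_def keeps_def)
qed

lemma keeps_upd: "keeps j s s' \<Longrightarrow> i \<ge> j \<Longrightarrow> keeps j s (set_reg s' (tmp i) n)"
  by (auto simp: keeps_def)

lemma keeps_refl: "keeps j s s"
  by (auto simp: keeps_def)

lemma exec_addn:
  assumes "x \<noteq> y"
  shows "exec (addn x y k) s (k + 1) (set_reg s x (k * regs s y))"
proof (induction k)
  case 0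
  then show ?case using exec.Const[of x 0 s] by (simp add: fun_upd_def)
next
  case (Suc k)
  have eq: "set_reg (set_reg s x (k * regs s y)) x
      (regs (set_reg s x (k * regs s y)) x + regs (set_reg s x (k * regs s y)) y) =
      set_reg s x (Suc k * regs s y)"
    using assms by (simp add: add.commute)
  show ?case
    using exec.Seq[OF Suc exec.Add[of x x y], unfolded eq] by (simp add: fun_upd_def)
qed

lemma exec_cex:
  assumes "sim K B a s" "earr e \<subseteq> {..<K}"
  shows "\<exists>t s'. exec (cex K e j) s t s' \<and> t \<le> ecost K e \<and> regs s' (tmp j) = val a e \<and> keeps j s s'"
  using assms
proof (induction e arbitrary: j s)
  case (Lit n)
  show ?case using exec.Const keeps_upd[OF keeps_refl, of j j]
    by (intro exI[of _ 1] exI[of _ "set_reg s (tmp j) n"]) simp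
next
  case (Var x)
  let ?s1 = "set_reg s (tmp j) 0"
  let ?s2 = "set_reg ?s1 (tmp j) (regs ?s1 (vreg x) + regs ?s1 (tmp j))"
  have "exec (cex K (Var x) j) s (1 + 1) ?s2"
    unfolding cex.simps by (rule exec.Seq[OF exec.Const exec.Add])
  moreover have "keeps j s ?s2" by (intro keeps_upd keeps_refl) auto
  moreover have "vreg x \<noteq> tmp j" by presburger
  then have "regs ?s2 (tmp j) = rg a x" using Var by (simp add: sim_def)
  ultimately show ?case by fastforce
next
  case (Plus e f)
  from Plus.IH(1)[of s j] Plus.prems obtain t s1 where 1: "exec (cex K e j) s t s1" "t \<le> ecost K e"
    "regs s1 (tmp j) = val a e" "keeps j s s1" by auto
  from Plus.IH(2)[of s1 "Suc j"] Plus.prems keeps_sim[OF Plus.prems(1) 1(4)]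
  obtain t' s2 where 2: "exec (cex K f (Suc j)) s1 t' s2" "t' \<le> ecost K f"
    "regs s2 (tmp (Suc j)) = val a f" "keeps (Suc j) s1 s2" by auto
  have r: "regs s2 (tmp j) = val a e" using 2(4) 1(3) by (auto simp: keeps_def)
  let ?s3 = "set_reg s2 (tmp j) (regs s2 (tmp j) + regs s2 (tmp (Suc j)))"
  have "exec (cex K (Plus e f) j) s (t + (t' + 1)) ?s3"
    unfolding cex.simps by (rule exec.Seq[OF 1(1) exec.Seq[OF 2(1) exec.Add]])
  moreover have "keeps j s ?s3"
    using keeps_upd[OF keeps_trans[OF 1(4) 2(4)]] by simp
  ultimately show ?case using 1(2) 2(2,3) r by (intro exI[of _ "t + (t' + 1)"] exI[of _ ?s3]) simp
next
  case (Minus e f)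
  from Minus.IH(1)[of s j] Minus.prems obtain t s1 where 1: "exec (cex K e j) s t s1" "t \<le> ecost K e"
    "regs s1 (tmp j) = val a e" "keeps j s s1" by auto
  from Minus.IH(2)[of s1 "Suc j"] Minus.prems keeps_sim[OF Minus.prems(1) 1(4)]
  obtain t' s2 where 2: "exec (cex K f (Suc j)) s1 t' s2" "t' \<le> ecost K f"
    "regs s2 (tmp (Suc j)) = val a f" "keeps (Suc j) s1 s2" by auto
  have r: "regs s2 (tmp j) = val a e" using 2(4) 1(3) by (auto simp: keeps_def)
  let ?s3 = "set_reg s2 (tmp j) (regs s2 (tmp j) - regs s2 (tmp (Suc j)))"
  have "exec (cex K (Minus e f) j) s (t + (t' + 1)) ?s3"
    unfolding cex.simps by (rule exec.Seq[OF 1(1) exec.Seq[OF 2(1) exec.Sub]])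
  moreover have "keeps j s ?s3"
    using keeps_upd[OF keeps_trans[OF 1(4) 2(4)]] by simp
  ultimately show ?case using 1(2) 2(2,3) r by (intro exI[of _ "t + (t' + 1)"] exI[of _ ?s3]) simp
next
  case (Scale k e)
  from Scale.IH[of s "Suc j"] Scale.prems obtain t s1 where 1: "exec (cex K e (Suc j)) s t s1"
    "t \<le> ecost K e" "regs s1 (tmp (Suc j)) = val a e" "keeps (Suc j) s s1" by auto
  let ?s3 = "set_reg s1 (tmp j) (k * regs s1 (tmp (Suc j)))"
  have "exec (cex K (Scale k e) j) s (t + (k + 1)) ?s3"
    unfolding cex.simps by (rule exec.Seq[OF 1(1) exec_addn]) simp
  moreover have "keeps j s ?s3"
    using keeps_upd[OF keeps_trans[OF keeps_refl 1(4)]] by simp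
  ultimately show ?case using 1(2,3) by (intro exI[of _ "t + (k + 1)"] exI[of _ ?s3]) simp
next
  case (Rd b e)
  show ?case
  proof (cases "b = 0")
    case True
    from Rd.IH[of s j] Rd.prems obtain t s1 where 1: "exec (cex K e j) s t s1" "t \<le> ecost K e"
      "regs s1 (tmp j) = val a e" "keeps j s s1" by auto
    let ?s2 = "set_reg s1 (tmp (Suc j)) 1"
    let ?s3 = "set_reg ?s2 (tmp (Suc j)) (regs ?s2 0 - regs ?s2 (tmp (Suc j)))"
    let ?s4 = "set_reg ?s3 (tmp (Suc j)) (regs ?s3 (tmp j) - regs ?s3 (tmp (Suc j)))"
    let ?s5 = "set_reg ?s4 (tmp j) (regs ?s4 (tmp j) - regs ?s4 (tmp (Suc j)))"
    let ?s6 = "set_reg ?s5 (tmp j) (mem ?s5 (regs ?s5 (tmp j)))"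
    have "exec (cex K (Rd b e) j) s (t + (1 + (1 + (1 + (1 + 1))))) ?s6"
      unfolding cex.simps if_P[OF True]
      by (rule exec.Seq[OF 1(1) exec.Seq[OF exec.Const exec.Seq[OF exec.Sub
        exec.Seq[OF exec.Sub exec.Seq[OF exec.Sub exec.Load]]]]])
    moreover have "keeps j s ?s6"
      by (intro keeps_upd 1(4)) simp_all
    moreover have "sim K B a s1" using keeps_sim Rd.prems(1) 1(4) by blast
    then have "regs ?s6 (tmp j) = val a (Rd b e)"
    proof -
      have "val a e - (Suc (val a e) - B) = min (val a e) (B - Suc 0)"
        if "0 < B" using that by simp
      then show ?thesis using True 1(3) \<open>sim K B a s1\<close> unfolding sim_def by simp
    qed
    ultimately show ?thesis using 1(2)
      by (intro exI[of _ "t + (1 + (1 + (1 + (1 + 1))))"] exI[of _ ?s6]) simp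
  next
    case False
    from Rd.IH[of s "Suc j"] Rd.prems obtain t s1 where 1: "exec (cex K e (Suc j)) s t s1"
      "t \<le> ecost K e" "regs s1 (tmp (Suc j)) = val a e" "keeps (Suc j) s s1" by auto
    let ?s2 = "set_reg s1 (tmp j) (K * regs s1 (tmp (Suc j)))"
    let ?s3 = "set_reg ?s2 (tmp (Suc j)) b"
    let ?s4 = "set_reg ?s3 (tmp j) (regs ?s3 (tmp j) + regs ?s3 (tmp (Suc j)))"
    let ?s5 = "set_reg ?s4 (tmp j) (regs ?s4 (tmp j) + regs ?s4 0)"
    let ?s6 = "set_reg ?s5 (tmp j) (mem ?s5 (regs ?s5 (tmp j)))"
    have "exec (cex K (Rd b e) j) s (t + ((K + 1) + (1 + (1 + (1 + 1))))) ?s6"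
      unfolding cex.simps if_not_P[OF False]
      by (rule exec.Seq[OF 1(1) exec.Seq[OF exec_addn exec.Seq[OF exec.Const
        exec.Seq[OF exec.Add exec.Seq[OF exec.Add exec.Load]]]]]) simp
    moreover have "keeps j s ?s6"
      by (intro keeps_upd keeps_trans[OF keeps_refl 1(4)]) simp_all
    moreover have "sim K B a s1" using keeps_sim Rd.prems(1) 1(4) by blast
    then have "regs ?s6 (tmp j) = val a (Rd b e)"
    proof -
      have "mem s1 (B + K * val a e + b) = ar a b (val a e)"
        using False Rd.prems(2) \<open>sim K B a s1\<close> unfolding sim_def by simp
      then have "mem s1 (K * val a e + b + B) = ar a b (val a e)"
        by (simp only: add.commute[of _ B] add.assoc)
      moreover have "regs s1 0 = B" using \<open>sim K B a s1\<close> unfolding sim_def by simp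
      ultimately show ?thesis using 1(3) by (simp del: add.assoc)
    qed
    ultimately show ?thesis using 1(2)
      by (intro exI[of _ "t + ((K + 1) + (1 + (1 + (1 + 1))))"] exI[of _ ?s6]) simp
  qed
qed

section \<open>Compilation of commands\<close>

primrec ccm :: "nat \<Rightarrow> cm \<Rightarrow> prog" where
  "ccm K Pass = Skip"
| "ccm K (x ::= e) = Seq (cex K e 0) (Seq (Const (tmp 1) 0) (Add (vreg x) (tmp 0) (tmp 1)))"
| "ccm K (Sto a e f) = Seq (cex K (Plus (Scale K e) (Lit a)) 0) (Seq (Add (tmp 0) (tmp 0) 0)
     (Seq (cex K f 1) (Store (tmp 0) (tmp 1))))"
| "ccm K (Put xs) = Emit (map vreg xs)"
| "ccm K (p ;; q) = Seq (ccm K p) (ccm K q)"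
| "ccm K (Cond e p q) = Seq (cex K e 0) (IfNZ (tmp 0) (ccm K p) (ccm K q))"
| "ccm K (Loop e p) = Seq (cex K e 0) (WhileNZ (tmp 0) (Seq (ccm K p) (cex K e 0)))"

text \<open>This is a conversion factor from ticks to machine steps, not the cost of one run.
  Summing over the whole text is generous, but the sum dominates every primitive inside, which is
  what the induction over runs requires.\<close>

primrec ccost :: "nat \<Rightarrow> cm \<Rightarrow> nat" where
  "ccost K Pass = 1"
| "ccost K (x ::= e) = ecost K e + 2"
| "ccost K (Sto a e f) = ecost K e + ecost K f + K + 5"
| "ccost K (Put xs) = 1 + length xs"
| "ccost K (p ;; q) = ccost K p + ccost K q"
| "ccost K (Cond e p q) = ecost K e + 1 + ccost K p + ccost K q"
| "ccost K (Loop e p) = ecost K e + 1 + ccost K p"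

primrec wf :: "nat \<Rightarrow> cm \<Rightarrow> bool" where
  "wf K Pass = True"
| "wf K (x ::= e) = (earr e \<subseteq> {..<K})"
| "wf K (Sto a e f) = (0 < a \<and> a < K \<and> earr e \<subseteq> {..<K} \<and> earr f \<subseteq> {..<K})"
| "wf K (Put xs) = True"
| "wf K (p ;; q) = (wf K p \<and> wf K q)"
| "wf K (Cond e p q) = (earr e \<subseteq> {..<K} \<and> wf K p \<and> wf K q)"
| "wf K (Loop e p) = (earr e \<subseteq> {..<K} \<and> wf K p)"

lemma run_tm_less: "run p s s' \<Longrightarrow> tm s < tm s'"
  by (induction rule: run.induct) auto

lemma sim_tick [simp]: "sim K B (tick a) s = sim K B a s"
  by (simp add: sim_def)

lemma address_inject:
  fixes K :: nat
  assumes "j < K" "j' < K" "K * i + j = K * i' + j'"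
  shows "i = i' \<and> j = j'"
proof -
  have "(K * i + j) div K = i" "(K * i' + j') div K = i'"
    using assms(1,2) by (simp_all add: div_mult_self4)
  with assms(3) show ?thesis by simp
qed

text \<open>Every rule except sequencing spends a tick of its own, and this tick pays for evaluating
  the guard or the operands. The inequality adds the initial clock on the left because natural
  subtraction would truncate.\<close>

lemma exec_ccm:
  assumes "run p a a'" "sim K B a s" "wf K p"
  shows "\<exists>t s'. exec (ccm K p) s t s' \<and> t + ccost K p * tm a \<le> ccost K p * tm a' \<and> sim K B a' s'"
  using assms
proof (induction arbitrary: s rule: run.induct)
  case (Pass a)
  then show ?case using exec.Skip[of s] by (intro exI[of _ 1] exI[of _ s]) simp
next
  case (Asg x e a)
  from exec_cex[OF Asg(1), of e 0] Asg(2) obtain t s1 where 1: "exec (cex K e 0) s t s1"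
    "t \<le> ecost K e" "regs s1 (tmp 0) = val a e" "keeps 0 s s1" by auto
  let ?s2 = "set_reg s1 (tmp 1) 0"
  let ?s3 = "set_reg ?s2 (vreg x) (regs ?s2 (tmp 0) + regs ?s2 (tmp 1))"
  have "exec (ccm K (x ::= e)) s (t + (1 + 1)) ?s3"
    unfolding ccm.simps by (rule exec.Seq[OF 1(1) exec.Seq[OF exec.Const exec.Add]])
  moreover have "sim K B a s1" using keeps_sim[OF Asg(1) 1(4)] .
  have "vreg x \<noteq> 4" for x :: nat by presburger
  with \<open>sim K B a s1\<close> have "sim K B (upd_reg x (val a e) a) ?s3"
    using 1(3) by (auto simp: sim_def)
  ultimately show ?case using 1(2) by (intro exI[of _ "t + (1 + 1)"] exI[of _ ?s3]) simp
next
  case (Sto b e f a)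
  have "earr (Plus (Scale K e) (Lit b)) \<subseteq> {..<K}" using Sto by simp
  from exec_cex[OF Sto(1) this, of 0] obtain t s1 where 1: "exec (cex K (Plus (Scale K e) (Lit b)) 0) s t s1"
    "t \<le> ecost K (Plus (Scale K e) (Lit b))" "regs s1 (tmp 0) = val a (Plus (Scale K e) (Lit b))" "keeps 0 s s1"
    by blast
  let ?s2 = "set_reg s1 (tmp 0) (regs s1 (tmp 0) + regs s1 0)"
  have k2: "keeps 0 s ?s2" using keeps_upd[OF 1(4), of 0] by simp
  have s2: "sim K B a ?s2" using keeps_sim[OF Sto(1) k2] .
  from exec_cex[OF s2, of f 1] Sto(2) obtain t' s3 where 3: "exec (cex K f 1) ?s2 t' s3"
    "t' \<le> ecost K f" "regs s3 (tmp 1) = val a f" "keeps 1 ?s2 s3" by auto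
  let ?s4 = "s3\<lparr>mem := (mem s3)(regs s3 (tmp 0) := regs s3 (tmp 1))\<rparr>"
  have "exec (ccm K (Sto b e f)) s (t + (1 + (t' + 1))) ?s4"
    unfolding ccm.simps
    by (rule exec.Seq[OF 1(1) exec.Seq[OF exec.Add exec.Seq[OF 3(1) exec.Store]]])
  moreover have s3: "sim K B a s3" using keeps_sim[OF s2 3(4)] .
  have "regs s1 0 = B" using keeps_sim[OF Sto(1) 1(4)] by (simp add: sim_def)
  then have addr: "regs s3 (tmp 0) = B + K * val a e + b"
    using 1(3) 3(4) by (auto simp: keeps_def)
  have "sim K B (upd_arr b (val a e) (val a f) a) ?s4"
  proof -
    have m4: "mem ?s4 = (mem s3)(B + K * val a e + b := val a f)"
      unfolding addr 3(3) by simp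
    have "mem ?s4 (B + K * i + j) = ar (upd_arr b (val a e) (val a f) a) j i" if "0 < j" "j < K" for i j
      using that s3 Sto(2) 3(3) address_inject[of j K b i "val a e"]
      unfolding m4 by (cases "j = b \<and> i = val a e") (auto simp: sim_def)
    moreover have "ar (upd_arr b (val a e) (val a f) a) 0 i = mem ?s4 (min i (B - 1))" for i
    proof -
      have "min i (B - 1) < B + K * val a e + b" using Sto(2) by auto
      then have "min i (B - 1) \<noteq> B + K * val a e + b" by simp
      then show ?thesis using s3 Sto(2) unfolding m4 by (simp add: sim_def)
    qed
    ultimately show ?thesis using s3 unfolding sim_def by simp
  qed
  ultimately show ?case using 1(2) 3(2)
    by (intro exI[of _ "t + (1 + (t' + 1))"] exI[of _ ?s4]) simp
next
  case (Put xs a)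
  let ?s1 = "s\<lparr>out := out s @ [map (regs s) (map vreg xs)]\<rparr>"
  have "exec (ccm K (Put xs)) s (1 + length (map vreg xs)) ?s1"
    unfolding ccm.simps by (rule exec.Emit)
  moreover have "sim K B (upd_out (map (rg a) xs) a) ?s1" using Put by (auto simp: sim_def)
  ultimately show ?case by fastforce
next
  case (Sq p a a1 q a2)
  from Sq.IH(1)[OF Sq.prems(1)] Sq.prems(2) obtain t s1 where 1: "exec (ccm K p) s t s1"
    "t + ccost K p * tm a \<le> ccost K p * tm a1" "sim K B a1 s1" by auto
  from Sq.IH(2)[OF 1(3)] Sq.prems(2) obtain t' s2 where 2: "exec (ccm K q) s1 t' s2"
    "t' + ccost K q * tm a1 \<le> ccost K q * tm a2" "sim K B a2 s2" by auto
  have "tm a \<le> tm a1" "tm a1 \<le> tm a2" using run_tm_less Sq.hyps less_imp_le by blast+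
  then have "ccost K q * tm a \<le> ccost K q * tm a1" "ccost K p * tm a1 \<le> ccost K p * tm a2" by auto
  with 1(2) 2(2) have "t + t' + ccost K (p ;; q) * tm a \<le> ccost K (p ;; q) * tm a2"
    unfolding ccost.simps distrib_right by linarith
  with 2(3) exec.Seq[OF 1(1) 2(1)] show ?case
    by (intro exI[of _ "t + t'"] exI[of _ s2]) simp
next
  case (CondT a e p a' q)
  from exec_cex[OF CondT.prems(1), of e 0] CondT.prems(2) obtain t s1 where 1: "exec (cex K e 0) s t s1"
    "t \<le> ecost K e" "regs s1 (tmp 0) = val a e" "keeps 0 s s1" by auto
  have "sim K B (tick a) s1" using keeps_sim[OF CondT.prems(1) 1(4)] by simp
  from CondT.IH[OF this] CondT.prems(2) obtain t' s2 where 2: "exec (ccm K p) s1 t' s2"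
    "t' + ccost K p * Suc (tm a) \<le> ccost K p * tm a'" "sim K B a' s2" by auto
  have "exec (ccm K (Cond e p q)) s (t + (1 + t')) s2"
    unfolding ccm.simps using 1(3) CondT.hyps(1)
    by (intro exec.Seq[OF 1(1)] exec.IfTrue 2(1)) simp
  moreover have "Suc (tm a) \<le> tm a'" using run_tm_less[OF CondT.hyps(2)] by simp
  then have "ecost K e * Suc (tm a) \<le> ecost K e * tm a'"
    "ccost K q * Suc (tm a) \<le> ccost K q * tm a'" by (auto simp only: mult_le_mono2)
  ultimately show ?case using 1(2) 2(2,3) \<open>Suc (tm a) \<le> tm a'\<close>
    by (intro exI[of _ "t + (1 + t')"] exI[of _ s2]) (simp add: algebra_simps)
next
  case (CondF a e q a' p)
  from exec_cex[OF CondF.prems(1), of e 0] CondF.prems(2) obtain t s1 where 1: "exec (cex K e 0) s t s1"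
    "t \<le> ecost K e" "regs s1 (tmp 0) = val a e" "keeps 0 s s1" by auto
  have "sim K B (tick a) s1" using keeps_sim[OF CondF.prems(1) 1(4)] by simp
  from CondF.IH[OF this] CondF.prems(2) obtain t' s2 where 2: "exec (ccm K q) s1 t' s2"
    "t' + ccost K q * Suc (tm a) \<le> ccost K q * tm a'" "sim K B a' s2" by auto
  have "exec (ccm K (Cond e p q)) s (t + (1 + t')) s2"
    unfolding ccm.simps using 1(3) CondF.hyps(1)
    by (intro exec.Seq[OF 1(1)] exec.IfFalse 2(1)) simp
  moreover have "Suc (tm a) \<le> tm a'" using run_tm_less[OF CondF.hyps(2)] by simp
  then have "ecost K e * Suc (tm a) \<le> ecost K e * tm a'"
    "ccost K p * Suc (tm a) \<le> ccost K p * tm a'" by (auto simp only: mult_le_mono2)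
  ultimately show ?case using 1(2) 2(2,3) \<open>Suc (tm a) \<le> tm a'\<close>
    by (intro exI[of _ "t + (1 + t')"] exI[of _ s2]) (simp add: algebra_simps)
next
  case (LoopF a e p)
  from exec_cex[OF LoopF.prems(1), of e 0] LoopF.prems(2) obtain t s1 where 1: "exec (cex K e 0) s t s1"
    "t \<le> ecost K e" "regs s1 (tmp 0) = val a e" "keeps 0 s s1" by auto
  have "exec (ccm K (Loop e p)) s (t + 1) s1"
    unfolding ccm.simps using 1(3) LoopF.hyps by (intro exec.Seq[OF 1(1)] exec.WhileFalse) simp
  then show ?case using 1(2) keeps_sim[OF LoopF.prems(1) 1(4)]
    by (intro exI[of _ "t + 1"] exI[of _ s1]) simp
next
  case (LoopT a e p a1 a2)
  from exec_cex[OF LoopT.prems(1), of e 0] LoopT.prems(2) obtain t s1 where 1: "exec (cex K e 0) s t s1"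
    "t \<le> ecost K e" "regs s1 (tmp 0) = val a e" "keeps 0 s s1" by auto
  have "sim K B (tick a) s1" using keeps_sim[OF LoopT.prems(1) 1(4)] by simp
  from LoopT.IH(1)[OF this] LoopT.prems(2) obtain t' s2 where 2: "exec (ccm K p) s1 t' s2"
    "t' + ccost K p * Suc (tm a) \<le> ccost K p * tm a1" "sim K B a1 s2" by auto
  from LoopT.IH(2)[OF 2(3) LoopT.prems(2)] obtain t'' s3 where 3: "exec (ccm K (Loop e p)) s2 t'' s3"
    "t'' + ccost K (Loop e p) * tm a1 \<le> ccost K (Loop e p) * tm a2" "sim K B a2 s3" by auto
  \<comment> \<open>The remaining loop, seen as a fresh compiled loop, begins by evaluating the
    guard. In the machine code of the current loop this evaluation is the tail of the iteration just
    finished, so it has to be split off and regrouped.\<close>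
  from 3(1) obtain u u' s4 where 4: "exec (cex K e 0) s2 u s4"
    "exec (WhileNZ (tmp 0) (Seq (ccm K p) (cex K e 0))) s4 u' s3" "t'' = u + u'"
    unfolding ccm.simps by (auto elim: exec.cases)
  have "exec (ccm K (Loop e p)) s (t + (1 + (t' + u) + u')) s3"
    unfolding ccm.simps using 1(3) LoopT.hyps(1)
    by (intro exec.Seq[OF 1(1) exec.WhileTrue[OF _ exec.Seq[OF 2(1) 4(1)] 4(2)]]) simp
  moreover have le: "Suc (tm a) \<le> tm a1" using run_tm_less[OF LoopT.hyps(2)] by simp
  then have "Suc (ecost K e) * Suc (tm a) \<le> Suc (ecost K e) * tm a1" by (simp only: mult_le_mono2)
  ultimately show ?case using 1(2) 2(2) 3(2,3) 4(3)
    by (intro exI[of _ "t + (1 + (t' + u) + u')"] exI[of _ s3]) (simp add: algebra_simps)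
qed

definition start :: "nat list \<Rightarrow> st" where
  "start w = \<lparr>rg = (\<lambda>_. 0), ar = (\<lambda>a i. if a = 0 then w ! min i (length w - 1) else 0), ou = [], tm = 0\<rparr>"

text \<open>Register 0 receives three times the edge count in cell 0 plus 1, which is the length of
  the input and hence the first free address.\<close>

definition boot :: prog where
  "boot = Seq (Load 2 0) (Seq (addn 4 2 3) (Seq (Const 2 1) (Add 0 4 2)))"

text \<open>The temporaries 2 and 4 need not be cleared: \<^const>\<open>sim\<close> ignores them.\<close>

lemma exec_boot:
  assumes "length w = 3 * hd w + 1"
  shows "\<exists>s. exec boot (initial w) 7 s \<and> sim K (length w) (start w) s"
proof -
  let ?s0 = "initial w"
  let ?s1 = "set_reg ?s0 2 (mem ?s0 (regs ?s0 0))"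
  let ?s2 = "set_reg ?s1 4 (3 * regs ?s1 2)"
  let ?s3 = "set_reg ?s2 2 1"
  let ?s4 = "set_reg ?s3 0 (regs ?s3 4 + regs ?s3 2)"
  have "exec boot ?s0 (1 + ((3 + 1) + (1 + 1))) ?s4"
    unfolding boot_def
    by (rule exec.Seq[OF exec.Load exec.Seq[OF exec_addn exec.Seq[OF exec.Const exec.Add]]]) simp
  moreover have "w \<noteq> []" using assms by auto
  then have "regs ?s4 0 = length w"
    using assms by (simp add: initial_def hd_conv_nth)
  moreover have "vreg x \<noteq> 2" "vreg x \<noteq> 4" for x by presburger+
  ultimately show ?thesis using \<open>w \<noteq> []\<close>
    by (intro exI[of _ ?s4]) (auto simp: sim_def start_def initial_def)
qed

lemma exec_compiled:
  assumes "length w = 3 * hd w + 1" "wf K p" "wp p Q (start w)"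
  shows "\<exists>t s a. exec (Seq boot (ccm K p)) (initial w) t s \<and> Q a \<and> out s = ou a \<and>
    t \<le> 7 + ccost K p * tm a"
proof -
  from exec_boot[OF assms(1)] obtain s where 1: "exec boot (initial w) 7 s" "sim K (length w) (start w) s"
    by blast
  from assms(3) obtain a where a: "run p (start w) a" "Q a" by (auto simp: wp_def)
  from exec_ccm[OF a(1) 1(2) assms(2)] obtain t s' where
    2: "exec (ccm K p) s t s'" "t \<le> ccost K p * tm a" "sim K (length w) a s'"
    by (auto simp: start_def)
  show ?thesis using exec.Seq[OF 1(1) 2(1)] a(2) 2(2,3) by (fastforce simp: sim_def)
qed

section \<open>Linked lists in arrays\<close>

text \<open>Every cell points to a smaller one, and 0 is the null pointer; the test \<open>p \<le> nx p\<close> only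
  serves to make the function total.\<close>

function lst :: "(nat \<Rightarrow> nat) \<Rightarrow> (nat \<Rightarrow> nat) \<Rightarrow> nat \<Rightarrow> nat list" where
  "lst nx vl p = (if p = 0 \<or> p \<le> nx p then [] else vl p # lst nx vl (nx p))"
  by auto
termination by (relation "measure (\<lambda>(nx, vl, p). p)") auto

declare lst.simps [simp del]

definition decr :: "(nat \<Rightarrow> nat) \<Rightarrow> bool" where "decr nx \<longleftrightarrow> (\<forall>c>0. nx c < c)"

lemma lst_0 [simp]: "lst nx vl 0 = []"
  by (simp add: lst.simps)

lemma lst_step: "decr nx \<Longrightarrow> p \<noteq> 0 \<Longrightarrow> lst nx vl p = vl p # lst nx vl (nx p)"
  by (simp add: decr_def not_le lst.simps[of nx vl p])

text \<open>The walk from \<open>p\<close> only descends, so it sees no cell above \<open>p\<close>.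
  As allocation uses ever larger addresses, all older lists persist without any separation
  argument.\<close>

lemma lst_cong:
  assumes "\<And>c. c \<le> p \<Longrightarrow> nx c = nx' c \<and> vl c = vl' c"
  shows "lst nx vl p = lst nx' vl' p"
  using assms
proof (induction p rule: less_induct)
  case (less p)
  show ?case
  proof (cases "p = 0 \<or> p \<le> nx p")
    case True
    then show ?thesis using less.prems[of p] by (auto simp: lst.simps[of _ _ p])
  next
    case False
    then have "lst nx vl (nx p) = lst nx' vl' (nx p)" using less by (meson le_trans less_imp_le not_le)
    then show ?thesis using False less.prems[of p] by (auto simp: lst.simps[of _ _ p])
  qed
qed

lemma lst_upd: "p < c \<Longrightarrow> lst (nx(c := a)) (vl(c := b)) p = lst nx vl p"
  by (rule lst_cong) auto

lemma decr_upd: "decr nx \<Longrightarrow> a < c \<Longrightarrow> decr (nx(c := a))"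
  by (auto simp: decr_def)

lemma lst_new: "decr nx \<Longrightarrow> p < c \<Longrightarrow> lst (nx(c := p)) (vl(c := b)) c = b # lst nx vl p"
  by (subst lst_step) (auto simp: decr_upd lst_upd)

section \<open>Registers, arrays and loops over the vertices\<close>

text \<open>
  The vertices are listed in array \<open>aVT\<close>, \<open>rN\<close> is their number, and \<open>aSN\<close> marks those seen in the
  input. The product graph has adjacency lists with heads \<open>aHE\<close>, links \<open>aNE\<close> and targets \<open>aDS\<close>.
  The tags received by a node form a list with head \<open>aHD\<close> in the cells \<open>aNX\<close> (link), \<open>aVA\<close> (value)
  up to \<open>rP\<close>; \<open>aCN\<close> is its length, at most \<open>rD\<close>, and \<open>aST\<close> the number (\<open>rC\<close>) of the last search to
  reach the node. \<open>aSK\<close> is the stack of a search, of height \<open>rS\<close>. \<open>aMK i\<close> marks the remaining values of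
  variable \<open>i\<close>, and \<open>aLH i\<close> holds for each value of its parent the list of its partners. The cells
  \<open>aNX\<close>, \<open>aVA\<close> are never overwritten, so these lists survive later searches. \<open>aHV\<close> marks the heavy
  vertices, \<open>rH\<close> counts them.
\<close>

abbreviation (input) "rN \<equiv> 11 :: nat"
abbreviation (input) "rI \<equiv> 12 :: nat"
abbreviation (input) "rV \<equiv> 2 :: nat"
abbreviation (input) "rW \<equiv> 3 :: nat"
abbreviation (input) "rE \<equiv> 4 :: nat"
abbreviation (input) "rS \<equiv> 5 :: nat"
abbreviation (input) "rY \<equiv> 6 :: nat"
abbreviation (input) "rC \<equiv> 7 :: nat"
abbreviation (input) "rP \<equiv> 8 :: nat"
abbreviation (input) "rD \<equiv> 9 :: nat"
abbreviation (input) "rH \<equiv> 10 :: nat"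

abbreviation (input) "aVT \<equiv> 13 :: nat"
abbreviation (input) "aSN \<equiv> 2 :: nat"
abbreviation (input) "aHE \<equiv> 3 :: nat"
abbreviation (input) "aNE \<equiv> 4 :: nat"
abbreviation (input) "aDS \<equiv> 5 :: nat"
abbreviation (input) "aST \<equiv> 6 :: nat"
abbreviation (input) "aCN \<equiv> 7 :: nat"
abbreviation (input) "aHD \<equiv> 8 :: nat"
abbreviation (input) "aVA \<equiv> 9 :: nat"
abbreviation (input) "aNX \<equiv> 10 :: nat"
abbreviation (input) "aSK \<equiv> 11 :: nat"
abbreviation (input) "aHV \<equiv> 12 :: nat"
abbreviation (input) aMK :: "nat \<Rightarrow> nat" where "aMK i \<equiv> 20 + 2 * i"
abbreviation (input) aLH :: "nat \<Rightarrow> nat" where "aLH i \<equiv> 21 + 2 * i"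

definition for_verts :: "cm \<Rightarrow> cm" where
  "for_verts p = rI ::= Lit 0 ;; Loop (Minus (Var rN) (Var rI))
     (rV ::= Rd aVT (Var rI) ;; p ;; rI ::= Plus (Var rI) (Lit 1))"

definition vlist :: "st \<Rightarrow> nat list" where
  "vlist s = map (ar s aVT) [0..<rg s rN]"

lemma vlist_simps [simp]:
  "vlist (tick s) = vlist s"
  "x \<noteq> rN \<Longrightarrow> vlist (upd_reg x n s) = vlist s"
  "a \<noteq> aVT \<Longrightarrow> vlist (upd_arr a i n s) = vlist s"
  by (auto simp: vlist_def)

lemma vlist_same: "same p s s' \<Longrightarrow> rN \<notin> wreg p \<Longrightarrow> aVT \<notin> warr p \<Longrightarrow> vlist s' = vlist s"
  by (simp add: vlist_def same_reg same_arr)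

text \<open>\<open>Inv\<close> is evaluated after the counter has been set, so its clause on
  \<open>tm\<close> already includes the ticks of the loop itself, and a body is verified from a
  state in which its vertex is loaded. The frame conditions ensure that the counter and the list of
  vertices survive the body.\<close>

lemma wp_for_verts:
  assumes frame: "rI \<notin> wreg p" "rN \<notin> wreg p" "aVT \<notin> warr p"
    and vs: "vlist s = vs"
    and init: "Inv 0 (upd_reg rI 0 s)"
    and step: "\<And>k s. k < length vs \<Longrightarrow> Inv k s \<Longrightarrow> vlist s = vs \<Longrightarrow>
      wp p (\<lambda>s'. Inv (Suc k) (upd_reg rI (Suc k) s')) (upd_reg rV (vs ! k) (tick s))"
    and fin: "\<And>s. Inv (length vs) s \<Longrightarrow> vlist s = vs \<Longrightarrow> Q (tick s)"
  shows "wp (for_verts p) Q s"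
proof -
  let ?I = "\<lambda>s. vlist s = vs \<and> rg s rI \<le> length vs \<and> Inv (rg s rI) s"
  have "wp (Loop (Minus (Var rN) (Var rI)) (rV ::= Rd aVT (Var rI) ;; p ;; rI ::= Plus (Var rI) (Lit 1)))
      Q (upd_reg rI 0 s)"
  proof (rule wp_Loop[where I = ?I and \<phi> = "\<lambda>s. rg s rN - rg s rI"])
    show "?I (upd_reg rI 0 s)" using vs init by simp
  next
    fix s assume I: "?I s" and b: "val s (Minus (Var rN) (Var rI)) \<noteq> 0"
    have N: "rg s rN = length vs" using I by (auto simp: vlist_def)
    let ?k = "rg s rI"
    have k: "?k < length vs" using b N by simp
    have V: "ar s aVT ?k = vs ! ?k" using I k by (auto simp: vlist_def)
    have "wp p (\<lambda>s'. Inv (Suc ?k) (upd_reg rI (Suc ?k) s')) (upd_reg rV (vs ! ?k) (tick s))"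
      using step[OF k] I by auto
    then have "wp p (wp (rI ::= Plus (Var rI) (Lit 1)) (\<lambda>s'. ?I s' \<and> rg s' rN - rg s' rI < rg s rN - rg s rI))
      (upd_reg rV (vs ! ?k) (tick s))"
    proof (rule wp_same)
      fix s' assume i: "Inv (Suc ?k) (upd_reg rI (Suc ?k) s')"
        and sm: "same p (upd_reg rV (vs ! ?k) (tick s)) s'"
      have "rg s' rI = ?k" "rg s' rN = length vs" "vlist s' = vs"
        using same_reg[OF sm frame(1)] same_reg[OF sm frame(2)] vlist_same[OF sm frame(2,3)] I N
        by auto
      then show "wp (rI ::= Plus (Var rI) (Lit 1)) (\<lambda>s'. ?I s' \<and> rg s' rN - rg s' rI < rg s rN - rg s rI) s'"
        using i k N by simp
    qed
    then show "wp (rV ::= Rd aVT (Var rI) ;; p ;; rI ::= Plus (Var rI) (Lit 1))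
      (\<lambda>s'. ?I s' \<and> rg s' rN - rg s' rI < rg s rN - rg s rI) (tick s)"
      by (simp add: V)
  next
    fix s assume I: "?I s" and b: "val s (Minus (Var rN) (Var rI)) = 0"
    have "rg s rN = length vs" using I by (auto simp: vlist_def)
    then have "rg s rI = length vs" using I b by simp
    with I fin show "Q (tick s)" by auto
  qed
  then show ?thesis by (simp add: for_verts_def)
qed

lemma for_verts_frame [simp]:
  "wreg (for_verts p) = insert rI (insert rV (wreg p))" "warr (for_verts p) = warr p"
  "puts (for_verts p) = puts p"
  by (auto simp: for_verts_def)

section \<open>Truncated reachability\<close>

text \<open>A node accepts the current tag unless its stamp shows that this search has been there or
  its counter shows saturation. Since search numbers only grow, the stamps are never cleared, not
  even between rounds.\<close>

definition visit :: cm where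
  "visit = Cond (Minus (Var rC) (Rd aST (Var rY)))
     (Cond (Minus (Var rD) (Rd aCN (Var rY)))
       (Sto aST (Var rY) (Var rC) ;; Sto aCN (Var rY) (Plus (Rd aCN (Var rY)) (Lit 1)) ;;
        rP ::= Plus (Var rP) (Lit 1) ;; Sto aVA (Var rP) (Var rW) ;;
        Sto aNX (Var rP) (Rd aHD (Var rY)) ;; Sto aHD (Var rY) (Var rP) ;;
        Sto aSK (Var rS) (Var rY) ;; rS ::= Plus (Var rS) (Lit 1)) Pass) Pass"

text \<open>A single loop serves two tasks: \<open>rE\<close> is the unread rest of the adjacency
  list in progress, \<open>rS\<close> the height of the stack, and the search ends when both are 0.
  With one loop instead of two nested ones, one potential covers everything.\<close>

definition search :: cm where
  "search = visit ;; rE ::= Lit 0 ;; Loop (Plus (Var rE) (Var rS))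
     (Cond (Var rE) (rY ::= Rd aDS (Var rE) ;; visit ;; rE ::= Rd aNE (Var rE))
       (rS ::= Minus (Var rS) (Lit 1) ;; rE ::= Rd aHE (Rd aSK (Var rS))))"

abbreviation node :: "nat \<Rightarrow> nat \<Rightarrow> ex" where
  "node Q q \<equiv> Plus (Scale Q (Var rV)) (Lit q)"

primrec resets :: "nat \<Rightarrow> nat \<Rightarrow> cm" where
  "resets Q 0 = Pass"
| "resets Q (Suc q) = resets Q q ;; Sto aCN (node Q q) (Lit 0) ;; Sto aHD (node Q q) (Lit 0)"

text \<open>
  A node accepts at most \<open>rD\<close> tags and is expanded once per accepted tag, whence the time bound
  \<open>O(rD * |E|)\<close> for the searches from all vertices marked in \<open>m\<close>.
\<close>

definition round :: "nat \<Rightarrow> nat \<Rightarrow> nat \<Rightarrow> cm" where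
  "round Q m q = for_verts (resets Q Q) ;;
     for_verts (Cond (Rd m (Var rV))
       (rC ::= Plus (Var rC) (Lit 1) ;; rW ::= Var rV ;; rY ::= node Q q ;; search) Pass)"

definition stack :: "st \<Rightarrow> nat list" where
  "stack s = rev (map (ar s aSK) [0..<rg s rS])"

definition marks :: "st \<Rightarrow> nat \<Rightarrow> nat list" where
  "marks s z = lst (ar s aNX) (ar s aVA) (ar s aHD z)"

definition heap :: "st \<Rightarrow> bool" where
  "heap s \<longleftrightarrow> decr (ar s aNX) \<and> (\<forall>z. ar s aHD z \<le> rg s rP)"

definition extends :: "st \<Rightarrow> st \<Rightarrow> bool" where
  "extends s s' \<longleftrightarrow> rg s rP \<le> rg s' rP \<and>
     (\<forall>c\<le>rg s rP. ar s' aNX c = ar s aNX c \<and> ar s' aVA c = ar s aVA c)"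

lemma extends_refl [simp]: "extends s s"
  by (simp add: extends_def)

lemma extends_trans: "extends s s' \<Longrightarrow> extends s' s'' \<Longrightarrow> extends s s''"
  by (auto simp: extends_def)

lemma extends_simps [simp]:
  "extends s (tick s') = extends s s'" "extends (tick s) s' = extends s s'"
  "x \<noteq> rP \<Longrightarrow> extends s (upd_reg x n s') = extends s s'"
  "x \<noteq> rP \<Longrightarrow> extends (upd_reg x n s) s' = extends s s'"
  "a \<noteq> aNX \<Longrightarrow> a \<noteq> aVA \<Longrightarrow> extends s (upd_arr a i n s') = extends s s'"
  "a \<noteq> aNX \<Longrightarrow> a \<noteq> aVA \<Longrightarrow> extends (upd_arr a i n s) s' = extends s s'"
  by (auto simp: extends_def)

lemma extends_lst:
  "extends s s' \<Longrightarrow> p \<le> rg s rP \<Longrightarrow> lst (ar s' aNX) (ar s' aVA) p = lst (ar s aNX) (ar s aVA) p"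
  by (rule lst_cong) (auto simp: extends_def)

locale graph =
  fixes Q :: nat and vs :: "nat list" and he ne ds :: "nat \<Rightarrow> nat"
  assumes Q_pos: "0 < Q" and distinct_vs: "distinct vs" and decr_ne: "decr ne"
begin

definition nd :: "nat \<Rightarrow> nat \<Rightarrow> nat" where "nd v q = Q * v + q"

definition Z :: "nat set" where "Z = {nd v q | v q. v \<in> set vs \<and> q < Q}"

definition adj :: "nat \<Rightarrow> nat list" where "adj z = lst ne ds (he z)"

definition E :: "(nat \<times> nat) set" where "E = {(x, y). x \<in> Z \<and> y \<in> set (adj x)}"

definition weight :: nat where "weight = (\<Sum>z\<in>Z. length (adj z) + 2)"

lemma finite_Z [simp]: "finite Z"
proof -
  have "Z = (\<lambda>(v, q). nd v q) ` (set vs \<times> {..<Q})" by (auto simp: Z_def)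
  then show ?thesis by (metis finite_SigmaI finite_imageI finite_lessThan finite_set)
qed

lemma nd_inject: "q < Q \<Longrightarrow> q' < Q \<Longrightarrow> nd v q = nd v' q' \<longleftrightarrow> v = v' \<and> q = q'"
  using address_inject[of q Q q' v v'] by (auto simp: nd_def)

lemma nd_in_Z: "v \<in> set vs \<Longrightarrow> q < Q \<Longrightarrow> nd v q \<in> Z"
  by (auto simp: Z_def)

lemma length_le_weight: "length vs \<le> weight"
proof -
  have "length vs = card ((\<lambda>v. nd v 0) ` set vs)"
    using distinct_vs Q_pos by (simp add: card_image inj_on_def nd_inject distinct_card)
  also have "\<dots> \<le> card Z" using Q_pos by (intro card_mono) (auto simp: nd_in_Z)
  also have "\<dots> \<le> weight" unfolding weight_def card_eq_sum by (rule sum_mono) simp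
  finally show ?thesis .
qed

text \<open>
  \<open>S\<close> bounds the tags of a node from above and \<open>L\<close> from below. Only the tag \<open>w\<close> of the current search
  may still have to be passed on, from nodes on the stack or to nodes in the unread part \<open>rem\<close> of an
  adjacency list; saturated nodes need no further tags.
\<close>

definition sinv :: "nat \<Rightarrow> (nat \<Rightarrow> nat set) \<Rightarrow> (nat \<Rightarrow> nat set) \<Rightarrow> nat \<Rightarrow> nat \<Rightarrow> (nat \<Rightarrow> nat) \<Rightarrow>
    (nat \<Rightarrow> nat) \<Rightarrow> (nat \<Rightarrow> nat list) \<Rightarrow> nat list \<Rightarrow> nat list \<Rightarrow> bool" where
  "sinv D S L cur w st cn T stk rem \<longleftrightarrow>
     (\<forall>z\<in>Z. distinct (T z) \<and> set (T z) \<subseteq> S z \<and> cn z = length (T z) \<and> length (T z) \<le> D \<and>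
        st z \<le> cur \<and> (st z = cur \<longleftrightarrow> w \<in> set (T z))) \<and>
     (\<forall>z\<in>Z. \<forall>y\<in>set (adj z). \<forall>t\<in>set (T z). t \<in> set (T y) \<or> cn y = D \<or>
        t = w \<and> (z \<in> set stk \<or> y \<in> set rem)) \<and>
     (\<forall>z\<in>Z. \<forall>t\<in>L z. t \<in> set (T z) \<or> cn z = D \<or> t = w \<and> z \<in> set rem) \<and>
     set stk \<subseteq> Z \<and> set rem \<subseteq> Z \<and> (\<forall>y\<in>set stk \<union> set rem. w \<in> S y) \<and>
     (\<forall>z\<in>Z. \<forall>y\<in>set (adj z). S z \<subseteq> S y)"

text \<open>Amortised cost still to come: each of the \<open>D - cn z\<close> acceptances left at
  \<open>z\<close> will stack \<open>z\<close> and later read its adjacency list; a stacked node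
  owes its removal and its list; an unread target owes one visit.\<close>

definition pot :: "nat \<Rightarrow> (nat \<Rightarrow> nat) \<Rightarrow> nat list \<Rightarrow> nat list \<Rightarrow> nat" where
  "pot D cn stk rem = (\<Sum>z\<in>Z. (D - cn z) * (length (adj z) + 2)) +
     (\<Sum>z\<leftarrow>stk. length (adj z) + 1) + length rem"

text \<open>A rejected node already carries \<open>w\<close> or is saturated. Either way the
  exemptions that \<open>y\<close> enjoyed as a member of the unread part are no longer
  used.\<close>

lemma sinv_skip:
  assumes "sinv D S L cur w st cn T stk (y # rem)" "\<not> (st y < cur \<and> cn y < D)"
  shows "sinv D S L cur w st cn T stk rem"
proof -
  have y: "y \<in> Z" using assms(1) by (simp add: sinv_def)
  then have "cn y \<le> D" "st y \<le> cur" "st y = cur \<longleftrightarrow> w \<in> set (T y)"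
    using assms(1) by (simp_all add: sinv_def)
  then have ok: "w \<in> set (T y) \<or> cn y = D"
    using assms(2) by (cases "st y = cur") auto
  show ?thesis unfolding sinv_def
  proof (intro conjI ballI)
    fix z x t
    assume "z \<in> Z" "x \<in> set (adj z)" "t \<in> set (T z)"
    then have "t \<in> set (T x) \<or> cn x = D \<or> t = w \<and> (z \<in> set stk \<or> x \<in> set (y # rem))"
      using assms(1) by (simp add: sinv_def)
    then show "t \<in> set (T x) \<or> cn x = D \<or> t = w \<and> (z \<in> set stk \<or> x \<in> set rem)"
      using ok by auto
  next
    fix z t assume "z \<in> Z" "t \<in> L z"
    then have "t \<in> set (T z) \<or> cn z = D \<or> t = w \<and> z \<in> set (y # rem)"
      using assms(1) unfolding sinv_def by blast
    then show "t \<in> set (T z) \<or> cn z = D \<or> t = w \<and> z \<in> set rem"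
      using ok by auto
  qed (use assms(1) in \<open>simp_all add: sinv_def\<close>)
qed

text \<open>Edges into \<open>y\<close> are satisfied by the new tag, and edges out of
  \<open>y\<close> are excused because \<open>y\<close> is now on the stack. The stamp guarantees
  that the tag is really new, which keeps the tags distinct.\<close>

lemma sinv_visit:
  assumes "sinv D S L cur w st cn T stk (y # rem)" "st y < cur" "cn y < D"
  shows "sinv D S L cur w (st(y := cur)) (cn(y := Suc (cn y))) (T(y := w # T y)) (y # stk) rem"
proof -
  have y: "y \<in> Z" "w \<in> S y" using assms(1) by (simp_all add: sinv_def)
  then have "st y = cur \<longleftrightarrow> w \<in> set (T y)" using assms(1) by (simp add: sinv_def)
  then have "w \<notin> set (T y)" using assms(2) by auto
  note y = y this
  show ?thesis unfolding sinv_def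
  proof (intro conjI ballI)
    fix z assume z: "z \<in> Z"
    then have zz: "distinct (T z) \<and> set (T z) \<subseteq> S z \<and> cn z = length (T z) \<and> cn z \<le> D \<and>
        st z \<le> cur \<and> (st z = cur \<longleftrightarrow> w \<in> set (T z))" using assms(1) by (simp add: sinv_def)
    show "distinct ((T(y := w # T y)) z)" "set ((T(y := w # T y)) z) \<subseteq> S z"
      "(cn(y := Suc (cn y))) z = length ((T(y := w # T y)) z)" "length ((T(y := w # T y)) z) \<le> D"
      "(st(y := cur)) z \<le> cur" "((st(y := cur)) z = cur) = (w \<in> set ((T(y := w # T y)) z))"
      using zz y assms(3) by auto
    fix x t
    assume x: "x \<in> set (adj z)" and t: "t \<in> set ((T(y := w # T y)) z)"
    then have "t \<in> set (T z) \<or> t = w \<and> z = y" by (auto split: if_splits)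
    moreover have "t \<in> set (T x) \<or> cn x = D \<or> t = w \<and> (z \<in> set stk \<or> x \<in> set (y # rem))"
      if "t \<in> set (T z)" using assms(1) that z x by (simp add: sinv_def)
    ultimately show "t \<in> set ((T(y := w # T y)) x) \<or> (cn(y := Suc (cn y))) x = D \<or>
        t = w \<and> (z \<in> set (y # stk) \<or> x \<in> set rem)"
      using assms(3) by auto
  next
    fix z t assume "z \<in> Z" "t \<in> L z"
    then have "t \<in> set (T z) \<or> cn z = D \<or> t = w \<and> z \<in> set (y # rem)"
      using assms(1) unfolding sinv_def by blast
    then show "t \<in> set ((T(y := w # T y)) z) \<or> (cn(y := Suc (cn y))) z = D \<or> t = w \<and> z \<in> set rem"
      using assms(3) by auto
  next
    fix x assume "x \<in> set (y # stk) \<union> set rem"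
    then show "w \<in> S x" using assms(1) y(2) unfolding sinv_def by auto
  qed (use assms(1) y in \<open>simp_all add: sinv_def\<close>)
qed

text \<open>The excuse of \<open>z\<close> as a source is traded for the excuse of its successors as
  targets.\<close>

lemma sinv_pop:
  assumes "sinv D S L cur w st cn T (z # stk) []" "set (adj z) \<subseteq> Z"
  shows "sinv D S L cur w st cn T stk (adj z)"
  unfolding sinv_def
proof (intro conjI ballI)
  fix x y t
  assume "x \<in> Z" "y \<in> set (adj x)" "t \<in> set (T x)"
  then have "t \<in> set (T y) \<or> cn y = D \<or> t = w \<and> (x \<in> set (z # stk) \<or> y \<in> set [])"
    using assms(1) unfolding sinv_def by blast
  then show "t \<in> set (T y) \<or> cn y = D \<or> t = w \<and> (x \<in> set stk \<or> y \<in> set (adj z))"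
    using \<open>y \<in> set (adj x)\<close> by auto
next
  fix x t assume "x \<in> Z" "t \<in> L x"
  then have "t \<in> set (T x) \<or> cn x = D \<or> t = w \<and> x \<in> set []"
    using assms(1) unfolding sinv_def by blast
  then show "t \<in> set (T x) \<or> cn x = D \<or> t = w \<and> x \<in> set (adj z)"
    by auto
next
  fix y assume "y \<in> set stk \<union> set (adj z)"
  moreover have "z \<in> Z" "\<forall>y\<in>set (z # stk). w \<in> S y" "\<forall>x\<in>Z. \<forall>y\<in>set (adj x). S x \<subseteq> S y"
    using assms(1) by (simp_all add: sinv_def)
  ultimately show "w \<in> S y" by auto
qed (use assms in \<open>simp_all add: sinv_def\<close>)

lemma pot_skip: "pot D cn stk rem < pot D cn stk (y # rem)"
  by (simp add: pot_def)

lemma pot_visit: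
  assumes "y \<in> Z" "cn y < D"
  shows "pot D (cn(y := Suc (cn y))) (y # stk) rem < pot D cn stk (y # rem)"
proof -
  have "(\<Sum>z\<in>Z. (D - cn z) * (length (adj z) + 2)) =
      (D - cn y) * (length (adj y) + 2) + (\<Sum>z\<in>Z - {y}. (D - cn z) * (length (adj z) + 2))"
    using assms(1) by (simp add: sum.remove)
  moreover have "(\<Sum>z\<in>Z. (D - (cn(y := Suc (cn y))) z) * (length (adj z) + 2)) =
      (D - Suc (cn y)) * (length (adj y) + 2) + (\<Sum>z\<in>Z - {y}. (D - cn z) * (length (adj z) + 2))"
    using assms(1) by (simp add: sum.remove)
  moreover have "D - cn y = Suc (D - Suc (cn y))" using assms(2) by simp
  then have "(D - cn y) * (length (adj y) + 2) =
      (length (adj y) + 2) + (D - Suc (cn y)) * (length (adj y) + 2)"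
    by (simp only: mult_Suc)
  moreover have "(\<Sum>z\<leftarrow>y # stk. length (adj z) + 1) = length (adj y) + 1 + (\<Sum>z\<leftarrow>stk. length (adj z) + 1)"
    "length (y # rem) = length rem + 1" by simp_all
  ultimately show ?thesis unfolding pot_def by linarith
qed

lemma pot_pop: "pot D cn stk (adj z) < pot D cn (z # stk) []"
  by (simp add: pot_def)

end

lemma wreg_visit [simp]: "wreg visit = {rP, rS}" "warr visit = {aST, aCN, aVA, aNX, aHD, aSK}"
  "\<not> puts visit"
  by (auto simp: visit_def)

lemma wreg_search [simp]: "wreg search = {rP, rS, rE, rY}" "warr search = {aST, aCN, aVA, aNX, aHD, aSK}"
  "\<not> puts search"
  by (auto simp: search_def)

lemma wreg_resets [simp]: "wreg (resets Q k) = {}" "\<not> puts (resets Q k)"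
  by (induction k) auto

lemma warr_resets: "warr (resets Q k) \<subseteq> {aCN, aHD}"
  by (induction k) auto

lemma wp_visit_new:
  assumes "ar s aST (rg s rY) < rg s rC" "ar s aCN (rg s rY) < rg s rD"
  shows "wp visit (\<lambda>s'. rg s' = (rg s)(rP := Suc (rg s rP), rS := Suc (rg s rS)) \<and>
    ar s' = (ar s)(aST := (ar s aST)(rg s rY := rg s rC), aCN := (ar s aCN)(rg s rY := Suc (ar s aCN (rg s rY))),
      aVA := (ar s aVA)(Suc (rg s rP) := rg s rW), aNX := (ar s aNX)(Suc (rg s rP) := ar s aHD (rg s rY)),
      aHD := (ar s aHD)(rg s rY := Suc (rg s rP)), aSK := (ar s aSK)(rg s rS := rg s rY)) \<and>
    tm s' = tm s + 10) s"
  using assms by (simp add: visit_def)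

lemma wp_visit_old:
  assumes "\<not> (ar s aST (rg s rY) < rg s rC \<and> ar s aCN (rg s rY) < rg s rD)"
  shows "wp visit (\<lambda>s'. rg s' = rg s \<and> ar s' = ar s \<and> tm s' \<le> tm s + 10) s"
  using assms by (auto simp: visit_def)

section \<open>Amortised analysis of a single search\<close>

context graph
begin

definition J where
  "J D S L cur w s0 rem s \<longleftrightarrow>
     sinv D S L cur w (ar s aST) (ar s aCN) (marks s) (stack s) rem \<and>
     rg s rC = cur \<and> rg s rW = w \<and> rg s rD = D \<and> heap s \<and> extends s0 s \<and>
     ar s aHE = he \<and> ar s aNE = ne \<and> ar s aDS = ds"

definition spot where "spot D s rem = pot D (ar s aCN) (stack s) rem"

lemma J_cong:
  assumes "rg s' rC = rg s rC" "rg s' rW = rg s rW" "rg s' rD = rg s rD" "rg s' rP = rg s rP"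
    "rg s' rS = rg s rS" "ar s' = ar s"
  shows "J D S L cur w s0 rem s' = J D S L cur w s0 rem s" "spot D s' rem = spot D s rem"
  using assms by (auto simp: J_def spot_def heap_def extends_def marks_def[abs_def] stack_def)

lemma wp_visit:
  assumes J: "J D S L cur w s0 (rg s rY # rem) s"
  shows "wp visit (\<lambda>s'. J D S L cur w s0 rem s' \<and>
    spot D s' rem < spot D s (rg s rY # rem) \<and> tm s' \<le> tm s + 10) s"
proof (cases "ar s aST (rg s rY) < rg s rC \<and> ar s aCN (rg s rY) < rg s rD")
  case True
  let ?y = "rg s rY" and ?p = "Suc (rg s rP)"
  show ?thesis
  proof (rule wp_mono[OF wp_visit_new], goal_cases)
    case (3 s')
    then have r: "rg s' = (rg s)(rP := ?p, rS := Suc (rg s rS))"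
      and a: "ar s' = (ar s)(aST := (ar s aST)(?y := rg s rC), aCN := (ar s aCN)(?y := Suc (ar s aCN ?y)),
        aVA := (ar s aVA)(?p := rg s rW), aNX := (ar s aNX)(?p := ar s aHD ?y),
        aHD := (ar s aHD)(?y := ?p), aSK := (ar s aSK)(rg s rS := ?y))"
      and t: "tm s' = tm s + 10" by auto
    have y: "?y \<in> Z" using J by (simp add: J_def sinv_def)
    have hp: "decr (ar s aNX)" "\<And>z. ar s aHD z \<le> rg s rP" using J by (auto simp: J_def heap_def)
    have lt: "ar s aHD z < ?p" for z using hp(2)[of z] by simp
    have T: "marks s' = (marks s)(?y := w # marks s ?y)"
      using J by (auto simp: fun_eq_iff marks_def a lst_new lst_upd hp lt J_def)
    have st: "stack s' = ?y # stack s"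
      by (simp add: stack_def a r)
    have "sinv D S L cur w (ar s' aST) (ar s' aCN) (marks s') (stack s') rem"
      unfolding T st using J True sinv_visit[of D S L cur w "ar s aST" "ar s aCN" "marks s" "stack s" ?y rem]
      by (simp add: J_def a)
    moreover have "heap s'"
      using hp lt by (auto simp: heap_def a r intro!: decr_upd le_SucI)
    moreover have "extends s s'" by (simp add: extends_def a r)
    then have "extends s0 s'" using J by (auto simp: J_def intro: extends_trans)
    ultimately have "J D S L cur w s0 rem s'" using J by (simp add: J_def a r)
    moreover have "spot D s' rem < spot D s (?y # rem)"
      using pot_visit[OF y] True J by (simp add: spot_def st a J_def)
    ultimately show ?case using t by simp
  qed (use True in auto)
next
  case False
  show ?thesis
  proof (rule wp_mono[OF wp_visit_old[OF False]])
    fix s' :: st assume s': "rg s' = rg s \<and> ar s' = ar s \<and> tm s' \<le> tm s + 10"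
    have "J D S L cur w s0 rem s"
      using J sinv_skip[of D S L cur w "ar s aST" "ar s aCN" "marks s" "stack s" "rg s rY" rem] False
      by (auto simp: J_def)
    then show "J D S L cur w s0 rem s' \<and> spot D s' rem < spot D s (rg s rY # rem) \<and> tm s' \<le> tm s + 10"
      using s' pot_skip[of D "ar s aCN" "stack s" rem "rg s rY"] J_cong(1)[of s' s D S L cur w s0 rem]
        J_cong(2)[of s' s D rem] by (simp add: spot_def)
  qed
qed

end

locale closed_graph = graph +
  assumes closed: "z \<in> Z \<Longrightarrow> set (adj z) \<subseteq> Z"
begin

lemma wp_search:
  assumes J: "J D S L cur w s0 [rg s rY] s" and S: "rg s rS = 0"
  shows "wp search (\<lambda>s'. J D S L cur w s0 [] s' \<and> rg s' rS = 0 \<and>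
    tm s' + 20 * spot D s' [] \<le> tm s + 20 * spot D s [rg s rY]) s"
  unfolding search_def wp_simps
proof (rule wp_mono[OF wp_visit[OF J]])
  let ?rem = "\<lambda>s. lst ne ds (rg s rE)"
  let ?T0 = "tm s + 20 * spot D s [rg s rY]"
  \<comment> \<open>An iteration lowers the potential by at least 1 and takes at most 14 ticks, of
    which a visit uses up to 10, so 20 per unit is ample. The additional 1 is reserved for the final
    test of the loop.\<close>
  let ?I = "\<lambda>s'. J D S L cur w s0 (?rem s') s' \<and> tm s' + 20 * spot D s' (?rem s') + 1 \<le> ?T0"
  fix s1 assume s1: "J D S L cur w s0 [] s1 \<and> spot D s1 [] < spot D s [rg s rY] \<and> tm s1 \<le> tm s + 10"
  show "wp (Loop (Plus (Var rE) (Var rS)) (Cond (Var rE) (rY ::= Rd aDS (Var rE) ;; visit ;; rE ::= Rd aNE (Var rE))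
       (rS ::= Minus (Var rS) (Lit 1) ;; rE ::= Rd aHE (Rd aSK (Var rS)))))
     (\<lambda>s'. J D S L cur w s0 [] s' \<and> rg s' rS = 0 \<and> tm s' + 20 * spot D s' [] \<le> ?T0) (upd_reg rE (val s1 (Lit 0)) s1)"
  proof (rule wp_Loop[where I = ?I and \<phi> = "\<lambda>s. spot D s (?rem s)"])
    show "?I (upd_reg rE (val s1 (Lit 0)) s1)"
      using s1 J_cong[of "upd_reg rE 0 s1" s1] by simp
  next
    fix s assume I: "?I s" and b: "val s (Plus (Var rE) (Var rS)) \<noteq> 0"
    show "wp (Cond (Var rE) (rY ::= Rd aDS (Var rE) ;; visit ;; rE ::= Rd aNE (Var rE))
       (rS ::= Minus (Var rS) (Lit 1) ;; rE ::= Rd aHE (Rd aSK (Var rS))))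
       (\<lambda>s'. ?I s' \<and> spot D s' (?rem s') < spot D s (?rem s)) (tick s)"
    proof (cases "rg s rE = 0")
      case False
      let ?e = "rg s rE"
      have ds: "ar s aDS = ds" "ar s aNE = ne" using I by (auto simp: J_def)
      have rem: "?rem s = ds ?e # lst ne ds (ne ?e)" using lst_step[OF decr_ne False] .
      let ?s = "upd_reg rY (ds ?e) (tick (tick s))"
      have eqs: "spot D ?s rem = spot D s rem" "J D S L cur w s0 rem ?s = J D S L cur w s0 rem s" for rem
        by (rule J_cong; simp)+
      have "J D S L cur w s0 (rg ?s rY # lst ne ds (ne ?e)) ?s"
        using I rem eqs by simp
      from wp_visit[OF this]
      have "wp visit (wp (rE ::= Rd aNE (Var rE)) (\<lambda>s'. ?I s' \<and> spot D s' (?rem s') < spot D s (?rem s))) ?s"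
      proof (rule wp_same, goal_cases)
        case (1 s')
        then have e: "rg s' rE = ?e" "ar s' aNE = ne" by (auto simp: same_def ds)
        have "spot D (upd_reg rE (ne ?e) s') rem = spot D s' rem"
          "J D S L cur w s0 rem (upd_reg rE (ne ?e) s') = J D S L cur w s0 rem s'" for rem
          by (rule J_cong; simp)+
        moreover have "spot D ?s (rg ?s rY # lst ne ds (ne ?e)) = spot D s (?rem s)"
          using rem eqs by simp
        ultimately show ?case using 1 e I by simp
      qed
      then show ?thesis using False by (simp add: ds)
    next
      case True
      then have S: "rg s rS \<noteq> 0" using b by simp
      let ?z = "ar s aSK (rg s rS - 1)"
      let ?s = "upd_reg rE (he ?z) (upd_reg rS (rg s rS - 1) (tick (tick s)))"
      have "[0..<rg s rS] = [0..<rg s rS - 1] @ [rg s rS - 1]"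
        using S by (metis Suc_pred' neq0_conv upt_Suc_append zero_le)
      then have stk: "stack s = ?z # stack ?s" by (simp add: stack_def)
      have "?z \<in> Z" using I stk by (simp add: J_def sinv_def)
      then have "sinv D S L cur w (ar s aST) (ar s aCN) (marks s) (stack ?s) (adj ?z)"
        using I True sinv_pop[OF _ closed] by (auto simp: J_def stk)
      then have "J D S L cur w s0 (?rem ?s) ?s"
        using I by (simp add: J_def marks_def[abs_def] heap_def adj_def)
      moreover have "spot D ?s (?rem ?s) < spot D s (?rem s)"
        using True pot_pop[of D _ _ ?z] by (simp add: spot_def stk adj_def)
      ultimately have "?I ?s \<and> spot D ?s (?rem ?s) < spot D s (?rem s)"
        using I by simp
      moreover have "ar s aHE = he" using I by (simp add: J_def)
      ultimately show ?thesis using True by simp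
    qed
  next
    fix s assume I: "?I s" and b: "val s (Plus (Var rE) (Var rS)) = 0"
    then show "J D S L cur w s0 [] (tick s) \<and> rg (tick s) rS = 0 \<and> tm (tick s) + 20 * spot D (tick s) [] \<le> ?T0"
      using J_cong[of "tick s" s] by simp
  qed
qed

end

lemma heap_simps [simp]:
  "heap (tick s) = heap s"
  "x \<noteq> rP \<Longrightarrow> heap (upd_reg x n s) = heap s"
  "a \<noteq> aNX \<Longrightarrow> a \<noteq> aHD \<Longrightarrow> heap (upd_arr a i n s) = heap s"
  by (auto simp: heap_def)

lemma wp_resets:
  fixes Q :: nat
  shows "wp (resets Q k) (\<lambda>s'. rg s' = rg s \<and> (\<forall>a. a \<noteq> aCN \<longrightarrow> a \<noteq> aHD \<longrightarrow> ar s' a = ar s a) \<and>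
    (\<forall>z. ar s' aCN z = (if \<exists>j<k. z = Q * rg s rV + j then 0 else ar s aCN z)) \<and>
    (\<forall>z. ar s' aHD z = (if \<exists>j<k. z = Q * rg s rV + j then 0 else ar s aHD z)) \<and>
    tm s' = tm s + 2 * k + 1) s"
proof (induction k)
  case 0
  then show ?case by simp
next
  case (Suc k)
  show ?case unfolding resets.simps wp_simps
    by (rule wp_mono[OF Suc]) (auto simp: less_Suc_eq)
qed

section \<open>Correctness of a full round of searches\<close>

context closed_graph
begin

text \<open>The two bounds for \<open>sinv\<close>: tags never exceed \<open>reach\<close>, and they
  contain at least the seeds. Together with closure under edges the seeds regenerate all of
  \<open>reach\<close>, except where saturation intervenes.\<close>

definition reach :: "nat \<Rightarrow> nat set \<Rightarrow> nat \<Rightarrow> nat set" where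
  "reach q X z = {t \<in> X. (nd t q, z) \<in> E\<^sup>*}"

definition seed :: "nat \<Rightarrow> nat set \<Rightarrow> nat \<Rightarrow> nat set" where
  "seed q X z = {t \<in> X. nd t q = z}"

text \<open>The form that \<open>sinv\<close> takes between two searches, when no tag is in transit
  and the excuses for stacked and unread nodes are void.\<close>

definition rinv where
  "rinv D q X s0 s \<longleftrightarrow>
     (\<forall>z\<in>Z. distinct (marks s z) \<and> set (marks s z) \<subseteq> reach q X z \<and> ar s aCN z = length (marks s z) \<and>
        length (marks s z) \<le> D \<and> ar s aST z \<le> rg s rC) \<and>
     (\<forall>z\<in>Z. \<forall>y\<in>set (adj z). \<forall>t\<in>set (marks s z). t \<in> set (marks s y) \<or> ar s aCN y = D) \<and>
     (\<forall>z\<in>Z. \<forall>t\<in>seed q X z. t \<in> set (marks s z) \<or> ar s aCN z = D) \<and>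
     rg s rD = D \<and> heap s \<and> extends s0 s \<and> ar s aHE = he \<and> ar s aNE = ne \<and> ar s aDS = ds \<and> rg s rS = 0"

lemma rinv_cong:
  assumes "rg s' rC = rg s rC" "rg s' rD = rg s rD" "rg s' rP = rg s rP" "rg s' rS = rg s rS" "ar s' = ar s"
  shows "rinv D q X s0 s' = rinv D q X s0 s"
  using assms unfolding rinv_def heap_def extends_def marks_def by simp

text \<open>The increased search number exceeds all stamps, and \<open>w \<notin> X\<close> means
  that no node carries the tag \<open>w\<close> yet; so stamps and tags agree at the start. The only
  excuse needed is the start node itself, a seed that has not been visited.\<close>

lemma J_start:
  assumes "rinv D q X s0 s" "w \<notin> X" "w \<in> set vs" "q < Q"
    and "ar s' = ar s" "rg s' rD = rg s rD" "rg s' rP = rg s rP" "rg s' rS = rg s rS"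
      "rg s' rC = Suc (rg s rC)" "rg s' rW = w"
  shows "J D (reach q (insert w X)) (seed q (insert w X)) (Suc (rg s rC)) w s0 [nd w q] s'"
proof -
  have m: "marks s' = marks s" using assms by (simp add: marks_def[abs_def])
  have stk: "stack s' = []" using assms by (simp add: stack_def rinv_def)
  have "sinv D (reach q (insert w X)) (seed q (insert w X)) (Suc (rg s rC)) w (ar s aST) (ar s aCN) (marks s) [] [nd w q]"
    unfolding sinv_def
  proof (intro conjI ballI)
    fix z assume z: "z \<in> Z"
    then have *: "distinct (marks s z) \<and> set (marks s z) \<subseteq> reach q X z \<and> ar s aCN z = length (marks s z) \<and>
        length (marks s z) \<le> D \<and> ar s aST z \<le> rg s rC" using assms(1) by (simp add: rinv_def)
    then show "distinct (marks s z)" "set (marks s z) \<subseteq> reach q (insert w X) z"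
      "ar s aCN z = length (marks s z)" "length (marks s z) \<le> D" "ar s aST z \<le> Suc (rg s rC)"
      "(ar s aST z = Suc (rg s rC)) = (w \<in> set (marks s z))"
      using assms(2) by (auto simp: reach_def)
  next
    fix z y t assume "z \<in> Z" "y \<in> set (adj z)" "t \<in> set (marks s z)"
    then show "t \<in> set (marks s y) \<or> ar s aCN y = D \<or> t = w \<and> (z \<in> set [] \<or> y \<in> set [nd w q])"
      using assms(1) unfolding rinv_def by blast
  next
    fix z t assume z: "z \<in> Z" and t: "t \<in> seed q (insert w X) z"
    show "t \<in> set (marks s z) \<or> ar s aCN z = D \<or> t = w \<and> z \<in> set [nd w q]"
    proof (cases "t = w")
      case True
      then show ?thesis using t by (simp add: seed_def)
    next
      case False
      then have "t \<in> seed q X z" using t by (simp add: seed_def)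
      then show ?thesis using assms(1) z unfolding rinv_def by blast
    qed
  next
    fix z y assume "z \<in> Z" "y \<in> set (adj z)"
    then have "(z, y) \<in> E" by (simp add: E_def)
    then show "reach q (insert w X) z \<subseteq> reach q (insert w X) y"
      by (auto simp: reach_def intro: rtrancl_into_rtrancl)
  qed (use nd_in_Z[OF assms(3,4)] in \<open>simp_all add: reach_def\<close>)
  then show ?thesis
    using assms unfolding J_def m stk by (simp add: rinv_def heap_def extends_def)
qed

lemma J_finish:
  assumes "J D (reach q X) (seed q X) cur w s0 [] s" "rg s rS = 0"
  shows "rinv D q X s0 s"
proof -
  have "stack s = []" using assms(2) by (simp add: stack_def)
  then show ?thesis
    using assms(1) unfolding J_def sinv_def rinv_def assms(2) by auto
qed

definition rpost where
  "rpost D q X s \<longleftrightarrow> (\<forall>z\<in>Z. distinct (marks s z) \<and> set (marks s z) \<subseteq> reach q X z \<and>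
     ar s aCN z = length (marks s z) \<and> ar s aCN z \<le> D \<and> (ar s aCN z < D \<longrightarrow> set (marks s z) = reach q X z))"

lemma E_in_Z: "(x, y) \<in> E \<Longrightarrow> x \<in> Z \<and> y \<in> Z"
  using closed by (auto simp: E_def)

text \<open>A node that misses a tag is saturated, and so are then all nodes below it.\<close>

lemma rpost:
  assumes r: "rinv D q X s0 s" and X: "X \<subseteq> set vs" and q: "q < Q"
  shows "rpost D q X s"
proof -
  have full: "z \<in> Z \<and> (t \<in> set (marks s z) \<or> ar s aCN z = D)" if t: "t \<in> X" "(nd t q, z) \<in> E\<^sup>*" for t z
    using t(2)
  proof (induction rule: rtrancl_induct)
    case base
    have "nd t q \<in> Z" using t X q nd_in_Z by auto
    then show ?case using r t(1) unfolding rinv_def seed_def by blast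
  next
    case (step x y)
    have x: "x \<in> Z" "y \<in> Z" "y \<in> set (adj x)" using step(2) E_in_Z[OF step(2)] by (simp_all add: E_def)
    have c: "ar s aCN x = length (marks s x)" "distinct (marks s x)"
      "ar s aCN y = length (marks s y)" "distinct (marks s y)" "length (marks s y) \<le> D"
      using r x unfolding rinv_def by blast+
    have sub: "\<forall>t\<in>set (marks s x). t \<in> set (marks s y) \<or> ar s aCN y = D"
      using r x unfolding rinv_def by blast
    show ?case
    proof (cases "ar s aCN y = D")
      case False
      then have "set (marks s x) \<subseteq> set (marks s y)" using sub by blast
      moreover from this have "length (marks s x) \<le> length (marks s y)"
        using c by (metis card_mono distinct_card finite_set)
      then have "ar s aCN x \<noteq> D" using c False by simp
      ultimately show ?thesis using step(3) x by blast
    qed (use x in simp)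
  qed
  show ?thesis unfolding rpost_def
  proof (intro ballI conjI impI)
    fix z assume z: "z \<in> Z"
    then have *: "distinct (marks s z) \<and> set (marks s z) \<subseteq> reach q X z \<and> ar s aCN z = length (marks s z) \<and>
        length (marks s z) \<le> D" using r by (simp add: rinv_def)
    then show "distinct (marks s z)" "set (marks s z) \<subseteq> reach q X z" "ar s aCN z = length (marks s z)" "ar s aCN z \<le> D"
      by auto
    assume "ar s aCN z < D"
    then have "t \<in> set (marks s z)" if "t \<in> reach q X z" for t
      using full[of t z] that by (auto simp: reach_def)
    then show "set (marks s z) = reach q X z" using * by blast
  qed
qed

definition env :: "st \<Rightarrow> bool" where
  "env s \<longleftrightarrow> ar s aHE = he \<and> ar s aNE = ne \<and> ar s aDS = ds \<and> vlist s = vs \<and> heap s \<and>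
     (\<forall>z\<in>Z. ar s aST z \<le> rg s rC) \<and> rg s rS = 0"

lemma env_simps [simp]:
  "env (tick s) = env s"
  "x \<notin> {rN, rP, rC, rS} \<Longrightarrow> env (upd_reg x n s) = env s"
  "a \<notin> {aHE, aNE, aDS, aVT, aNX, aHD, aST} \<Longrightarrow> env (upd_arr a i n s) = env s"
  by (auto simp: env_def heap_def)

definition marked :: "st \<Rightarrow> nat \<Rightarrow> nat set" where
  "marked s m = {v \<in> set vs. ar s m v \<noteq> 0}"

lemma wp_reset_all:
  assumes env: "env s"
  shows "wp (for_verts (resets Q Q)) (\<lambda>s'. env s' \<and> rinv (rg s rD) q {} s s' \<and>
    tm s' \<le> tm s + (2 * Q + 4) * length vs + 2) s"
proof -
  let ?Inv = "\<lambda>k s'. (\<forall>x. x \<noteq> rI \<longrightarrow> x \<noteq> rV \<longrightarrow> rg s' x = rg s x) \<and>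
    (\<forall>a. a \<noteq> aCN \<longrightarrow> a \<noteq> aHD \<longrightarrow> ar s' a = ar s a) \<and>
    (\<forall>i<k. \<forall>j<Q. ar s' aCN (nd (vs ! i) j) = 0 \<and> ar s' aHD (nd (vs ! i) j) = 0) \<and>
    (\<forall>z. ar s' aHD z \<le> rg s rP) \<and> tm s' \<le> tm s + (2 * Q + 4) * k + 1"
  show ?thesis
  proof (rule wp_for_verts[where vs = vs and Inv = ?Inv])
    show "vlist s = vs" using env by (simp add: env_def)
    show "?Inv 0 (upd_reg rI 0 s)" using env by (simp add: env_def heap_def)
  next
    fix k and s1 :: st assume k: "k < length vs" and I: "?Inv k s1"
    show "wp (resets Q Q) (\<lambda>s'. ?Inv (Suc k) (upd_reg rI (Suc k) s')) (upd_reg rV (vs ! k) (tick s1))"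
    proof (rule wp_mono[OF wp_resets], elim conjE)
      fix s' :: st assume a: "rg s' = rg (upd_reg rV (vs ! k) (tick s1))"
        "\<forall>a. a \<noteq> aCN \<longrightarrow> a \<noteq> aHD \<longrightarrow> ar s' a = ar (upd_reg rV (vs ! k) (tick s1)) a"
        "\<forall>z. ar s' aCN z = (if \<exists>j<Q. z = Q * rg (upd_reg rV (vs ! k) (tick s1)) rV + j then 0
           else ar (upd_reg rV (vs ! k) (tick s1)) aCN z)"
        "\<forall>z. ar s' aHD z = (if \<exists>j<Q. z = Q * rg (upd_reg rV (vs ! k) (tick s1)) rV + j then 0
           else ar (upd_reg rV (vs ! k) (tick s1)) aHD z)"
        "tm s' = tm (upd_reg rV (vs ! k) (tick s1)) + 2 * Q + 1"
      have "ar s' aCN (nd (vs ! i) j) = 0 \<and> ar s' aHD (nd (vs ! i) j) = 0" if "i < Suc k" "j < Q" for i j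
        using that a(3,4) I by (cases "i = k") (auto simp: nd_def less_Suc_eq)
      moreover have "ar s' aHD z \<le> rg s rP" for z using a(4) I by simp
      ultimately show "?Inv (Suc k) (upd_reg rI (Suc k) s')"
        using I a(1,2,5) by (simp add: add_mult_distrib)
    qed
  next
    fix s' :: st assume I: "?Inv (length vs) s'"
    have z: "ar s' aCN z = 0 \<and> marks s' z = []" if "z \<in> Z" for z
      using that I unfolding Z_def marks_def by (auto simp: in_set_conv_nth)
    have "heap s'" using I env by (simp add: heap_def env_def)
    moreover have "vlist s' = vlist s" using I by (simp add: vlist_def)
    moreover have "extends s s'" using I by (simp add: extends_def)
    ultimately show "env (tick s') \<and> rinv (rg s rD) q {} s (tick s') \<and>
        tm (tick s') \<le> tm s + (2 * Q + 4) * length vs + 2"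
      using I env z by (simp add: env_def rinv_def heap_def marks_def seed_def)
  qed (use warr_resets[of Q Q] in auto)
qed

lemma wp_round:
  assumes env: "env s" and m: "m \<notin> {aST, aCN, aVA, aNX, aHD, aSK}" and q: "q < Q"
  shows "wp (round Q m q) (\<lambda>s'. env s' \<and> rpost (rg s rD) q (marked s m) s' \<and> extends s s' \<and>
    tm s' \<le> tm s + (2 * Q + 60) * ((rg s rD + 1) * (weight + 1))) s"
  unfolding round_def wp_simps
proof (rule wp_same[OF wp_reset_all[OF env, of q]], elim conjE)
  fix s1 assume env1: "env s1" and rinv1: "rinv (rg s rD) q {} s s1"
    and t1: "tm s1 \<le> tm s + (2 * Q + 4) * length vs + 2"
    and same1: "same (for_verts (resets Q Q)) s s1"
  let ?D = "rg s rD"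
  let ?X = "\<lambda>k. {v \<in> set (take k vs). ar s m v \<noteq> 0}"
  have m1: "ar s1 m = ar s m" using same_arr[OF same1, of m] m warr_resets[of Q Q] by auto
  \<comment> \<open>Each source is charged 20 for the potential of its start node and fewer than 20
    for the loop around its search. The edge traversals of all searches together are paid from the
    one potential of \<open>s1\<close>; this is what keeps the round linear in \<open>weight\<close>
    for fixed \<open>D\<close>, whatever the number of sources.\<close>
  let ?Inv = "\<lambda>k s'. rinv ?D q (?X k) s s' \<and> ar s' m = ar s m \<and> 
     tm s' + 20 * spot ?D s' [] \<le> tm s1 + 20 * spot ?D s1 [] + 1 + 40 * k"
  have spot: "spot ?D s [] = (\<Sum>z\<in>Z. (?D - ar s aCN z) * (length (adj z) + 2))" if "rg s rS = 0" for s
    using that by (simp add: spot_def pot_def stack_def)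
  show "wp (for_verts (Cond (Rd m (Var rV))
      (rC ::= Plus (Var rC) (Lit 1) ;; rW ::= Var rV ;; rY ::= node Q q ;; search) Pass))
    (\<lambda>s'. env s' \<and> rpost ?D q (marked s m) s' \<and> extends s s' \<and>
      tm s' \<le> tm s + (2 * Q + 60) * ((?D + 1) * (weight + 1))) s1"
  proof (rule wp_for_verts[where vs = vs and Inv = ?Inv])
    show "vlist s1 = vs" using env1 by (simp add: env_def)
    have "rinv ?D q {} s (upd_reg rI 0 s1)"
      using rinv1 rinv_cong[of "upd_reg rI 0 s1" s1] by simp
    then show "?Inv 0 (upd_reg rI 0 s1)"
      using m1 J_cong(2)[of "upd_reg rI 0 s1" s1] by simp
  next
    fix k s2 assume k: "k < length vs" and I: "?Inv k s2"
    let ?w = "vs ! k"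
    have X: "?X (Suc k) = (if ar s m ?w \<noteq> 0 then insert ?w (?X k) else ?X k)"
      using k by (auto simp: take_Suc_conv_app_nth)
    have new: "?w \<notin> ?X k"
      using k distinct_vs by (auto simp: in_set_conv_nth nth_eq_iff_index_eq)
    let ?s = "upd_reg rV ?w (tick s2)"
    let ?Q = "\<lambda>s'. ?Inv (Suc k) (upd_reg rI (Suc k) s')"
    show "wp (Cond (Rd m (Var rV)) (rC ::= Plus (Var rC) (Lit 1) ;; rW ::= Var rV ;; rY ::= node Q q ;; search) Pass) ?Q ?s"
    proof (cases "ar s m ?w = 0")
      case True
      have "rinv ?D q (?X k) s (upd_reg rI (Suc k) (tick (tick ?s)))"
        using I rinv_cong[of "upd_reg rI (Suc k) (tick (tick ?s))" s2] by simp
      then have "?Q (tick (tick ?s))"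
        using I True X J_cong(2)[of "upd_reg rI (Suc k) (tick (tick ?s))" s2] by (simp add: X)
      then show ?thesis using True I by simp
    next
      case False
      let ?s' = "upd_reg rY (nd ?w q) (upd_reg rW ?w (upd_reg rC (Suc (rg s2 rC)) (tick ?s)))"
      have J: "J ?D (reach q (insert ?w (?X k))) (seed q (insert ?w (?X k))) (Suc (rg s2 rC)) ?w s [nd ?w q] ?s'"
        using I k new q by (intro J_start) auto
      then have J': "J ?D (reach q (insert ?w (?X k))) (seed q (insert ?w (?X k))) (Suc (rg s2 rC)) ?w s [rg ?s' rY] ?s'"
        by simp
      have S: "rg ?s' rS = 0" using I by (simp add: rinv_def)
      have "wp search ?Q ?s'"
      proof (rule wp_same[OF wp_search[OF J' S]])
        fix s3
        assume s3: "J ?D (reach q (insert ?w (?X k))) (seed q (insert ?w (?X k))) (Suc (rg s2 rC)) ?w s [] s3 \<and>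
          rg s3 rS = 0 \<and> tm s3 + 20 * spot ?D s3 [] \<le> tm ?s' + 20 * spot ?D ?s' [rg ?s' rY]"
          and sm: "same search ?s' s3"
        have r: "rinv ?D q (?X (Suc k)) s s3" using s3 J_finish X False by auto
        have "ar s3 m = ar s2 m" using same_arr[OF sm, of m] m by simp
        moreover have "rinv ?D q (?X (Suc k)) s (upd_reg rI (Suc k) s3)"
          using r rinv_cong[of "upd_reg rI (Suc k) s3" s3] by simp
        moreover have "spot ?D ?s' [rg ?s' rY] = spot ?D s2 [] + 1"
          by (simp add: spot_def pot_def stack_def)
        ultimately show "?Q s3"
          using s3 I J_cong(2)[of "upd_reg rI (Suc k) s3" s3] by simp
      qed
      then show ?thesis using False I by (simp add: nd_def)
    qed
  next
    fix s' assume I: "?Inv (length vs) s'" and v: "vlist s' = vs"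
    have "spot ?D s1 [] \<le> ?D * weight"
      using rinv1 spot[of s1] unfolding rinv_def weight_def sum_distrib_left
      by (metis (mono_tags, lifting) diff_le_self mult_le_mono1 sum_mono)
    then have "tm s' \<le> tm s + (2 * Q + 4) * length vs + 2 + 20 * (?D * weight) + 1 + 40 * length vs"
      using I t1 by simp
    then have "tm s' + 1 \<le> tm s + (2 * Q + 44) * length vs + 20 * (?D * weight) + 4"
      by (simp add: algebra_simps)
    moreover have "(2 * Q + 44) * length vs \<le> (2 * Q + 44) * weight"
      by (intro mult_le_mono2 length_le_weight)
    moreover have "(2 * Q + 44) * weight + 20 * (?D * weight) + 4 \<le> (2 * Q + 60) * ((?D + 1) * (weight + 1))"
      by (simp add: algebra_simps)
    ultimately have tt: "tm s' + 1 \<le> tm s + (2 * Q + 60) * ((?D + 1) * (weight + 1))"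
      by linarith
    have "rpost ?D q (marked s m) s'"
      using rpost[of ?D q "?X (length vs)" s s'] I q by (auto simp: marked_def)
    then have "rpost ?D q (marked s m) (tick s')" by (simp only: rpost_def marks_def tick_simps)
    moreover have "env (tick s')" using I v by (simp add: rinv_def env_def)
    moreover have "extends s (tick s')" using I by (simp add: rinv_def)
    ultimately show "env (tick s') \<and> rpost ?D q (marked s m) (tick s') \<and> extends s (tick s') \<and>
        tm (tick s') \<le> tm s + (2 * Q + 60) * ((?D + 1) * (weight + 1))"
      using tt by simp
  qed auto
qed

end

lemma round_frame [simp]:
  "wreg (round Q m q) = {rC, rW, rY, rP, rS, rE, rI, rV}" "\<not> puts (round Q m q)"
  by (auto simp: round_def)

lemma warr_round: "warr (round Q m q) \<subseteq> {aST, aCN, aVA, aNX, aHD, aSK}"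
  using warr_resets[of Q Q] by (auto simp: round_def)

section \<open>Semijoins and binary relations\<close>

text \<open>With bound 1 a node keeps one witness only, so linear time suffices to decide for all
  nodes at once whether some marked source reaches them.\<close>

definition semijoin :: "nat \<Rightarrow> nat \<Rightarrow> nat \<Rightarrow> nat \<Rightarrow> nat \<Rightarrow> cm" where
  "semijoin Q m q m' q' = rD ::= Lit 1 ;; round Q m q ;;
     for_verts (Cond (Rd aCN (node Q q')) Pass (Sto m' (Var rV) (Lit 0)))"

definition count_heavy :: "nat \<Rightarrow> nat \<Rightarrow> nat \<Rightarrow> cm" where
  "count_heavy Q m q = rH ::= Lit 0 ;; for_verts (Cond (Rd m (Var rV))
     (Cond (Minus (Var rD) (Rd aCN (node Q q))) Pass (rH ::= Plus (Var rH) (Lit 1))) Pass)"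

definition probe :: "nat \<Rightarrow> nat \<Rightarrow> nat \<Rightarrow> nat \<Rightarrow> nat \<Rightarrow> cm" where
  "probe Q m q m' q' = round Q m q ;; count_heavy Q m' q'"

text \<open>A heavy value starts with an empty list, since its truncated list may be incomplete;
  \<open>invert\<close> supplies the whole list later. A light value keeps the list of tags it has
  received, which is complete.\<close>

definition split_heavy :: "nat \<Rightarrow> nat \<Rightarrow> nat \<Rightarrow> nat \<Rightarrow> cm" where
  "split_heavy Q m q l = for_verts (Cond (Rd m (Var rV))
     (Cond (Minus (Var rD) (Rd aCN (node Q q)))
       (Sto aHV (Var rV) (Lit 0) ;; Sto l (Var rV) (Rd aHD (node Q q)))
       (Sto aHV (Var rV) (Lit 1) ;; Sto l (Var rV) (Lit 0)))
     (Sto aHV (Var rV) (Lit 0)))"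

definition push_all :: "nat \<Rightarrow> cm" where
  "push_all l = Loop (Var rE) (rP ::= Plus (Var rP) (Lit 1) ;; Sto aVA (Var rP) (Var rV) ;;
     Sto aNX (Var rP) (Rd l (Rd aVA (Var rE))) ;; Sto l (Rd aVA (Var rE)) (Var rP) ;;
     rE ::= Rd aNX (Var rE))"

text \<open>The last round tells each partner which heavy values reach it, whereas the enumeration
  needs the partners of each heavy value. This transposes the lists; light values never occur in
  them and keep theirs.\<close>

definition invert :: "nat \<Rightarrow> nat \<Rightarrow> nat \<Rightarrow> nat \<Rightarrow> cm" where
  "invert Q m q l = for_verts (Cond (Rd m (Var rV)) (rE ::= Rd aHD (node Q q) ;; push_all l) Pass)"

text \<open>\<open>m\<close>, \<open>m'\<close> hold the two sides of the relation, which leads from state \<open>s\<close> to \<open>t\<close>, its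
  converse from \<open>s'\<close> to \<open>t'\<close>. The last round runs with bound \<open>D + 1\<close>: with at most \<open>D\<close> heavy values
  no node gets saturated.\<close>

definition relation :: "nat \<Rightarrow> nat \<Rightarrow> nat \<Rightarrow> nat \<Rightarrow> nat \<Rightarrow> nat \<Rightarrow> nat \<Rightarrow> nat \<Rightarrow> cm" where
  "relation Q m m' s t s' t' l = rD ::= Lit 1 ;; probe Q m' s' m t' ;;
     Loop (Minus (Var rH) (Var rD)) (rD ::= Plus (Var rD) (Var rD) ;; probe Q m' s' m t') ;;
     split_heavy Q m t' l ;; rD ::= Plus (Var rD) (Lit 1) ;; round Q aHV s ;; invert Q m' t l"

definition llist :: "nat \<Rightarrow> st \<Rightarrow> nat \<Rightarrow> nat list" where
  "llist l s v = lst (ar s aNX) (ar s aVA) (ar s l v)"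

text \<open>Distinctness of \<open>xs\<close> lets each list grow by at most one cell. The cells
  being read lie at or below the old \<open>rP\<close>, so the new cells cannot disturb the
  traversal.\<close>

lemma wp_push_all:
  assumes l: "l \<ge> 20" and hp: "heap s" "\<forall>v. ar s l v \<le> rg s rP" "rg s rE \<le> rg s rP"
    and xs: "xs = lst (ar s aNX) (ar s aVA) (rg s rE)" "distinct xs"
  shows "wp (push_all l) (\<lambda>s'. heap s' \<and> (\<forall>v. ar s' l v \<le> rg s' rP) \<and> extends s s' \<and>
    (\<forall>v. llist l s' v = (if v \<in> set xs then [rg s rV] else []) @ llist l s v) \<and>
    tm s' \<le> tm s + 6 * length xs + 1) s"
  unfolding push_all_def
proof (rule wp_Loop[where \<phi> = "\<lambda>s. rg s rE" and
    I = "\<lambda>s'. heap s' \<and> (\<forall>v. ar s' l v \<le> rg s' rP) \<and> extends s s' \<and> rg s' rE \<le> rg s rP \<and> rg s' rV = rg s rV \<and>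
      (\<exists>ys. xs = ys @ lst (ar s' aNX) (ar s' aVA) (rg s' rE) \<and>
        (\<forall>v. llist l s' v = (if v \<in> set ys then [rg s rV] else []) @ llist l s v) \<and>
        tm s' \<le> tm s + 6 * length ys)"], goal_cases)
  case 1
  show ?case using hp xs by simp
next
  case (2 s1)
  let ?e = "rg s1 rE" and ?p = "Suc (rg s1 rP)"
  from 2 have hp1: "decr (ar s1 aNX)" "\<forall>v. ar s1 l v \<le> rg s1 rP" "extends s s1" "?e \<le> rg s rP"
    "rg s1 rV = rg s rV" "\<forall>z. ar s1 aHD z \<le> rg s1 rP" and e0: "?e \<noteq> 0"
    by (auto simp: heap_def)
  from 2 obtain ys where ys: "xs = ys @ lst (ar s1 aNX) (ar s1 aVA) ?e"
    "\<forall>v. llist l s1 v = (if v \<in> set ys then [rg s rV] else []) @ llist l s v"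
    "tm s1 \<le> tm s + 6 * length ys" by blast
  have eP: "?e \<le> rg s1 rP" using hp1(3,4) by (auto simp: extends_def)
  let ?v = "ar s1 aVA ?e"
  have nx: "ar s1 aNX ?e < ?e" using hp1(1) e0 by (simp add: decr_def)
  have xs1: "xs = (ys @ [?v]) @ lst (ar s1 aNX) (ar s1 aVA) (ar s1 aNX ?e)"
    using ys(1) lst_step[OF hp1(1) e0] by simp
  have new: "?v \<notin> set ys" using xs(2) xs1 by auto
  let ?NX = "(ar s1 aNX)(?p := ar s1 l ?v)" and ?VA = "(ar s1 aVA)(?p := rg s rV)"
  have lt: "ar s1 l v < ?p" for v using hp1(2) by (simp add: le_imp_less_Suc)
  have ll: "lst ?NX ?VA (((ar s1 l)(?v := ?p)) v) =
      (if v \<in> set (ys @ [?v]) then [rg s rV] else []) @ llist l s v" for v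
    using lst_new[OF hp1(1) lt, of ?v] lst_upd[OF lt] ys(2) new by (auto simp: llist_def)
  have rest: "lst ?NX ?VA (ar s1 aNX ?e) = lst (ar s1 aNX) (ar s1 aVA) (ar s1 aNX ?e)"
    using nx eP by (intro lst_upd) simp
  have dec: "decr ?NX" using hp1(1) lt by (rule decr_upd)
  have ex: "rg s rP \<le> rg s1 rP" "\<forall>c\<le>rg s rP. ar s1 aNX c = ar s aNX c \<and> ar s1 aVA c = ar s aVA c"
    using hp1(3) by (auto simp: extends_def)
  have ne: "?e \<noteq> ?p" using eP by simp
  show ?case
    using l e0 ne dec hp1 ex nx ll ys(3) xs1 rest
    by (auto simp: heap_def extends_def llist_def le_Suc_eq intro!: exI[of _ "ys @ [?v]"])
next
  case (3 s1)
  then have "rg s1 rE = 0" by simp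
  with 3 show ?case by (auto simp: heap_def llist_def)
qed

context closed_graph
begin

lemma env_round_frame: "same (round Q m q) s s' \<Longrightarrow> rg s' rD = rg s rD \<and> rg s' rH = rg s rH \<and>
    (\<forall>a. a \<notin> {aST, aCN, aVA, aNX, aHD, aSK} \<longrightarrow> ar s' a = ar s a)"
  using warr_round[of Q m q] by (auto simp: same_def)

lemma wp_semijoin:
  assumes env: "env s" and m: "m \<ge> 20" "m' \<ge> 20" and q: "q < Q" "q' < Q"
  shows "wp (semijoin Q m q m' q') (\<lambda>s'. env s' \<and> extends s s' \<and>
    marked s' m' = {v \<in> marked s m'. \<exists>w\<in>marked s m. (nd w q, nd v q') \<in> E\<^sup>*} \<and>
    tm s' \<le> tm s + (4 * Q + 140) * (weight + 1)) s"
  unfolding semijoin_def wp_simps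
proof (rule wp_same[OF wp_round], goal_cases)
  case (4 s1)
  let ?X = "marked s m"
  have X: "marked (upd_reg rD (val s (Lit 1)) s) m = ?X" by (simp add: marked_def)
  have s1: "env s1" "rpost 1 q ?X s1" "extends s s1"
    "tm s1 \<le> tm s + 1 + (2 * Q + 60) * ((1 + 1) * (weight + 1))" "ar s1 m' = ar s m'"
    using 4(1) m env_round_frame[OF 4(2)] unfolding X by simp_all
  have cn: "ar s1 aCN (nd v q') = 0 \<longleftrightarrow> \<not> (\<exists>w\<in>?X. (nd w q, nd v q') \<in> E\<^sup>*)" if "v \<in> set vs" for v
  proof -
    have "nd v q' \<in> Z" using that q nd_in_Z by simp
    then have a: "set (marks s1 (nd v q')) \<subseteq> reach q ?X (nd v q')" "ar s1 aCN (nd v q') = length (marks s1 (nd v q'))"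
      "ar s1 aCN (nd v q') < 1 \<longrightarrow> set (marks s1 (nd v q')) = reach q ?X (nd v q')"
      using s1(2) unfolding rpost_def by blast+
    then have "ar s1 aCN (nd v q') = 0 \<longleftrightarrow> reach q ?X (nd v q') = {}" by auto
    then show ?thesis by (auto simp: reach_def)
  qed
  let ?Inv = "\<lambda>k s'. env s' \<and> extends s s' \<and> ar s' aCN = ar s1 aCN \<and>
    (\<forall>v. ar s' m' v = (if v \<in> set (take k vs) \<and> ar s1 aCN (nd v q') = 0 then 0 else ar s m' v)) \<and>
    tm s' \<le> tm s1 + 1 + 5 * k"
  show ?case
  proof (rule wp_for_verts[where vs = vs and Inv = ?Inv])
    show "vlist s1 = vs" using s1(1) by (simp add: env_def)
    show "?Inv 0 (upd_reg rI 0 s1)" using s1 by simp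
  next
    fix k and s2 :: st assume k: "k < length vs" and I: "?Inv k s2"
    have X: "set (take (Suc k) vs) = insert (vs ! k) (set (take k vs))"
      using k by (simp add: take_Suc_conv_app_nth)
    show "wp (Cond (Rd aCN (node Q q')) Pass (Sto m' (Var rV) (Lit 0)))
      (\<lambda>s'. ?Inv (Suc k) (upd_reg rI (Suc k) s')) (upd_reg rV (vs ! k) (tick s2))"
      using I m unfolding X by (auto simp: nd_def)
  next
    fix s2 :: st assume I: "?Inv (length vs) s2"
    have "marked s2 m' = {v \<in> marked s m'. \<exists>w\<in>?X. (nd w q, nd v q') \<in> E\<^sup>*}"
    proof -
      have "ar s2 m' v \<noteq> 0 \<longleftrightarrow> ar s m' v \<noteq> 0 \<and> (\<exists>w\<in>?X. (nd w q, nd v q') \<in> E\<^sup>*)" if "v \<in> set vs" for v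
        using I cn[OF that] that by simp
      then show ?thesis by (auto simp: marked_def[of _ m'])
    qed
    moreover have "tm s2 + 1 \<le> tm s + (4 * Q + 140) * (weight + 1)"
      using I s1(4) length_le_weight by (simp add: algebra_simps)
    ultimately show "env (tick s2) \<and> extends s (tick s2) \<and>
      marked (tick s2) m' = {v \<in> marked s m'. \<exists>w\<in>?X. (nd w q, nd v q') \<in> E\<^sup>*} \<and>
      tm (tick s2) \<le> tm s + (4 * Q + 140) * (weight + 1)"
      using I by (simp add: marked_def)
  qed (use m in auto)
qed (use env m q in auto)

lemma wp_count_heavy:
  assumes env: "env s"
  shows "wp (count_heavy Q m q) (\<lambda>s'. env s' \<and> ar s' = ar s \<and> rg s' rD = rg s rD \<and> extends s s' \<and>
    rg s' rH = card {v \<in> marked s m. rg s rD \<le> ar s aCN (nd v q)} \<and> tm s' \<le> tm s + 7 * (weight + 1)) s"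
proof -
  let ?X = "\<lambda>k. {v \<in> set (take k vs). ar s m v \<noteq> 0 \<and> rg s rD \<le> ar s aCN (nd v q)}"
  let ?Inv = "\<lambda>k s'. env s' \<and> ar s' = ar s \<and> rg s' rD = rg s rD \<and> extends s s' \<and>
     rg s' rH = card (?X k) \<and> tm s' \<le> tm s + 2 + 6 * k"
  show ?thesis unfolding count_heavy_def wp_simps
  proof (rule wp_for_verts[where vs = vs and Inv = ?Inv])
    show "vlist (upd_reg rH (val s (Lit 0)) s) = vs" using env by (simp add: env_def)
    show "?Inv 0 (upd_reg rI 0 (upd_reg rH (val s (Lit 0)) s))" using env by simp
  next
    fix k and s2 :: st assume k: "k < length vs" and I: "?Inv k s2"
    have X: "?X (Suc k) = (if ar s m (vs ! k) \<noteq> 0 \<and> rg s rD \<le> ar s aCN (nd (vs ! k) q)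
        then insert (vs ! k) (?X k) else ?X k)"
      using k by (auto simp: take_Suc_conv_app_nth)
    have new: "vs ! k \<notin> ?X k"
      using k distinct_vs by (auto simp: in_set_conv_nth nth_eq_iff_index_eq)
    then have "card (insert (vs ! k) (?X k)) = Suc (card (?X k))" by (intro card_insert_disjoint) auto
    then show "wp (Cond (Rd m (Var rV)) (Cond (Minus (Var rD) (Rd aCN (node Q q))) Pass
        (rH ::= Plus (Var rH) (Lit 1))) Pass)
      (\<lambda>s'. ?Inv (Suc k) (upd_reg rI (Suc k) s')) (upd_reg rV (vs ! k) (tick s2))"
      using I unfolding X by (auto simp: nd_def)
  next
    fix s2 :: st assume I: "?Inv (length vs) s2"
    then show "env (tick s2) \<and> ar (tick s2) = ar s \<and> rg (tick s2) rD = rg s rD \<and> extends s (tick s2) \<and>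
      rg (tick s2) rH = card {v \<in> marked s m. rg s rD \<le> ar s aCN (nd v q)} \<and> tm (tick s2) \<le> tm s + 7 * (weight + 1)"
      using length_le_weight by (simp add: marked_def conj_assoc)
  qed auto
qed

lemma wp_split_heavy:
  assumes env: "env s" and m: "m \<ge> 20" "l \<ge> 20" "m \<noteq> l"
  shows "wp (split_heavy Q m q l) (\<lambda>s'. env s' \<and> rg s' rD = rg s rD \<and> extends s s' \<and>
    (\<forall>a. a \<noteq> aHV \<longrightarrow> a \<noteq> l \<longrightarrow> ar s' a = ar s a) \<and>
    marked s' aHV = {v \<in> marked s m. rg s rD \<le> ar s aCN (nd v q)} \<and>
    (\<forall>v. ar s' l v = (if v \<in> marked s m then if rg s rD \<le> ar s aCN (nd v q) then 0 else ar s aHD (nd v q)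
       else ar s l v)) \<and>
    tm s' \<le> tm s + 8 * (weight + 1)) s"
proof -
  let ?Inv = "\<lambda>k s'. env s' \<and> rg s' rD = rg s rD \<and> extends s s' \<and> (\<forall>a. a \<noteq> aHV \<longrightarrow> a \<noteq> l \<longrightarrow> ar s' a = ar s a) \<and>
    (\<forall>v\<in>set (take k vs). ar s' aHV v = (if ar s m v \<noteq> 0 \<and> rg s rD \<le> ar s aCN (nd v q) then 1 else 0)) \<and>
    (\<forall>v. ar s' l v = (if v \<in> set (take k vs) \<and> ar s m v \<noteq> 0 then
       if rg s rD \<le> ar s aCN (nd v q) then 0 else ar s aHD (nd v q) else ar s l v)) \<and>
    tm s' \<le> tm s + 1 + 7 * k"
  show ?thesis unfolding split_heavy_def
  proof (rule wp_for_verts[where vs = vs and Inv = ?Inv])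
    show "vlist s = vs" using env by (simp add: env_def)
    show "?Inv 0 (upd_reg rI 0 s)" using env by simp
  next
    fix k and s2 :: st assume k: "k < length vs" and I: "?Inv k s2"
    have X: "set (take (Suc k) vs) = insert (vs ! k) (set (take k vs))"
      using k by (simp add: take_Suc_conv_app_nth)
    have new: "vs ! k \<notin> set (take k vs)"
      using k distinct_vs by (auto simp: in_set_conv_nth nth_eq_iff_index_eq)
    show "wp (Cond (Rd m (Var rV)) (Cond (Minus (Var rD) (Rd aCN (node Q q)))
       (Sto aHV (Var rV) (Lit 0) ;; Sto l (Var rV) (Rd aHD (node Q q)))
       (Sto aHV (Var rV) (Lit 1) ;; Sto l (Var rV) (Lit 0))) (Sto aHV (Var rV) (Lit 0)))
      (\<lambda>s'. ?Inv (Suc k) (upd_reg rI (Suc k) s')) (upd_reg rV (vs ! k) (tick s2))"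
      using I m new unfolding X by (auto simp: nd_def)
  next
    fix s2 :: st assume I: "?Inv (length vs) s2"
    then show "env (tick s2) \<and> rg (tick s2) rD = rg s rD \<and> extends s (tick s2) \<and>
      (\<forall>a. a \<noteq> aHV \<longrightarrow> a \<noteq> l \<longrightarrow> ar (tick s2) a = ar s a) \<and>
      marked (tick s2) aHV = {v \<in> marked s m. rg s rD \<le> ar s aCN (nd v q)} \<and>
      (\<forall>v. ar (tick s2) l v = (if v \<in> marked s m then if rg s rD \<le> ar s aCN (nd v q) then 0
        else ar s aHD (nd v q) else ar s l v)) \<and> tm (tick s2) \<le> tm s + 8 * (weight + 1)"
      using length_le_weight by (auto simp: marked_def split: if_splits)
  qed (use m in auto)
qed

end

lemma push_all_frame [simp]:
  "wreg (push_all l) = {rP, rE}" "warr (push_all l) = {aVA, aNX, l}" "\<not> puts (push_all l)"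
  by (auto simp: push_all_def)

lemma probe_frame [simp]:
  "wreg (probe Q m q m' q') = {rC, rW, rY, rP, rS, rE, rI, rV, rH}" "\<not> puts (probe Q m q m' q')"
  by (auto simp: probe_def count_heavy_def)

lemma warr_probe: "warr (probe Q m q m' q') \<subseteq> {aST, aCN, aVA, aNX, aHD, aSK}"
  using warr_round by (auto simp: probe_def count_heavy_def)

section \<open>Computing a relation from heavy and light values\<close>

context closed_graph
begin

lemma rpost_cong: "ar s' = ar s \<Longrightarrow> rpost D q X s' = rpost D q X s"
  by (simp only: rpost_def marks_def)

lemma wp_invert:
  assumes env: "env s" and m: "m \<ge> 20" "l \<ge> 20" "m \<noteq> l" and q: "q < Q"
    and lP: "\<forall>v. ar s l v \<le> rg s rP"
    and len: "\<And>w. w \<in> set vs \<Longrightarrow> distinct (marks s (nd w q)) \<and> length (marks s (nd w q)) \<le> D"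
  shows "wp (invert Q m q l) (\<lambda>s'. env s' \<and> extends s s' \<and> (\<forall>v. ar s' l v \<le> rg s' rP) \<and>
    (\<forall>v. \<exists>xs. llist l s' v = xs @ llist l s v \<and> distinct xs \<and>
       set xs = {w \<in> marked s m. v \<in> set (marks s (nd w q))}) \<and>
    tm s' \<le> tm s + 20 * ((D + 1) * (weight + 1))) s"
proof -
  let ?X = "\<lambda>k v. {w \<in> set (take k vs). ar s m w \<noteq> 0 \<and> v \<in> set (marks s (nd w q))}"
  let ?Inv = "\<lambda>k s'. env s' \<and> extends s s' \<and> ar s' aHD = ar s aHD \<and> ar s' m = ar s m \<and>
    (\<forall>v. ar s' l v \<le> rg s' rP) \<and>
    (\<forall>v. \<exists>xs. llist l s' v = xs @ llist l s v \<and> distinct xs \<and> set xs = ?X k v) \<and>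
    tm s' \<le> tm s + 1 + k * (6 * D + 8)"
  show ?thesis unfolding invert_def
  proof (rule wp_for_verts[where vs = vs and Inv = ?Inv])
    show "vlist s = vs" using env by (simp add: env_def)
    show "?Inv 0 (upd_reg rI 0 s)" using env lP by (simp add: llist_def)
  next
    fix k and s2 :: st assume k: "k < length vs" and I: "?Inv k s2"
    let ?w = "vs ! k"
    have tk: "set (take (Suc k) vs) = insert ?w (set (take k vs))"
      using k by (simp add: take_Suc_conv_app_nth)
    let ?Q = "\<lambda>s'. ?Inv (Suc k) (upd_reg rI (Suc k) s')"
    let ?s = "upd_reg rV ?w (tick s2)"
    show "wp (Cond (Rd m (Var rV)) (rE ::= Rd aHD (node Q q) ;; push_all l) Pass) ?Q ?s"
    proof (cases "ar s m ?w = 0")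
      case True
      then have "?X (Suc k) v = ?X k v" for v using tk by auto
      then show ?thesis using I True by (simp add: llist_def)
    next
      case False
      let ?s' = "upd_reg rE (ar s aHD (nd ?w q)) (tick ?s)"
      let ?xs = "marks s (nd ?w q)"
      have hp: "decr (ar s2 aNX)" "ar s aHD (nd ?w q) \<le> rg s rP" "heap s2"
        using I env by (auto simp: env_def heap_def)
      have xs: "?xs = lst (ar s2 aNX) (ar s2 aVA) (ar s aHD (nd ?w q))"
        using extends_lst[of s s2] I hp by (simp add: marks_def)
      have "rg s rP \<le> rg s2 rP" using I by (simp add: extends_def)
      then have le: "ar s aHD (nd ?w q) \<le> rg s2 rP" using hp(2) by simp
      have d: "distinct ?xs" "length ?xs \<le> D" using len k by auto
      have "wp (push_all l) ?Q ?s'"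
      proof (rule wp_same[OF wp_push_all[of l ?s' ?xs]])
        fix s3
        assume s3: "heap s3 \<and> (\<forall>v. ar s3 l v \<le> rg s3 rP) \<and> extends ?s' s3 \<and>
          (\<forall>v. llist l s3 v = (if v \<in> set ?xs then [rg ?s' rV] else []) @ llist l ?s' v) \<and>
          tm s3 \<le> tm ?s' + 6 * length ?xs + 1"
          and sm: "same (push_all l) ?s' s3"
        have fr: "ar s3 a = ar s2 a" if "a \<notin> {aVA, aNX, l}" for a
          using same_arr[OF sm] that by simp
        have fr2: "rg s3 x = rg ?s' x" if "x \<notin> {rP, rE}" for x
          using same_reg[OF sm] that by simp
        have e3: "env s3" using I s3 fr m fr2 by (simp add: env_def vlist_def)
        have ll: "llist l ?s' v = llist l s2 v" for v by (simp add: llist_def)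
        have "\<exists>xs. llist l s3 v = xs @ llist l s v \<and> distinct xs \<and> set xs = ?X (Suc k) v" for v
        proof -
          from I obtain xs where x: "llist l s2 v = xs @ llist l s v" "distinct xs" "set xs = ?X k v" by blast
          let ?ys = "(if v \<in> set ?xs then [?w] else []) @ xs"
          have "?w \<notin> set (take k vs)"
            using k distinct_vs by (auto simp: in_set_conv_nth nth_eq_iff_index_eq)
          then have "distinct ?ys" "set ?ys = ?X (Suc k) v" using x False tk by auto
          moreover have "llist l s3 v = ?ys @ llist l s v" using s3 x ll by simp
          ultimately show ?thesis by blast
        qed
        moreover have "extends s s3" using s3 I extends_trans[of s s2 s3] by simp
        moreover have "tm s3 + 1 \<le> tm s + 1 + Suc k * (6 * D + 8)"
          using s3 I d by simp
        ultimately show "?Q s3" using e3 s3 fr[of aHD] fr[of m] m I by (simp add: llist_def)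
      qed (use I m hp le d xs in auto)
      then show ?thesis using False I by (simp add: nd_def)
    qed
  next
    fix s2 :: st assume I: "?Inv (length vs) s2"
    have "length vs * (6 * D + 8) \<le> weight * (6 * D + 8)"
      by (intro mult_le_mono1 length_le_weight)
    moreover have "weight * (6 * D + 8) + 2 \<le> 20 * ((D + 1) * (weight + 1))"
      by (simp add: algebra_simps)
    ultimately have "tm s2 + 1 \<le> tm s + 20 * ((D + 1) * (weight + 1))" using I by linarith
    then show "env (tick s2) \<and> extends s (tick s2) \<and> (\<forall>v. ar (tick s2) l v \<le> rg (tick s2) rP) \<and>
      (\<forall>v. \<exists>xs. llist l (tick s2) v = xs @ llist l s v \<and> distinct xs \<and>
       set xs = {w \<in> marked s m. v \<in> set (marks s (nd w q))}) \<and>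
      tm (tick s2) \<le> tm s + 20 * ((D + 1) * (weight + 1))"
      using I by (simp add: marked_def llist_def conj_assoc)
  qed (use m in auto)
qed

text \<open>A counter below \<open>D\<close> is exact, and a counter equal to \<open>D\<close>
  witnesses \<open>D\<close> different tags. Hence comparing the truncated counter with
  \<open>D\<close> gives the same answer as comparing the true number of partners.\<close>

lemma wp_probe:
  assumes env: "env s" and m: "m \<ge> 20" "m' \<ge> 20" and q: "q < Q" "q' < Q"
    and L: "\<And>v. L v = {w \<in> marked s m. (nd w q, nd v q') \<in> E\<^sup>*}"
  shows "wp (probe Q m q m' q') (\<lambda>s'. env s' \<and> extends s s' \<and> rg s' rD = rg s rD \<and>
    rpost (rg s rD) q (marked s m) s' \<and>
    rg s' rH = card {v \<in> marked s m'. rg s rD \<le> card (L v)} \<and>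
    tm s' \<le> tm s + (2 * Q + 67) * ((rg s rD + 1) * (weight + 1))) s"
  unfolding probe_def wp_simps
proof (rule wp_same[OF wp_round[OF env _ q(1)]], use m in simp)
  let ?D = "rg s rD"
  fix s1
  assume s1: "env s1 \<and> rpost ?D q (marked s m) s1 \<and> extends s s1 \<and>
      tm s1 \<le> tm s + (2 * Q + 60) * ((?D + 1) * (weight + 1))"
    and sm: "same (round Q m q) s s1"
  have fr: "rg s1 rD = ?D" "\<And>a. a \<ge> 20 \<Longrightarrow> ar s1 a = ar s a" using env_round_frame[OF sm] by auto
  have heavy: "?D \<le> ar s1 aCN (nd v q') \<longleftrightarrow> ?D \<le> card (L v)" if "v \<in> set vs" for v
  proof -
    have "nd v q' \<in> Z" using that q nd_in_Z by simp
    then have a: "set (marks s1 (nd v q')) \<subseteq> L v" "ar s1 aCN (nd v q') = length (marks s1 (nd v q'))"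
      "ar s1 aCN (nd v q') < ?D \<longrightarrow> set (marks s1 (nd v q')) = L v" "distinct (marks s1 (nd v q'))"
      using s1 unfolding rpost_def L reach_def by blast+
    have "finite (L v)" by (simp add: L marked_def)
    then have "ar s1 aCN (nd v q') \<le> card (L v)" using a by (metis card_mono distinct_card)
    moreover have "ar s1 aCN (nd v q') < ?D \<Longrightarrow> card (L v) < ?D" using a by (metis distinct_card)
    ultimately show ?thesis by linarith
  qed
  have m': "marked s1 m' = marked s m'" using fr m by (simp add: marked_def)
  show "wp (count_heavy Q m' q') (\<lambda>s'. env s' \<and> extends s s' \<and> rg s' rD = ?D \<and>
    rpost ?D q (marked s m) s' \<and> rg s' rH = card {v \<in> marked s m'. ?D \<le> card (L v)} \<and>
    tm s' \<le> tm s + (2 * Q + 67) * ((?D + 1) * (weight + 1))) s1"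
  proof (rule wp_mono[OF wp_count_heavy])
    show "env s1" using s1 by simp
    fix s2
    assume s2: "env s2 \<and> ar s2 = ar s1 \<and> rg s2 rD = rg s1 rD \<and> extends s1 s2 \<and>
      rg s2 rH = card {v \<in> marked s1 m'. rg s1 rD \<le> ar s1 aCN (nd v q')} \<and> tm s2 \<le> tm s1 + 7 * (weight + 1)"
    have "{v \<in> marked s1 m'. rg s1 rD \<le> ar s1 aCN (nd v q')} = {v \<in> marked s m'. ?D \<le> card (L v)}"
      unfolding m' fr(1) using heavy by (auto simp: marked_def)
    moreover have "rpost ?D q (marked s m) s2" using s1 s2 rpost_cong[of s2 s1] by simp
    moreover have "extends s s2" using s1 s2 extends_trans by blast
    moreover have "7 * (weight + 1) \<le> 7 * ((?D + 1) * (weight + 1))" by simp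
    then have "tm s2 \<le> tm s + (2 * Q + 67) * ((?D + 1) * (weight + 1))"
      using s1 s2 unfolding add_mult_distrib by linarith
    ultimately show "env s2 \<and> extends s s2 \<and> rg s2 rD = ?D \<and>
      rpost ?D q (marked s m) s2 \<and> rg s2 rH = card {v \<in> marked s m'. ?D \<le> card (L v)} \<and>
      tm s2 \<le> tm s + (2 * Q + 67) * ((?D + 1) * (weight + 1))" using s2 fr by simp
  qed
qed

text \<open>The final threshold \<open>d\<close> is 1 or twice a threshold \<open>d'\<close> at
  which more than \<open>d'\<close> values were heavy. Each of those contributes at least
  \<open>d'\<close> pairs, so \<open>d' * d' < R\<close>: thus \<open>d\<close> is of the order of
  the square root of \<open>R\<close> although \<open>R\<close> is never computed. The case
  \<open>d = 1\<close> also covers an empty relation.\<close>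

lemma wp_relation:
  assumes env: "env s" and m: "m \<ge> 20" "m' \<ge> 20" "l \<ge> 20" "m \<noteq> l" "m' \<noteq> l"
    and q: "qs < Q" "qt < Q" "qs' < Q" "qt' < Q"
    and conv: "\<And>v w. v \<in> set vs \<Longrightarrow> w \<in> set vs \<Longrightarrow> (nd v qs, nd w qt) \<in> E\<^sup>* \<longleftrightarrow> (nd w qs', nd v qt') \<in> E\<^sup>*"
    and L: "\<And>v. L v = {w \<in> marked s m'. (nd v qs, nd w qt) \<in> E\<^sup>*}"
    and R: "R = (\<Sum>v\<in>marked s m. card (L v))"
    and lP: "\<forall>v. ar s l v \<le> rg s rP"
  shows "wp (relation Q m m' qs qt qs' qt' l) (\<lambda>s'. env s' \<and> extends s s' \<and>
    (\<forall>v. ar s' l v \<le> rg s' rP) \<and>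
    (\<forall>v\<in>marked s m. distinct (llist l s' v) \<and> set (llist l s' v) = L v) \<and>
    (\<exists>d\<ge>1. (d = 1 \<or> d * d \<le> 4 * R) \<and> tm s' \<le> tm s + (30 * Q + 800) * (d * (weight + 1)))) s"
proof -
  let ?W = "weight + 1"
  let ?L = "\<lambda>v. {w \<in> marked s m'. (nd w qs', nd v qt') \<in> E\<^sup>*}"
  have LL: "L v = ?L v" if "v \<in> set vs" for v
    using conv that by (auto simp: L marked_def)
  have fin: "finite (marked s m)" "finite (?L v)" for v by (auto simp: marked_def)
  have R': "R = (\<Sum>v\<in>marked s m. card (?L v))"
    unfolding R by (rule sum.cong) (auto simp: LL marked_def)
  \<comment> \<open>Markov's inequality for the numbers of partners.\<close>
  have heavy: "card {v \<in> marked s m. d \<le> card (?L v)} * d \<le> R" for d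
  proof -
    have "card {v \<in> marked s m. d \<le> card (?L v)} * d = (\<Sum>v\<in>{v \<in> marked s m. d \<le> card (?L v)}. d)" by simp
    also have "\<dots> \<le> (\<Sum>v\<in>{v \<in> marked s m. d \<le> card (?L v)}. card (?L v))" by (rule sum_mono) simp
    also have "\<dots> \<le> R" unfolding R' using fin by (intro sum_mono2) auto
    finally show ?thesis .
  qed
  let ?c = "2 * Q + 70"
  let ?fr = "\<lambda>s'. (\<forall>a\<ge>20. ar s' a = ar s a)"
  \<comment> \<open>A probe with threshold \<open>d\<close> costs at most
    \<open>2 * ?c * (d * ?W)\<close>, loop overhead included. For thresholds 1, 2, 4 and so on this
    is a geometric sum, bounded by twice its last term. The parameter \<open>k\<close> becomes 1
    once the final test of the loop has been paid.\<close>
  let ?I = "\<lambda>k s'. env s' \<and> extends s s' \<and> ?fr s' \<and> 1 \<le> rg s' rD \<and> (rg s' rD = 1 \<or> rg s' rD * rg s' rD \<le> 4 * R) \<and>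
    rpost (rg s' rD) qs' (marked s m') s' \<and> rg s' rH = card {v \<in> marked s m. rg s' rD \<le> card (?L v)} \<and>
    tm s' \<le> tm s + k + 4 * ?c * (rg s' rD * ?W)"
  have probe: "wp (probe Q m' qs' m qt') (\<lambda>s'. env s' \<and> extends s s' \<and> ?fr s' \<and> rg s' rD = rg s1 rD \<and>
      rpost (rg s1 rD) qs' (marked s m') s' \<and> rg s' rH = card {v \<in> marked s m. rg s1 rD \<le> card (?L v)} \<and>
      tm s' + 3 \<le> tm s1 + 2 * ?c * (rg s1 rD * ?W)) s1"
    if s1: "env s1" "extends s s1" "?fr s1" "1 \<le> rg s1 rD" for s1
  proof -
    have mm: "marked s1 m' = marked s m'" "marked s1 m = marked s m" using s1 m by (auto simp: marked_def)
    have LLL: "{w \<in> marked s1 m'. (nd w qs', nd v qt') \<in> E\<^sup>*} = ?L v" for v by (simp add: mm)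
    note wpp = wp_probe[OF s1(1) m(2) m(1) q(3) q(4), of ?L, OF LLL[symmetric]]
    show ?thesis
    proof (rule wp_same[OF wpp])
      fix s2
      assume s2: "env s2 \<and> extends s1 s2 \<and> rg s2 rD = rg s1 rD \<and> rpost (rg s1 rD) qs' (marked s1 m') s2 \<and>
        rg s2 rH = card {v \<in> marked s1 m. rg s1 rD \<le> card (?L v)} \<and>
        tm s2 \<le> tm s1 + (2 * Q + 67) * ((rg s1 rD + 1) * ?W)"
        and sm: "same (probe Q m' qs' m qt') s1 s2"
      have "a \<notin> warr (probe Q m' qs' m qt')" if "a \<ge> 20" for a
        using that warr_probe[of Q m' qs' m qt'] by auto
      then have fr2: "?fr s2" using s1(3) same_arr[OF sm] by simp
      have "(rg s1 rD + 1) * ?W \<le> (2 * rg s1 rD) * ?W" using s1(4) by (intro mult_le_mono1) simp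
      then have "(2 * Q + 67) * ((rg s1 rD + 1) * ?W) \<le> (2 * Q + 67) * ((2 * rg s1 rD) * ?W)"
        by (rule mult_le_mono2)
      moreover have "1 \<le> rg s1 rD * ?W" using s1(4) by simp
      moreover have "2 * ?c * (rg s1 rD * ?W) = (2 * Q + 67) * ((2 * rg s1 rD) * ?W) + 6 * (rg s1 rD * ?W)"
        by (simp add: algebra_simps)
      ultimately have "tm s2 + 3 \<le> tm s1 + 2 * ?c * (rg s1 rD * ?W)" using s2 by linarith
      then show "env s2 \<and> extends s s2 \<and> ?fr s2 \<and> rg s2 rD = rg s1 rD \<and>
        rpost (rg s1 rD) qs' (marked s m') s2 \<and> rg s2 rH = card {v \<in> marked s m. rg s1 rD \<le> card (?L v)} \<and>
        tm s2 + 3 \<le> tm s1 + 2 * ?c * (rg s1 rD * ?W)"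
        using s2 fr2 \<open>tm s2 + 3 \<le> _\<close> extends_trans[OF s1(2)] unfolding mm by blast
    qed
  qed
  let ?rest = "split_heavy Q m qt' l ;; rD ::= Plus (Var rD) (Lit 1) ;; round Q aHV qs ;; invert Q m' qt l"
  let ?post = "\<lambda>s'. env s' \<and> extends s s' \<and> (\<forall>v. ar s' l v \<le> rg s' rP) \<and>
    (\<forall>v\<in>marked s m. distinct (llist l s' v) \<and> set (llist l s' v) = L v) \<and>
    (\<exists>d\<ge>1. (d = 1 \<or> d * d \<le> 4 * R) \<and> tm s' \<le> tm s + (30 * Q + 800) * (d * ?W))"
  have rest: "wp ?rest ?post s1" if I: "?I 1 s1" and H: "rg s1 rH \<le> rg s1 rD" for s1
  proof -
    let ?d = "rg s1 rD"
    have e1: "env s1" using I by simp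
    have mm: "marked s1 m = marked s m" "marked s1 m' = marked s m'" using I m by (auto simp: marked_def)
    have rp: "distinct (marks s1 (nd v qt'))" "ar s1 aCN (nd v qt') = length (marks s1 (nd v qt'))"
      "set (marks s1 (nd v qt')) \<subseteq> ?L v" "ar s1 aCN (nd v qt') < ?d \<longrightarrow> set (marks s1 (nd v qt')) = ?L v"
      if "v \<in> set vs" for v
      using I nd_in_Z[OF that q(4)] unfolding rpost_def reach_def by blast+
    have hv: "?d \<le> ar s1 aCN (nd v qt') \<longleftrightarrow> ?d \<le> card (?L v)" if "v \<in> set vs" for v
    proof -
      have c: "card (set (marks s1 (nd v qt'))) = ar s1 aCN (nd v qt')"
        using distinct_card[OF rp(1)[OF that]] rp(2)[OF that] by simp
      then have "ar s1 aCN (nd v qt') \<le> card (?L v)" using card_mono[OF fin(2) rp(3)[OF that]] by simp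
      moreover have "ar s1 aCN (nd v qt') < ?d \<Longrightarrow> card (?L v) < ?d" using rp(4)[OF that] c by simp
      ultimately show ?thesis by linarith
    qed
    let ?Hv = "{v \<in> marked s m. ?d \<le> card (?L v)}"
    have Hv: "{v \<in> marked s1 m. ?d \<le> ar s1 aCN (nd v qt')} = ?Hv"
      unfolding mm using hv by (auto simp: marked_def)
    show ?thesis unfolding wp_simps(5)
    proof (rule wp_mono[OF wp_split_heavy[OF e1 m(1,3,4)]], elim conjE)
      fix s2
      assume s2: "env s2" "rg s2 rD = ?d" "extends s1 s2" "\<forall>a. a \<noteq> aHV \<longrightarrow> a \<noteq> l \<longrightarrow> ar s2 a = ar s1 a"
        "marked s2 aHV = {v \<in> marked s1 m. ?d \<le> ar s1 aCN (nd v qt')}"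
        "\<forall>v. ar s2 l v = (if v \<in> marked s1 m then if ?d \<le> ar s1 aCN (nd v qt') then 0 else ar s1 aHD (nd v qt')
           else ar s1 l v)"
        "tm s2 \<le> tm s1 + 8 * ?W"
      let ?s2 = "upd_reg rD (?d + 1) s2"
      have e2: "env ?s2" using s2(1) by simp
      have "rg s rP \<le> rg s1 rP" "ar s1 l = ar s l" "\<forall>z. ar s1 aHD z \<le> rg s1 rP"
        using I m(3) e1 by (simp_all add: extends_def env_def heap_def)
      then have "ar s2 l v \<le> rg s1 rP" for v
        using s2(6) le_trans[OF lP[rule_format, of v]] by simp
      moreover have "rg s1 rP \<le> rg s2 rP" using s2(3) by (simp add: extends_def)
      ultimately have lP2: "ar s2 l v \<le> rg s2 rP" for v using le_trans by blast
      have llist2: "llist l s2 v = (if v \<in> ?Hv then [] else marks s1 (nd v qt'))" if "v \<in> marked s m" for v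
      proof -
        have "v \<in> set vs" using that by (simp add: marked_def)
        then show ?thesis
          using that s2(4,6) hv[of v] m mm by (auto simp: llist_def marks_def)
      qed
      show "wp (rD ::= Plus (Var rD) (Lit 1)) (wp (round Q aHV qs) (wp (invert Q m' qt l) ?post)) s2"
        unfolding wp_simps(2)
      proof (rule wp_same[OF wp_round[OF _ _ q(1)]])
        show "env (upd_reg rD (val s2 (Plus (Var rD) (Lit 1))) s2)" using e2 s2 by simp
        fix s3
        let ?s2' = "upd_reg rD (val s2 (Plus (Var rD) (Lit 1))) s2"
        assume s3': "env s3 \<and> rpost (rg ?s2' rD) qs (marked ?s2' aHV) s3 \<and> extends ?s2' s3 \<and>
          tm s3 \<le> tm ?s2' + (2 * Q + 60) * ((rg ?s2' rD + 1) * ?W)" and sm3: "same (round Q aHV qs) ?s2' s3"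
        have Hv2: "marked ?s2' aHV = ?Hv" using s2(5) Hv by (simp add: marked_def)
        have s3: "env s3" "rpost (?d + 1) qs ?Hv s3" "extends s2 s3"
          "tm s3 \<le> tm s2 + 1 + (2 * Q + 60) * ((?d + 1 + 1) * ?W)"
          using s3' s2(2) unfolding Hv2 by simp_all
        have fr3: "ar s3 a = ar s2 a" if "a \<ge> 20" for a
          using env_round_frame[OF sm3] that by auto
        have cH: "card ?Hv \<le> ?d" using I H by simp
        have mk: "distinct (marks s3 (nd w qt)) \<and> length (marks s3 (nd w qt)) \<le> ?d \<and>
          set (marks s3 (nd w qt)) = {v \<in> ?Hv. (nd v qs, nd w qt) \<in> E\<^sup>*}" if "w \<in> set vs" for w
        proof -
          have "nd w qt \<in> Z" using that q nd_in_Z by simp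
          then have a: "set (marks s3 (nd w qt)) \<subseteq> reach qs ?Hv (nd w qt)" "ar s3 aCN (nd w qt) = length (marks s3 (nd w qt))"
            "ar s3 aCN (nd w qt) < ?d + 1 \<longrightarrow> set (marks s3 (nd w qt)) = reach qs ?Hv (nd w qt)"
            "distinct (marks s3 (nd w qt))"
            using s3(2) unfolding rpost_def by blast+
          have "set (marks s3 (nd w qt)) \<subseteq> ?Hv" using a(1) by (auto simp: reach_def)
          then have "length (marks s3 (nd w qt)) \<le> card ?Hv"
            using card_mono[of ?Hv "set (marks s3 (nd w qt))"] distinct_card[OF a(4)] fin(1) by simp
          then have "length (marks s3 (nd w qt)) \<le> ?d" using cH by simp
          then show ?thesis using a by (simp add: reach_def)
        qed
        have lP3: "\<forall>v. ar s3 l v \<le> rg s3 rP"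
          using lP2 s3(3) fr3[OF m(3)] by (auto simp: extends_def intro: le_trans)
        have ll3: "llist l s3 v = llist l s2 v" for v
          using extends_lst[OF s3(3) lP2] fr3[OF m(3)] by (simp add: llist_def)
        have mm3: "marked s3 m' = marked s m'" using fr3 s2(4) I m by (simp add: marked_def)
        have mk3: "distinct (marks s3 (nd w qt)) \<and> length (marks s3 (nd w qt)) \<le> ?d" if "w \<in> set vs" for w
          using mk[OF that] by blast
        show "wp (invert Q m' qt l) ?post s3"
        proof (rule wp_mono[OF wp_invert[where D = ?d, OF s3(1) m(2,3,5) q(2) lP3]])
          fix w assume "w \<in> set vs"
          then show "distinct (marks s3 (nd w qt)) \<and> length (marks s3 (nd w qt)) \<le> ?d" by (rule mk3)
        next
          fix s4
          assume s4': "env s4 \<and> extends s3 s4 \<and> (\<forall>v. ar s4 l v \<le> rg s4 rP) \<and>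
            (\<forall>v. \<exists>xs. llist l s4 v = xs @ llist l s3 v \<and> distinct xs \<and>
               set xs = {w \<in> marked s3 m'. v \<in> set (marks s3 (nd w qt))}) \<and>
            tm s4 \<le> tm s3 + 20 * ((?d + 1) * ?W)"
          then have s4: "env s4" "extends s3 s4" "\<forall>v. ar s4 l v \<le> rg s4 rP"
            "\<forall>v. \<exists>xs. llist l s4 v = xs @ llist l s3 v \<and> distinct xs \<and>
               set xs = {w \<in> marked s3 m'. v \<in> set (marks s3 (nd w qt))}"
            "tm s4 \<le> tm s3 + 20 * ((?d + 1) * ?W)" by blast+
          have "distinct (llist l s4 v) \<and> set (llist l s4 v) = L v" if v: "v \<in> marked s m" for v
          proof -
            have vv: "v \<in> set vs" using v by (simp add: marked_def)
            obtain xs where xs: "llist l s4 v = xs @ llist l s3 v" "distinct xs"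
              "set xs = {w \<in> marked s m'. v \<in> set (marks s3 (nd w qt))}" using s4(4) mm3 by metis
            have sub: "w \<in> set vs" if "w \<in> marked s m'" for w using that by (simp add: marked_def)
            \<comment> \<open>The tags of the last round are heavy values, so the inversion
              contributes all partners to a heavy value and nothing to a light one. In either case
              one of the two parts of the list is empty, and distinctness is immediate.\<close>
            have xs': "set xs = (if v \<in> ?Hv then L v else {})"
              using mk sub by (auto simp: xs(3) L)
            show ?thesis
            proof (cases "v \<in> ?Hv")
              case True
              then have "set xs = L v" "llist l s3 v = []" using xs' llist2[OF v] ll3 by simp_all
              then show ?thesis using xs(1,2) by simp
            next
              case False
              then have "xs = []" "llist l s3 v = marks s1 (nd v qt')"
                using xs' llist2[OF v] ll3 by (simp_all only: if_False set_empty)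
              moreover have lt: "ar s1 aCN (nd v qt') < ?d" using hv[OF vv] v False by auto
              ultimately show ?thesis using xs(1) rp[OF vv] LL[OF vv] lt by simp
            qed
          qed
          moreover have "extends s s4" using I s2(3) s3(3) s4(2) extends_trans by blast
          moreover have "\<exists>d\<ge>1. (d = 1 \<or> d * d \<le> 4 * R) \<and> tm s4 \<le> tm s + (30 * Q + 800) * (d * ?W)"
          proof (intro exI[of _ ?d] conjI)
            show "1 \<le> ?d" "?d = 1 \<or> ?d * ?d \<le> 4 * R" using I by blast+
            have d: "1 \<le> ?d" using I by blast
            define p where "p = ?d * ?W"
            have "4 * ?c * (?d * ?W) = 8 * (Q * p) + 280 * p" unfolding p_def by (simp add: algebra_simps)
            then have t1: "tm s1 \<le> tm s + 1 + (8 * (Q * p) + 280 * p)" using I by metis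
            have a: "(?d + 1 + 1) * ?W \<le> (3 * ?d) * ?W" "(?d + 1) * ?W \<le> (2 * ?d) * ?W"
              using d by (intro mult_le_mono1; simp)+
            have "(2 * Q + 60) * ((?d + 1 + 1) * ?W) \<le> (2 * Q + 60) * ((3 * ?d) * ?W)"
              by (rule mult_le_mono2[OF a(1)])
            also have "\<dots> = 6 * (Q * p) + 180 * p" unfolding p_def by (simp add: algebra_simps)
            finally have t3: "tm s3 \<le> tm s2 + 1 + (6 * (Q * p) + 180 * p)" using s3(4) by linarith
            have "(2 * ?d) * ?W = 2 * p" unfolding p_def by simp
            then have t4: "tm s4 \<le> tm s3 + 40 * p" using s4(5) a(2) by linarith
            have "?W \<le> p" using mult_le_mono1[OF d, of ?W] by (simp only: nat_mult_1 p_def)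
            then have t2: "tm s2 \<le> tm s1 + 8 * p" and p1: "1 \<le> p" using s2(7) by simp_all
            have "(30 * Q + 800) * p = 30 * (Q * p) + 800 * p" by (simp add: algebra_simps)
            then show "tm s4 \<le> tm s + (30 * Q + 800) * (?d * ?W)"
              using t1 t2 t3 t4 p1 unfolding p_def[symmetric] by linarith
          qed
          ultimately show "?post s4" using s4 by blast
        qed
      qed simp
    qed
  qed
  have "wp (Loop (Minus (Var rH) (Var rD)) (rD ::= Plus (Var rD) (Var rD) ;; probe Q m' qs' m qt')) (wp ?rest ?post) s1"
    if "?I 0 s1" for s1
    using that
  proof (rule wp_Loop[where \<phi> = "\<lambda>s. 4 * R + 1 - rg s rD"], goal_cases)
    case (1 s2)
    let ?d = "rg s2 rD"
    let ?s = "upd_reg rD (?d + ?d) (tick s2)"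
    have d: "1 \<le> ?d" using 1 by blast
    have "?d < card {v \<in> marked s m. ?d \<le> card (?L v)}" using 1 by simp
    \<comment> \<open>The loop continues because more than \<open>?d\<close> values are heavy,
      whence \<open>?d * ?d < R\<close>. Squaring the doubled threshold explains the factor in
      \<open>4 * R\<close>, and \<open>?d < R\<close> makes the variant decrease.\<close>
    then have "?d * ?d < card {v \<in> marked s m. ?d \<le> card (?L v)} * ?d" using d by simp
    then have dR: "?d * ?d < R" using heavy[of ?d] by linarith
    have "?d \<le> ?d * ?d" using d by simp
    then have dR': "?d < R" using dR by linarith
    have "env ?s" "extends s ?s" "?fr ?s" "1 \<le> rg ?s rD" using 1 d by auto
    from probe[OF this] have "wp (probe Q m' qs' m qt') (\<lambda>s'. ?I 0 s' \<and> 4 * R + 1 - rg s' rD < 4 * R + 1 - ?d) ?s"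
    proof (rule wp_mono, elim conjE)
      fix s3
      assume s3: "env s3" "extends s s3" "?fr s3" "rg s3 rD = rg ?s rD" "rpost (rg ?s rD) qs' (marked s m') s3"
        "rg s3 rH = card {v \<in> marked s m. rg ?s rD \<le> card (?L v)}"
        "tm s3 + 3 \<le> tm ?s + 2 * ?c * (rg ?s rD * ?W)"
      have "tm s2 \<le> tm s + 0 + 4 * ?c * (?d * ?W)" using 1 by blast
      moreover have "4 * ?c * ((?d + ?d) * ?W) = 4 * ?c * (?d * ?W) + 2 * ?c * ((?d + ?d) * ?W)"
        by (simp add: algebra_simps)
      moreover have "tm s3 + 3 \<le> tm s2 + 2 + 2 * ?c * ((?d + ?d) * ?W)" using s3(7) by simp
      ultimately have "tm s3 \<le> tm s + 0 + 4 * ?c * ((?d + ?d) * ?W)" by linarith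
      moreover have "(?d + ?d) * (?d + ?d) \<le> 4 * R" using dR by (simp add: algebra_simps)
      moreover have "1 \<le> ?d + ?d" using d by simp
      ultimately have "?I 0 s3" using s3 by simp
      then show "?I 0 s3 \<and> 4 * R + 1 - rg s3 rD < 4 * R + 1 - ?d" using s3(4) dR' d by simp
    qed
    then show ?case by simp
  next
    case (2 s2)
    then have "rg s2 rH \<le> rg s2 rD" by simp
    moreover have "?I 1 (tick s2)" using 2 rpost_cong[of "tick s2" s2] by simp
    ultimately show ?case using rest[of "tick s2"] by simp
  qed
  note loop = this
  show ?thesis
    unfolding relation_def wp_simps(5)
  proof (subst wp_simps(2), rule wp_mono[OF probe])
    let ?s = "upd_reg rD (val s (Lit 1)) s"
    show "env ?s" "extends s ?s" "?fr ?s" "1 \<le> rg ?s rD" using env by auto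
    fix s3
    assume s3: "env s3 \<and> extends s s3 \<and> ?fr s3 \<and> rg s3 rD = rg ?s rD \<and> rpost (rg ?s rD) qs' (marked s m') s3 \<and>
      rg s3 rH = card {v \<in> marked s m. rg ?s rD \<le> card (?L v)} \<and>
      tm s3 + 3 \<le> tm ?s + 2 * ?c * (rg ?s rD * ?W)"
    then have t: "tm s3 + 3 \<le> tm s + 1 + 2 * ?c * (1 * ?W)" and d: "rg s3 rD = 1" by simp_all
    have "2 * ?c * (1 * ?W) \<le> 4 * ?c * (1 * ?W)" by (intro mult_le_mono1) simp
    with t have "tm s3 \<le> tm s + 0 + 4 * ?c * (1 * ?W)" by linarith
    then have "?I 0 s3" using s3 d by simp
    from loop[OF this, unfolded wp_simps(5)]
    show "wp (Loop (Minus (Var rH) (Var rD)) (rD ::= Plus (Var rD) (Var rD) ;; probe Q m' qs' m qt'))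
      (wp (split_heavy Q m qt' l) (wp (rD ::= Plus (Var rD) (Lit 1)) (wp (round Q aHV qs) (wp (invert Q m' qt l) ?post)))) s3" .
  qed
qed

end

section \<open>Construction of the product graph\<close>

abbreviation (input) "rEP \<equiv> 13 :: nat"
abbreviation (input) "rJ \<equiv> 14 :: nat"
abbreviation (input) "rPT \<equiv> 15 :: nat"
abbreviation (input) "rU \<equiv> 16 :: nat"
abbreviation (input) "rA \<equiv> 17 :: nat"
abbreviation (input) "rX \<equiv> 18 :: nat"

text \<open>A template \<open>(l, a, q, b, q')\<close> adds, for every edge from \<open>u\<close> to \<open>x\<close> labeled \<open>l\<close> (any label
  for \<open>None\<close>), an edge from \<open>a\<close> in state \<open>q\<close> to \<open>b\<close> in state \<open>q'\<close>; the end points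
  \<open>Root\<close>, \<open>Src\<close>, \<open>Tgt\<close> stand for the virtual vertex 0, \<open>u\<close> and \<open>x\<close>.\<close>

datatype endpoint = Root | Src | Tgt

type_synonym template = "nat option \<times> endpoint \<times> nat \<times> endpoint \<times> nat"

primrec pick :: "endpoint \<Rightarrow> nat \<Rightarrow> nat \<Rightarrow> nat" where
  "pick Root u x = 0"
| "pick Src u x = u"
| "pick Tgt u x = x"

primrec pick_ex :: "endpoint \<Rightarrow> ex" where
  "pick_ex Root = Lit 0"
| "pick_ex Src = Var rU"
| "pick_ex Tgt = Var rX"

definition add_edge :: "ex \<Rightarrow> ex \<Rightarrow> cm" where
  "add_edge e f = rEP ::= Plus (Var rEP) (Lit 1) ;; Sto aDS (Var rEP) f ;; Sto aNE (Var rEP) (Rd aHE e) ;;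
     Sto aHE e (Var rEP)"

text \<open>The two truncated differences add up to 0 exactly if the label of the current edge is
  \<open>c\<close>, so the edge is added in the branch for 0.\<close>

fun add_template :: "nat \<Rightarrow> template \<Rightarrow> cm" where
  "add_template Q (l, a, q, b, q') =
     (let p = add_edge (Plus (Scale Q (pick_ex a)) (Lit q)) (Plus (Scale Q (pick_ex b)) (Lit q'))
      in case l of None \<Rightarrow> p
         | Some c \<Rightarrow> Cond (Plus (Minus (Var rA) (Lit c)) (Minus (Lit c) (Var rA))) Pass p)"

primrec add_templates :: "nat \<Rightarrow> template list \<Rightarrow> cm" where
  "add_templates Q [] = Pass"
| "add_templates Q (t # ts) = add_template Q t ;; add_templates Q ts"

primrec set_marks :: "nat \<Rightarrow> ex \<Rightarrow> cm" where
  "set_marks 0 e = Pass"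
| "set_marks (Suc m) e = set_marks m e ;; Sto (aMK (Suc m)) e (Lit 1)"

definition new_vertex :: "nat \<Rightarrow> nat \<Rightarrow> cm" where
  "new_vertex m x = Cond (Rd aSN (Var x)) Pass
     (Sto aSN (Var x) (Lit 1) ;; Sto aVT (Var rN) (Var x) ;; rN ::= Plus (Var rN) (Lit 1) ;; set_marks m (Var x))"

text \<open>Input vertices are shifted by 1 to keep 0 for the virtual vertex. That vertex needs no
  entry of its own in the list: the list starts with length 1, and its first cell is 0 as all memory
  is.\<close>

definition build :: "nat \<Rightarrow> nat \<Rightarrow> template list \<Rightarrow> cm" where
  "build Q m ts = rN ::= Lit 1 ;; Sto (aMK 0) (Lit 0) (Lit 1) ;; rJ ::= Rd 0 (Lit 0) ;; rPT ::= Lit 1 ;;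
     Loop (Var rJ)
       (rU ::= Plus (Rd 0 (Var rPT)) (Lit 1) ;; rA ::= Rd 0 (Plus (Var rPT) (Lit 1)) ;;
        rX ::= Plus (Rd 0 (Plus (Var rPT) (Lit 2))) (Lit 1) ;;
        new_vertex m rU ;; new_vertex m rX ;; add_templates Q ts ;;
        rPT ::= Plus (Var rPT) (Lit 3) ;; rJ ::= Minus (Var rJ) (Lit 1))"

fun matches :: "template \<Rightarrow> nat \<Rightarrow> bool" where
  "matches (l, a, q, b, q') c \<longleftrightarrow> (case l of None \<Rightarrow> True | Some d \<Rightarrow> c = d)"

fun link :: "nat \<Rightarrow> template \<Rightarrow> nat \<times> nat \<times> nat \<Rightarrow> nat \<times> nat" where
  "link Q (l, a, q, b, q') (u, c, x) = (Q * pick a (Suc u) (Suc x) + q, Q * pick b (Suc u) (Suc x) + q')"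

definition succs :: "st \<Rightarrow> nat \<Rightarrow> nat list" where
  "succs s z = lst (ar s aNE) (ar s aDS) (ar s aHE z)"

text \<open>Multisets, because the lengths of adjacency lists enter the running time. Repetitions do
  occur: a template without label fires for every edge at a vertex.\<close>

definition edges_rep :: "st \<Rightarrow> (nat \<times> nat) list \<Rightarrow> bool" where
  "edges_rep s xs \<longleftrightarrow> decr (ar s aNE) \<and> (\<forall>z. ar s aHE z \<le> rg s rEP) \<and>
     (\<forall>z. mset (succs s z) = mset (map snd (filter (\<lambda>e. fst e = z) xs)))"

lemma wp_add_edge:
  assumes "edges_rep s xs" and e: "\<And>s'. ar s' aHE = ar s aHE \<Longrightarrow> (\<forall>x. x \<noteq> rEP \<longrightarrow> rg s' x = rg s x) \<Longrightarrow> val s' e = z"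
    "\<And>s'. (\<forall>x. x \<noteq> rEP \<longrightarrow> rg s' x = rg s x) \<Longrightarrow> val s' f = y"
  shows "wp (add_edge e f) (\<lambda>s'. edges_rep s' ((z, y) # xs) \<and> tm s' = tm s + 4) s"
proof -
  let ?p = "Suc (rg s rEP)"
  have hp: "decr (ar s aNE)" "ar s aHE x < ?p" for x
    using assms(1) by (auto simp: edges_rep_def le_imp_less_Suc)
  let ?s1 = "upd_reg rEP ?p s"
  let ?s2 = "upd_arr aDS ?p y ?s1"
  let ?s3 = "upd_arr aNE ?p (ar s aHE z) ?s2"
  let ?s4 = "upd_arr aHE z ?p ?s3"
  have "val ?s1 f = y" "val ?s2 e = z" "val ?s3 e = z" by (rule e; simp)+
  then have "wp (add_edge e f) (\<lambda>s'. edges_rep s' ((z, y) # xs) \<and> tm s' = tm s + 4) s \<longleftrightarrow>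
      edges_rep ?s4 ((z, y) # xs) \<and> tm ?s4 = tm s + 4"
    by (simp add: add_edge_def)
  moreover have "succs ?s4 x = (if x = z then y # succs s x else succs s x)" for x
    using hp by (simp add: succs_def lst_new lst_upd)
  then have "edges_rep ?s4 ((z, y) # xs)"
    using assms(1) hp by (auto simp: edges_rep_def decr_upd less_imp_le)
  ultimately show ?thesis by simp
qed

lemma edges_rep_cong: "ar s' aNE = ar s aNE \<Longrightarrow> ar s' aDS = ar s aDS \<Longrightarrow> ar s' aHE = ar s aHE \<Longrightarrow>
    rg s' rEP = rg s rEP \<Longrightarrow> edges_rep s' xs = edges_rep s xs"
  by (simp add: edges_rep_def succs_def)

lemma val_pick_ex: "rg s rU = u \<Longrightarrow> rg s rX = x \<Longrightarrow> val s (pick_ex a) = pick a u x"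
  by (cases a) auto

lemma wp_add_template:
  assumes g: "edges_rep s xs" and r: "rg s rU = Suc u" "rg s rX = Suc x" "rg s rA = c"
  shows "wp (add_template Q t) (\<lambda>s'. edges_rep s' ((if matches t c then [link Q t (u, c, x)] else []) @ xs) \<and>
    tm s' \<le> tm s + 5) s"
proof -
  obtain l a q b q' where t: "t = (l, a, q, b, q')" by (cases t) auto
  let ?e = "Plus (Scale Q (pick_ex a)) (Lit q)" and ?f = "Plus (Scale Q (pick_ex b)) (Lit q')"
  have p: "wp (add_edge ?e ?f) (\<lambda>s''. edges_rep s'' (link Q t (u, c, x) # xs) \<and> tm s'' = tm s' + 4) s'"
    if "s' = s \<or> s' = tick s" for s'
    unfolding t link.simps
  proof (rule wp_add_edge)
    show "edges_rep s' xs" using g that edges_rep_cong[of "tick s" s xs] by auto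
  qed (use that r in \<open>auto simp: val_pick_ex\<close>)
  show ?thesis
  proof (cases l)
    case None
    then show ?thesis using p[of s] by (simp add: t) (erule wp_mono, simp)
  next
    case (Some d)
    show ?thesis
    proof (cases "c = d")
      case True
      then show ?thesis using p[of "tick s"] Some r by (simp add: t) (erule wp_mono, simp)
    next
      case False
      then show ?thesis using g Some r edges_rep_cong[of "tick (tick s)" s xs] by (auto simp: t)
    qed
  qed
qed

lemma add_template_frame: "wreg (add_template Q t) = {rEP}" "warr (add_template Q t) = {aDS, aNE, aHE}"
  "\<not> puts (add_template Q t)"
  by (cases t; auto simp: add_edge_def Let_def split: option.splits)+

lemma add_templates_frame: "wreg (add_templates Q ts) \<subseteq> {rEP}" "warr (add_templates Q ts) \<subseteq> {aDS, aNE, aHE}"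
  "\<not> puts (add_templates Q ts)"
  by (induction ts) (auto simp: add_template_frame)

definition links_of :: "nat \<Rightarrow> template list \<Rightarrow> nat \<times> nat \<times> nat \<Rightarrow> (nat \<times> nat) set" where
  "links_of Q ts e = {link Q t e | t. t \<in> set ts \<and> matches t (fst (snd e))}"

lemma wp_Sq: "wp (p ;; q) Q = wp p (wp q Q)"
  by (simp add: fun_eq_iff)

lemma links_of_Cons: "links_of Q (t # ts) e =
    (if matches t (fst (snd e)) then {link Q t e} else {}) \<union> links_of Q ts e"
  by (auto simp: links_of_def simp del: split_paired_Ex split_paired_All link.simps matches.simps)

lemma wp_add_templates:
  assumes "edges_rep s xs" "rg s rU = Suc u" "rg s rX = Suc x" "rg s rA = c"
  shows "wp (add_templates Q ts) (\<lambda>s'. (\<exists>ys. edges_rep s' ys \<and> set ys = links_of Q ts (u, c, x) \<union> set xs \<and>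
    length ys \<le> length ts + length xs) \<and> tm s' \<le> tm s + 5 * length ts + 1) s"
  using assms
proof (induction ts arbitrary: s xs)
  case Nil
  then show ?case using edges_rep_cong[of "tick s" s xs]
    by (auto simp: links_of_def intro!: exI[of _ xs])
next
  case (Cons t ts)
  show ?case unfolding add_templates.simps wp_simps(5)
  proof (rule wp_same[OF wp_add_template[OF Cons.prems, of Q t]])
    fix s1
    let ?xs = "(if matches t c then [link Q t (u, c, x)] else []) @ xs"
    assume s1: "edges_rep s1 ?xs \<and> tm s1 \<le> tm s + 5" and sm: "same (add_template Q t) s s1"
    have "rg s1 rU = Suc u" "rg s1 rX = Suc x" "rg s1 rA = c"
      using Cons.prems same_reg[OF sm] by (simp_all add: add_template_frame)
    from Cons.IH[OF conjunct1[OF s1] this]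
    show "wp (add_templates Q ts) (\<lambda>s'. (\<exists>ys. edges_rep s' ys \<and> set ys = links_of Q (t # ts) (u, c, x) \<union> set xs \<and>
      length ys \<le> length (t # ts) + length xs) \<and> tm s' \<le> tm s + 5 * length (t # ts) + 1) s1"
    proof (rule wp_mono)
      fix s2
      assume s2: "(\<exists>ys. edges_rep s2 ys \<and> set ys = links_of Q ts (u, c, x) \<union> set ?xs \<and>
        length ys \<le> length ts + length ?xs) \<and> tm s2 \<le> tm s1 + 5 * length ts + 1"
      then obtain ys where ys: "edges_rep s2 ys" "set ys = links_of Q ts (u, c, x) \<union> set ?xs"
        "length ys \<le> length ts + length ?xs" by blast
      have "set ys = links_of Q (t # ts) (u, c, x) \<union> set xs"
        unfolding links_of_Cons ys(2) by auto
      moreover have "length ys \<le> length (t # ts) + length xs" using ys(3) by (auto split: if_splits)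
      ultimately show "(\<exists>ys. edges_rep s2 ys \<and> set ys = links_of Q (t # ts) (u, c, x) \<union> set xs \<and>
        length ys \<le> length (t # ts) + length xs) \<and> tm s2 \<le> tm s + 5 * length (t # ts) + 1"
        using ys(1) s1 s2 by auto
    qed
  qed
qed

section \<open>Registration of the vertices\<close>

lemma aMK_large: "a < 20 \<Longrightarrow> a \<notin> aMK ` X"
  by auto

lemma set_marks_frame: "wreg (set_marks m e) = {}" "warr (set_marks m e) = aMK ` {1..m}" "\<not> puts (set_marks m e)"
  by (induction m) (auto simp: atLeastAtMostSuc_conv)

lemma wp_set_marks:
  "wp (set_marks m (Var x)) (\<lambda>s'. (\<forall>i. ar s' (aMK i) = (if 1 \<le> i \<and> i \<le> m then (ar s (aMK i))(rg s x := 1) else ar s (aMK i))) \<and>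
     tm s' = tm s + m + 1) s"
proof (induction m)
  case 0
  then show ?case by simp
next
  case (Suc m)
  show ?case unfolding set_marks.simps wp_simps(5)
  proof (rule wp_same[OF Suc])
    fix s'
    assume s': "(\<forall>i. ar s' (aMK i) = (if 1 \<le> i \<and> i \<le> m then (ar s (aMK i))(rg s x := 1) else ar s (aMK i))) \<and>
      tm s' = tm s + m + 1" and sm: "same (set_marks m (Var x)) s s'"
    have r: "rg s' x = rg s x" using same_reg[OF sm] by (simp add: set_marks_frame)
    have "ar (upd_arr (aMK (Suc m)) (rg s x) 1 s') (aMK i) =
        (if 1 \<le> i \<and> i \<le> Suc m then (ar s (aMK i))(rg s x := 1) else ar s (aMK i))" for i
      using s'[THEN conjunct1, rule_format, of i] by (cases "i = Suc m") (auto simp: le_Suc_eq)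
    then show "wp (Sto (aMK (Suc m)) (Var x) (Lit 1)) (\<lambda>s'. (\<forall>i. ar s' (aMK i) =
        (if 1 \<le> i \<and> i \<le> Suc m then (ar s (aMK i))(rg s x := 1) else ar s (aMK i))) \<and>
      tm s' = tm s + Suc m + 1) s'"
      using s' by (simp only: wp_simps val.simps r upd_simps) simp
  qed
qed

lemma new_vertex_frame: "wreg (new_vertex m x) = {rN}" "warr (new_vertex m x) = {aSN, aVT} \<union> aMK ` {1..m}"
  "\<not> puts (new_vertex m x)"
  by (auto simp: new_vertex_def set_marks_frame)

definition verts_rep :: "nat \<Rightarrow> st \<Rightarrow> nat set \<Rightarrow> bool" where
  "verts_rep m s X \<longleftrightarrow> distinct (vlist s) \<and> set (vlist s) = insert 0 X \<and> 0 \<notin> X \<and>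
     (\<forall>v. v \<noteq> 0 \<longrightarrow> (ar s aSN v \<noteq> 0 \<longleftrightarrow> v \<in> X)) \<and>
     (\<forall>i\<in>{1..m}. \<forall>v. ar s (aMK i) v \<noteq> 0 \<longleftrightarrow> v \<in> X) \<and> (\<forall>v. ar s (aMK 0) v \<noteq> 0 \<longleftrightarrow> v = 0)"

lemma verts_rep_cong: "\<lbrakk>\<And>a. a \<notin> {aDS, aNE, aHE} \<Longrightarrow> ar s' a = ar s a; rg s' rN = rg s rN\<rbrakk> \<Longrightarrow> verts_rep m s' X = verts_rep m s X"
  by (simp add: verts_rep_def vlist_def)

lemma wp_new_vertex:
  assumes v: "verts_rep m s X" and x: "rg s x \<noteq> 0" "x \<noteq> rN"
  shows "wp (new_vertex m x) (\<lambda>s'. verts_rep m s' (insert (rg s x) X) \<and> tm s' \<le> tm s + m + 5) s"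
proof (cases "ar s aSN (rg s x) = 0")
  case False
  then have "insert (rg s x) X = X" using v x by (auto simp: verts_rep_def)
  then show ?thesis using False v verts_rep_cong[of "tick (tick s)" s m X] by (simp add: new_vertex_def)
next
  case True
  let ?v = "rg s x"
  have "ar s aSN ?v \<noteq> 0 \<longleftrightarrow> ?v \<in> X" "set (vlist s) = insert 0 X" using v x by (simp_all add: verts_rep_def)
  then have new: "?v \<notin> set (vlist s)" using True x by simp
  let ?s = "upd_reg rN (Suc (rg s rN)) (upd_arr aVT (rg s rN) ?v (upd_arr aSN ?v 1 (tick s)))"
  have "wp (set_marks m (Var x)) (\<lambda>s'. verts_rep m s' (insert ?v X) \<and> tm s' \<le> tm s + m + 5) ?s"
  proof (rule wp_same[OF wp_set_marks])
    fix s'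
    assume s': "(\<forall>i. ar s' (aMK i) = (if 1 \<le> i \<and> i \<le> m then (ar ?s (aMK i))(rg ?s x := 1) else ar ?s (aMK i))) \<and>
      tm s' = tm ?s + m + 1" and sm: "same (set_marks m (Var x)) ?s s'"
    have mk: "ar s' (aMK i) = (if 1 \<le> i \<and> i \<le> m then (ar s (aMK i))(?v := 1) else ar s (aMK i))" for i
      using s' x by simp
    have a: "ar s' aVT = (ar s aVT)(rg s rN := ?v)" "ar s' aSN = (ar s aSN)(?v := 1)" "rg s' rN = Suc (rg s rN)"
      using same_arr[OF sm, of aVT] same_arr[OF sm, of aSN] same_reg[OF sm, of rN]
      by (simp_all add: set_marks_frame aMK_large)
    have "vlist s' = vlist s @ [?v]" by (simp add: vlist_def a)
    then have "verts_rep m s' (insert ?v X)"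
      using v x new mk[of 0] mk unfolding verts_rep_def by (simp add: a(2)) blast
    then show "verts_rep m s' (insert ?v X) \<and> tm s' \<le> tm s + m + 5" using s' by simp
  qed
  then show ?thesis using True x by (simp add: new_vertex_def)
qed

lemma nth_encode_edges:
  assumes "k < length es"
  shows "encode_edges es ! (3 * k + 1) = fst (es ! k)"
    "encode_edges es ! (3 * k + 2) = fst (snd (es ! k))"
    "encode_edges es ! (3 * k + 3) = snd (snd (es ! k))"
proof -
  let ?f = "\<lambda>(u, a, v). [u, a, v]"
  have "concat (map ?f es) ! (3 * k + j) = ?f (es ! k) ! j" if "j < 3" "k < length es" for j k
    using that(2)
  proof (induction es arbitrary: k)
    case (Cons e es)
    then show ?case using that(1)
      by (cases k; cases e) (auto simp: nth_append less_Suc_eq_0_disj numeral_3_eq_3)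
  qed simp
  from this[of 0 k] this[of 1 k] this[of 2 k] assms
  show "encode_edges es ! (3 * k + 1) = fst (es ! k)"
    "encode_edges es ! (3 * k + 2) = fst (snd (es ! k))"
    "encode_edges es ! (3 * k + 3) = snd (snd (es ! k))"
    by (auto simp: encode_edges_def split: prod.splits)
qed

lemma length_encode_edges: "length (encode_edges es) = 3 * length es + 1"
  by (induction es) (auto simp: encode_edges_def)

definition endpoints :: "(nat \<times> nat \<times> nat) set \<Rightarrow> nat set" where
  "endpoints es = (\<Union>(u, a, v)\<in>es. {Suc u, Suc v})"

lemma start_simps [simp]: "rg (start w) x = 0" "a \<noteq> 0 \<Longrightarrow> ar (start w) a i = 0" "ou (start w) = []" "tm (start w) = 0"
  by (auto simp: start_def)

lemma build_frame: "wreg (build Q m ts) \<subseteq> {rN, rJ, rPT, rU, rA, rX, rEP}"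
  "warr (build Q m ts) \<subseteq> {aSN, aVT, aDS, aNE, aHE} \<union> aMK ` {0..m}" "\<not> puts (build Q m ts)"
  using add_templates_frame[of Q ts] by (auto simp: build_def new_vertex_frame)

lemma wp_build:
  "wp (build Q m ts) (\<lambda>s. verts_rep m s (endpoints (set es)) \<and>
     (\<exists>xs. edges_rep s xs \<and> set xs = (\<Union>e\<in>set es. links_of Q ts e) \<and> length xs \<le> length ts * length es) \<and>
     tm s \<le> (2 * m + 5 * length ts + 20) * (length es + 1)) (start (encode_edges es))"
proof -
  let ?w = "encode_edges es"
  let ?s0 = "upd_reg rPT 1 (upd_reg rJ (length es) (upd_arr (aMK 0) 0 1 (upd_reg rN 1 (start ?w))))"
  let ?c = "2 * m + 5 * length ts + 18"
  let ?I = "\<lambda>s. \<exists>k. k \<le> length es \<and> rg s rJ = length es - k \<and> rg s rPT = 3 * k + 1 \<and> ar s 0 = ar (start ?w) 0 \<and>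
    verts_rep m s (endpoints (set (take k es))) \<and>
    (\<exists>xs. edges_rep s xs \<and> set xs = (\<Union>e\<in>set (take k es). links_of Q ts e) \<and> length xs \<le> length ts * k) \<and>
    tm s \<le> 4 + ?c * k"
  let ?post = "\<lambda>s. verts_rep m s (endpoints (set es)) \<and>
     (\<exists>xs. edges_rep s xs \<and> set xs = (\<Union>e\<in>set es. links_of Q ts e) \<and> length xs \<le> length ts * length es) \<and>
     tm s \<le> (2 * m + 5 * length ts + 20) * (length es + 1)"
  let ?body = "rU ::= Plus (Rd 0 (Var rPT)) (Lit 1) ;; rA ::= Rd 0 (Plus (Var rPT) (Lit 1)) ;;
        rX ::= Plus (Rd 0 (Plus (Var rPT) (Lit 2))) (Lit 1) ;;
        new_vertex m rU ;; new_vertex m rX ;; add_templates Q ts ;;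
        rPT ::= Plus (Var rPT) (Lit 3) ;; rJ ::= Minus (Var rJ) (Lit 1)"
  have "wp (Loop (Var rJ) ?body) ?post ?s0"
  proof (rule wp_Loop[where I = ?I and \<phi> = "\<lambda>s. rg s rJ"])
    have "edges_rep ?s0 []" by (simp add: edges_rep_def succs_def decr_def)
    moreover have "verts_rep m ?s0 {}" by (simp add: verts_rep_def vlist_def)
    ultimately show "?I ?s0" by (intro exI[of _ 0]) (simp add: endpoints_def)
  next
    fix s assume "?I s" and b: "val s (Var rJ) \<noteq> 0"
    then obtain k xs where k: "k \<le> length es" "rg s rJ = length es - k" "rg s rPT = 3 * k + 1" "ar s 0 = ar (start ?w) 0"
      "verts_rep m s (endpoints (set (take k es)))" "edges_rep s xs" "set xs = (\<Union>e\<in>set (take k es). links_of Q ts e)"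
      "length xs \<le> length ts * k" "tm s \<le> 4 + ?c * k" by blast
    then have kl: "k < length es" using b by simp
    obtain u c x where e: "es ! k = (u, c, x)" by (cases "es ! k") auto
    have rd: "ar s 0 i = ?w ! i" if "i < length ?w" for i
    proof -
      have "min i (length ?w - 1) = i" using that by simp
      then show ?thesis using k(4) by (simp add: start_def)
    qed
    have ux: "ar s 0 (3 * k + 1) = u" "ar s 0 (3 * k + 2) = c" "ar s 0 (3 * k + 3) = x"
      using nth_encode_edges[OF kl] kl e by (simp_all add: rd length_encode_edges)
    have tk: "set (take (Suc k) es) = insert (u, c, x) (set (take k es))"
      using kl e by (simp add: take_Suc_conv_app_nth)
    let ?s = "upd_reg rX (Suc x) (upd_reg rA c (upd_reg rU (Suc u) (tick s)))"
    let ?Q = "\<lambda>s'. ?I s' \<and> rg s' rJ < rg s rJ"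
    let ?p3 = "rPT ::= Plus (Var rPT) (Lit 3) ;; rJ ::= Minus (Var rJ) (Lit 1)"
    have v0: "verts_rep m ?s (endpoints (set (take k es)))" using k(5) verts_rep_cong[of ?s s m] by simp
    have "wp (new_vertex m rU) (wp (new_vertex m rX) (wp (add_templates Q ts) (wp ?p3 ?Q))) ?s"
    proof (rule wp_same[OF wp_new_vertex[OF v0]])
      show "rg ?s rU \<noteq> 0" "rU \<noteq> rN" by simp_all
      fix s1
      assume s1: "verts_rep m s1 (insert (rg ?s rU) (endpoints (set (take k es)))) \<and> tm s1 \<le> tm ?s + m + 5"
        and sm1: "same (new_vertex m rU) ?s s1"
      have f1: "rg s1 r = rg ?s r" if "r \<noteq> rN" for r using same_reg[OF sm1] that by (simp add: new_vertex_frame)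
      have g1: "ar s1 a = ar s a" if "a \<in> {0, aDS, aNE, aHE}" for a
        using same_arr[OF sm1, of a] that by (auto simp: new_vertex_frame aMK_large)
      show "wp (new_vertex m rX) (wp (add_templates Q ts) (wp ?p3 ?Q)) s1"
      proof (rule wp_same[OF wp_new_vertex[OF conjunct1[OF s1]]])
        show "rg s1 rX \<noteq> 0" "rX \<noteq> rN" by (simp_all add: f1)
        fix s2
        assume s2: "verts_rep m s2 (insert (rg s1 rX) (insert (rg ?s rU) (endpoints (set (take k es))))) \<and> tm s2 \<le> tm s1 + m + 5"
          and sm2: "same (new_vertex m rX) s1 s2"
        have f2: "rg s2 r = rg ?s r" if "r \<noteq> rN" for r
          using same_reg[OF sm2] f1 that by (simp add: new_vertex_frame)
        have g2: "ar s2 a = ar s a" if "a \<in> {0, aDS, aNE, aHE}" for a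
          using same_arr[OF sm2, of a] g1[OF that] that by (auto simp: new_vertex_frame aMK_large)
        have gr2: "edges_rep s2 xs" using k(6) edges_rep_cong[of s2 s xs] by (simp add: f2 g2)
        have r2: "rg s2 rU = Suc u" "rg s2 rX = Suc x" "rg s2 rA = c" by (simp_all add: f2)
        show "wp (add_templates Q ts) (wp ?p3 ?Q) s2"
        proof (rule wp_same[OF wp_add_templates[OF gr2 r2]])
          fix s3
          assume s3: "(\<exists>ys. edges_rep s3 ys \<and> set ys = links_of Q ts (u, c, x) \<union> set xs \<and>
            length ys \<le> length ts + length xs) \<and> tm s3 \<le> tm s2 + 5 * length ts + 1"
            and sm3: "same (add_templates Q ts) s2 s3"
          obtain ys where ys: "edges_rep s3 ys" "set ys = links_of Q ts (u, c, x) \<union> set xs"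
            "length ys \<le> length ts + length xs" using s3 by blast
          have f3: "rg s3 r = rg s2 r" if "r \<noteq> rEP" for r
            using same_reg[OF sm3, of r] add_templates_frame(1)[of Q ts] that by auto
          have g3: "ar s3 a = ar s2 a" if "a \<notin> {aDS, aNE, aHE}" for a
            using same_arr[OF sm3, of a] add_templates_frame(2)[of Q ts] that by auto
          let ?s4 = "upd_reg rJ (length es - Suc k) (upd_reg rPT (3 * Suc k + 1) s3)"
          have "verts_rep m s3 (insert (Suc x) (insert (Suc u) (endpoints (set (take k es)))))"
            using s2 verts_rep_cong[of s3 s2 m] by (simp add: f1 f3 g3)
          moreover have "insert (Suc x) (insert (Suc u) (endpoints (set (take k es)))) = endpoints (set (take (Suc k) es))"
            unfolding tk by (auto simp: endpoints_def)
          ultimately have "verts_rep m ?s4 (endpoints (set (take (Suc k) es)))"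
            using verts_rep_cong[of ?s4 s3 m] by simp
          moreover have "edges_rep ?s4 ys" using ys(1) edges_rep_cong[of ?s4 s3 ys] by simp
          moreover have "set ys = (\<Union>e\<in>set (take (Suc k) es). links_of Q ts e)"
            unfolding tk using ys(2) k(7) by auto
          moreover have "length ys \<le> length ts * Suc k" using ys(3) k(8) by simp
          moreover have "tm ?s4 \<le> 4 + ?c * Suc k" using s3 s2 s1 k(9) by simp
          moreover have "ar ?s4 0 = ar (start ?w) 0" using k(4) by (simp add: g3 g2)
          ultimately have I4: "?I ?s4" using kl by (intro exI[of _ "Suc k"]) (simp, blast)
          have r3: "rg s3 rPT = 3 * k + 1" "rg s3 rJ = length es - k"
            using k by (simp_all add: f3 f2)
          have e: "upd_reg rJ (val (upd_reg rPT (val s3 (Plus (Var rPT) (Lit 3))) s3) (Minus (Var rJ) (Lit 1)))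
            (upd_reg rPT (val s3 (Plus (Var rPT) (Lit 3))) s3) = ?s4"
            by (simp add: r3)
          have "rg ?s4 rJ < rg s rJ" using kl k(2) by simp
          with I4 show "wp ?p3 ?Q s3" unfolding wp_simps(2,5) e by blast
        qed
      qed
    qed
    moreover
    let ?u1 = "upd_reg rU (val (tick s) (Plus (Rd 0 (Var rPT)) (Lit 1))) (tick s)"
    let ?u2 = "upd_reg rA (val ?u1 (Rd 0 (Plus (Var rPT) (Lit 1)))) ?u1"
    have "upd_reg rX (val ?u2 (Plus (Rd 0 (Plus (Var rPT) (Lit 2))) (Lit 1))) ?u2 = ?s"
    proof -
      have "rg s rPT + 1 = 3 * k + 2" "rg s rPT + 2 = 3 * k + 3" using k(3) by simp_all
      then have "ar s 0 (rg s rPT) = u" "ar s 0 (rg s rPT + 1) = c" "ar s 0 (rg s rPT + 2) = x"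
        using ux k(3) by (simp_all only:)
      then show ?thesis by simp
    qed
    ultimately show "wp ?body ?Q (tick s)" by (simp only: wp_Sq wp_simps(2))
  next
    fix s assume I: "?I s" and b: "val s (Var rJ) = 0"
    then obtain k xs where k: "k \<le> length es" "rg s rJ = length es - k"
      "verts_rep m s (endpoints (set (take k es)))" "edges_rep s xs" "set xs = (\<Union>e\<in>set (take k es). links_of Q ts e)"
      "length xs \<le> length ts * k" "tm s \<le> 4 + ?c * k" by blast
    then have kl: "k = length es" using b by simp
    have "edges_rep (tick s) xs" "verts_rep m (tick s) (endpoints (set es))"
      using k kl edges_rep_cong[of "tick s" s xs] verts_rep_cong[of "tick s" s m] by simp_all
    moreover have "tm (tick s) \<le> (2 * m + 5 * length ts + 20) * (length es + 1)"
      using k(7) kl by (simp add: algebra_simps)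
    ultimately show "?post (tick s)" using k kl by auto
  qed
  moreover have "ar (start ?w) 0 0 = length es" by (simp add: start_def encode_edges_def)
  ultimately show ?thesis by (simp add: build_def)
qed

section \<open>Tree-shaped constraints\<close>

text \<open>Variable 0 is a virtual root with the single value 0; \<open>good\<close> and \<open>act\<close> are the results of
  the bottom-up and the top-down semijoin pass.\<close>

locale tree =
  fixes m :: nat and par :: "nat \<Rightarrow> nat" and X :: "nat set" and conn :: "nat \<Rightarrow> nat \<Rightarrow> nat \<Rightarrow> bool"
  assumes par: "i \<in> {1..m} \<Longrightarrow> par i < i" and conn: "conn i v w \<Longrightarrow> w \<in> X"
begin

definition dom :: "nat \<Rightarrow> nat set" where "dom i = (if i = 0 then {0} else X)"

inductive good :: "nat \<Rightarrow> nat \<Rightarrow> bool" where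
  "v \<in> dom i \<Longrightarrow> (\<forall>j\<in>{1..m}. par j = i \<longrightarrow> (\<exists>w. conn j v w \<and> good j w)) \<Longrightarrow> good i v"

inductive act :: "nat \<Rightarrow> nat \<Rightarrow> bool" where
  root: "good 0 v \<Longrightarrow> act 0 v"
| child: "i \<in> {1..m} \<Longrightarrow> act (par i) v \<Longrightarrow> conn i v w \<Longrightarrow> good i w \<Longrightarrow> act i w"

definition sat :: "(nat \<Rightarrow> nat) \<Rightarrow> bool" where
  "sat a \<longleftrightarrow> a 0 = 0 \<and> (\<forall>i\<in>{1..m}. conn i (a (par i)) (a i))"

lemma good_0: "good 0 v \<Longrightarrow> v = 0"
  by (auto simp: dom_def elim: good.cases)

lemma good_child: "good (par i) v \<Longrightarrow> i \<in> {1..m} \<Longrightarrow> \<exists>w. conn i v w \<and> good i w"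
  by (erule good.cases) blast

lemma act_good: "act i v \<Longrightarrow> good i v"
  by (auto elim: act.cases)

lemma sat_good: "sat a \<Longrightarrow> i \<le> m \<Longrightarrow> good i (a i)"
proof (induction "m - i" arbitrary: i rule: less_induct)
  case less
  have "a i \<in> dom i"
  proof (cases "i = 0")
    case False
    then have "conn i (a (par i)) (a i)" using less by (simp add: sat_def)
    then show ?thesis using conn False by (simp add: dom_def)
  qed (use less in \<open>simp add: sat_def dom_def\<close>)
  moreover have "\<exists>w. conn j (a i) w \<and> good j w" if "j \<in> {1..m}" "par j = i" for j
  proof -
    have "i < j" using par that by blast
    then have "good j (a j)" using less that by auto
    moreover have "conn j (a i) (a j)" using less(2) that by (auto simp: sat_def)
    ultimately show ?thesis by blast
  qed
  ultimately show ?case by (intro good.intros) auto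
qed

lemma sat_act: "sat a \<Longrightarrow> i \<le> m \<Longrightarrow> act i (a i)"
proof (induction i rule: less_induct)
  case (less i)
  show ?case
  proof (cases "i = 0")
    case True
    then show ?thesis using sat_good[OF less(2,3)] by (auto intro: act.intros)
  next
    case False
    then have i: "i \<in> {1..m}" using less by simp
    then have "act (par i) (a (par i))" using less par[OF i] by auto
    moreover have "conn i (a (par i)) (a i)" using less(2) i by (simp add: sat_def)
    ultimately show ?thesis using act.child[OF i] sat_good[OF less(2,3)] by blast
  qed
qed

text \<open>The remaining indices receive values in increasing order. When an index is reached, its
  parent already has a good value, and a good value has a good partner at each child; closure of
  \<open>S\<close> under parents ensures that values fixed beforehand never clash with new
  ones.\<close>

lemma extend:
  assumes S: "0 \<in> S" "\<And>i. i \<in> S \<Longrightarrow> i \<noteq> 0 \<Longrightarrow> par i \<in> S" and r0: "\<rho> 0 = 0"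
    and g: "\<And>i. i \<in> S \<Longrightarrow> good i (\<rho> i)"
    and c: "\<And>i. i \<in> S \<Longrightarrow> i \<noteq> 0 \<Longrightarrow> conn i (\<rho> (par i)) (\<rho> i)"
  shows "\<exists>a. sat a \<and> (\<forall>i\<in>S. a i = \<rho> i)"
proof -
  have "k \<le> m \<Longrightarrow> \<exists>a. (\<forall>i\<in>S. a i = \<rho> i) \<and> (\<forall>i\<le>k. good i (a i) \<and> (i \<noteq> 0 \<longrightarrow> conn i (a (par i)) (a i)))" for k
  proof (induction k)
    case 0
    then show ?case using S g by (intro exI[of _ \<rho>]) auto
  next
    case (Suc k)
    then obtain a where a: "\<forall>i\<in>S. a i = \<rho> i"
      "\<And>i. i \<le> k \<Longrightarrow> good i (a i)" "\<And>i. i \<le> k \<Longrightarrow> i \<noteq> 0 \<Longrightarrow> conn i (a (par i)) (a i)" by auto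
    have k: "Suc k \<in> {1..m}" using Suc by simp
    show ?case
    proof (cases "Suc k \<in> S")
      case True
      then have "good (Suc k) (a (Suc k))" "conn (Suc k) (a (par (Suc k))) (a (Suc k))"
        using g c S a(1) by auto
      then show ?thesis using a by (intro exI[of _ a]) (auto simp: le_Suc_eq)
    next
      case False
      have "good (par (Suc k)) (a (par (Suc k)))" using a(2) par[OF k] by simp
      then obtain w where w: "conn (Suc k) (a (par (Suc k))) w" "good (Suc k) w"
        using good_child k by blast
      have p: "par i \<noteq> Suc k" if "i \<le> Suc k" "i \<noteq> 0" for i
        using par[of i] that k by auto
      let ?a = "a(Suc k := w)"
      have "good i (?a i) \<and> (i \<noteq> 0 \<longrightarrow> conn i (?a (par i)) (?a i))" if "i \<le> Suc k" for i
        using that w a p[of i] by (cases "i = Suc k") auto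
      then show ?thesis using a(1) False by (intro exI[of _ ?a]) auto
    qed
  qed
  from this[OF le_refl] obtain a where a: "\<forall>i\<in>S. a i = \<rho> i"
    "\<forall>i\<le>m. good i (a i) \<and> (i \<noteq> 0 \<longrightarrow> conn i (a (par i)) (a i))" by blast
  then have "sat a" using S r0 by (auto simp: sat_def)
  then show ?thesis using a by blast
qed

text \<open>Unfolding \<open>act\<close> walks from \<open>i\<close> up to the root. The visited
  indices with the values met on the way form a set closed under parents, which is the kind of
  partial assignment that \<open>extend\<close> completes.\<close>

lemma act_path:
  "act i v \<Longrightarrow> \<exists>S \<rho>. 0 \<in> S \<and> i \<in> S \<and> S \<subseteq> {..i} \<and> (\<forall>j\<in>S. j \<noteq> 0 \<longrightarrow> par j \<in> S) \<and> \<rho> 0 = 0 \<and> \<rho> i = v \<and>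
    (\<forall>j\<in>S. good j (\<rho> j)) \<and> (\<forall>j\<in>S. j \<noteq> 0 \<longrightarrow> conn j (\<rho> (par j)) (\<rho> j))"
proof (induction rule: act.induct)
  case (root v)
  then show ?case using good_0[OF root] by (intro exI[of _ "{0}"] exI[of _ "\<lambda>_. 0"]) auto
next
  case (child i v w)
  then obtain S \<rho> where S: "0 \<in> S" "par i \<in> S" "S \<subseteq> {..par i}" "\<forall>j\<in>S. j \<noteq> 0 \<longrightarrow> par j \<in> S" "\<rho> 0 = 0" "\<rho> (par i) = v"
    "\<forall>j\<in>S. good j (\<rho> j)" "\<forall>j\<in>S. j \<noteq> 0 \<longrightarrow> conn j (\<rho> (par j)) (\<rho> j)" by blast
  have i: "i \<notin> S" "par i < i" using S(3) par[OF child(1)] by auto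
  then have n: "j \<noteq> i" if "j \<in> S" for j using that by auto
  have p: "par j \<noteq> i" if "j \<in> S" "j \<noteq> 0" for j using n S(4) that by auto
  show ?case
  proof (intro exI[of _ "insert i S"] exI[of _ "\<rho>(i := w)"] conjI ballI impI)
    show "good j ((\<rho>(i := w)) j)" if "j \<in> insert i S" for j using that S(7) child(4) n by auto
    show "conn j ((\<rho>(i := w)) (par j)) ((\<rho>(i := w)) j)" if "j \<in> insert i S" "j \<noteq> 0" for j
      using that S(6,8) child(3) n p i by (cases "j = i") auto
    show "par j \<in> insert i S" if "j \<in> insert i S" "j \<noteq> 0" for j
      using that S(2,4) by auto
  qed (use S i n in auto)
qed

text \<open>The path that realises \<open>v\<close> consists of indices up to \<open>par i\<close>,
  so \<open>i\<close> with value \<open>w\<close> can be attached to it freely, and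
  \<open>extend\<close> completes the assignment. Consequently no computed pair is dangling, which
  ties the size of a relation to the calibrated output.\<close>

lemma act_pair:
  assumes "i \<in> {1..m}" "act (par i) v" "conn i v w" "act i w"
  shows "\<exists>a. sat a \<and> a (par i) = v \<and> a i = w"
proof -
  from act_path[OF assms(2)] obtain S \<rho> where S: "0 \<in> S" "par i \<in> S" "S \<subseteq> {..par i}" "\<forall>j\<in>S. j \<noteq> 0 \<longrightarrow> par j \<in> S"
    "\<rho> 0 = 0" "\<rho> (par i) = v" "\<forall>j\<in>S. good j (\<rho> j)" "\<forall>j\<in>S. j \<noteq> 0 \<longrightarrow> conn j (\<rho> (par j)) (\<rho> j)" by blast
  have i: "i \<notin> S" "par i < i" using S(3) par[OF assms(1)] by auto
  have pS: "par j \<noteq> i" if "j \<in> S" "j \<noteq> 0" for j using S(4) that i by auto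
  have "\<exists>a. sat a \<and> (\<forall>j\<in>insert i S. a j = (\<rho>(i := w)) j)"
  proof (rule extend)
    show "good j ((\<rho>(i := w)) j)" if "j \<in> insert i S" for j
      using that S(7) act_good[OF assms(4)] by auto
    show "conn j ((\<rho>(i := w)) (par j)) ((\<rho>(i := w)) j)" if "j \<in> insert i S" "j \<noteq> 0" for j
      using that S(6,8) i assms(3) pS by auto
  qed (use S i in auto)
  then obtain a where "sat a" "\<forall>j\<in>insert i S. a j = (\<rho>(i := w)) j" by blast
  then show ?thesis using S i by (intro exI[of _ a]) auto
qed

lemma act_child:
  assumes "i \<in> {1..m}" "act (par i) v"
  shows "\<exists>w. conn i v w \<and> act i w"
proof -
  from act_good[OF assms(2)] assms(1) obtain w where "conn i v w" "good i w" using good_child by blast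
  then show ?thesis using act.child[OF assms] by blast
qed

text \<open>Pairwise conditions along the edges of \<open>F\<close> suffice because
  \<open>insert 0 F\<close> is closed under parents. Therefore the enumeration may consult the lists
  of partners one edge at a time.\<close>

lemma act_extend:
  assumes F: "F \<subseteq> {1..m}" "\<And>i. i \<in> F \<Longrightarrow> par i \<in> insert 0 F" and "act 0 0" and "\<rho> 0 = 0"
    and "\<And>i. i \<in> F \<Longrightarrow> conn i (\<rho> (par i)) (\<rho> i) \<and> act i (\<rho> i)"
  shows "\<exists>a. sat a \<and> (\<forall>i\<in>F. a i = \<rho> i)"
proof -
  have "\<exists>a. sat a \<and> (\<forall>i\<in>insert 0 F. a i = \<rho> i)"
    by (rule extend) (use assms act_good in auto)
  then show ?thesis by blast
qed

end

section \<open>Enumeration\<close>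

primrec enumf :: "(nat \<Rightarrow> nat) \<Rightarrow> (nat \<Rightarrow> nat \<Rightarrow> nat list) \<Rightarrow> nat list \<Rightarrow> (nat \<Rightarrow> nat) \<Rightarrow> (nat \<Rightarrow> nat) list" where
  "enumf par ll [] \<rho> = [\<rho>]"
| "enumf par ll (i # is) \<rho> = concat (map (\<lambda>w. enumf par ll is (\<rho>(i := w))) (ll i (\<rho> (par i))))"

primrec ecosts :: "(nat \<Rightarrow> nat) \<Rightarrow> (nat \<Rightarrow> nat \<Rightarrow> nat list) \<Rightarrow> nat list \<Rightarrow> (nat \<Rightarrow> nat) \<Rightarrow> nat" where
  "ecosts par ll [] \<rho> = 1"
| "ecosts par ll (i # is) \<rho> = 2 + (\<Sum>w\<leftarrow>ll i (\<rho> (par i)). 4 + ecosts par ll is (\<rho>(i := w)))"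

abbreviation (input) rCell :: "nat \<Rightarrow> nat" where "rCell i \<equiv> 20 + 3 * i"
abbreviation (input) rVal :: "nat \<Rightarrow> nat" where "rVal i \<equiv> 21 + 3 * i"
abbreviation (input) rOut :: "nat \<Rightarrow> nat" where "rOut i \<equiv> 22 + 3 * i"

text \<open>One nested loop per index, so the nesting depth depends on the query alone.
  \<open>rOut\<close> undoes the shift by 1, since the values to be emitted are the original
  vertices.\<close>

primrec enum :: "(nat \<Rightarrow> nat) \<Rightarrow> nat list \<Rightarrow> nat list \<Rightarrow> cm" where
  "enum par xs [] = Put (map (\<lambda>i. rOut i) xs)"
| "enum par xs (i # is) = rCell i ::= Rd (aLH i) (Var (rVal (par i))) ;;
     Loop (Var (rCell i)) (rVal i ::= Rd aVA (Var (rCell i)) ;; rOut i ::= Minus (Var (rVal i)) (Lit 1) ;;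
       enum par xs is ;; rCell i ::= Rd aNX (Var (rCell i)))"

lemma enum_frame: "wreg (enum par xs is) = (\<Union>i\<in>set is. {rCell i, rVal i, rOut i})" "warr (enum par xs is) = {}"
  by (induction "is") auto

text \<open>Parents are smaller and the list is increasing, so the value at a listed index is
  overwritten before it is first read. Stale register contents from earlier iterations are harmless
  for this reason.\<close>

lemma enumf_cong:
  assumes "sorted_wrt (<) is" "\<And>i. i \<in> set is \<Longrightarrow> par i < i" "\<And>j. j \<notin> set is \<Longrightarrow> \<rho> j = \<rho>' j"
  shows "enumf par ll is \<rho> = enumf par ll is \<rho>' \<and> ecosts par ll is \<rho> = ecosts par ll is \<rho>'"
  using assms
proof (induction "is" arbitrary: \<rho> \<rho>')
  case Nil
  then have "\<rho> = \<rho>'" by auto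
  then show ?case by simp
next
  case (Cons i "is")
  have "par i < i" "\<forall>k\<in>set is. i < k" using Cons.prems(1,2) by auto
  then have "par i \<notin> set (i # is)" by auto
  then have p: "\<rho> (par i) = \<rho>' (par i)" using Cons.prems(3) by blast
  have "enumf par ll is (\<rho>(i := w)) = enumf par ll is (\<rho>'(i := w)) \<and>
      ecosts par ll is (\<rho>(i := w)) = ecosts par ll is (\<rho>'(i := w))" for w
    using Cons.prems by (intro Cons.IH) auto
  then show ?case by (simp add: p)
qed

lemma wp_enum:
  assumes "sorted_wrt (<) is" "\<And>i. i \<in> set is \<Longrightarrow> par i < i" "decr (ar s aNX)"
    and "\<And>i. i \<in> set xs - set is \<Longrightarrow> rg s (rOut i) = rg s (rVal i) - 1"
  shows "wp (enum par xs is) (\<lambda>s'.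
    ou s' = ou s @ map (\<lambda>\<rho>. map (\<lambda>i. \<rho> i - 1) xs) (enumf par (\<lambda>i. llist (aLH i) s) is (\<lambda>i. rg s (rVal i))) \<and>
    tm s' \<le> tm s + ecosts par (\<lambda>i. llist (aLH i) s) is (\<lambda>i. rg s (rVal i))) s"
  using assms
proof (induction "is" arbitrary: s)
  case Nil
  then show ?case by simp
next
  case (Cons i "is")
  let ?ll = "\<lambda>i. llist (aLH i) s" and ?\<rho> = "\<lambda>i. rg s (rVal i)"
  let ?v = "rg s (rVal (par i))"
  let ?out = "map (\<lambda>\<rho>. map (\<lambda>i. \<rho> i - 1) xs)"
  let ?E = "\<lambda>w. ?out (enumf par ?ll is (?\<rho>(i := w)))" and ?C = "\<lambda>w. ecosts par ?ll is (?\<rho>(i := w))"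
  have i: "par i < i" "i \<notin> set is" "\<forall>k\<in>set is. i < k" using Cons.prems(1,2) by auto
  let ?R = "\<Union>i\<in>set (i # is). {rCell i, rVal i, rOut i}"
  \<comment> \<open>\<open>ws\<close> is the prefix of the list of partners already processed, and
    \<open>rCell i\<close> points to the rest. The inner enumeration belongs to larger indices, so
    it cannot touch \<open>rCell i\<close>.\<close>
  let ?I = "\<lambda>s'. ar s' = ar s \<and> (\<forall>x. x \<notin> ?R \<longrightarrow> rg s' x = rg s x) \<and>
    (\<exists>ws. ?ll i ?v = ws @ lst (ar s aNX) (ar s aVA) (rg s' (rCell i)) \<and>
      ou s' = ou s @ concat (map ?E ws) \<and> tm s' \<le> tm s + 1 + (\<Sum>w\<leftarrow>ws. 4 + ?C w))"
  let ?s0 = "upd_reg (rCell i) (ar s (aLH i) ?v) s"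
  let ?body = "rVal i ::= Rd aVA (Var (rCell i)) ;; rOut i ::= Minus (Var (rVal i)) (Lit 1) ;;
       enum par xs is ;; rCell i ::= Rd aNX (Var (rCell i))"
  let ?post = "\<lambda>s'. ou s' = ou s @ ?out (enumf par ?ll (i # is) ?\<rho>) \<and> tm s' \<le> tm s + ecosts par ?ll (i # is) ?\<rho>"
  have "wp (Loop (Var (rCell i)) ?body) ?post ?s0"
  proof (rule wp_Loop[where I = ?I and \<phi> = "\<lambda>s. rg s (rCell i)"])
    show "?I ?s0" by (auto simp: llist_def intro!: exI[of _ "[]"])
  next
    fix s1 assume I: "?I s1" and b: "val s1 (Var (rCell i)) \<noteq> 0"
    then obtain ws where ws: "?ll i ?v = ws @ lst (ar s aNX) (ar s aVA) (rg s1 (rCell i))"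
      "ou s1 = ou s @ concat (map ?E ws)" "tm s1 \<le> tm s + 1 + (\<Sum>w\<leftarrow>ws. 4 + ?C w)"
      and a1: "ar s1 = ar s" and r1: "\<forall>x. x \<notin> ?R \<longrightarrow> rg s1 x = rg s x" by blast
    let ?c = "rg s1 (rCell i)"
    let ?w = "ar s aVA ?c"
    have c: "?c \<noteq> 0" using b by simp
    have lst: "lst (ar s aNX) (ar s aVA) ?c = ?w # lst (ar s aNX) (ar s aVA) (ar s aNX ?c)"
      by (rule lst_step[OF Cons.prems(3) c])
    let ?s2 = "upd_reg (rOut i) (?w - 1) (upd_reg (rVal i) ?w (tick s1))"
    have "ar ?s2 = ar s" using a1 by simp
    then have ll: "(\<lambda>i. llist (aLH i) ?s2) = ?ll" unfolding llist_def by (simp only:)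
    have "rg ?s2 (rOut k) = rg ?s2 (rVal k) - 1" if "k \<in> set xs - set is" for k
    proof (cases "k = i")
      case False
      then have "k \<notin> set (i # is)" using that by simp
      then have "rOut k \<notin> ?R" "rVal k \<notin> ?R" by (auto; presburger)+
      moreover have "rOut k \<noteq> rVal i" "rVal k \<noteq> rOut i" by presburger+
      ultimately show ?thesis using False r1 Cons.prems(4)[of k] that by simp
    qed simp
    then have "wp (enum par xs is) (\<lambda>s'. ou s' = ou ?s2 @ ?out (enumf par (\<lambda>i. llist (aLH i) ?s2) is (\<lambda>i. rg ?s2 (rVal i))) \<and>
      tm s' \<le> tm ?s2 + ecosts par (\<lambda>i. llist (aLH i) ?s2) is (\<lambda>i. rg ?s2 (rVal i))) ?s2"
      using Cons.prems a1 by (intro Cons.IH) auto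
    moreover have "rg ?s2 (rVal j) = (?\<rho>(i := ?w)) j" if "j \<notin> set is" for j
    proof (cases "j = i")
      case True
      have "rVal i \<noteq> rOut i" by presburger
      then show ?thesis using True by simp
    next
      case False
      then have "rVal j \<notin> ?R" using that by (auto; presburger)
      moreover have "rVal j \<noteq> rOut i" by presburger
      ultimately show ?thesis using r1 False by simp
    qed
    then have eq: "enumf par ?ll is (\<lambda>i. rg ?s2 (rVal i)) = enumf par ?ll is (?\<rho>(i := ?w)) \<and>
        ecosts par ?ll is (\<lambda>i. rg ?s2 (rVal i)) = ?C ?w"
      using Cons.prems(1,2) by (intro enumf_cong) auto
    ultimately have "wp (enum par xs is) (\<lambda>s'. ou s' = ou ?s2 @ ?E ?w \<and> tm s' \<le> tm ?s2 + ?C ?w) ?s2"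
      unfolding ll by (simp only: eq)
    then have "wp (enum par xs is) (wp (rCell i ::= Rd aNX (Var (rCell i)))
        (\<lambda>s'. ?I s' \<and> rg s' (rCell i) < rg s1 (rCell i))) ?s2"
    proof (rule wp_same)
      fix s3 assume s3: "ou s3 = ou ?s2 @ ?E ?w \<and> tm s3 \<le> tm ?s2 + ?C ?w" and sm: "same (enum par xs is) ?s2 s3"
      have ar3: "ar s3 = ar s" using same_arr[OF sm] a1 by (simp add: enum_frame fun_eq_iff)
      have "rCell i \<notin> wreg (enum par xs is)" using i by (auto simp: enum_frame; presburger)
      then have "rg s3 (rCell i) = rg ?s2 (rCell i)" using same_reg[OF sm] by blast
      moreover have "rCell i \<noteq> rVal i" "rCell i \<noteq> rOut i" by presburger+
      ultimately have c3: "rg s3 (rCell i) = ?c" by simp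
      have r3: "rg s3 x = rg s x" if "x \<notin> ?R" for x
      proof -
        have "x \<notin> wreg (enum par xs is)" using that by (auto simp: enum_frame)
        then have "rg s3 x = rg ?s2 x" using same_reg[OF sm] by blast
        also have "\<dots> = rg s1 x" using that by auto
        finally show ?thesis using r1 that by simp
      qed
      let ?s4 = "upd_reg (rCell i) (ar s aNX ?c) s3"
      have "?I ?s4 \<and> rg ?s4 (rCell i) < ?c"
      proof (intro conjI exI[of _ "ws @ [?w]"] allI impI)
        show "rg ?s4 (rCell i) < ?c" using Cons.prems(3) c by (simp add: decr_def)
        show "?ll i ?v = (ws @ [?w]) @ lst (ar s aNX) (ar s aVA) (rg ?s4 (rCell i))" using ws(1) lst by simp
        show "ou ?s4 = ou s @ concat (map ?E (ws @ [?w]))" using s3 ws(2) by simp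
        show "tm ?s4 \<le> tm s + 1 + (\<Sum>w\<leftarrow>ws @ [?w]. 4 + ?C w)" using s3 ws(3) by simp
        show "rg ?s4 x = rg s x" if "x \<notin> ?R" for x using r3[OF that] that by auto
      qed (simp add: ar3)
      moreover have v: "val s3 (Rd aNX (Var (rCell i))) = ar s aNX ?c" using c3 by (simp add: ar3)
      ultimately show "wp (rCell i ::= Rd aNX (Var (rCell i))) (\<lambda>s'. ?I s' \<and> rg s' (rCell i) < rg s1 (rCell i)) s3"
        unfolding wp_simps(2) v by blast
    qed
    then have "wp (enum par xs is ;; rCell i ::= Rd aNX (Var (rCell i)))
        (\<lambda>s'. ?I s' \<and> rg s' (rCell i) < rg s1 (rCell i)) ?s2" by (simp only: wp_Sq)
    moreover have "upd_reg (rOut i) (val (upd_reg (rVal i) (val (tick s1) (Rd aVA (Var (rCell i)))) (tick s1))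
      (Minus (Var (rVal i)) (Lit 1))) (upd_reg (rVal i) (val (tick s1) (Rd aVA (Var (rCell i)))) (tick s1)) = ?s2"
      using a1 by simp
    ultimately show "wp ?body (\<lambda>s'. ?I s' \<and> rg s' (rCell i) < rg s1 (rCell i)) (tick s1)"
      by (simp only: wp_Sq wp_simps(2))
  next
    fix s1 assume I: "?I s1" and b: "val s1 (Var (rCell i)) = 0"
    then obtain ws where ws: "?ll i ?v = ws" "ou s1 = ou s @ concat (map ?E ws)"
      "tm s1 \<le> tm s + 1 + (\<Sum>w\<leftarrow>ws. 4 + ?C w)" by auto
    then show "?post (tick s1)" by (auto simp: map_concat comp_def)
  qed
  then show ?case by simp
qed

lemma enumf_iff:
  assumes "sorted_wrt (<) is" "\<And>i. i \<in> set is \<Longrightarrow> par i < i"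
  shows "\<rho>' \<in> set (enumf par ll is \<rho>) \<longleftrightarrow>
    (\<forall>j. j \<notin> set is \<longrightarrow> \<rho>' j = \<rho> j) \<and> (\<forall>i\<in>set is. \<rho>' i \<in> set (ll i (\<rho>' (par i))))"
  using assms
proof (induction "is" arbitrary: \<rho>)
  case Nil
  then show ?case by auto
next
  case (Cons i "is")
  have i: "par i < i" "i \<notin> set is" "\<forall>k\<in>set is. i < k" using Cons.prems by auto
  then have p: "par i \<notin> set (i # is)" by auto
  have "\<rho>' \<in> set (enumf par ll (i # is) \<rho>) \<longleftrightarrow> (\<exists>w\<in>set (ll i (\<rho> (par i))). \<rho>' \<in> set (enumf par ll is (\<rho>(i := w))))"
    by auto
  also have "\<dots> \<longleftrightarrow> (\<exists>w\<in>set (ll i (\<rho> (par i))). (\<forall>j. j \<notin> set is \<longrightarrow> \<rho>' j = (\<rho>(i := w)) j) \<and>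
      (\<forall>i\<in>set is. \<rho>' i \<in> set (ll i (\<rho>' (par i)))))"
    using Cons by simp
  also have "\<dots> \<longleftrightarrow> (\<forall>j. j \<notin> set (i # is) \<longrightarrow> \<rho>' j = \<rho> j) \<and> (\<forall>i\<in>set (i # is). \<rho>' i \<in> set (ll i (\<rho>' (par i))))"
    (is "?l \<longleftrightarrow> ?r")
  proof
    assume ?l
    then obtain w where w: "w \<in> set (ll i (\<rho> (par i)))" "\<forall>j. j \<notin> set is \<longrightarrow> \<rho>' j = (\<rho>(i := w)) j"
      "\<forall>i\<in>set is. \<rho>' i \<in> set (ll i (\<rho>' (par i)))" by blast
    have "\<rho>' i = w" "\<rho>' (par i) = \<rho> (par i)" using w(2) i p by auto
    then show ?r using w by auto
  next
    assume r: ?r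
    then have "\<rho>' (par i) = \<rho> (par i)" using p by blast
    then show ?l using r by (intro bexI[of _ "\<rho>' i"]) auto
  qed
  finally show ?case .
qed

lemma distinct_concat_map:
  "distinct xs \<Longrightarrow> (\<And>x. x \<in> set xs \<Longrightarrow> distinct (f x)) \<Longrightarrow>
    (\<And>x y. x \<in> set xs \<Longrightarrow> y \<in> set xs \<Longrightarrow> x \<noteq> y \<Longrightarrow> set (f x) \<inter> set (f y) = {}) \<Longrightarrow> distinct (concat (map f xs))"
proof (induction xs)
  case (Cons x xs)
  have "set (f x) \<inter> set (f y) = {}" if "y \<in> set xs" for y
    using Cons.prems(1) Cons.prems(3)[of x y] that by auto
  moreover have "distinct (concat (map f xs))" using Cons by simp
  ultimately show ?case using Cons.prems(2) by auto
qed simp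

text \<open>No dead ends: every list met during the enumeration is non-empty.\<close>

lemma enumf_cost:
  assumes "sorted_wrt (<) is" "\<And>i. i \<in> set is \<Longrightarrow> par i < i"
    and ll: "\<And>i v. i \<in> set is \<Longrightarrow> A (par i) v \<Longrightarrow> distinct (ll i v) \<and> ll i v \<noteq> [] \<and> (\<forall>w\<in>set (ll i v). A i w)"
    and "\<And>i. i \<in> set is \<Longrightarrow> par i \<notin> set is \<Longrightarrow> A (par i) (\<rho> (par i))"
  shows "distinct (enumf par ll is \<rho>) \<and> enumf par ll is \<rho> \<noteq> [] \<and>
    ecosts par ll is \<rho> \<le> (6 * length is + 1) * length (enumf par ll is \<rho>)"
  using assms
proof (induction "is" arbitrary: \<rho>)
  case Nil
  then show ?case by simp
next
  case (Cons i "is")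
  have i: "par i < i" "i \<notin> set is" "\<forall>k\<in>set is. i < k" using Cons.prems by auto
  then have "par i \<notin> set (i # is)" by auto
  then have "A (par i) (\<rho> (par i))" using Cons.prems(4)[of i] by simp
  then have l: "distinct (ll i (\<rho> (par i)))" "ll i (\<rho> (par i)) \<noteq> []" "\<forall>w\<in>set (ll i (\<rho> (par i))). A i w"
    using Cons.prems(3)[of i] by auto
  let ?e = "\<lambda>w. enumf par ll is (\<rho>(i := w))" and ?c = "6 * length is + 1"
  have IH: "distinct (?e w) \<and> ?e w \<noteq> [] \<and> ecosts par ll is (\<rho>(i := w)) \<le> ?c * length (?e w)"
    if "w \<in> set (ll i (\<rho> (par i)))" for w
  proof (rule Cons.IH)
    fix k assume k: "k \<in> set is" "par k \<notin> set is"
    show "A (par k) ((\<rho>(i := w)) (par k))"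
      using Cons.prems(4)[of k] k l(3) that by (cases "par k = i") auto
  qed (use Cons.prems in auto)
  have "set (?e w) \<inter> set (?e w') = {}" if "w \<noteq> w'" for w w'
  proof -
    have "\<rho>' i = w" if "\<rho>' \<in> set (?e w)" for \<rho>' w
      using that enumf_iff[of "is" par \<rho>' ll "\<rho>(i := w)"] Cons.prems(1,2) i by auto
    then show ?thesis using that by blast
  qed
  then have d: "distinct (enumf par ll (i # is) \<rho>)"
    using l(1) IH by (auto intro!: distinct_concat_map)
  have ne: "enumf par ll (i # is) \<rho> \<noteq> []"
    using l(2) IH by (cases "ll i (\<rho> (par i))") auto
  \<comment> \<open>Every inner enumeration produces at least one result, so the 4 ticks spent per
    value are charged to that result. With the 2 ticks around the loop this gives the 6 per level in
    the bound.\<close>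
  have "(\<Sum>w\<leftarrow>ll i (\<rho> (par i)). 4 + ecosts par ll is (\<rho>(i := w))) \<le> (\<Sum>w\<leftarrow>ll i (\<rho> (par i)). (?c + 4) * length (?e w))"
  proof (rule sum_list_mono)
    fix w assume w: "w \<in> set (ll i (\<rho> (par i)))"
    then have "1 \<le> length (?e w)" using IH by (simp add: Suc_le_eq)
    then show "4 + ecosts par ll is (\<rho>(i := w)) \<le> (?c + 4) * length (?e w)"
      using IH[OF w] unfolding add_mult_distrib by linarith
  qed
  also have "\<dots> = (?c + 4) * length (enumf par ll (i # is) \<rho>)"
    by (simp add: length_concat sum_list_const_mult comp_def)
  finally have "ecosts par ll (i # is) \<rho> \<le> 2 + (?c + 4) * length (enumf par ll (i # is) \<rho>)" by simp
  moreover have "1 \<le> length (enumf par ll (i # is) \<rho>)" using ne by (simp add: Suc_le_eq)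
  moreover have "(6 * length (i # is) + 1) * length (enumf par ll (i # is) \<rho>) =
      (?c + 4) * length (enumf par ll (i # is) \<rho>) + 2 * length (enumf par ll (i # is) \<rho>)"
    by (simp add: algebra_simps)
  ultimately show ?case using d ne by linarith
qed

section \<open>The evaluation program\<close>

primrec seqs :: "('a \<Rightarrow> cm) \<Rightarrow> 'a list \<Rightarrow> cm" where
  "seqs f [] = Pass"
| "seqs f (x # xs) = f x ;; seqs f xs"

lemma semijoin_frame: "wreg (semijoin Q m q m' q') = {rD, rC, rW, rY, rP, rS, rE, rI, rV}"
  "warr (semijoin Q m q m' q') \<subseteq> {aST, aCN, aVA, aNX, aHD, aSK, m'}" "\<not> puts (semijoin Q m q m' q')"
  using warr_round by (auto simp: semijoin_def)

lemma relation_frame: "wreg (relation Q m m' s t s' t' l) = {rD, rC, rW, rY, rP, rS, rE, rI, rV, rH}"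
  "warr (relation Q m m' s t s' t' l) \<subseteq> {aST, aCN, aVA, aNX, aHD, aSK, aHV, l}"
  "\<not> puts (relation Q m m' s t s' t' l)"
  using warr_round[of Q aHV s] warr_probe[of Q m' s' m t']
  by (auto simp: relation_def split_heavy_def invert_def)

definition up_step :: "nat \<Rightarrow> (nat \<Rightarrow> nat) \<Rightarrow> (nat \<Rightarrow> nat) \<Rightarrow> (nat \<Rightarrow> nat) \<Rightarrow> nat \<Rightarrow> cm" where
  "up_step Q par q' t' i = semijoin Q (aMK i) (q' i) (aMK (par i)) (t' i)"

definition down_step :: "nat \<Rightarrow> (nat \<Rightarrow> nat) \<Rightarrow> (nat \<Rightarrow> nat) \<Rightarrow> (nat \<Rightarrow> nat) \<Rightarrow> nat \<Rightarrow> cm" where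
  "down_step Q par q t i = semijoin Q (aMK (par i)) (q i) (aMK i) (t i)"

definition rel_step :: "nat \<Rightarrow> (nat \<Rightarrow> nat) \<Rightarrow> (nat \<Rightarrow> nat) \<Rightarrow> (nat \<Rightarrow> nat) \<Rightarrow> (nat \<Rightarrow> nat) \<Rightarrow> (nat \<Rightarrow> nat) \<Rightarrow> nat \<Rightarrow> cm"
  where "rel_step Q par q t q' t' i = relation Q (aMK (par i)) (aMK i) (q i) (t i) (q' i) (t' i) (aLH i)"

definition solve_prog :: "nat \<Rightarrow> nat \<Rightarrow> (nat \<Rightarrow> nat) \<Rightarrow> (nat \<Rightarrow> nat) \<Rightarrow> (nat \<Rightarrow> nat) \<Rightarrow> (nat \<Rightarrow> nat) \<Rightarrow> (nat \<Rightarrow> nat) \<Rightarrow>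
    nat list \<Rightarrow> nat list \<Rightarrow> cm" where
  "solve_prog Q m par q t q' t' is xs = seqs (up_step Q par q' t') (rev [1..<Suc m]) ;;
     seqs (down_step Q par q t) [1..<Suc m] ;; seqs (rel_step Q par q t q' t') is ;;
     Cond (Rd (aMK 0) (Lit 0)) (enum par xs is) Pass"

text \<open>The reversed automata enter through their effect only, in the assumption
  \<open>converse\<close>. The bottom-up pass and the probes use it to look for predecessors by
  forward searches.\<close>

locale solver = closed_graph Q vs he ne ds + tree m par X conn
  for Q :: nat and vs and he ne ds :: "nat \<Rightarrow> nat" and m :: nat and par :: "nat \<Rightarrow> nat" and X :: "nat set"
    and conn :: "nat \<Rightarrow> nat \<Rightarrow> nat \<Rightarrow> bool" +
  fixes q t q' t' :: "nat \<Rightarrow> nat"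
  assumes set_vs: "set vs = insert 0 X" and zero: "0 \<notin> X"
    and states: "i \<in> {1..m} \<Longrightarrow> q i < Q \<and> t i < Q \<and> q' i < Q \<and> t' i < Q"
    and conn_iff: "i \<in> {1..m} \<Longrightarrow> conn i v w \<longleftrightarrow> v \<in> set vs \<and> w \<in> X \<and> (nd v (q i), nd w (t i)) \<in> E\<^sup>*"
    and converse: "i \<in> {1..m} \<Longrightarrow> v \<in> set vs \<Longrightarrow> w \<in> set vs \<Longrightarrow>
      (nd v (q i), nd w (t i)) \<in> E\<^sup>* \<longleftrightarrow> (nd w (q' i), nd v (t' i)) \<in> E\<^sup>*"
begin

lemma par_le: "i \<in> {1..m} \<Longrightarrow> par i \<le> m"
  using par[of i] by simp

lemma act_parent: "act i w \<Longrightarrow> i \<noteq> 0 \<Longrightarrow> \<exists>v. act (par i) v \<and> conn i v w"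
  by (erule act.cases) auto

lemma good_dom: "good i v \<Longrightarrow> v \<in> dom i"
  by (erule good.cases) simp

lemma dom_vs: "v \<in> dom i \<Longrightarrow> v \<in> set vs"
  by (auto simp: dom_def set_vs split: if_splits)

abbreviation (input) sjc :: nat where "sjc \<equiv> (4 * Q + 140) * (weight + 1)"

abbreviation "up \<equiv> up_step Q par q' t'"
abbreviation "down \<equiv> down_step Q par q t"
abbreviation "rel \<equiv> rel_step Q par q t q' t'"
abbreviation "solve \<equiv> solve_prog Q m par q t q' t'"

definition frame :: "st \<Rightarrow> st \<Rightarrow> bool" where
  "frame s s' \<longleftrightarrow> (\<forall>i. ar s' (aLH i) = ar s (aLH i)) \<and> (\<forall>x\<ge>20. rg s' x = rg s x) \<and> ou s' = ou s"

lemma frame_trans: "frame s s' \<Longrightarrow> frame s' s'' \<Longrightarrow> frame s s''"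
  by (simp add: frame_def)

lemma semijoin_same:
  assumes "same (semijoin Q a x (aMK j) y) s s'"
  shows "frame s s'" "i \<noteq> j \<Longrightarrow> marked s' (aMK i) = marked s (aMK i)"
proof -
  have "aLH i \<noteq> aMK j" for i by presburger
  then have "aLH i \<notin> warr (semijoin Q a x (aMK j) y)" for i
    using semijoin_frame(2)[of Q a x "aMK j" y] by auto
  then show "frame s s'"
    using same_arr[OF assms] same_reg[OF assms] same_out[OF assms] by (simp add: frame_def semijoin_frame)
  assume "i \<noteq> j"
  then have "aMK i \<notin> warr (semijoin Q a x (aMK j) y)"
    using semijoin_frame(2)[of Q a x "aMK j" y] by auto
  then show "marked s' (aMK i) = marked s (aMK i)" using same_arr[OF assms] by (simp add: marked_def)
qed

text \<open>Children have larger indices than their parents, so in decreasing order an index has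
  absorbed all its children by the time it is passed on. The assumption on the marks records that
  only children above \<open>k\<close> have been taken into account.\<close>

lemma wp_ups:
  assumes "env s" "k \<le> m"
    and "\<And>i. i \<le> m \<Longrightarrow> marked s (aMK i) =
      {v \<in> dom i. \<forall>j\<in>{1..m}. k < j \<longrightarrow> par j = i \<longrightarrow> (\<exists>w. conn j v w \<and> good j w)}"
  shows "wp (seqs up (rev [1..<Suc k])) (\<lambda>s'. env s' \<and> (\<forall>i\<le>m. marked s' (aMK i) = {v. good i v}) \<and> frame s s' \<and>
    tm s' \<le> tm s + k * sjc + 1) s"
  using assms
proof (induction k arbitrary: s)
  case 0
  have "marked s (aMK i) = {v. good i v}" if "i \<le> m" for i
    unfolding 0(3)[OF that] by (auto simp: good_dom intro: good.intros elim: good.cases)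
  then show ?case using 0(1) by (simp add: marked_def frame_def)
next
  case (Suc k)
  let ?j = "Suc k"
  have j: "?j \<in> {1..m}" using Suc by simp
  have pj: "par ?j < ?j" "par ?j \<le> m" using par[OF j] par_le[OF j] by auto
  have gj: "marked s (aMK ?j) = {v. good ?j v}"
  proof -
    have "marked s (aMK ?j) = {v \<in> dom ?j. \<forall>j\<in>{1..m}. ?j < j \<longrightarrow> par j = ?j \<longrightarrow> (\<exists>w. conn j v w \<and> good j w)}"
      using Suc by blast
    moreover have "?j < j" if "j \<in> {1..m}" "par j = ?j" for j using par[OF that(1)] that(2) by simp
    ultimately show ?thesis by (auto simp: good_dom intro: good.intros elim: good.cases)
  qed
  have r: "rev [1..<Suc (Suc k)] = ?j # rev [1..<Suc k]" by simp
  have st: "q' ?j < Q" "t' ?j < Q" using states[OF j] by auto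
  show ?case unfolding r seqs.simps wp_simps(5)
    unfolding up_step_def[of Q par q' t' ?j]
  proof (rule wp_same[OF wp_semijoin[OF Suc.prems(1) _ _ st]])
    fix s1
    assume s1: "env s1 \<and> extends s s1 \<and>
      marked s1 (aMK (par ?j)) = {v \<in> marked s (aMK (par ?j)). \<exists>w\<in>marked s (aMK ?j). (nd w (q' ?j), nd v (t' ?j)) \<in> E\<^sup>*} \<and>
      tm s1 \<le> tm s + sjc" and sm: "same (semijoin Q (aMK ?j) (q' ?j) (aMK (par ?j)) (t' ?j)) s s1"
    note fr = semijoin_same[OF sm]
    have "marked s1 (aMK i) = {v \<in> dom i. \<forall>j\<in>{1..m}. k < j \<longrightarrow> par j = i \<longrightarrow> (\<exists>w. conn j v w \<and> good j w)}" (is "_ = ?B i")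
      if i: "i \<le> m" for i
    proof (cases "i = par ?j")
      case False
      have "?B i = {v \<in> dom i. \<forall>j\<in>{1..m}. Suc k < j \<longrightarrow> par j = i \<longrightarrow> (\<exists>w. conn j v w \<and> good j w)}"
      proof -
        have "(k < j \<longrightarrow> par j = i \<longrightarrow> R) \<longleftrightarrow> (Suc k < j \<longrightarrow> par j = i \<longrightarrow> R)" for j R
          using False by (cases "j = Suc k") auto
        then show ?thesis by (simp only:)
      qed
      then show ?thesis using fr(2)[OF False] Suc.prems(3)[OF i] by simp
    next
      case True
      have c: "conn ?j v w \<longleftrightarrow> (nd w (q' ?j), nd v (t' ?j)) \<in> E\<^sup>*" if "v \<in> dom i" "good ?j w" for v w
      proof -
        have "w \<in> X" using good_dom[OF that(2)] by (simp add: dom_def)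
        then show ?thesis using conn_iff[OF j] converse[OF j] dom_vs[OF that(1)] set_vs by auto
      qed
      have "v \<in> marked s1 (aMK i) \<longleftrightarrow> v \<in> ?B i" for v
      proof -
        have "v \<in> marked s1 (aMK i) \<longleftrightarrow> v \<in> marked s (aMK i) \<and> (\<exists>w. good ?j w \<and> (nd w (q' ?j), nd v (t' ?j)) \<in> E\<^sup>*)"
          using s1 gj True by auto
        also have "\<dots> \<longleftrightarrow> v \<in> dom i \<and> (\<forall>j\<in>{1..m}. Suc k < j \<longrightarrow> par j = i \<longrightarrow> (\<exists>w. conn j v w \<and> good j w)) \<and>
            (\<exists>w. good ?j w \<and> conn ?j v w)"
          using Suc.prems(3)[OF i] c by auto
        also have "\<dots> \<longleftrightarrow> v \<in> ?B i" (is "?l \<longleftrightarrow> _")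
        proof
          assume l: ?l
          have "\<exists>w. conn j v w \<and> good j w" if "j \<in> {1..m}" "k < j" "par j = i" for j
            using l that by (cases "j = ?j") (blast, metis Suc_lessI)
          then show "v \<in> ?B i" using l by blast
        next
          assume "v \<in> ?B i"
          then show ?l using j True by (auto simp del: atLeastAtMost_iff)
        qed
        finally show ?thesis .
      qed
      then show ?thesis by blast
    qed
    then have "wp (seqs up (rev [1..<Suc k])) (\<lambda>s'. env s' \<and> (\<forall>i\<le>m. marked s' (aMK i) = {v. good i v}) \<and> frame s1 s' \<and>
      tm s' \<le> tm s1 + k * sjc + 1) s1"
      using Suc s1 by (intro Suc.IH) auto
    then show "wp (seqs up (rev [1..<Suc k])) (\<lambda>s'. env s' \<and> (\<forall>i\<le>m. marked s' (aMK i) = {v. good i v}) \<and> frame s s' \<and>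
      tm s' \<le> tm s + Suc k * sjc + 1) s1"
      by (rule wp_mono) (use s1 fr(1) frame_trans in \<open>auto simp del: One_nat_def\<close>)
  qed simp_all
qed

text \<open>In increasing order the marks of the parent are already the active values when a child
  is filtered against them.\<close>

lemma wp_downs:
  assumes "env s" "k \<le> m"
    and "\<And>i. i \<le> m \<Longrightarrow> marked s (aMK i) = (if i \<le> k then {v. act i v} else {v. good i v})"
  shows "wp (seqs down [Suc k..<Suc m]) (\<lambda>s'. env s' \<and> (\<forall>i\<le>m. marked s' (aMK i) = {v. act i v}) \<and> frame s s' \<and>
    tm s' \<le> tm s + (m - k) * sjc + 1) s"
  using assms
proof (induction "m - k" arbitrary: k s)
  case 0
  then have "k = m" by simp
  then show ?case using 0 by (simp add: marked_def frame_def)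
next
  case (Suc d)
  let ?j = "Suc k"
  have j: "?j \<in> {1..m}" using Suc(2) by simp
  have pj: "par ?j \<le> k" "par ?j \<le> m" using par[OF j] par_le[OF j] by auto
  have r: "[Suc k..<Suc m] = ?j # [Suc ?j..<Suc m]" using j by (simp add: upt_conv_Cons)
  have st: "q ?j < Q" "t ?j < Q" using states[OF j] by auto
  show ?case unfolding r seqs.simps wp_simps(5)
    unfolding down_step_def[of Q par q t ?j]
  proof (rule wp_same[OF wp_semijoin[OF Suc.prems(1) _ _ st]])
    fix s1
    assume s1: "env s1 \<and> extends s s1 \<and>
      marked s1 (aMK ?j) = {v \<in> marked s (aMK ?j). \<exists>w\<in>marked s (aMK (par ?j)). (nd w (q ?j), nd v (t ?j)) \<in> E\<^sup>*} \<and>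
      tm s1 \<le> tm s + sjc" and sm: "same (semijoin Q (aMK (par ?j)) (q ?j) (aMK ?j) (t ?j)) s s1"
    note fr = semijoin_same[OF sm]
    have c: "conn ?j w v \<longleftrightarrow> (nd w (q ?j), nd v (t ?j)) \<in> E\<^sup>*" if "act (par ?j) w" "good ?j v" for v w
    proof -
      have "v \<in> X" using good_dom[OF that(2)] by (simp add: dom_def)
      then show ?thesis using conn_iff[OF j] dom_vs[OF good_dom[OF act_good[OF that(1)]]] by auto
    qed
    have "marked s1 (aMK ?j) = {v. good ?j v \<and> (\<exists>w. act (par ?j) w \<and> (nd w (q ?j), nd v (t ?j)) \<in> E\<^sup>*)}"
    proof -
      have "marked s (aMK ?j) = {v. good ?j v}" "marked s (aMK (par ?j)) = {v. act (par ?j) v}"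
        using Suc.prems(3)[of ?j] Suc.prems(3)[of "par ?j"] j pj by simp_all
      then show ?thesis using s1 by blast
    qed
    also have "\<dots> = {v. act ?j v}"
    proof -
      have "good ?j v \<and> (\<exists>w. act (par ?j) w \<and> (nd w (q ?j), nd v (t ?j)) \<in> E\<^sup>*) \<longleftrightarrow> act ?j v" for v
        using c act.child[OF j] act_good[of ?j v] act_parent[of ?j v] by blast
      then show ?thesis by simp
    qed
    finally have "marked s1 (aMK i) = (if i \<le> ?j then {v. act i v} else {v. good i v})" if "i \<le> m" for i
      using fr(2)[of i] Suc.prems(3)[OF that] by (cases "i = ?j") auto
    then have "wp (seqs down [Suc ?j..<Suc m]) (\<lambda>s'. env s' \<and> (\<forall>i\<le>m. marked s' (aMK i) = {v. act i v}) \<and> frame s1 s' \<and>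
      tm s' \<le> tm s1 + (m - ?j) * sjc + 1) s1"
      using Suc s1 j by (intro Suc.hyps(1)) auto
    then show "wp (seqs down [Suc ?j..<Suc m]) (\<lambda>s'. env s' \<and> (\<forall>i\<le>m. marked s' (aMK i) = {v. act i v}) \<and> frame s s' \<and>
      tm s' \<le> tm s + (m - k) * sjc + 1) s1"
    proof (rule wp_mono)
      fix s2
      assume s2: "env s2 \<and> (\<forall>i\<le>m. marked s2 (aMK i) = {v. act i v}) \<and> frame s1 s2 \<and> tm s2 \<le> tm s1 + (m - ?j) * sjc + 1"
      have "m - k = Suc (m - ?j)" using j by simp
      then have "(m - k) * sjc = sjc + (m - ?j) * sjc" by simp
      then show "env s2 \<and> (\<forall>i\<le>m. marked s2 (aMK i) = {v. act i v}) \<and> frame s s2 \<and> tm s2 \<le> tm s + (m - k) * sjc + 1"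
        using s1 s2 fr(1) frame_trans by (auto simp del: One_nat_def)
    qed
  qed simp_all
qed

section \<open>Sizes and lists of the relations\<close>

definition pairs :: "nat \<Rightarrow> nat" where
  "pairs i = card ((\<lambda>a. (a (par i), a i)) ` {a. sat a})"

text \<open>Each pair counted on the left extends to a solution by \<open>act_pair\<close>, and each
  solution stays within the active values by \<open>sat_act\<close>. So the size of the relation to
  be computed is a number of projections of solutions.\<close>

lemma sum_act:
  assumes i: "i \<in> {1..m}"
  shows "(\<Sum>v\<in>{v. act (par i) v}. card {w. conn i v w \<and> act i w}) = pairs i"
proof -
  have fin: "finite {v. act j v}" for j
    by (rule finite_subset[of _ "set vs"]) (use act_good good_dom dom_vs in blast)+
  have "(\<Sum>v\<in>{v. act (par i) v}. card {w. conn i v w \<and> act i w}) =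
      card (SIGMA v:{v. act (par i) v}. {w. conn i v w \<and> act i w})"
    using fin by (subst card_SigmaI) (auto intro: finite_subset[OF _ fin[of i]])
  also have "(SIGMA v:{v. act (par i) v}. {w. conn i v w \<and> act i w}) = (\<lambda>a. (a (par i), a i)) ` {a. sat a}"
  proof (intro equalityI subsetI)
    fix x assume "x \<in> (SIGMA v:{v. act (par i) v}. {w. conn i v w \<and> act i w})"
    then obtain v w where x: "x = (v, w)" "act (par i) v" "conn i v w" "act i w" by auto
    then show "x \<in> (\<lambda>a. (a (par i), a i)) ` {a. sat a}" using act_pair[OF i x(2-4)] by force
  next
    fix x assume "x \<in> (\<lambda>a. (a (par i), a i)) ` {a. sat a}"
    then obtain a where a: "x = (a (par i), a i)" "sat a" by blast
    moreover have "conn i (a (par i)) (a i)" using a(2) i by (simp add: sat_def)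
    ultimately show "x \<in> (SIGMA v:{v. act (par i) v}. {w. conn i v w \<and> act i w})"
      using sat_act[OF a(2)] par_le[OF i] i by auto
  qed
  finally show ?thesis by (simp add: pairs_def)
qed

definition listed :: "st \<Rightarrow> nat \<Rightarrow> bool" where
  "listed s i \<longleftrightarrow> (\<forall>v. ar s (aLH i) v \<le> rg s rP) \<and> (\<forall>v. act (par i) v \<longrightarrow>
     distinct (llist (aLH i) s v) \<and> set (llist (aLH i) s v) = {w. conn i v w \<and> act i w})"

text \<open>\<open>I\<close> collects the indices done before, whose lists must survive: later
  phases only allocate new cells. The time is stated for every \<open>d\<close> that bounds all
  integer square roots in question, so one \<open>d\<close> serves all relations and real numbers
  stay out of the program logic.\<close>

lemma wp_rels:
  assumes "env s" "set is \<subseteq> {1..m}" "distinct is" "\<And>i. i \<le> m \<Longrightarrow> marked s (aMK i) = {v. act i v}"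
    and "\<And>i v. i \<in> set is \<Longrightarrow> ar s (aLH i) v = 0" and "\<And>i. i \<in> I \<Longrightarrow> i \<notin> set is \<and> listed s i"
  shows "wp (seqs rel is) (\<lambda>s'. env s' \<and> (\<forall>i\<le>m. marked s' (aMK i) = {v. act i v}) \<and> (\<forall>i\<in>set is \<union> I. listed s' i) \<and>
    (\<forall>x\<ge>20. rg s' x = rg s x) \<and> ou s' = ou s \<and>
    (\<forall>d\<ge>1. (\<forall>i\<in>set is. \<forall>c. c * c \<le> 4 * pairs i \<longrightarrow> c \<le> d) \<longrightarrow>
       tm s' \<le> tm s + length is * ((30 * Q + 800) * (d * (weight + 1))) + 1)) s"
  using assms
proof (induction "is" arbitrary: s I)
  case Nil
  then show ?case by (simp add: marked_def listed_def llist_def)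
next
  case (Cons i "is")
  have i: "i \<in> {1..m}" using Cons.prems(2) by simp
  have mk: "marked s (aMK i) = {v. act i v}" "marked s (aMK (par i)) = {v. act (par i) v}"
    using Cons.prems(4) i par_le[OF i] by auto
  have st: "q i < Q" "t i < Q" "q' i < Q" "t' i < Q" using states[OF i] by auto
  have ne: "aMK (par i) \<noteq> aLH i" "aMK i \<noteq> aLH i" by presburger+
  let ?L = "\<lambda>v. {w \<in> marked s (aMK i). (nd v (q i), nd w (t i)) \<in> E\<^sup>*}"
  have L: "?L v = {w. conn i v w \<and> act i w}" if "act (par i) v" for v
  proof -
    have "v \<in> set vs" using dom_vs[OF good_dom[OF act_good[OF that]]] .
    moreover have "w \<in> X" if "act i w" for w using good_dom[OF act_good[OF that]] i by (auto simp: dom_def)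
    ultimately show ?thesis using conn_iff[OF i] mk by auto
  qed
  have R: "pairs i = (\<Sum>v\<in>marked s (aMK (par i)). card (?L v))"
    unfolding sum_act[OF i, symmetric] mk(2) by (rule sum.cong) (use L in auto)
  have lP: "\<forall>v. ar s (aLH i) v \<le> rg s rP" using Cons.prems(5) by simp
  show ?case unfolding seqs.simps wp_simps(5) rel_step_def[of Q par q t q' t' i]
  proof (rule wp_same[OF wp_relation[OF Cons.prems(1) _ _ _ ne st converse[OF i] refl R lP]])
    fix s1
    let ?p = "relation Q (aMK (par i)) (aMK i) (q i) (t i) (q' i) (t' i) (aLH i)"
    assume s1': "env s1 \<and> extends s s1 \<and> (\<forall>v. ar s1 (aLH i) v \<le> rg s1 rP) \<and>
      (\<forall>v\<in>marked s (aMK (par i)). distinct (llist (aLH i) s1 v) \<and> set (llist (aLH i) s1 v) = ?L v) \<and>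
      (\<exists>d\<ge>1. (d = 1 \<or> d * d \<le> 4 * pairs i) \<and> tm s1 \<le> tm s + (30 * Q + 800) * (d * (weight + 1)))"
      and sm: "same ?p s s1"
    then have s1: "env s1" "extends s s1" "\<forall>v. ar s1 (aLH i) v \<le> rg s1 rP"
      "\<forall>v\<in>marked s (aMK (par i)). distinct (llist (aLH i) s1 v) \<and> set (llist (aLH i) s1 v) = ?L v" by blast+
    have "aMK k \<notin> warr ?p" for k
    proof -
      have "aMK k \<noteq> aLH i" by presburger
      then show ?thesis using relation_frame(2)[of Q "aMK (par i)" "aMK i" "q i" "t i" "q' i" "t' i" "aLH i"] by auto
    qed
    then have mk1: "marked s1 (aMK k) = marked s (aMK k)" for k using same_arr[OF sm] by (simp add: marked_def)
    have lh: "ar s1 (aLH k) = ar s (aLH k)" if "k \<noteq> i" for k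
    proof -
      have "aLH k \<notin> {aST, aCN, aVA, aNX, aHD, aSK, aHV, aLH i}" using that by simp
      then have "aLH k \<notin> warr ?p"
        using relation_frame(2)[of Q "aMK (par i)" "aMK i" "q i" "t i" "q' i" "t' i" "aLH i"] by blast
      then show ?thesis by (rule same_arr[OF sm])
    qed
    have rg: "\<forall>x\<ge>20. rg s1 x = rg s x" "ou s1 = ou s"
      using same_reg[OF sm] same_out[OF sm] by (auto simp: relation_frame)
    have Li: "listed s1 i" using s1(3,4) L mk(2) by (auto simp: listed_def)
    have LJ: "listed s1 k" if "k \<in> I" for k
    proof -
      have k: "k \<noteq> i" "listed s k" using Cons.prems(6)[OF that] by auto
      have "rg s rP \<le> rg s1 rP" using s1(2) by (simp add: extends_def)
      then have "ar s1 (aLH k) v \<le> rg s1 rP" for v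
        using k lh[OF k(1)] by (auto simp: listed_def intro: le_trans)
      moreover have "llist (aLH k) s1 v = llist (aLH k) s v" for v
        using extends_lst[OF s1(2)] k lh[OF k(1)] by (simp add: llist_def listed_def)
      ultimately show ?thesis using k(2) by (simp add: listed_def)
    qed
    have "wp (seqs rel is) (\<lambda>s'. env s' \<and> (\<forall>i\<le>m. marked s' (aMK i) = {v. act i v}) \<and>
      (\<forall>i\<in>set is \<union> insert i I. listed s' i) \<and> (\<forall>x\<ge>20. rg s' x = rg s1 x) \<and> ou s' = ou s1 \<and>
      (\<forall>d\<ge>1. (\<forall>i\<in>set is. \<forall>c. c * c \<le> 4 * pairs i \<longrightarrow> c \<le> d) \<longrightarrow>
        tm s' \<le> tm s1 + length is * ((30 * Q + 800) * (d * (weight + 1))) + 1)) s1"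
    proof (rule Cons.IH[OF s1(1)])
      show "ar s1 (aLH k) v = 0" if "k \<in> set is" for k v
        using that Cons.prems(3,5) lh[of k] by (cases "k = i") auto
      show "k \<notin> set is \<and> listed s1 k" if "k \<in> insert i I" for k
        using that Cons.prems(3,6) Li LJ by auto
    qed (use Cons.prems mk1 in auto)
    then show "wp (seqs rel is) (\<lambda>s'. env s' \<and> (\<forall>i\<le>m. marked s' (aMK i) = {v. act i v}) \<and>
      (\<forall>i\<in>set (i # is) \<union> I. listed s' i) \<and> (\<forall>x\<ge>20. rg s' x = rg s x) \<and> ou s' = ou s \<and>
      (\<forall>d\<ge>1. (\<forall>i\<in>set (i # is). \<forall>c. c * c \<le> 4 * pairs i \<longrightarrow> c \<le> d) \<longrightarrow>
        tm s' \<le> tm s + length (i # is) * ((30 * Q + 800) * (d * (weight + 1))) + 1)) s1"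
    proof (rule wp_mono)
      fix s2
      let ?c = "\<lambda>d. (30 * Q + 800) * (d * (weight + 1))"
      assume s2: "env s2 \<and> (\<forall>i\<le>m. marked s2 (aMK i) = {v. act i v}) \<and>
        (\<forall>i\<in>set is \<union> insert i I. listed s2 i) \<and> (\<forall>x\<ge>20. rg s2 x = rg s1 x) \<and> ou s2 = ou s1 \<and>
        (\<forall>d\<ge>1. (\<forall>i\<in>set is. \<forall>c. c * c \<le> 4 * pairs i \<longrightarrow> c \<le> d) \<longrightarrow>
          tm s2 \<le> tm s1 + length is * ?c d + 1)"
      have "tm s2 \<le> tm s + length (i # is) * ?c d + 1"
        if d: "d \<ge> 1" "\<forall>i\<in>set (i # is). \<forall>c. c * c \<le> 4 * pairs i \<longrightarrow> c \<le> d" for d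
      proof -
        from s1' obtain e where e: "e \<ge> 1" "e = 1 \<or> e * e \<le> 4 * pairs i" "tm s1 \<le> tm s + ?c e" by blast
        have "e \<le> d" using e(2) d by auto
        then have "?c e \<le> ?c d" by (intro mult_le_mono2 mult_le_mono1)
        moreover have "tm s2 \<le> tm s1 + length is * ?c d + 1" using s2 d by simp
        moreover have "length (i # is) * ?c d = ?c d + length is * ?c d" by simp
        ultimately show ?thesis using e(3) by linarith
      qed
      then show "env s2 \<and> (\<forall>i\<le>m. marked s2 (aMK i) = {v. act i v}) \<and>
        (\<forall>i\<in>set (i # is) \<union> I. listed s2 i) \<and> (\<forall>x\<ge>20. rg s2 x = rg s x) \<and> ou s2 = ou s \<and>
        (\<forall>d\<ge>1. (\<forall>i\<in>set (i # is). \<forall>c. c * c \<le> 4 * pairs i \<longrightarrow> c \<le> d) \<longrightarrow>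
          tm s2 \<le> tm s + length (i # is) * ?c d + 1)"
        using s2 rg by auto
    qed
  qed simp_all
qed

definition results :: "nat list \<Rightarrow> nat list set" where
  "results xs = (\<lambda>a. map (\<lambda>i. a i - 1) xs) ` {a. sat a}"

lemma map_pred_eq_iff:
  assumes "set xs \<subseteq> {i. a i \<noteq> 0 \<and> b i \<noteq> 0}"
  shows "map (\<lambda>i. a i - 1 :: nat) xs = map (\<lambda>i. b i - 1) xs \<longleftrightarrow> (\<forall>i\<in>set xs. a i = b i)"
proof -
  have "a i - 1 = b i - 1 \<longleftrightarrow> a i = b i" if "i \<in> set xs" for i using assms that by fastforce
  then show ?thesis by auto
qed

lemma wp_solve:
  assumes env: "env s" and mk: "\<And>i. i \<le> m \<Longrightarrow> marked s (aMK i) = dom i"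
    and "is": "sorted_wrt (<) is" "set is \<subseteq> {1..m}" "\<And>i. i \<in> set is \<Longrightarrow> par i \<in> insert 0 (set is)"
    and lh: "\<And>i v. ar s (aLH i) v = 0" and rg: "\<And>x. x \<ge> 20 \<Longrightarrow> rg s x = 0" and ou: "ou s = []"
    and xs: "set xs = set is"
  shows "wp (solve is xs) (\<lambda>s'. distinct (ou s') \<and> set (ou s') = results xs \<and>
    (\<forall>d\<ge>1. (\<forall>i\<in>set is. \<forall>c. c * c \<le> 4 * pairs i \<longrightarrow> c \<le> d) \<longrightarrow>
       tm s' \<le> tm s + (2 * m * (4 * Q + 140) + m * (30 * Q + 800) + 6) * (d * (weight + 1)) +
         (6 * m + 1) * card (results xs))) s"
  unfolding solve_prog_def wp_simps(5)
proof (rule wp_mono[OF wp_ups[OF env le_refl]])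
  show "marked s (aMK i) = {v \<in> dom i. \<forall>j\<in>{1..m}. m < j \<longrightarrow> par j = i \<longrightarrow> (\<exists>w. conn j v w \<and> good j w)}"
    if "i \<le> m" for i using mk[OF that] by auto
  fix s1
  assume s1: "env s1 \<and> (\<forall>i\<le>m. marked s1 (aMK i) = {v. good i v}) \<and> frame s s1 \<and> tm s1 \<le> tm s + m * sjc + 1"
  have m1: "marked s1 (aMK i) = (if i \<le> 0 then {v. act i v} else {v. good i v})" if "i \<le> m" for i
    using s1 that by (auto intro: act.root act_good)
  have one: "[1..<Suc m] = [Suc 0..<Suc m]" by simp
  let ?W = "weight + 1"
  let ?post = "\<lambda>s'. distinct (ou s') \<and> set (ou s') = results xs \<and>
    (\<forall>d\<ge>1. (\<forall>i\<in>set is. \<forall>c. c * c \<le> 4 * pairs i \<longrightarrow> c \<le> d) \<longrightarrow>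
       tm s' \<le> tm s + (2 * m * (4 * Q + 140) + m * (30 * Q + 800) + 6) * (d * ?W) +
         (6 * m + 1) * card (results xs))"
  let ?last = "Cond (Rd (aMK 0) (Lit 0)) (enum par xs is) Pass"
  show "wp (seqs down [1..<Suc m]) (wp (seqs rel is) (wp ?last ?post)) s1"
    unfolding one
  proof (rule wp_mono[OF wp_downs[OF _ le0 m1]])
    show "env s1" using s1 by simp
    fix s2
    assume s2: "env s2 \<and> (\<forall>i\<le>m. marked s2 (aMK i) = {v. act i v}) \<and> frame s1 s2 \<and> tm s2 \<le> tm s1 + (m - 0) * sjc + 1"
    have fr2: "frame s s2" using s1 s2 frame_trans by blast
    have len: "length is \<le> m"
    proof -
      have "distinct is" using "is"(1) by (simp add: strict_sorted_iff)
      then have "length is = card (set is)" by (simp add: distinct_card)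
      also have "\<dots> \<le> card {1..m}" using "is"(2) by (intro card_mono) auto
      finally show ?thesis by simp
    qed
    show "wp (seqs rel is) (wp ?last ?post) s2"
    proof (rule wp_mono[OF wp_rels[where I = "{}"]])
      show "env s2" "set is \<subseteq> {1..m}" using s2 "is" by auto
      show "distinct is" using "is"(1) by (simp add: strict_sorted_iff)
      show "marked s2 (aMK i) = {v. act i v}" if "i \<le> m" for i using s2 that by blast
      show "ar s2 (aLH i) v = 0" for i v using fr2 lh by (simp add: frame_def)
      fix s3
      assume s3: "env s3 \<and> (\<forall>i\<le>m. marked s3 (aMK i) = {v. act i v}) \<and> (\<forall>i\<in>set is \<union> {}. listed s3 i) \<and>
        (\<forall>x\<ge>20. rg s3 x = rg s2 x) \<and> ou s3 = ou s2 \<and>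
        (\<forall>d\<ge>1. (\<forall>i\<in>set is. \<forall>c. c * c \<le> 4 * pairs i \<longrightarrow> c \<le> d) \<longrightarrow>
           tm s3 \<le> tm s2 + length is * ((30 * Q + 800) * (d * ?W)) + 1)"
      have r3: "rg s3 x = 0" if "x \<ge> 20" for x using s3 fr2 rg that by (simp add: frame_def)
      have o3: "ou s3 = []" using s3 fr2 ou by (simp add: frame_def)
      have t3: "tm s3 + 3 \<le> tm s + (2 * m * (4 * Q + 140) + m * (30 * Q + 800) + 6) * (d * ?W)"
        if d: "d \<ge> 1" "\<forall>i\<in>set is. \<forall>c. c * c \<le> 4 * pairs i \<longrightarrow> c \<le> d" for d
      proof -
        define p where "p = d * ?W"
        have W: "?W \<le> p" using mult_le_mono1[OF d(1), of ?W] by (simp only: nat_mult_1 p_def)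
        have a: "tm s3 \<le> tm s2 + length is * ((30 * Q + 800) * p) + 1" using s3 d unfolding p_def by blast
        have b: "length is * ((30 * Q + 800) * p) \<le> m * ((30 * Q + 800) * p)" using len by (rule mult_le_mono1)
        have c: "m * sjc \<le> m * ((4 * Q + 140) * p)" using W by (intro mult_le_mono2)
        have e: "(2 * m * (4 * Q + 140) + m * (30 * Q + 800) + 6) * p =
          m * ((4 * Q + 140) * p) + m * ((4 * Q + 140) * p) + m * ((30 * Q + 800) * p) + 6 * p"
          by (simp add: algebra_simps)
        have "tm s1 \<le> tm s + m * sjc + 1" "tm s2 \<le> tm s1 + m * sjc + 1" using s1 s2 by simp_all
        moreover have "1 \<le> p" using W by simp
        ultimately have "tm s3 + 3 \<le> tm s + (2 * m * (4 * Q + 140) + m * (30 * Q + 800) + 6) * p"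
          using a b c unfolding e by linarith
        then show ?thesis unfolding p_def .
      qed
      have parlt: "par i < i" if "i \<in> set is" for i using "is"(2) par that by blast
      have "0 \<in> set vs" by (simp add: set_vs)
      moreover have "marked s3 (aMK 0) = {v. act 0 v}" using s3 by blast
      then have "0 \<in> marked s3 (aMK 0) \<longleftrightarrow> act 0 0" by blast
      ultimately have root: "ar s3 (aMK 0) 0 \<noteq> 0 \<longleftrightarrow> act 0 0" by (simp add: marked_def)
      \<comment> \<open>The mark of 0 survives both passes exactly if all trees have solutions.
        Without free variables the list of loops is empty, and this test alone decides whether the
        empty tuple is emitted.\<close>
      show "wp ?last ?post s3"
      proof (cases "act 0 0")
        case False
        have "\<not> sat a" for a
        proof
          assume "sat a"
          then show False using sat_act[of a 0] False by (simp add: sat_def)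
        qed
        then have "results xs = {}" by (simp add: results_def)
        moreover have "ar s3 (aMK 0) 0 = 0" using root False by simp
        moreover have "tm s3 + 2 \<le> tm s + (2 * m * (4 * Q + 140) + m * (30 * Q + 800) + 6) * (d * ?W)"
          if "d \<ge> 1" "\<forall>i\<in>set is. \<forall>c. c * c \<le> 4 * pairs i \<longrightarrow> c \<le> d" for d
          using t3[OF that] by linarith
        ultimately have "?post (tick (tick s3))" using o3 by auto
        then show ?thesis using \<open>ar s3 (aMK 0) 0 = 0\<close> by simp
      next
        case True
        let ?ll = "\<lambda>i. llist (aLH i) s3"
        let ?e = "enumf par ?ll is (\<lambda>_. 0)"
        let ?out = "\<lambda>\<rho>. map (\<lambda>i. \<rho> i - 1 :: nat) xs"
        have ll: "distinct (?ll i v) \<and> set (?ll i v) = {w. conn i v w \<and> act i w}" if "i \<in> set is" "act (par i) v" for i v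
          using s3 that by (auto simp: listed_def)
        have ll': "distinct (?ll i v) \<and> ?ll i v \<noteq> [] \<and> (\<forall>w\<in>set (?ll i v). act i w)"
          if "i \<in> set is" "act (par i) v" for i v
        proof -
          have "i \<in> {1..m}" using that "is"(2) by blast
          then have "set (?ll i v) \<noteq> {}" using act_child[of i v] that ll[OF that] by auto
          then show ?thesis using ll[OF that] by auto
        qed
        have top: "act (par i) ((\<lambda>_. 0) (par i))" if "i \<in> set is" "par i \<notin> set is" for i
          using "is"(3)[OF that(1)] that(2) True by auto
        note cost = enumf_cost[of "is" par act ?ll "\<lambda>_. 0", OF "is"(1) parlt ll' top]
        have memb: "\<rho> \<in> set ?e \<longleftrightarrow> (\<forall>j. j \<notin> set is \<longrightarrow> \<rho> j = 0) \<and> (\<forall>i\<in>set is. conn i (\<rho> (par i)) (\<rho> i) \<and> act i (\<rho> i))" for \<rho>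
        proof -
          have "\<rho> \<in> set ?e \<longleftrightarrow> (\<forall>j. j \<notin> set is \<longrightarrow> \<rho> j = 0) \<and> (\<forall>i\<in>set is. \<rho> i \<in> set (?ll i (\<rho> (par i))))"
            using enumf_iff[OF "is"(1) parlt] by simp
          also have "\<dots> \<longleftrightarrow> (\<forall>j. j \<notin> set is \<longrightarrow> \<rho> j = 0) \<and> (\<forall>i\<in>set is. conn i (\<rho> (par i)) (\<rho> i) \<and> act i (\<rho> i))"
          proof (rule conj_cong[OF refl])
            assume z: "\<forall>j. j \<notin> set is \<longrightarrow> \<rho> j = 0"
            have z0: "0 \<notin> set is" using "is"(2) by auto
            show "(\<forall>i\<in>set is. \<rho> i \<in> set (?ll i (\<rho> (par i)))) \<longleftrightarrow> (\<forall>i\<in>set is. conn i (\<rho> (par i)) (\<rho> i) \<and> act i (\<rho> i))"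
              (is "?l \<longleftrightarrow> ?r")
            proof
              assume l: ?l
              \<comment> \<open>A list is known to be correct only for an active value of the
                parent, so activity has to be carried from the root downwards before the lists can
                be interpreted.\<close>
              have "i \<in> insert 0 (set is) \<Longrightarrow> act i (\<rho> i)" for i
              proof (induction i rule: less_induct)
                case (less i)
                show ?case
                proof (cases "i = 0")
                  case True
                  then show ?thesis using z z0 \<open>act 0 0\<close> by simp
                next
                  case False
                  then have i: "i \<in> set is" using less by simp
                  then have "act (par i) (\<rho> (par i))" using less.IH[OF parlt[OF i]] "is"(3) by blast
                  then show ?thesis using l i ll by blast
                qed
              qed
              then show ?r using l ll "is"(3) by blast
            next
              assume r: ?r
              have "act (par i) (\<rho> (par i))" if "i \<in> set is" for i
                using "is"(3)[OF that] r z z0 True by auto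
              then show ?l using r ll by blast
            qed
          qed
          finally show ?thesis .
        qed
        have pos: "set xs \<subseteq> {i. \<rho> i \<noteq> 0}" if "\<rho> \<in> set ?e" for \<rho>
          using that memb conn zero xs by fastforce
        have inj: "inj_on ?out (set ?e)"
        proof (rule inj_onI)
          fix \<rho> \<rho>' assume *: "\<rho> \<in> set ?e" "\<rho>' \<in> set ?e" "?out \<rho> = ?out \<rho>'"
          then have "\<forall>i\<in>set xs. \<rho> i = \<rho>' i" using map_pred_eq_iff[of xs \<rho> \<rho>'] pos by blast
          moreover have "\<rho> j = \<rho>' j" if "j \<notin> set is" for j using * memb that by simp
          ultimately show "\<rho> = \<rho>'" using xs by (metis ext)
        qed
        have res: "?out ` set ?e = results xs"
        proof (intro equalityI subsetI)
          fix x assume "x \<in> ?out ` set ?e"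
          then obtain \<rho> where \<rho>: "\<rho> \<in> set ?e" "x = ?out \<rho>" by blast
          have "\<rho> 0 = 0" using \<rho>(1) memb "is"(2) by auto
          then obtain a where "sat a" "\<forall>i\<in>set is. a i = \<rho> i"
            using act_extend[OF "is"(2,3) True, of \<rho>] \<rho>(1) memb by blast
          then show "x \<in> results xs" using \<rho>(2) xs by (auto simp: results_def intro!: image_eqI[of _ _ a])
        next
          fix x assume "x \<in> results xs"
          then obtain a where a: "sat a" "x = ?out a" by (auto simp: results_def)
          let ?\<rho> = "\<lambda>i. if i \<in> set is then a i else 0"
          have "conn i (?\<rho> (par i)) (?\<rho> i) \<and> act i (?\<rho> i)" if "i \<in> set is" for i
          proof -
            have i: "i \<in> {1..m}" using that "is"(2) by blast
            have "?\<rho> (par i) = a (par i)" using "is"(3)[OF that] a(1) by (auto simp: sat_def)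
            then show ?thesis using a(1) i that sat_act[OF a(1), of i] by (auto simp: sat_def)
          qed
          then have "?\<rho> \<in> set ?e" unfolding memb by simp
          moreover have "x = ?out ?\<rho>" using a(2) xs by simp
          ultimately show "x \<in> ?out ` set ?e" using image_eqI[of x ?out ?\<rho> "set ?e"] by blast
        qed
        have dist: "distinct (map ?out ?e)" using cost inj by (simp add: distinct_map)
        then have card: "length ?e = card (results xs)"
          using distinct_card[OF dist] res by simp
        have c2: "ecosts par ?ll is (\<lambda>_. 0) \<le> (6 * m + 1) * card (results xs)"
        proof -
          have "ecosts par ?ll is (\<lambda>_. 0) \<le> (6 * length is + 1) * card (results xs)" using cost card by simp
          also have "\<dots> \<le> (6 * m + 1) * card (results xs)" using len by (intro mult_le_mono1) simp
          finally show ?thesis .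
        qed
        have ar3: "ar (tick s3) = ar s3" by simp
        have lt: "(\<lambda>i. llist (aLH i) (tick s3)) = ?ll" by (rule ext)+ (simp add: llist_def)
        have v0: "(\<lambda>i. rg (tick s3) (rVal i)) = (\<lambda>_. 0)" using r3 by simp
        have "wp (enum par xs is) ?post (tick s3)"
        proof (rule wp_mono[OF wp_enum[OF "is"(1) parlt]])
          show "decr (ar (tick s3) aNX)" using s3 by (simp add: env_def heap_def)
          show "rg (tick s3) (rOut i) = rg (tick s3) (rVal i) - 1" for i using r3 by simp
          fix s4
          assume "ou s4 = ou (tick s3) @ map ?out (enumf par (\<lambda>i. llist (aLH i) (tick s3)) is (\<lambda>i. rg (tick s3) (rVal i))) \<and>
            tm s4 \<le> tm (tick s3) + ecosts par (\<lambda>i. llist (aLH i) (tick s3)) is (\<lambda>i. rg (tick s3) (rVal i))"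
          then have s4: "ou s4 = map ?out ?e" "tm s4 \<le> Suc (tm s3) + (6 * m + 1) * card (results xs)"
            unfolding lt v0 using o3 c2 by simp_all
          have "tm s4 \<le> tm s + (2 * m * (4 * Q + 140) + m * (30 * Q + 800) + 6) * (d * ?W) + (6 * m + 1) * card (results xs)"
            if "d \<ge> 1" "\<forall>i\<in>set is. \<forall>c. c * c \<le> 4 * pairs i \<longrightarrow> c \<le> d" for d
            using t3[OF that] s4(2) by linarith
          then show "?post s4" using s4(1) dist res by simp
        qed
        then show ?thesis using root True by simp
      qed
    qed simp
  qed simp
qed

end

section \<open>Assembly with the input phase\<close>

definition whole :: "nat \<Rightarrow> nat \<Rightarrow> (nat \<Rightarrow> nat) \<Rightarrow> (nat \<Rightarrow> nat) \<Rightarrow> (nat \<Rightarrow> nat) \<Rightarrow> (nat \<Rightarrow> nat) \<Rightarrow> (nat \<Rightarrow> nat) \<Rightarrow>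
    template list \<Rightarrow> nat list \<Rightarrow> nat list \<Rightarrow> cm" where
  "whole Q m par q t q' t' ts is xs = build Q m ts ;; solve_prog Q m par q t q' t' is xs"

lemma wf_seqs: "wf K (seqs f xs) \<longleftrightarrow> (\<forall>x\<in>set xs. wf K (f x))"
  by (induction xs) auto

lemma wf_round: "22 \<le> K \<Longrightarrow> m < K \<Longrightarrow> wf K (round Q m q)"
proof -
  assume K: "22 \<le> K" "m < K"
  have "wf K (resets Q k)" for k using K by (induction k) auto
  then show ?thesis using K by (auto simp: round_def for_verts_def search_def visit_def)
qed

lemma wf_probe: "22 \<le> K \<Longrightarrow> m < K \<Longrightarrow> m' < K \<Longrightarrow> wf K (probe Q m q m' q')"
  by (simp add: probe_def wf_round count_heavy_def for_verts_def)

lemma wf_semijoin: "22 \<le> K \<Longrightarrow> m < K \<Longrightarrow> 0 < m' \<Longrightarrow> m' < K \<Longrightarrow> wf K (semijoin Q m q m' q')"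
  by (simp add: semijoin_def wf_round for_verts_def)

lemma wf_relation: "22 \<le> K \<Longrightarrow> m < K \<Longrightarrow> m' < K \<Longrightarrow> 0 < l \<Longrightarrow> l < K \<Longrightarrow> wf K (relation Q m m' s t s' t' l)"
  by (simp add: relation_def wf_round wf_probe split_heavy_def invert_def push_all_def for_verts_def)

lemma wf_build: "22 + 2 * m \<le> K \<Longrightarrow> wf K (build Q m ts)"
proof -
  assume K: "22 + 2 * m \<le> K"
  have "k \<le> m \<Longrightarrow> wf K (set_marks k (Var x))" for k x using K by (induction k) auto
  moreover have "wf K (add_templates Q ts)"
  proof (induction ts)
    case (Cons a ts)
    obtain l b q b' q' where a: "a = (l, b, q, b', q')" by (cases a) auto
    have "earr (pick_ex b) = {}" for b by (cases b) auto
    then show ?case using Cons K by (auto simp: a add_edge_def Let_def split: option.splits)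
  qed simp
  ultimately show ?thesis using K by (simp add: build_def new_vertex_def)
qed

text \<open>The bound \<open>22 + 2 * m\<close> is one more than \<open>aLH m\<close>, the largest
  array number in use.\<close>

lemma wf_whole:
  assumes par: "\<And>i. i \<in> {1..m} \<Longrightarrow> par i < i" and "is": "set is \<subseteq> {1..m}"
  shows "wf (22 + 2 * m) (whole Q m par q t q' t' ts is xs)"
proof -
  have p: "par i \<le> m" if "i \<in> {1..m}" for i using par[OF that] that by simp
  have "wf (22 + 2 * m) (enum par xs is)"
    using "is" by (induction "is") auto
  moreover have "wf (22 + 2 * m) (up_step Q par q' t' i)" "wf (22 + 2 * m) (down_step Q par q t i)"
    "wf (22 + 2 * m) (rel_step Q par q t q' t' i)" if "i \<in> {1..m}" for i
    using p[OF that] that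
    by (auto simp: up_step_def down_step_def rel_step_def intro!: wf_semijoin wf_relation)
  ultimately show ?thesis using "is"
    by (auto simp: whole_def solve_prog_def wf_seqs wf_build)
qed

definition product_edges :: "nat \<Rightarrow> template list \<Rightarrow> (nat \<times> nat \<times> nat) list \<Rightarrow> (nat \<times> nat) set" where
  "product_edges Q ts es = (\<Union>e\<in>set es. links_of Q ts e)"

definition linked :: "nat \<Rightarrow> template list \<Rightarrow> (nat \<Rightarrow> nat) \<Rightarrow> (nat \<Rightarrow> nat) \<Rightarrow> (nat \<times> nat \<times> nat) list \<Rightarrow> nat \<Rightarrow> nat \<Rightarrow> nat \<Rightarrow> bool"
  where "linked Q ts q t es i v w \<longleftrightarrow> v \<in> insert 0 (endpoints (set es)) \<and> w \<in> endpoints (set es) \<and>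
     (Q * v + q i, Q * w + t i) \<in> (product_edges Q ts es)\<^sup>*"

lemma sum_length_filter:
  "finite Z \<Longrightarrow> (\<Sum>z\<in>Z. length (filter (\<lambda>e. fst e = z) xs)) \<le> length xs"
proof (induction xs)
  case (Cons x xs)
  have "(\<Sum>z\<in>Z. length (filter (\<lambda>e. fst e = z) (x # xs))) =
      (\<Sum>z\<in>Z. (if fst x = z then 1 else 0) + length (filter (\<lambda>e. fst e = z) xs))"
    by (rule sum.cong) auto
  also have "\<dots> = (\<Sum>z\<in>Z. if fst x = z then 1 else 0) + (\<Sum>z\<in>Z. length (filter (\<lambda>e. fst e = z) xs))"
    by (rule sum.distrib)
  also have "(\<Sum>z\<in>Z. if fst x = z then 1 else 0 :: nat) \<le> 1" using Cons.prems by (simp add: sum.delta')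
  finally show ?case using Cons by simp
qed simp

lemma card_endpoints: "card (insert 0 (endpoints (set es))) \<le> 2 * length es + 1"
proof -
  have "finite (endpoints (set es)) \<and> card (endpoints (set es)) \<le> 2 * length es"
  proof (induction es)
    case (Cons e es)
    obtain u a v where e: "e = (u, a, v)" by (cases e) auto
    have "endpoints (set (e # es)) = insert (Suc u) (insert (Suc v) (endpoints (set es)))"
      by (auto simp: endpoints_def e)
    moreover have "card (insert (Suc u) (insert (Suc v) (endpoints (set es)))) \<le> 2 + card (endpoints (set es))"
      using card_insert_le_m1[of 2] by (simp add: card_insert_if Cons)
    ultimately show ?case using Cons by auto
  qed (simp add: endpoints_def)
  then show ?thesis by (simp add: card_insert_if)
qed

lemma wp_whole:
  assumes Q: "0 < Q" and ts: "\<And>l a x b y. (l, a, x, b, y) \<in> set ts \<Longrightarrow> x < Q \<and> y < Q"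
    and states: "\<And>i. i \<in> {1..m} \<Longrightarrow> q i < Q \<and> t i < Q \<and> q' i < Q \<and> t' i < Q"
    and par: "\<And>i. i \<in> {1..m} \<Longrightarrow> par i < i"
    and "is": "sorted_wrt (<) is" "set is \<subseteq> {1..m}" "\<And>i. i \<in> set is \<Longrightarrow> par i \<in> insert 0 (set is)"
    and xs: "set xs = set is"
    and conv: "\<And>i v w. i \<in> {1..m} \<Longrightarrow> v \<in> insert 0 (endpoints (set es)) \<Longrightarrow> w \<in> insert 0 (endpoints (set es)) \<Longrightarrow>
      (Q * v + q i, Q * w + t i) \<in> (product_edges Q ts es)\<^sup>* \<longleftrightarrow> (Q * w + q' i, Q * v + t' i) \<in> (product_edges Q ts es)\<^sup>*"
  defines "S \<equiv> {a. tree.sat m par (linked Q ts q t es) a}"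
  shows "wp (whole Q m par q t q' t' ts is xs) (\<lambda>s. distinct (ou s) \<and> set (ou s) = (\<lambda>a. map (\<lambda>i. a i - 1) xs) ` S \<and>
    (\<forall>d\<ge>1. (\<forall>i\<in>set is. \<forall>c. c * c \<le> 4 * card ((\<lambda>a. (a (par i), a i)) ` S) \<longrightarrow> c \<le> d) \<longrightarrow>
       tm s \<le> ((2 * m + 5 * length ts + 20) + (2 * m * (4 * Q + 140) + m * (30 * Q + 800) + 6) * (length ts + 4 * Q + 1)) *
         (d * (length es + 1)) + (6 * m + 1) * card ((\<lambda>a. map (\<lambda>i. a i - 1) xs) ` S))) (start (encode_edges es))"
  unfolding whole_def wp_simps(5)
proof (rule wp_same[OF wp_build])
  let ?X = "endpoints (set es)" and ?E = "product_edges Q ts es"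
  let ?conn = "linked Q ts q t es"
  let ?s0 = "start (encode_edges es)"
  fix s
  assume s: "verts_rep m s ?X \<and> (\<exists>xs. edges_rep s xs \<and> set xs = (\<Union>e\<in>set es. links_of Q ts e) \<and> length xs \<le> length ts * length es) \<and>
     tm s \<le> (2 * m + 5 * length ts + 20) * (length es + 1)" and sm: "same (build Q m ts) ?s0 s"
  then obtain ys where ys: "edges_rep s ys" "set ys = ?E" "length ys \<le> length ts * length es"
    by (auto simp: product_edges_def)
  have v: "distinct (vlist s)" "set (vlist s) = insert 0 ?X" "0 \<notin> ?X" using s by (auto simp: verts_rep_def)
  interpret graph Q "vlist s" "ar s aHE" "ar s aNE" "ar s aDS"
    by unfold_locales (use Q v ys in \<open>auto simp: edges_rep_def\<close>)
  have succs: "adj z = succs s z" for z by (simp add: adj_def succs_def)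
  have mset: "mset (adj z) = mset (map snd (filter (\<lambda>e. fst e = z) ys))" for z
    using ys(1) by (simp add: succs edges_rep_def)
  have set_adj: "y \<in> set (adj z) \<longleftrightarrow> (z, y) \<in> ?E" for y z
  proof -
    have "y \<in> set (adj z) \<longleftrightarrow> y \<in># mset (adj z)" by simp
    also have "\<dots> \<longleftrightarrow> (z, y) \<in> set ys" unfolding mset by force
    finally show ?thesis using ys(2) by simp
  qed
  have EZ: "z \<in> Z \<and> y \<in> Z" if zy: "(z, y) \<in> ?E" for z y
  proof -
    from zy obtain u c x l a p b r where e: "(u, c, x) \<in> set es" "(l, a, p, b, r) \<in> set ts"
      "(z, y) = link Q (l, a, p, b, r) (u, c, x)"
      unfolding product_edges_def links_of_def by (auto simp del: link.simps)
    have "Suc u \<in> ?X" "Suc x \<in> ?X" using e(1) by (force simp: endpoints_def)+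
    then have "pick a' (Suc u) (Suc x) \<in> set (vlist s)" for a' unfolding v(2) by (cases a') auto
    then show ?thesis using e(3) ts[OF e(2)] nd_in_Z by (auto simp: nd_def)
  qed
  interpret closed_graph Q "vlist s" "ar s aHE" "ar s aNE" "ar s aDS"
    by unfold_locales (use EZ set_adj in blast)
  have E: "E = ?E" using EZ by (auto simp: E_def set_adj)
  interpret tree m par ?X ?conn
    by unfold_locales (use par in \<open>auto simp: linked_def\<close>)
  interpret solver Q "vlist s" "ar s aHE" "ar s aNE" "ar s aDS" m par ?X ?conn q t q' t'
    by unfold_locales (use v states conv in \<open>auto simp: linked_def E nd_def\<close>)
  have fr: "ar s a = ar ?s0 a" if "a \<notin> {aSN, aVT, aDS, aNE, aHE} \<union> aMK ` {0..m}" for a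
    using same_arr[OF sm, of a] build_frame(2)[of Q m ts] that by blast
  have fr2: "rg s x = 0" if "x \<notin> {rN, rJ, rPT, rU, rA, rX, rEP}" for x
    using same_reg[OF sm, of x] build_frame(1)[of Q m ts] that by auto
  have z: "ar s a i = 0" if "a \<in> {aST, aHD, aNX}" for a i using that by (auto simp: fr aMK_large)
  have env: "env s" using v z by (auto simp: env_def heap_def fr2 decr_def)
  have mk: "marked s (aMK i) = dom i" if "i \<le> m" for i
    using s that v(2,3) by (cases "i = 0") (auto simp: verts_rep_def marked_def dom_def)
  have lh: "ar s (aLH i) v = 0" for i v
  proof -
    have "aLH i \<notin> aMK ` {0..m}" by (auto; presburger)
    then show ?thesis by (simp add: fr)
  qed
  have rg: "rg s x = 0" if "x \<ge> 20" for x using fr2 that by simp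
  have ou: "ou s = []" using same_out[OF sm] build_frame(3) by simp
  \<comment> \<open>Linearity in the number of edges: a template fires at most once per edge, and
    there are at most \<open>2 * length es + 1\<close> vertices with \<open>Q\<close> nodes
    each.\<close>
  have W: "weight + 1 \<le> (length ts + 4 * Q + 1) * (length es + 1)"
  proof -
    have "card Z \<le> Q * length (vlist s)"
    proof -
      have "Z = (\<lambda>(v, q). nd v q) ` (set (vlist s) \<times> {..<Q})" by (auto simp: Z_def)
      then have "card Z \<le> card (set (vlist s) \<times> {..<Q})" by (metis card_image_le finite_SigmaI finite_lessThan finite_set)
      then show ?thesis using v(1) by (simp add: card_cartesian_product distinct_card mult.commute)
    qed
    also have "length (vlist s) \<le> 2 * length es + 1" using card_endpoints[of es] distinct_card[OF v(1)] v(2) by simp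
    finally have cZ: "card Z \<le> Q * (2 * length es + 1)" by simp
    have la: "length (adj z) = length (filter (\<lambda>e. fst e = z) ys)" for z
      using mset_eq_length[OF mset[of z]] by simp
    have "weight = (\<Sum>z\<in>Z. length (filter (\<lambda>e. fst e = z) ys)) + 2 * card Z"
      unfolding weight_def la sum.distrib by simp
    also have "\<dots> \<le> length ts * length es + 2 * (Q * (2 * length es + 1))"
      using sum_length_filter[OF finite_Z, of ys] ys(3) cZ by linarith
    finally show ?thesis by (simp add: algebra_simps)
  qed
  have SS: "S = {a. sat a}" by (simp add: S_def)
  have res: "results xs = (\<lambda>a. map (\<lambda>i. a i - 1) xs) ` S" by (simp add: results_def SS)
  have prs: "pairs i = card ((\<lambda>a. (a (par i), a i)) ` S)" for i by (simp add: pairs_def SS)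
  let ?c = "2 * m * (4 * Q + 140) + m * (30 * Q + 800) + 6"
  let ?A = "(2 * m + 5 * length ts + 20) + ?c * (length ts + 4 * Q + 1)"
  show "wp (solve_prog Q m par q t q' t' is xs) (\<lambda>s. distinct (ou s) \<and> set (ou s) = (\<lambda>a. map (\<lambda>i. a i - 1) xs) ` S \<and>
    (\<forall>d\<ge>1. (\<forall>i\<in>set is. \<forall>c. c * c \<le> 4 * card ((\<lambda>a. (a (par i), a i)) ` S) \<longrightarrow> c \<le> d) \<longrightarrow>
       tm s \<le> ?A * (d * (length es + 1)) + (6 * m + 1) * card ((\<lambda>a. map (\<lambda>i. a i - 1) xs) ` S))) s"
  proof (rule wp_mono[OF wp_solve[OF env mk "is" lh rg ou xs]])
    fix s'
    assume s': "distinct (ou s') \<and> set (ou s') = results xs \<and>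
      (\<forall>d\<ge>1. (\<forall>i\<in>set is. \<forall>c. c * c \<le> 4 * pairs i \<longrightarrow> c \<le> d) \<longrightarrow>
         tm s' \<le> tm s + ?c * (d * (weight + 1)) + (6 * m + 1) * card (results xs))"
    have "tm s' \<le> ?A * (d * (length es + 1)) + (6 * m + 1) * card (results xs)"
      if d: "d \<ge> 1" "\<forall>i\<in>set is. \<forall>c. c * c \<le> 4 * pairs i \<longrightarrow> c \<le> d" for d
    proof -
      have "tm s' \<le> tm s + ?c * (d * (weight + 1)) + (6 * m + 1) * card (results xs)" using s' d by blast
      moreover have "d * (weight + 1) \<le> d * ((length ts + 4 * Q + 1) * (length es + 1))" using W by (rule mult_le_mono2)
      then have "?c * (d * (weight + 1)) \<le> ?c * (d * ((length ts + 4 * Q + 1) * (length es + 1)))" by (rule mult_le_mono2)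
      moreover have "length es + 1 \<le> d * (length es + 1)"
        using mult_le_mono1[OF d(1), of "length es + 1"] by (simp only: nat_mult_1)
      then have "(2 * m + 5 * length ts + 20) * (length es + 1) \<le> (2 * m + 5 * length ts + 20) * (d * (length es + 1))"
        by (rule mult_le_mono2)
      moreover have "?A * (d * (length es + 1)) = (2 * m + 5 * length ts + 20) * (d * (length es + 1)) +
          ?c * (d * ((length ts + 4 * Q + 1) * (length es + 1)))"
      proof -
        have "(a + c * b) * (d * n) = a * (d * n) + c * (d * (b * n))" for a b c n :: nat
          by (simp add: algebra_simps)
        then show ?thesis by blast
      qed
      ultimately show ?thesis using s by linarith
    qed
    then show "distinct (ou s') \<and> set (ou s') = (\<lambda>a. map (\<lambda>i. a i - 1) xs) ` S \<and>
      (\<forall>d\<ge>1. (\<forall>i\<in>set is. \<forall>c. c * c \<le> 4 * card ((\<lambda>a. (a (par i), a i)) ` S) \<longrightarrow> c \<le> d) \<longrightarrow>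
        tm s' \<le> ?A * (d * (length es + 1)) + (6 * m + 1) * card ((\<lambda>a. map (\<lambda>i. a i - 1) xs) ` S))"
      using s' unfolding res prs by blast
  qed
qed

section \<open>Ordering the vertices of a forest\<close>

abbreviation edge_in :: "'x ugraph \<Rightarrow> 'x set \<Rightarrow> ('x \<times> 'x) set" where
  "edge_in H S \<equiv> {(a, b). a \<in> S \<and> b \<in> S \<and> {a, b} \<in> links H}"

lemma sym_edge_in: "sym (edge_in H S)"
  by (auto simp: sym_def insert_commute)

lemma edge_in_mono: "S \<subseteq> S' \<Longrightarrow> (edge_in H S)\<^sup>* \<subseteq> (edge_in H S')\<^sup>*"
  by (rule rtrancl_mono) auto

lemma edge_in_sym: "(a, b) \<in> (edge_in H S)\<^sup>* \<Longrightarrow> (b, a) \<in> (edge_in H S)\<^sup>*"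
  by (rule symD[OF sym_rtrancl[OF sym_edge_in]])

text \<open>For \<open>S = free Q\<close> this is the second half of free-connexity.\<close>

definition convex_in :: "'x ugraph \<Rightarrow> 'x set \<Rightarrow> bool" where
  "convex_in H S \<longleftrightarrow> (\<forall>a\<in>S. \<forall>b\<in>S. (a, b) \<in> (edge_in H (nodes H))\<^sup>* \<longrightarrow> (a, b) \<in> (edge_in H S)\<^sup>*)"

lemma simple_path:
  assumes "(a, b) \<in> (edge_in H S)\<^sup>*" "a \<in> S"
  shows "\<exists>p. p \<noteq> [] \<and> hd p = a \<and> last p = b \<and> distinct p \<and> set p \<subseteq> S \<and>
    (\<forall>i. Suc i < length p \<longrightarrow> {p ! i, p ! Suc i} \<in> links H)"
  using assms(1)
proof (induction rule: rtrancl_induct)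
  case base
  then show ?case using assms(2) by (intro exI[of _ "[a]"]) auto
next
  case (step b c)
  then obtain p where p: "p \<noteq> []" "hd p = a" "last p = b" "distinct p" "set p \<subseteq> S"
    "\<forall>i. Suc i < length p \<longrightarrow> {p ! i, p ! Suc i} \<in> links H" by blast
  show ?case
  proof (cases "c \<in> set p")
    case True
    then obtain k where k: "k < length p" "p ! k = c" by (auto simp: in_set_conv_nth)
    let ?q = "take (Suc k) p"
    have "last ?q = c" using k p(1) by (simp add: take_Suc_conv_app_nth)
    then show ?thesis using p k by (intro exI[of _ ?q]) (auto dest: in_set_takeD)
  next
    case False
    have "{(p @ [c]) ! i, (p @ [c]) ! Suc i} \<in> links H" if "Suc i < length (p @ [c])" for i
    proof (cases "Suc i < length p")
      case True
      then show ?thesis using p by (simp add: nth_append)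
    next
      case False
      then have "i = length p - 1" "i < length p" using that p(1) by auto
      then show ?thesis using step(2) p(1,3) by (simp add: nth_append last_conv_nth)
    qed
    then show ?thesis using p False step(2) by (intro exI[of _ "p @ [c]"]) auto
  qed
qed

text \<open>Two neighbors of \<open>y\<close> inside \<open>D\<close> would be joined by a simple
  path within \<open>D\<close>, and \<open>y\<close> would close it to a cycle.\<close>

lemma one_neighbor:
  assumes ac: "\<nexists>vs. is_cycle H vs" and D: "convex_in H D" "D \<subseteq> nodes H" and y: "y \<in> nodes H" "y \<notin> D"
    and a: "a \<in> D" "{a, y} \<in> links H" and b: "b \<in> D" "{b, y} \<in> links H"
  shows "a = b"
proof (rule ccontr)
  assume ne: "a \<noteq> b"
  have "(a, y) \<in> edge_in H (nodes H)" "(y, b) \<in> edge_in H (nodes H)"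
    using a b y D(2) by (auto simp: insert_commute)
  then have "(a, b) \<in> (edge_in H (nodes H))\<^sup>*" by (meson converse_rtrancl_into_rtrancl r_into_rtrancl)
  then have "(a, b) \<in> (edge_in H D)\<^sup>*" using D(1) a b by (simp add: convex_in_def)
  from simple_path[OF this a(1)] obtain p where p: "p \<noteq> []" "hd p = a" "last p = b" "distinct p" "set p \<subseteq> D"
    "\<forall>i. Suc i < length p \<longrightarrow> {p ! i, p ! Suc i} \<in> links H" by blast
  have len: "length p \<ge> 2"
  proof (rule ccontr)
    assume "\<not> length p \<ge> 2"
    then obtain x where "p = [x]" using p(1) by (cases p; cases "tl p") auto
    then show False using p(2,3) ne by simp
  qed
  let ?c = "p @ [y]"
  have "{?c ! i, ?c ! (Suc i mod length ?c)} \<in> links H" if i: "i < length ?c" for i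
  proof -
    consider "Suc i < length p" | "Suc i = length p" | "i = length p" using i by (simp add: less_Suc_eq) linarith
    then show ?thesis
    proof cases
      case 1
      then show ?thesis using p(6) by (simp add: nth_append)
    next
      case 2
      then have "i = length p - 1" by simp
      then have "p ! i = b" using p(1,3) by (simp add: last_conv_nth)
      then show ?thesis using 2 b by (simp add: nth_append)
    next
      case 3
      have "p ! 0 = a" using p(1,2) by (simp add: hd_conv_nth)
      then show ?thesis using 3 a p(1) by (simp add: nth_append insert_commute)
    qed
  qed
  then have "is_cycle H ?c" using len p D(2) y by (auto simp: is_cycle_def)
  then show False using ac by blast
qed

lemma crossing:
  assumes "(a, b) \<in> (edge_in H U)\<^sup>*" "a \<in> D" "b \<notin> D"
  shows "\<exists>x\<in>D. \<exists>z\<in>U - D. {x, z} \<in> links H"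
  using assms by (induction rule: rtrancl_induct) blast+

text \<open>If some vertex of \<open>U - D\<close> has a neighbor in \<open>D\<close>, adding it
  prolongs a tree. Otherwise no vertex of \<open>U - D\<close> is connected to \<open>D\<close> even
  in the whole graph, since convexity of \<open>U\<close> would move the path into \<open>U\<close>,
  where it has to cross the border of \<open>D\<close>; any such vertex then starts a new
  tree.\<close>

lemma next_vertex:
  assumes D: "convex_in H D" "D \<subset> U" and U: "convex_in H U" "U \<subseteq> nodes H"
  shows "\<exists>y\<in>U - D. convex_in H (insert y D) \<and> ((\<exists>a\<in>D. {a, y} \<in> links H) \<or> (\<forall>b\<in>D. (b, y) \<notin> (edge_in H (nodes H))\<^sup>*))"
proof (cases "\<exists>y\<in>U - D. \<exists>a\<in>D. {a, y} \<in> links H")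
  case True
  then obtain y a where y: "y \<in> U - D" "a \<in> D" "{a, y} \<in> links H" by blast
  have e: "(y, a) \<in> edge_in H (nodes H)" "(a, y) \<in> edge_in H (insert y D)"
    using y U(2) D(2) by (auto simp: insert_commute)
  have conn_y: "(b, y) \<in> (edge_in H (insert y D))\<^sup>*" if b: "b \<in> D" "(b, y) \<in> (edge_in H (nodes H))\<^sup>*" for b
  proof -
    have "(b, a) \<in> (edge_in H (nodes H))\<^sup>*" using b(2) e(1) by (rule rtrancl_into_rtrancl)
    then have "(b, a) \<in> (edge_in H D)\<^sup>*" using D(1) b(1) y(2) by (simp add: convex_in_def)
    then have "(b, a) \<in> (edge_in H (insert y D))\<^sup>*" using edge_in_mono[of D "insert y D"] by blast
    then show ?thesis using e(2) by (rule rtrancl_into_rtrancl)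
  qed
  have "convex_in H (insert y D)"
    unfolding convex_in_def
  proof (intro ballI impI)
    fix b c assume b: "b \<in> insert y D" "c \<in> insert y D" "(b, c) \<in> (edge_in H (nodes H))\<^sup>*"
    consider "b = c" | "b \<in> D" "c \<in> D" | "b \<in> D" "c = y" | "b = y" "c \<in> D" using b by blast
    then show "(b, c) \<in> (edge_in H (insert y D))\<^sup>*"
    proof cases
      case 2
      then have "(b, c) \<in> (edge_in H D)\<^sup>*" using D(1) b(3) by (simp add: convex_in_def)
      then show ?thesis using edge_in_mono[of D "insert y D"] by blast
    next
      case 4
      then have "(c, y) \<in> (edge_in H (nodes H))\<^sup>*" using edge_in_sym[OF b(3)] by simp
      then show ?thesis using edge_in_sym[OF conn_y[OF 4(2)]] 4(1) by simp
    qed (use conn_y b in auto)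
  qed
  then show ?thesis using y by blast
next
  case False
  obtain y where y: "y \<in> U - D" using D(2) by blast
  have no: "(b, y) \<notin> (edge_in H (nodes H))\<^sup>*" if "b \<in> D" for b
  proof
    assume "(b, y) \<in> (edge_in H (nodes H))\<^sup>*"
    then have "(b, y) \<in> (edge_in H U)\<^sup>*" using U(1) y that D(2) by (auto simp: convex_in_def)
    from crossing[OF this that] show False using y False by blast
  qed
  have "convex_in H (insert y D)"
    unfolding convex_in_def
  proof (intro ballI impI)
    fix b c assume b: "b \<in> insert y D" "c \<in> insert y D" "(b, c) \<in> (edge_in H (nodes H))\<^sup>*"
    consider "b = c" | "b \<in> D" "c \<in> D" | "b \<in> D" "c = y" | "b = y" "c \<in> D" using b by blast
    then show "(b, c) \<in> (edge_in H (insert y D))\<^sup>*"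
    proof cases
      case 2
      then have "(b, c) \<in> (edge_in H D)\<^sup>*" using D(1) b(3) by (simp add: convex_in_def)
      then show ?thesis using edge_in_mono[of D "insert y D"] by blast
    next
      case 3
      then show ?thesis using no[of b] b(3) by simp
    next
      case 4
      then show ?thesis using no[of c] edge_in_sym[OF b(3)] by simp
    qed simp
  qed
  then show ?thesis using y no by blast
qed

section \<open>Orders with at most one earlier neighbor\<close>

inductive tree_order :: "'x ugraph \<Rightarrow> 'x list \<Rightarrow> bool" for H where
  Nil: "tree_order H []"
| snoc: "tree_order H vs \<Longrightarrow> y \<in> nodes H \<Longrightarrow> y \<notin> set vs \<Longrightarrow>
    (\<And>a b. a \<in> set vs \<Longrightarrow> b \<in> set vs \<Longrightarrow> {a, y} \<in> links H \<Longrightarrow> {b, y} \<in> links H \<Longrightarrow> a = b) \<Longrightarrow> tree_order H (vs @ [y])"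

lemma extend_tree_order:
  assumes ac: "\<nexists>vs. is_cycle H vs" and fin: "finite U" and U: "convex_in H U" "U \<subseteq> nodes H"
    and "tree_order H vs" "set vs \<subseteq> U" "convex_in H (set vs)"
  shows "\<exists>ws. tree_order H (vs @ ws) \<and> set (vs @ ws) = U"
  using assms(5-7)
proof (induction "card (U - set vs)" arbitrary: vs rule: less_induct)
  case less
  show ?case
  proof (cases "set vs = U")
    case True
    then show ?thesis using less by (intro exI[of _ "[]"]) auto
  next
    case False
    then have "set vs \<subset> U" using less by blast
    from next_vertex[OF less.prems(3) this U] obtain y where y: "y \<in> U - set vs" "convex_in H (insert y (set vs))" by blast
    have "tree_order H (vs @ [y])"
    proof (rule tree_order.snoc[OF less.prems(1)])
      have sub: "set vs \<subseteq> nodes H" "y \<in> nodes H" "y \<notin> set vs" using less.prems(2) y(1) U(2) by auto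
      then show "y \<in> nodes H" "y \<notin> set vs" by auto
      show "a = b" if "a \<in> set vs" "b \<in> set vs" "{a, y} \<in> links H" "{b, y} \<in> links H" for a b
        using one_neighbor[OF ac less.prems(3) sub that(1,3) that(2,4)] .
    qed
    moreover have "card (U - set (vs @ [y])) < card (U - set vs)"
      using y fin by (intro psubset_card_mono) auto
    moreover have "set (vs @ [y]) \<subseteq> U" "convex_in H (set (vs @ [y]))" using y less.prems by auto
    ultimately obtain ws where "tree_order H ((vs @ [y]) @ ws)" "set ((vs @ [y]) @ ws) = U"
      using less.hyps[of "vs @ [y]"] by blast
    then show ?thesis by (intro exI[of _ "y # ws"]) auto
  qed
qed

lemma tree_order_distinct: "tree_order H vs \<Longrightarrow> distinct vs \<and> set vs \<subseteq> nodes H"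
  by (induction rule: tree_order.induct) auto

lemma tree_order_unique:
  "tree_order H vs \<Longrightarrow> i < length vs \<Longrightarrow> j < i \<Longrightarrow> k < i \<Longrightarrow> {vs ! j, vs ! i} \<in> links H \<Longrightarrow>
    {vs ! k, vs ! i} \<in> links H \<Longrightarrow> j = k"
proof (induction arbitrary: i j k rule: tree_order.induct)
  case (snoc vs y)
  show ?case
  proof (cases "i = length vs")
    case True
    then have jk: "j < length vs" "k < length vs" using snoc by auto
    then have "vs ! j = vs ! k" using snoc.prems True snoc.hyps(4)[of "vs ! j" "vs ! k"] by (simp add: nth_append)
    then show ?thesis using jk tree_order_distinct[OF snoc.hyps(1)] by (simp add: nth_eq_iff_index_eq)
  next
    case False
    then show ?thesis using snoc.prems snoc.IH[of i j k] by (simp add: nth_append)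
  qed
qed simp

text \<open>Indices start at 1; the parent of an index without earlier neighbor is 0.\<close>

lemma forest_parents:
  assumes fin: "finite (nodes H)" and links: "\<And>e. e \<in> links H \<Longrightarrow> e \<subseteq> nodes H \<and> card e = 2"
    and ac: "\<nexists>vs. is_cycle H vs" and F: "F \<subseteq> nodes H" "convex_in H F"
  obtains m :: nat and vx :: "nat \<Rightarrow> 'x" and par :: "nat \<Rightarrow> nat"
  where "bij_betw vx {1..m} (nodes H)" "\<And>i. i \<in> {1..m} \<Longrightarrow> par i < i"
    "links H = {{vx i, vx (par i)} | i. i \<in> {1..m} \<and> par i \<noteq> 0}"
    "\<And>i. i \<in> {1..m} \<Longrightarrow> vx i \<in> F \<Longrightarrow> par i \<noteq> 0 \<Longrightarrow> vx (par i) \<in> F"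
proof -
  \<comment> \<open>Ordering the free vertices by themselves and continuing with the rest makes them
    a prefix. The earlier neighbor of a free vertex then lies in this prefix, so it is free
    too.\<close>
  have "tree_order H []" "convex_in H {}" by (auto intro: tree_order.Nil simp: convex_in_def)
  then obtain us where us: "tree_order H us" "set us = F"
    using extend_tree_order[OF ac finite_subset[OF F(1) fin] F(2,1), of "[]"]
    unfolding append_Nil list.set by blast
  have "convex_in H (nodes H)" by (simp add: convex_in_def)
  then obtain ws where ws: "tree_order H (us @ ws)" "set (us @ ws) = nodes H"
    using extend_tree_order[OF ac fin _ order_refl us(1)] F unfolding us(2) by blast
  define vs where "vs = us @ ws"
  define m where "m = length vs"
  define vx where "vx i = vs ! (i - 1)" for i
  define par where "par i = (if \<exists>j. 1 \<le> j \<and> j < i \<and> {vx j, vx i} \<in> links H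
      then SOME j. 1 \<le> j \<and> j < i \<and> {vx j, vx i} \<in> links H else 0)" for i
  have par: "1 \<le> par i \<and> par i < i \<and> {vx (par i), vx i} \<in> links H" if "1 \<le> j" "j < i" "{vx j, vx i} \<in> links H" for i j
  proof -
    have ex: "\<exists>j. 1 \<le> j \<and> j < i \<and> {vx j, vx i} \<in> links H" using that by blast
    then show ?thesis unfolding par_def using someI_ex[OF ex] by simp
  qed
  have par0: "1 \<le> par i \<and> par i < i \<and> {vx (par i), vx i} \<in> links H" if "par i \<noteq> 0" for i
  proof -
    have "\<exists>j. 1 \<le> j \<and> j < i \<and> {vx j, vx i} \<in> links H"
    proof (rule ccontr)
      assume "\<not> ?thesis"
      then have "par i = 0" unfolding par_def by (rule if_not_P)
      then show False using that by contradiction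
    qed
    then show ?thesis using par by blast
  qed
  have uniq: "j = k" if "i \<in> {1..m}" "1 \<le> j" "j < i" "1 \<le> k" "k < i" "{vx j, vx i} \<in> links H" "{vx k, vx i} \<in> links H" for i j k
  proof -
    have "j - 1 = k - 1"
      using tree_order_unique[OF ws(1)[folded vs_def], of "i - 1" "j - 1" "k - 1"] that by (auto simp: vx_def m_def)
    then show ?thesis using that by simp
  qed
  have d: "distinct vs" "set vs = nodes H" using tree_order_distinct[OF ws(1)] ws(2) by (auto simp: vs_def)
  have bij: "bij_betw vx {1..m} (nodes H)"
    unfolding bij_betw_def
  proof
    show "inj_on vx {1..m}"
    proof (rule inj_onI)
      fix i j assume "i \<in> {1..m}" "j \<in> {1..m}" "vx i = vx j"
      then have "i - 1 = j - 1" using d(1) by (auto simp: vx_def m_def nth_eq_iff_index_eq)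
      then show "i = j" using \<open>i \<in> _\<close> \<open>j \<in> _\<close> by auto
    qed
    have "vx ` {1..m} = (\<lambda>i. vs ! i) ` {..<length vs}"
    proof (intro equalityI subsetI)
      fix x assume "x \<in> (\<lambda>i. vs ! i) ` {..<length vs}"
      then obtain i where "i < length vs" "x = vs ! i" by blast
      then show "x \<in> vx ` {1..m}" by (intro image_eqI[of _ _ "Suc i"]) (auto simp: vx_def m_def)
    next
      fix x assume "x \<in> vx ` {1..m}"
      then obtain i where "i \<in> {1..m}" "x = vs ! (i - 1)" by (auto simp: vx_def)
      then show "x \<in> (\<lambda>i. vs ! i) ` {..<length vs}" by (intro image_eqI[of _ _ "i - 1"]) (auto simp: m_def)
    qed
    then show "vx ` {1..m} = nodes H" using d(2) by (auto simp: set_conv_nth)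
  qed
  show thesis
  proof (rule that[OF bij])
    show "par i < i" if "i \<in> {1..m}" for i using par0[of i] that by (cases "par i = 0") auto
    show "links H = {{vx i, vx (par i)} | i. i \<in> {1..m} \<and> par i \<noteq> 0}"
    proof (intro equalityI subsetI)
      fix e assume e: "e \<in> links H"
      then obtain a b where ab: "e = {a, b}" "a \<noteq> b" using links[OF e] by (auto simp: card_2_iff)
      then have "a \<in> vx ` {1..m}" "b \<in> vx ` {1..m}" using bij links[OF e] by (auto simp: bij_betw_def)
      then obtain i j where ij: "i \<in> {1..m}" "j \<in> {1..m}" "a = vx i" "b = vx j" by blast
      then have "i \<noteq> j" using ab by auto
      then obtain k l where kl: "k \<in> {1..m}" "l \<in> {1..m}" "k < l" "e = {vx k, vx l}"
      proof (cases "i < j")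
        case True
        then show ?thesis using ij ab by (intro that[of i j]) auto
      next
        case False
        then show ?thesis using ij ab \<open>i \<noteq> j\<close> by (intro that[of j i]) auto
      qed
      then have p: "1 \<le> par l \<and> par l < l \<and> {vx (par l), vx l} \<in> links H" using par[of k l] e by auto
      then have "par l = k" using uniq[of l "par l" k] kl e by auto
      then show "e \<in> {{vx i, vx (par i)} | i. i \<in> {1..m} \<and> par i \<noteq> 0}"
        using kl p by (auto simp: insert_commute)
    next
      fix e assume "e \<in> {{vx i, vx (par i)} | i. i \<in> {1..m} \<and> par i \<noteq> 0}"
      then show "e \<in> links H" using par0 by (auto simp: insert_commute)
    qed
    show "vx (par i) \<in> F" if "i \<in> {1..m}" "vx i \<in> F" "par i \<noteq> 0" for i
    proof -
      have "i - 1 < length us"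
      proof (rule ccontr)
        assume "\<not> i - 1 < length us"
        then have "vx i \<in> set ws" using that(1) by (auto simp: vx_def vs_def nth_append m_def)
        then show False using that(2) us(2) d(1) by (auto simp: vs_def)
      qed
      moreover have "par i < i" using par0[OF that(3)] by blast
      ultimately have "par i - 1 < length us" by linarith
      then show ?thesis using us(2) by (auto simp: vx_def vs_def nth_append)
    qed
  qed
qed

section \<open>Contraction width\<close>

text \<open>The last clause, that every set of vertices spans a forest, is phrased by counting since this
  form is preserved by eliminations for trivial reasons.\<close>

definition sparse :: "'x ugraph \<Rightarrow> bool" where
  "sparse H \<longleftrightarrow> finite (nodes H) \<and> (\<forall>e\<in>links H. e \<subseteq> nodes H \<and> card e = 2) \<and>
     (\<forall>u\<in>nodes H. neighbors H u \<noteq> {}) \<and>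
     (\<forall>S. S \<subseteq> nodes H \<longrightarrow> S \<noteq> {} \<longrightarrow> card {e \<in> links H. e \<subseteq> S} < card S)"

lemma sparse_edge: "sparse H \<Longrightarrow> e \<in> links H \<Longrightarrow> e \<subseteq> nodes H \<and> card e = 2"
  and sparse_finite: "sparse H \<Longrightarrow> finite (nodes H)"
  and sparse_neighbor: "sparse H \<Longrightarrow> u \<in> nodes H \<Longrightarrow> neighbors H u \<noteq> {}"
  and sparse_card: "sparse H \<Longrightarrow> S \<subseteq> nodes H \<Longrightarrow> S \<noteq> {} \<Longrightarrow> card {e \<in> links H. e \<subseteq> S} < card S"
  by (simp_all add: sparse_def)

lemma sparse_link: "sparse H \<Longrightarrow> {u, v} \<in> links H \<Longrightarrow> u \<noteq> v \<and> u \<in> nodes H \<and> v \<in> nodes H"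
proof -
  assume "sparse H" "{u, v} \<in> links H"
  then have "{u, v} \<subseteq> nodes H" "card {u, v} = 2" using sparse_edge by metis+
  then show ?thesis by (auto simp: card_insert_if split: if_splits)
qed

lemma finite_links: "sparse H \<Longrightarrow> finite (links H)"
  by (rule finite_subset[of _ "Pow (nodes H)"]) (use sparse_edge sparse_finite in auto)

lemma neighbors_iff: "sparse H \<Longrightarrow> v \<in> neighbors H u \<longleftrightarrow> {u, v} \<in> links H"
  using sparse_link[of H u v] by (auto simp: neighbors_def)

lemma sparse_mono:
  assumes "sparse H" and N: "nodes H' \<subseteq> nodes H"
    and L: "\<And>e. e \<in> links H' \<Longrightarrow> e \<in> links H \<and> e \<subseteq> nodes H'"
    and nb: "\<And>u. u \<in> nodes H' \<Longrightarrow> \<exists>v. {u, v} \<in> links H'"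
  shows "sparse H'"
  unfolding sparse_def
proof (intro conjI ballI allI impI)
  show "finite (nodes H')" using finite_subset[OF N sparse_finite[OF assms(1)]] .
  show "e \<subseteq> nodes H'" "card e = 2" if "e \<in> links H'" for e
    using L[OF that] sparse_edge[OF assms(1)] by blast+
  show "neighbors H' u \<noteq> {}" if u: "u \<in> nodes H'" for u
  proof -
    obtain v where "{u, v} \<in> links H'" using nb[OF u] by blast
    then have "v \<in> neighbors H' u" using L by (auto simp: neighbors_def)
    then show ?thesis by blast
  qed
  fix S assume S: "S \<subseteq> nodes H'" "S \<noteq> {}"
  have "card {e \<in> links H'. e \<subseteq> S} \<le> card {e \<in> links H. e \<subseteq> S}"
    using finite_links[OF assms(1)] L by (intro card_mono) auto
  also have "\<dots> < card S" using sparse_card[OF assms(1) _ S(2)] S(1) N by blast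
  finally show "card {e \<in> links H'. e \<subseteq> S} < card S" .
qed

lemma sparse_eliminates:
  assumes "eliminates H u H'" "sparse H"
  shows "sparse H' \<and> nodes H' \<subset> nodes H"
  using assms
proof cases
  case (deg2 v1 v2)
  have l: "{u, v1} \<in> links H" "{u, v2} \<in> links H" and nb: "\<And>v. {u, v} \<in> links H \<Longrightarrow> v = v1 \<or> v = v2"
    using neighbors_iff[OF assms(2), of _ u] deg2(3) by auto
  have ne: "u \<noteq> v1" "u \<noteq> v2" "v1 \<in> nodes H" "v2 \<in> nodes H"
    using sparse_link[OF assms(2)] l by blast+
  have nu: "u \<notin> e" if "e \<in> links H" "e \<noteq> {u, v1}" "e \<noteq> {u, v2}" for e
  proof
    assume "u \<in> e"
    moreover have "card e = 2" using sparse_edge[OF assms(2) that(1)] by blast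
    ultimately obtain v where "e = {u, v}" by (auto simp: card_2_iff)
    then show False using nb that by auto
  qed
  have N: "nodes H' = nodes H - {u}" and L: "links H' = links H - {{u, v1}, {u, v2}} \<union> {{v1, v2}}"
    using deg2(1) by simp_all
  have "sparse H'" unfolding sparse_def
  proof (intro conjI ballI allI impI)
    show "finite (nodes H')" using sparse_finite[OF assms(2)] N by simp
    show "e \<subseteq> nodes H'" "card e = 2" if e: "e \<in> links H'" for e
    proof -
      consider "e = {v1, v2}" | "e \<in> links H" "e \<noteq> {u, v1}" "e \<noteq> {u, v2}" using e L by blast
      then have "e \<subseteq> nodes H' \<and> card e = 2"
      proof cases
        case 1
        then show ?thesis using ne deg2(4) N by auto
      next
        case 2
        then have "e \<subseteq> nodes H" "card e = 2" using sparse_edge[OF assms(2)] by blast+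
        then show ?thesis using nu[OF 2] N by auto
      qed
      then show "e \<subseteq> nodes H'" "card e = 2" by blast+
    qed
    show "neighbors H' w \<noteq> {}" if w: "w \<in> nodes H'" for w
    proof -
      consider "w = v1" | "w = v2" | "w \<noteq> v1" "w \<noteq> v2" by blast
      then show ?thesis
      proof cases
        case 1
        then have "v2 \<in> neighbors H' w" using ne by (auto simp: neighbors_def L N)
        then show ?thesis by blast
      next
        case 2
        then have "v1 \<in> neighbors H' w" using ne by (auto simp: neighbors_def L N insert_commute)
        then show ?thesis by blast
      next
        case 3
        have "w \<in> nodes H" "w \<noteq> u" using w N by auto
        then obtain x where x: "{w, x} \<in> links H" using sparse_neighbor[OF assms(2)] by (auto simp: neighbors_def)
        then have "x \<noteq> u" using nb[of w] 3 by (auto simp: insert_commute)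
        then have "{w, x} \<noteq> {u, v1}" "{w, x} \<noteq> {u, v2}" using \<open>w \<noteq> u\<close> by (auto simp: doubleton_eq_iff)
        then have "x \<in> neighbors H' w"
          using x sparse_link[OF assms(2) x] \<open>x \<noteq> u\<close> by (simp add: neighbors_def L N)
        then show ?thesis by blast
      qed
    qed
    fix S assume S: "S \<subseteq> nodes H'" "S \<noteq> {}"
    have fS: "finite S" using finite_subset[OF _ sparse_finite[OF assms(2)], of S] S N by blast
    \<comment> \<open>Only a set that contains both \<open>v1\<close> and \<open>v2\<close> can gain
      an edge. It is compared with \<open>insert u S\<close> in the old graph: one vertex fewer, and
      two edges replaced by one.\<close>
    show "card {e \<in> links H'. e \<subseteq> S} < card S"
    proof (cases "v1 \<in> S \<and> v2 \<in> S")
      case True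
      let ?A = "{e \<in> links H. e \<subseteq> insert u S}"
      have uS: "u \<notin> S" using S N by auto
      have fA: "finite ?A" using finite_links[OF assms(2)] by simp
      have two: "{{u, v1}, {u, v2}} \<subseteq> ?A" "card {{u, v1}, {u, v2}} = 2"
        using l True deg2(4) by (auto simp: doubleton_eq_iff card_insert_if)
      have "card ?A < card (insert u S)" using sparse_card[OF assms(2), of "insert u S"] S deg2(2) N by blast
      then have A: "card ?A \<le> card S" using uS fS by simp
      have "{e \<in> links H'. e \<subseteq> S} \<subseteq> insert {v1, v2} (?A - {{u, v1}, {u, v2}})"
        unfolding L by auto
      then have "card {e \<in> links H'. e \<subseteq> S} \<le> card (insert {v1, v2} (?A - {{u, v1}, {u, v2}}))"
        using fA by (intro card_mono) auto
      also have "\<dots> \<le> Suc (card (?A - {{u, v1}, {u, v2}}))" by (rule card_insert_le_m1) simp_all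
      also have "card (?A - {{u, v1}, {u, v2}}) = card ?A - 2"
        using card_Diff_subset[of "{{u, v1}, {u, v2}}" ?A] two by simp
      finally show ?thesis using A card_mono[OF fA two(1)] two(2) by linarith
    next
      case False
      then have "{e \<in> links H'. e \<subseteq> S} \<subseteq> {e \<in> links H. e \<subseteq> S}" unfolding L by auto
      then have "card {e \<in> links H'. e \<subseteq> S} \<le> card {e \<in> links H. e \<subseteq> S}"
        using finite_links[OF assms(2)] by (intro card_mono) auto
      also have "\<dots> < card S" using sparse_card[OF assms(2) _ S(2)] S(1) N by blast
      finally show ?thesis .
    qed
  qed
  then show ?thesis using N deg2(2) by auto
next
  case (deg1_keep v)
  have l: "{u, v} \<in> links H" and nb: "\<And>x. {u, x} \<in> links H \<Longrightarrow> x = v"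
    using neighbors_iff[OF assms(2), of _ u] deg1_keep(3) by auto
  have N: "nodes H' = nodes H - {u}" and L: "links H' = links H - {{u, v}}" using deg1_keep(1) by simp_all
  have "sparse H'"
  proof (rule sparse_mono[OF assms(2)])
    show "e \<in> links H \<and> e \<subseteq> nodes H'" if e: "e \<in> links H'" for e
    proof -
      have "e \<in> links H" using e by (simp add: L)
      moreover from this have "e \<subseteq> nodes H" "card e = 2" using sparse_edge[OF assms(2)] by blast+
      moreover have "u \<notin> e"
      proof
        assume "u \<in> e"
        then obtain x where "e = {u, x}" using \<open>card e = 2\<close> by (auto simp: card_2_iff)
        then show False using nb[of x] e L by auto
      qed
      ultimately show ?thesis by (auto simp: N)
    qed
    fix w assume w: "w \<in> nodes H'"
    show "\<exists>x. {w, x} \<in> links H'"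
    proof (cases "w = v")
      case True
      have "u \<in> neighbors H v" using l neighbors_iff[OF assms(2)] by (simp add: insert_commute)
      then obtain x where "x \<in> neighbors H v" "x \<noteq> u" using deg1_keep(4) by blast
      then have "{v, x} \<in> links H'" using sparse_link[OF assms(2) l]
        by (auto simp: neighbors_def L doubleton_eq_iff)
      then show ?thesis using True by blast
    next
      case False
      obtain x where x: "{w, x} \<in> links H" using w sparse_neighbor[OF assms(2), of w] by (auto simp: neighbors_def N)
      then have "{w, x} \<noteq> {u, v}" using False w by (auto simp: N doubleton_eq_iff)
      then show ?thesis using x by (auto simp: L)
    qed
  qed (simp add: N)
  then show ?thesis using N deg1_keep(2) by auto
next
  case (deg1_drop v)
  have l: "{u, v} \<in> links H" and nb: "\<And>x. {u, x} \<in> links H \<Longrightarrow> x = v" "\<And>x. {v, x} \<in> links H \<Longrightarrow> x = u"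
    using neighbors_iff[OF assms(2)] deg1_drop(3,4) by (metis singleton_iff)+
  have N: "nodes H' = nodes H - {u, v}" and L: "links H' = links H - {{u, v}}" using deg1_drop(1) by simp_all
  have nuv: "u \<notin> e \<and> v \<notin> e" if e: "e \<in> links H'" for e
  proof -
    have e': "e \<in> links H" "e \<noteq> {u, v}" using e by (simp_all add: L)
    then have "card e = 2" using sparse_edge[OF assms(2)] by blast
    show ?thesis
    proof (rule ccontr)
      assume "\<not> ?thesis"
      then obtain x where "e = {u, x} \<or> e = {v, x}" using \<open>card e = 2\<close> by (auto simp: card_2_iff)
      then show False using nb[of x] e' by (auto simp: insert_commute)
    qed
  qed
  have "sparse H'"
  proof (rule sparse_mono[OF assms(2)])
    show "e \<in> links H \<and> e \<subseteq> nodes H'" if e: "e \<in> links H'" for e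
      using nuv[OF e] e sparse_edge[OF assms(2), of e] by (auto simp: L N)
    fix w assume w: "w \<in> nodes H'"
    obtain x where x: "{w, x} \<in> links H" using w sparse_neighbor[OF assms(2), of w] by (auto simp: neighbors_def N)
    then have "{w, x} \<noteq> {u, v}" using w by (auto simp: N doubleton_eq_iff)
    then show "\<exists>x. {w, x} \<in> links H'" using x by (auto simp: L)
  qed (auto simp: N)
  then show ?thesis using N deg1_drop(2) by auto
qed

text \<open>Double counting: an edge yields at most two ordered pairs of adjacent vertices.\<close>

lemma sum_degree: "sparse H \<Longrightarrow> (\<Sum>u\<in>nodes H. degree H u) \<le> 2 * card (links H)"
proof -
  assume sp: "sparse H"
  have fin: "finite (nodes H)" "finite (neighbors H u)" for u
    using sparse_finite[OF sp] by (auto simp: neighbors_def)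
  have "(\<Sum>u\<in>nodes H. degree H u) = card (SIGMA u:nodes H. neighbors H u)"
    using fin by (simp add: degree_def card_SigmaI)
  also have "\<dots> \<le> card (\<Union>e\<in>links H. {(u, v). {u, v} = e})"
  proof (rule card_mono)
    have "(\<Union>e\<in>links H. {(u, v). {u, v} = e}) \<subseteq> nodes H \<times> nodes H" using sparse_link[OF sp] by auto
    then show "finite (\<Union>e\<in>links H. {(u, v). {u, v} = e})" using fin(1) by (meson finite_SigmaI finite_subset)
  qed (auto simp: neighbors_def)
  also have "\<dots> \<le> (\<Sum>e\<in>links H. card {(u, v). {u, v} = e})" by (rule card_UN_le[OF finite_links[OF sp]])
  also have "\<dots> \<le> (\<Sum>e\<in>links H. 2)"
  proof (rule sum_mono)
    fix e assume "e \<in> links H"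
    then have "card e = 2" using sparse_edge[OF sp] by blast
    then obtain a b where "e = {a, b}" by (auto simp: card_2_iff)
    then have "{(u, v). {u, v} = e} \<subseteq> {(a, b), (b, a)}" by (auto simp: doubleton_eq_iff)
    then have "card {(u, v). {u, v} = e} \<le> card {(a, b), (b, a)}" by (intro card_mono) auto
    also have "\<dots> \<le> 2" by (rule card_insert_le_m1) simp_all
    finally show "card {(u, v). {u, v} = e} \<le> 2" .
  qed
  finally show ?thesis by simp
qed

text \<open>Let \<open>b\<close> be the number of vertices in \<open>B\<close> and \<open>f\<close>
  the number of the others. Sparsity leaves at most \<open>b + f - 1\<close> edges, and every vertex
  has a neighbor, so counting degrees gives \<open>3 * b + f \<le> 2 * (b + f - 1)\<close>, that is
  \<open>b + 2 \<le> f\<close>, unless the graph is empty. With \<open>f \<le> 2\<close> nothing is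
  left for \<open>b\<close>.\<close>

lemma no_branching:
  assumes sp: "sparse H" and B: "\<And>u. u \<in> B \<inter> nodes H \<Longrightarrow> 3 \<le> degree H u" and f: "card (nodes H - B) \<le> 2"
  shows "B \<inter> nodes H = {}"
proof (cases "nodes H = {}")
  case False
  have fin: "finite (nodes H)" using sparse_finite[OF sp] .
  have "card {e \<in> links H. e \<subseteq> nodes H} < card (nodes H)" using sparse_card[OF sp order_refl False] .
  moreover have "{e \<in> links H. e \<subseteq> nodes H} = links H" using sparse_edge[OF sp] by blast
  ultimately have l: "card (links H) < card (nodes H)" by simp
  have part: "nodes H = (B \<inter> nodes H) \<union> (nodes H - B)" "(B \<inter> nodes H) \<inter> (nodes H - B) = {}" by auto
  have "3 * card (B \<inter> nodes H) = (\<Sum>u\<in>B \<inter> nodes H. 3)" by simp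
  also have "\<dots> \<le> (\<Sum>u\<in>B \<inter> nodes H. degree H u)" using B by (rule sum_mono)
  finally have b: "3 * card (B \<inter> nodes H) \<le> (\<Sum>u\<in>B \<inter> nodes H. degree H u)" .
  have "card (nodes H - B) = (\<Sum>u\<in>nodes H - B. 1)" by simp
  also have "\<dots> \<le> (\<Sum>u\<in>nodes H - B. degree H u)"
  proof (rule sum_mono)
    fix u assume "u \<in> nodes H - B"
    then have "neighbors H u \<noteq> {}" "finite (neighbors H u)" using sparse_neighbor[OF sp] fin by (auto simp: neighbors_def)
    then show "1 \<le> degree H u" by (simp add: degree_def Suc_le_eq card_gt_0_iff)
  qed
  finally have "card (nodes H - B) \<le> (\<Sum>u\<in>nodes H - B. degree H u)" .
  moreover have "(\<Sum>u\<in>nodes H. degree H u) = (\<Sum>u\<in>B \<inter> nodes H. degree H u) + (\<Sum>u\<in>nodes H - B. degree H u)"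
    by (subst part(1), rule sum.union_disjoint) (use fin in auto)
  moreover have "card (nodes H) = card (B \<inter> nodes H) + card (nodes H - B)"
    by (subst part(1), rule card_Un_disjoint) (use fin in auto)
  ultimately have "card (B \<inter> nodes H) = 0" using b l f sum_degree[OF sp] by linarith
  then show ?thesis using fin by simp
qed simp

lemma eliminates_exists:
  assumes "sparse H" "u \<in> nodes H" "\<not> 3 \<le> degree H u"
  shows "\<exists>H'. eliminates H u H'"
proof -
  have n: "neighbors H u \<noteq> {}" "finite (neighbors H u)"
    using sparse_neighbor[OF assms(1,2)] sparse_finite[OF assms(1)] by (auto simp: neighbors_def)
  then have "card (neighbors H u) = 1 \<or> card (neighbors H u) = 2"
    using assms(3) card_gt_0_iff[of "neighbors H u"] unfolding degree_def by linarith
  then show ?thesis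
  proof
    assume "card (neighbors H u) = 1"
    then obtain v where "neighbors H u = {v}" by (auto simp: card_1_singleton_iff)
    then show ?thesis using assms(2) eliminates.deg1_keep eliminates.deg1_drop by metis
  next
    assume "card (neighbors H u) = 2"
    then obtain v1 v2 where "neighbors H u = {v1, v2}" "v1 \<noteq> v2" by (auto simp: card_2_iff)
    then show ?thesis using assms(2) eliminates.deg2 by metis
  qed
qed

text \<open>Every elimination removes a vertex, so the process stops. Existence matters because
  \<open>cg\<close> is a choice, about which something can be said only if some elimination order
  exists.\<close>

lemma elimination_exists:
  assumes "sparse H"
  shows "\<exists>Xs Gs. set Xs \<subseteq> B \<and> length Gs = Suc (length Xs) \<and> Gs ! 0 = H \<and>
    (\<forall>i<length Xs. eliminates (Gs ! i) (Xs ! i) (Gs ! Suc i)) \<and>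
    (\<forall>X\<in>B \<inter> nodes (Gs ! length Xs). 3 \<le> degree (Gs ! length Xs) X)"
  using assms
proof (induction "card (nodes H)" arbitrary: H rule: less_induct)
  case less
  show ?case
  proof (cases "\<forall>X\<in>B \<inter> nodes H. 3 \<le> degree H X")
    case True
    then show ?thesis by (intro exI[of _ "[]"] exI[of _ "[H]"]) auto
  next
    case False
    then obtain u where u: "u \<in> B" "u \<in> nodes H" "\<not> 3 \<le> degree H u" by blast
    from eliminates_exists[OF less.prems u(2,3)] obtain H' where H': "eliminates H u H'" by blast
    have "card (nodes H') < card (nodes H)"
      using sparse_eliminates[OF H' less.prems] sparse_finite[OF less.prems] by (intro psubset_card_mono) auto
    from less.hyps[OF this] sparse_eliminates[OF H' less.prems] obtain Xs Gs where
      *: "set Xs \<subseteq> B" "length Gs = Suc (length Xs)" "Gs ! 0 = H'"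
      "\<forall>i<length Xs. eliminates (Gs ! i) (Xs ! i) (Gs ! Suc i)"
      "\<forall>X\<in>B \<inter> nodes (Gs ! length Xs). 3 \<le> degree (Gs ! length Xs) X" by blast
    have "eliminates ((H # Gs) ! i) ((u # Xs) ! i) ((H # Gs) ! Suc i)" if "i < length (u # Xs)" for i
      using that H' * by (cases i) auto
    then show ?thesis using * u(1) by (intro exI[of _ "u # Xs"] exI[of _ "H # Gs"]) auto
  qed
qed

text \<open>An edge inside \<open>S\<close> is charged to its child. The smallest index in
  \<open>S\<close> is never charged, because its parent would be a smaller index in
  \<open>S\<close>.\<close>

lemma sparse_query_graph:
  fixes m :: nat
  assumes bij: "bij_betw vx {1..m} (nodes H)" and par: "\<And>i. i \<in> {1..m} \<Longrightarrow> par i < i"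
    and L: "links H = {{vx i, vx (par i)} | i. i \<in> {1..m} \<and> par i \<noteq> 0}"
    and e: "\<And>e. e \<in> links H \<Longrightarrow> e \<subseteq> nodes H \<and> card e = 2" and cover: "\<And>u. u \<in> nodes H \<Longrightarrow> \<exists>v. {u, v} \<in> links H"
  shows "sparse H"
  unfolding sparse_def
proof (intro conjI ballI allI impI)
  show "finite (nodes H)" using bij_betw_finite[OF bij] by simp
  show "x \<subseteq> nodes H" "card x = 2" if "x \<in> links H" for x using e[OF that] by auto
  show "neighbors H u \<noteq> {}" if u: "u \<in> nodes H" for u
  proof -
    obtain v where "{u, v} \<in> links H" using cover[OF u] by blast
    then have "v \<in> neighbors H u" using e by (auto simp: neighbors_def)
    then show ?thesis by blast
  qed
  fix S assume S: "S \<subseteq> nodes H" "S \<noteq> {}"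
  let ?I = "{i \<in> {1..m}. vx i \<in> S}"
  have "nodes H = vx ` {1..m}" using bij by (simp add: bij_betw_def)
  have img: "vx ` ?I = S"
  proof (intro equalityI subsetI)
    fix x assume "x \<in> S"
    then have "x \<in> vx ` {1..m}" using S(1) \<open>nodes H = vx ` {1..m}\<close> by (metis subsetD)
    then show "x \<in> vx ` ?I" using \<open>x \<in> S\<close> by auto
  qed auto
  have inj: "inj_on vx ?I" using bij by (auto simp: bij_betw_def intro: inj_on_subset)
  have cI: "card ?I = card S" using card_image[OF inj] img by simp
  have ne: "?I \<noteq> {}" using img S(2) by blast
  let ?k = "Min ?I"
  have k: "?k \<in> ?I" using ne by (intro Min_in) auto
  have "{x \<in> links H. x \<subseteq> S} \<subseteq> (\<lambda>i. {vx i, vx (par i)}) ` (?I - {?k})"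
  proof
    fix x assume x: "x \<in> {x \<in> links H. x \<subseteq> S}"
    then obtain i where i: "x = {vx i, vx (par i)}" "i \<in> {1..m}" "par i \<noteq> 0" unfolding L by blast
    have "par i \<in> ?I" using i x par[OF i(2)] by auto
    then have "?k \<le> par i" by (intro Min_le) auto
    then have "i \<noteq> ?k" using par[OF i(2)] by simp
    then show "x \<in> (\<lambda>i. {vx i, vx (par i)}) ` (?I - {?k})" using i x by auto
  qed
  then have "card {x \<in> links H. x \<subseteq> S} \<le> card (?I - {?k})"
    by (intro surj_card_le) simp_all
  also have "\<dots> < card ?I" using k by (intro psubset_card_mono) auto
  finally show "card {x \<in> links H. x \<subseteq> S} < card S" using cI by simp
qed

section \<open>The query graph of a free-connex query\<close>

lemma query_graph_facts:
  assumes "free_connex Q" "is_crpq Q"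
  shows "finite (nodes (query_graph Q))" "\<And>e. e \<in> links (query_graph Q) \<Longrightarrow> e \<subseteq> nodes (query_graph Q) \<and> card e = 2"
    "\<nexists>vs. is_cycle (query_graph Q) vs" "free Q \<subseteq> nodes (query_graph Q)" "convex_in (query_graph Q) (free Q)"
    "\<And>u. u \<in> nodes (query_graph Q) \<Longrightarrow> \<exists>v. {u, v} \<in> links (query_graph Q)"
proof -
  let ?H = "query_graph Q"
  have ac: "acyclic_crpq Q" using assms(1) by (simp add: free_connex_def)
  show "finite (nodes ?H)" by (auto simp: query_graph_def vars_def)
  show "e \<subseteq> nodes ?H \<and> card e = 2" if "e \<in> links ?H" for e
    using that ac by (force simp: query_graph_def vars_def acyclic_crpq_def card_insert_if)
  show "\<nexists>vs. is_cycle ?H vs" using ac by (simp add: acyclic_crpq_def)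
  show F: "free Q \<subseteq> nodes ?H" using assms(2) by (simp add: is_crpq_def query_graph_def)
  show "convex_in ?H (free Q)" unfolding convex_in_def
  proof (intro ballI impI)
    fix a b assume ab: "a \<in> free Q" "b \<in> free Q" "(a, b) \<in> (edge_in ?H (nodes ?H))\<^sup>*"
    let ?C = "component_of ?H a"
    have "?C \<in> components ?H" using ab(1) F by (auto simp: components_def)
    then have "connected_in ?H (free Q \<inter> ?C)" using assms(1) by (simp add: free_connex_def)
    moreover have "a \<in> ?C" "b \<in> ?C" using ab(3) by (auto simp: component_of_def)
    ultimately have "(a, b) \<in> (edge_in ?H (free Q \<inter> ?C))\<^sup>*" using ab unfolding connected_in_def by blast
    then show "(a, b) \<in> (edge_in ?H (free Q))\<^sup>*" using edge_in_mono[of "free Q \<inter> ?C" "free Q" ?H] by blast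
  qed
  show "\<exists>v. {u, v} \<in> links ?H" if "u \<in> nodes ?H" for u
  proof -
    from that obtain A where "A \<in> set (body Q)" "u \<in> (case A of (X, r, Y) \<Rightarrow> {X, Y})"
      unfolding query_graph_def vars_def by auto
    then obtain X r Y where A: "(X, r, Y) \<in> set (body Q)" "u = X \<or> u = Y" by (cases A) auto
    then have "{X, Y} \<in> links ?H" by (force simp: query_graph_def)
    then show ?thesis using A(2) by (auto simp: insert_commute)
  qed
qed

text \<open>The argument holds for every graph at the end of an elimination order: eliminations
  preserve sparsity, and the surviving vertices that are not bound are among the at most two free
  ones. So uniqueness of the contracted query graph does not have to be established.\<close>

lemma bound_cg_empty:
  assumes sp: "sparse (query_graph Q)" and f: "finite (free Q)" "card (free Q) \<le> 2"
  shows "bound Q \<inter> nodes (cg Q) = {}"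
proof -
  have "\<exists>H Xs. elimination_order Q Xs H"
    using elimination_exists[OF sp, of "bound Q"] unfolding elimination_order_def by blast
  then have "\<exists>Xs. elimination_order Q Xs (cg Q)" unfolding cg_def by (rule someI_ex)
  then obtain Xs Gs where G: "length Gs = Suc (length Xs)" "Gs ! 0 = query_graph Q"
    "\<forall>i<length Xs. eliminates (Gs ! i) (Xs ! i) (Gs ! Suc i)" "Gs ! length Xs = cg Q"
    "\<forall>X\<in>bound Q \<inter> nodes (cg Q). 3 \<le> degree (cg Q) X"
    unfolding elimination_order_def by blast
  have "i \<le> length Xs \<Longrightarrow> sparse (Gs ! i) \<and> nodes (Gs ! i) \<subseteq> vars Q" for i
  proof (induction i)
    case 0
    then show ?case using sp G(2) by (simp add: query_graph_def)
  next
    case (Suc i)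
    then have "eliminates (Gs ! i) (Xs ! i) (Gs ! Suc i)" using G(3) by simp
    then show ?case using sparse_eliminates[of "Gs ! i" "Xs ! i" "Gs ! Suc i"] Suc by auto
  qed
  from this[OF order_refl] have H: "sparse (cg Q)" "nodes (cg Q) \<subseteq> vars Q" by (simp_all add: G(4))
  then have "nodes (cg Q) - bound Q \<subseteq> free Q" by (auto simp: bound_def)
  then have "card (nodes (cg Q) - bound Q) \<le> 2" using card_mono[OF f(1)] f(2) le_trans by blast
  then show ?thesis using no_branching[OF H(1)] G(5) by blast
qed

text \<open>The largest vertex of a cycle has smaller vertices as both its neighbors on the cycle,
  so both are its parent. On a cycle of length at least 3 they are different.\<close>

lemma parent_tree:
  fixes par :: "nat \<Rightarrow> nat"
  assumes par: "\<And>i. i \<in> {1..m} \<Longrightarrow> par i < i"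
  defines "T \<equiv> \<lparr>nodes = {0..m}, links = {{i, par i} | i. i \<in> {1..m}}\<rparr>"
  shows "is_tree T" "\<And>S. 0 \<in> S \<Longrightarrow> S \<subseteq> {0..m} \<Longrightarrow> (\<And>i. i \<in> S \<Longrightarrow> i \<noteq> 0 \<Longrightarrow> par i \<in> S) \<Longrightarrow> connected_in T S"
proof -
  show conn: "connected_in T S" if S: "0 \<in> S" "S \<subseteq> {0..m}" "\<And>i. i \<in> S \<Longrightarrow> i \<noteq> 0 \<Longrightarrow> par i \<in> S" for S
  proof -
    have to0: "i \<in> S \<Longrightarrow> (i, 0) \<in> (edge_in T S)\<^sup>*" for i
    proof (induction i rule: less_induct)
      case (less i)
      show ?case
      proof (cases "i = 0")
        case False
        then have i: "i \<in> {1..m}" "par i \<in> S" using less.prems S by auto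
        then have "(i, par i) \<in> edge_in T S" using less.prems unfolding T_def by auto
        then show ?thesis using less.IH[OF par[OF i(1)] i(2)] by (rule converse_rtrancl_into_rtrancl)
      qed simp
    qed
    have "(i, j) \<in> (edge_in T S)\<^sup>*" if "i \<in> S" "j \<in> S" for i j
      by (rule rtrancl_trans[OF to0[OF that(1)] edge_in_sym[OF to0[OF that(2)]]])
    then show ?thesis using S(2) by (simp add: connected_in_def T_def)
  qed
  have par0: "par i \<in> {0..m}" if "i \<in> {1..m}" for i using par[OF that] that by auto
  have "\<not> is_cycle T vs" for vs
  proof
    assume cyc: "is_cycle T vs"
    let ?n = "length vs"
    have n: "3 \<le> ?n" "distinct vs" "\<And>i. i < ?n \<Longrightarrow> {vs ! i, vs ! (Suc i mod ?n)} \<in> links T"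
      using cyc by (auto simp: is_cycle_def)
    have "vs \<noteq> []" using n by auto
    then have "Max (set vs) \<in> set vs" by simp
    then obtain k where k: "k < ?n" "vs ! k = Max (set vs)" by (metis in_set_conv_nth)
    have up: "x = par (vs ! k)" if "{vs ! k, x} \<in> links T" "x \<in> set vs" for x
    proof -
      from that(1) obtain i where i: "{vs ! k, x} = {i, par i}" "i \<in> {1..m}" unfolding T_def by auto
      have "x \<le> vs ! k" using that(2) k by simp
      then show ?thesis using i par[OF i(2)] by (auto simp: doubleton_eq_iff)
    qed
    let ?s = "Suc k mod ?n" and ?p = "(k + ?n - 1) mod ?n"
    have "0 < ?n" using n(1) by linarith
    then have sp: "?s < ?n" "?p < ?n" by (simp_all only: mod_less_divisor)
    have "Suc ?p mod ?n = k"
    proof -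
      have "Suc (k + ?n - 1) = k + ?n" using n(1) by linarith
      then have "Suc ?p mod ?n = (k + ?n) mod ?n" by (simp only: mod_Suc_eq)
      then show ?thesis using k(1) by simp
    qed
    then have "vs ! ?p = par (vs ! k)" using up[of "vs ! ?p"] n(3)[OF sp(2)] sp by (simp add: insert_commute)
    moreover have "vs ! ?s = par (vs ! k)" using up[of "vs ! ?s"] n(3)[OF k(1)] sp by simp
    ultimately have "?p = ?s" using nth_eq_iff_index_eq[OF n(2) sp(2,1)] by metis
    moreover have "?p = (if k = 0 then ?n - 1 else k - 1)" using k(1) n(1)
      by (auto simp: mod_if)
    moreover have "?s = (if Suc k = ?n then 0 else Suc k)" using k(1) by (auto simp: mod_if)
    ultimately show False using n(1) k(1) by (auto split: if_splits)
  qed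
  moreover have "connected_in T {0..m}" using par0 by (intro conn) auto
  moreover have "e \<subseteq> nodes T \<and> card e = 2" if "e \<in> links T" for e
    using that par par0 unfolding T_def by (auto simp: card_insert_if; force)
  moreover have "nodes T = {0..m}" by (simp add: T_def)
  ultimately show "is_tree T" unfolding is_tree_def by simp
qed

lemma cw_zero:
  assumes "is_crpq Q" "free_connex Q"
  shows "cw Q = 0"
proof -
  let ?H = "query_graph Q"
  note facts = query_graph_facts[OF assms(2,1)]
  obtain m :: nat and vx par where bij: "bij_betw vx {1..m} (nodes ?H)" and par: "\<And>i. i \<in> {1..m} \<Longrightarrow> par i < i"
    and L: "links ?H = {{vx i, vx (par i)} | i. i \<in> {1..m} \<and> par i \<noteq> 0}"
    and F: "\<And>i. i \<in> {1..m} \<Longrightarrow> vx i \<in> free Q \<Longrightarrow> par i \<noteq> 0 \<Longrightarrow> vx (par i) \<in> free Q"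
    by (rule forest_parents[OF facts(1-5)]) (assumption | rule that)+
  have V: "nodes ?H = vars Q" by (simp add: query_graph_def)
  have img: "vx ` {1..m} = vars Q" using bij V by (simp add: bij_betw_def)
  have inj: "vx i = vx j \<longleftrightarrow> i = j" if "i \<in> {1..m}" "j \<in> {1..m}" for i j
    using bij that by (meson bij_betw_def inj_on_eq_iff)
  define T :: "nat ugraph" where "T = \<lparr>nodes = {0..m}, links = {{i, par i} | i. i \<in> {1..m}}\<rparr>"
  \<comment> \<open>The empty bag at 0 links the bags of the roots. It keeps the bags of free
    variables connected across several trees and provides a non-empty subtree if there is no free
    variable at all.\<close>
  define \<chi> where "\<chi> i = (if i = 0 then {} else if par i = 0 then {vx i} else {vx i, vx (par i)})" for i
  have T: "is_tree T" "\<And>S. 0 \<in> S \<Longrightarrow> S \<subseteq> {0..m} \<Longrightarrow> (\<And>i. i \<in> S \<Longrightarrow> i \<noteq> 0 \<Longrightarrow> par i \<in> S) \<Longrightarrow> connected_in T S"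
    using parent_tree[OF par] unfolding T_def by blast+
  have nT: "nodes T = {0..m}" by (simp add: T_def)
  have parV: "par i \<in> {1..m}" if "i \<in> {1..m}" "par i \<noteq> 0" for i using par[OF that(1)] that by auto
  have "tree_decomposition Q (T, \<chi>)"
    unfolding tree_decomposition_def prod.case
  proof (intro conjI ballI)
    show "is_tree T" by (rule T)
    show "\<chi> t \<subseteq> vars Q" if "t \<in> nodes T" for t
      using that img parV[of t] by (auto simp: \<chi>_def nT)
    show "case A of (X, r, Y) \<Rightarrow> \<exists>t\<in>nodes T. X \<in> \<chi> t \<and> Y \<in> \<chi> t" if A: "A \<in> set (body Q)" for A
    proof -
      obtain X r Y where XY: "A = (X, r, Y)" by (cases A) auto
      then have "{X, Y} \<in> links ?H" using A by (force simp: query_graph_def)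
      then obtain i where "{X, Y} = {vx i, vx (par i)}" "i \<in> {1..m}" "par i \<noteq> 0" unfolding L by auto
      then have "X \<in> \<chi> i" "Y \<in> \<chi> i" "i \<in> nodes T" by (auto simp: \<chi>_def nT doubleton_eq_iff)
      then show ?thesis using XY by auto
    qed
    fix X assume "X \<in> vars Q"
    then obtain k where k: "k \<in> {1..m}" "X = vx k" using img by blast
    \<comment> \<open>The variable \<open>vx k\<close> occurs in its own bag and in those of its
      children, which form a star around \<open>k\<close>.\<close>
    have bag: "{t \<in> nodes T. X \<in> \<chi> t} = insert k {i \<in> {1..m}. par i = k}"
      using k inj parV by (auto simp: \<chi>_def nT split: if_splits)
    show "{t \<in> nodes T. X \<in> \<chi> t} \<noteq> {}" unfolding bag by blast
    let ?S = "insert k {i \<in> {1..m}. par i = k}"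
    have tok: "(i, k) \<in> (edge_in T ?S)\<^sup>*" if i: "i \<in> ?S" for i
    proof (cases "i = k")
      case False
      then have "(i, k) \<in> edge_in T ?S" using i unfolding T_def by auto
      then show ?thesis by (rule r_into_rtrancl)
    qed simp
    have "(i, j) \<in> (edge_in T ?S)\<^sup>*" if "i \<in> ?S" "j \<in> ?S" for i j
      by (rule rtrancl_trans[OF tok[OF that(1)] edge_in_sym[OF tok[OF that(2)]]])
    then show "connected_in T {t \<in> nodes T. X \<in> \<chi> t}"
      unfolding bag unfolding connected_in_def nT using k by auto
  qed
  moreover have "\<exists>S. S \<noteq> {} \<and> connected_in T S \<and> (\<Union>t\<in>S. \<chi> t) = free Q"
  proof (intro exI[of _ "insert 0 {i \<in> {1..m}. vx i \<in> free Q}"] conjI)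
    show "connected_in T (insert 0 {i \<in> {1..m}. vx i \<in> free Q})"
      using parV F by (intro T(2)) auto
    have "free Q \<subseteq> vx ` {1..m}" using facts(4) V img by simp
    then show "(\<Union>t\<in>insert 0 {i \<in> {1..m}. vx i \<in> free Q}. \<chi> t) = free Q"
    proof (intro equalityI subsetI)
      fix X assume "X \<in> (\<Union>t\<in>insert 0 {i \<in> {1..m}. vx i \<in> free Q}. \<chi> t)"
      then obtain i where i: "i \<in> {1..m}" "vx i \<in> free Q" "X \<in> \<chi> i" by (auto simp: \<chi>_def)
      then show "X \<in> free Q" using F[of i] by (auto simp: \<chi>_def split: if_splits)
    next
      fix X assume X: "X \<in> free Q"
      then obtain i where i: "i \<in> {1..m}" "X = vx i" using \<open>free Q \<subseteq> vx ` {1..m}\<close> by blast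
      then have "X \<in> \<chi> i" by (auto simp: \<chi>_def)
      then show "X \<in> (\<Union>t\<in>insert 0 {i \<in> {1..m}. vx i \<in> free Q}. \<chi> t)" using i X by blast
    qed
  qed simp
  ultimately have FTD: "(T, \<chi>) \<in> FTD Q" by (simp add: FTD_def)
  have "card (bound (induced_query Q B) \<inter> nodes (cg (induced_query Q B))) = 0" if B: "B \<in> \<chi> ` nodes T" for B
  proof -
    have fB: "finite B \<and> card B \<le> 2" using B by (auto simp: \<chi>_def card_insert_if)
    have "query_graph (induced_query Q B) = ?H" by (simp add: query_graph_def induced_query_def vars_def)
    moreover have "sparse ?H" by (rule sparse_query_graph[OF bij par L facts(2,6)])
    moreover have "card (free (induced_query Q B)) \<le> 2"
      using fB card_mono[of B "free Q \<inter> B"] by (auto simp: induced_query_def)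
    ultimately have "bound (induced_query Q B) \<inter> nodes (cg (induced_query Q B)) = {}"
      using fB by (intro bound_cg_empty) (auto simp: induced_query_def)
    then show ?thesis by simp
  qed
  then have "(\<lambda>B. card (bound (induced_query Q B) \<inter> nodes (cg (induced_query Q B)))) ` \<chi> ` nodes T = {0}"
    using nT by force
  then have "cw_decomp Q (T, \<chi>) = 0" by (simp add: cw_decomp_def)
  then have "cw Q \<le> 0" using INF_lower[OF FTD, of "\<lambda>D. enat (cw_decomp Q D)"] by (simp add: cw_def zero_enat_def)
  then show ?thesis by simp
qed

section \<open>Automata\<close>

text \<open>The states of the automaton of a regular expression are lists of expressions still to be read.\<close>

inductive step :: "'a rexp list \<Rightarrow> 'a option \<Rightarrow> 'a rexp list \<Rightarrow> bool" where
  eps: "step (REps # ks) None ks"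
| sym: "step (RSym a # ks) (Some a) ks"
| alt1: "step (RAlt r s # ks) None (r # ks)"
| alt2: "step (RAlt r s # ks) None (s # ks)"
| cat: "step (RCat r s # ks) None (r # s # ks)"
| star0: "step (RStar r # ks) None ks"
| star1: "step (RStar r # ks) None (r # RStar r # ks)"

primrec langs :: "'a rexp list \<Rightarrow> 'a list set" where
  "langs [] = {[]}"
| "langs (r # ks) = {u @ v | u v. u \<in> lang r \<and> v \<in> langs ks}"

inductive acc :: "'a rexp list \<Rightarrow> 'a list \<Rightarrow> bool" where
  nil: "acc [] []"
| eps: "step x None y \<Longrightarrow> acc y w \<Longrightarrow> acc x w"
| sym: "step x (Some a) y \<Longrightarrow> acc y w \<Longrightarrow> acc x (a # w)"

lemma step_langs_None: "step x None y \<Longrightarrow> w \<in> langs y \<Longrightarrow> w \<in> langs x"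
proof (induction x "None :: 'a option" y rule: step.induct)
  case (cat r s ks)
  then obtain u v v' where "w = u @ v @ v'" "u \<in> lang r" "v \<in> lang s" "v' \<in> langs ks" by auto
  then have "w = (u @ v) @ v'" "u @ v \<in> lang (RCat r s)" "v' \<in> langs ks" by auto
  then show ?case unfolding langs.simps by blast
next
  case (star0 r ks)
  have "concat [] \<in> lang (RStar r)" unfolding lang.simps by (intro CollectI exI[of _ "[]"]) simp
  then have "w = [] @ w" "[] \<in> lang (RStar r)" by simp_all
  then show ?case using star0 unfolding langs.simps by blast
next
  case (star1 r ks)
  then obtain u us v where "w = u @ concat us @ v" "u \<in> lang r" "set us \<subseteq> lang r" "v \<in> langs ks" by auto
  then have "w = concat (u # us) @ v" "set (u # us) \<subseteq> lang r" "v \<in> langs ks" by auto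
  then show ?case unfolding langs.simps lang.simps by blast
qed auto

lemma acc_langs: "acc x w \<Longrightarrow> w \<in> langs x"
proof (induction rule: acc.induct)
  case (eps x y w)
  then show ?case using step_langs_None by blast
next
  case (sym x a y w)
  from sym(1) show ?case using sym(3) by cases auto
qed simp

lemma acc_lang: "u \<in> lang r \<Longrightarrow> acc ks v \<Longrightarrow> acc (r # ks) (u @ v)"
proof (induction r arbitrary: u ks v)
  case REps
  then show ?case by (auto intro: acc.eps step.intros)
next
  case (RSym a)
  then show ?case by (auto intro: acc.sym step.intros)
next
  case (RAlt r s)
  then show ?case by (auto intro: acc.eps step.intros)
next
  case (RCat r s)
  then obtain u1 u2 where "u = u1 @ u2" "u1 \<in> lang r" "u2 \<in> lang s" by auto
  then have "acc (r # s # ks) (u @ v)" using RCat by simp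
  then show ?case by (rule acc.eps[OF step.cat])
next
  case (RStar r)
  then obtain us where "u = concat us" "set us \<subseteq> lang r" by auto
  then show ?case
  proof (induction us arbitrary: u)
    case Nil
    then show ?case using RStar.prems(2) by (auto intro: acc.eps step.intros)
  next
    case (Cons w us)
    then have "acc (r # RStar r # ks) (w @ (concat us @ v))" by (intro RStar.IH) auto
    then show ?case using acc.eps[OF step.star1] Cons.prems by simp
  qed
qed simp

lemma acc_iff: "acc x w \<longleftrightarrow> w \<in> langs x"
proof
  show "w \<in> langs x \<Longrightarrow> acc x w"
    by (induction x arbitrary: w) (auto intro: acc.nil acc_lang)
qed (rule acc_langs)

text \<open>A finite superset of the states reachable from \<open>[r]\<close>: the rest of a
  subexpression followed by the context that is still pending. It is closed under
  \<open>step\<close>, which is all that a finite automaton requires.\<close>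

primrec conts :: "'a rexp \<Rightarrow> 'a rexp list set" where
  "conts REmpty = {[REmpty], []}"
| "conts REps = {[REps], []}"
| "conts (RSym a) = {[RSym a], []}"
| "conts (RAlt r s) = {[RAlt r s], []} \<union> conts r \<union> conts s"
| "conts (RCat r s) = {[RCat r s]} \<union> (\<lambda>x. x @ [s]) ` conts r \<union> conts s"
| "conts (RStar r) = {[RStar r], []} \<union> (\<lambda>x. x @ [RStar r]) ` conts r"

lemma conts_basic: "finite (conts r) \<and> [r] \<in> conts r \<and> [] \<in> conts r"
  by (induction r) auto

lemma step_append: "step (x @ z) l y \<Longrightarrow> x \<noteq> [] \<Longrightarrow> \<exists>y'. y = y' @ z \<and> step x l y'"
  by (cases x) (auto elim!: step.cases intro: step.intros)

lemma step_Nil: "\<not> step [] l y"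
  by (auto elim: step.cases)

lemma conts_step: "x \<in> conts r \<Longrightarrow> step x l y \<Longrightarrow> y \<in> conts r"
proof (induction r arbitrary: x l y)
  case (RAlt r s)
  then consider "x = [RAlt r s]" | "x = []" | "x \<in> conts r" | "x \<in> conts s" by auto
  then show ?case
  proof cases
    case 1
    then show ?thesis using RAlt.prems(2) conts_basic by (auto elim!: step.cases)
  next
    case 2
    then show ?thesis using RAlt.prems(2) step_Nil by blast
  qed (use RAlt in auto)
next
  case (RCat r s)
  then consider "x = [RCat r s]" | x' where "x = x' @ [s]" "x' \<in> conts r" | "x \<in> conts s" by auto
  then show ?case
  proof cases
    case 1
    then have "y = [r] @ [s]" using RCat.prems(2) by (auto elim!: step.cases)
    then show ?thesis using conts_basic[of r] unfolding conts.simps by blast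
  next
    case 2
    show ?thesis
    proof (cases "x' = []")
      case True
      then have "x \<in> conts s" using 2 conts_basic by auto
      then show ?thesis using RCat by auto
    next
      case False
      then obtain y' where "y = y' @ [s]" "step x' l y'" using step_append 2 RCat.prems(2) by blast
      then show ?thesis using RCat.IH(1)[OF 2(2)] by auto
    qed
  next
    case 3
    then show ?thesis using RCat by auto
  qed
next
  case (RStar r)
  then consider "x = [RStar r]" | "x = []" | x' where "x = x' @ [RStar r]" "x' \<in> conts r" "x' \<noteq> []" by auto
  then show ?case
  proof cases
    case 1
    then have "y = [] \<or> y = [r] @ [RStar r]" using RStar.prems(2) by (auto elim!: step.cases)
    then show ?thesis using conts_basic[of r] unfolding conts.simps by blast
  next
    case 2
    then show ?thesis using RStar.prems(2) step_Nil by blast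
  next
    case 3
    then obtain y' where "y = y' @ [RStar r]" "step x' l y'" using step_append RStar.prems(2) by blast
    then show ?thesis using RStar.IH[OF 3(2)] by auto
  qed
qed (auto elim!: step.cases)

definition label :: "'a rexp list \<Rightarrow> 'a option" where
  "label x = (case x of RSym a # ks \<Rightarrow> Some a | _ \<Rightarrow> None)"

text \<open>The source of a step determines its label. This keeps the automaton finite although
  symbols range over all natural numbers.\<close>

lemma step_label: "step x l y \<Longrightarrow> l = label x"
  by (auto elim!: step.cases simp: label_def)

section \<open>Labeled paths as walks in the product\<close>

lemma has_path_Nil: "has_path G u [] v \<longleftrightarrow> u = v \<and> u \<in> verts G"
proof
  assume "has_path G u [] v"
  then obtain ws where "length ws = 1" "set ws \<subseteq> verts G" "ws ! 0 = u" "ws ! 0 = v" by (auto simp: has_path_def)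
  then show "u = v \<and> u \<in> verts G" by (cases ws) auto
qed (auto simp: has_path_def intro!: exI[of _ "[u]"])

lemma has_path_Cons:
  "has_path G u (a # w) v \<longleftrightarrow> u \<in> verts G \<and> (\<exists>x. (u, a, x) \<in> edges G \<and> has_path G x w v)"
proof
  assume "has_path G u (a # w) v"
  then obtain ws where ws: "length ws = Suc (Suc (length w))" "set ws \<subseteq> verts G" "ws ! 0 = u" "ws ! Suc (length w) = v"
    "\<forall>i<Suc (length w). (ws ! i, (a # w) ! i, ws ! Suc i) \<in> edges G" by (auto simp: has_path_def)
  then obtain y ys where y: "ws = y # ys" by (cases ws) auto
  have "(u, a, ys ! 0) \<in> edges G" using ws(3) ws(5)[rule_format, of 0] y by simp
  moreover have "(ys ! i, w ! i, ys ! Suc i) \<in> edges G" if "i < length w" for i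
    using ws(5)[rule_format, of "Suc i"] that y by simp
  then have "has_path G (ys ! 0) w v" using ws y by (auto simp: has_path_def intro!: exI[of _ ys])
  ultimately show "u \<in> verts G \<and> (\<exists>x. (u, a, x) \<in> edges G \<and> has_path G x w v)" using ws y by auto
next
  assume "u \<in> verts G \<and> (\<exists>x. (u, a, x) \<in> edges G \<and> has_path G x w v)"
  then obtain x ws where x: "u \<in> verts G" "(u, a, x) \<in> edges G" "length ws = Suc (length w)" "set ws \<subseteq> verts G"
    "ws ! 0 = x" "ws ! length w = v" "\<forall>i<length w. (ws ! i, w ! i, ws ! Suc i) \<in> edges G"
    by (auto simp: has_path_def)
  have "((u # ws) ! i, (a # w) ! i, (u # ws) ! Suc i) \<in> edges G" if "i < length (a # w)" for i
    using x that by (cases i) auto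
  then show "has_path G u (a # w) v" using x by (auto simp: has_path_def intro!: exI[of _ "u # ws"])
qed

definition move :: "(nat \<times> nat \<times> nat) set \<Rightarrow> ((nat \<times> nat rexp list) \<times> (nat \<times> nat rexp list)) set" where
  "move Es = {((Suc u, x), (Suc v, y)) | u v x y a. (u, a, v) \<in> Es \<and> step x (Some a) y} \<union>
     {((v, x), (v, y)) | v x y. v \<in> endpoints Es \<and> step x None y}"

text \<open>Reflexivity relates \<open>(Suc u, [])\<close> to itself for every \<open>u\<close>,
  also outside the graph, whereas an empty path must sit at a vertex; hence the conjunct
  \<open>u \<in> verts G\<close>.\<close>

lemma move_path:
  assumes V: "\<And>u. u \<in> verts G \<longleftrightarrow> Suc u \<in> endpoints (edges G)"
  shows "((Suc u, x), (Suc v, [])) \<in> (move (edges G))\<^sup>* \<and> u \<in> verts G \<longleftrightarrow> (\<exists>w\<in>langs x. has_path G u w v)"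
proof
  have edge: "u \<in> verts G \<and> v \<in> verts G" if "(u, a, v) \<in> edges G" for u a v
    using that unfolding V by (auto simp: endpoints_def)
  have gen: "(p, q) \<in> (move (edges G))\<^sup>* \<Longrightarrow> q = (Suc v, []) \<Longrightarrow>
      \<forall>u x. p = (Suc u, x) \<longrightarrow> u \<in> verts G \<longrightarrow> (\<exists>w. acc x w \<and> has_path G u w v)" for p q
  proof (induction rule: converse_rtrancl_induct)
    case base
    then show ?case by (auto simp: has_path_Nil intro: acc.nil)
  next
    case (step p p')
    show ?case
    proof (intro allI impI)
      fix u x assume p: "p = (Suc u, x)" "u \<in> verts G"
      from step(1) consider a u' y where "p' = (Suc u', y)" "(u, a, u') \<in> edges G" "Submission.step x (Some a) y"
        | y where "p' = (Suc u, y)" "Submission.step x None y"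
        unfolding move_def p by auto
      then show "\<exists>w. acc x w \<and> has_path G u w v"
      proof cases
        case 1
        then obtain w where "acc y w" "has_path G u' w v" using step.IH[OF step.prems] edge by blast
        then show ?thesis using 1 p(2) by (intro exI[of _ "a # w"]) (auto simp: has_path_Cons intro: acc.sym)
      next
        case 2
        then obtain w where "acc y w" "has_path G u w v" using step.IH[OF step.prems] p(2) by blast
        then show ?thesis using acc.eps[OF 2(2)] by blast
      qed
    qed
  qed
  show "((Suc u, x), (Suc v, [])) \<in> (move (edges G))\<^sup>* \<and> u \<in> verts G \<Longrightarrow> \<exists>w\<in>langs x. has_path G u w v"
    using gen[OF _ refl] unfolding acc_iff by blast
  have "acc x w \<Longrightarrow> has_path G u w v \<Longrightarrow> ((Suc u, x), (Suc v, [])) \<in> (move (edges G))\<^sup>* \<and> u \<in> verts G" for u x w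
  proof (induction arbitrary: u rule: acc.induct)
    case nil
    then show ?case by (auto simp: has_path_Nil)
  next
    case (eps x y w)
    then have IH: "((Suc u, y), (Suc v, [])) \<in> (move (edges G))\<^sup>*" "u \<in> verts G" by blast+
    then have "((Suc u, x), (Suc u, y)) \<in> move (edges G)" using eps(1) V by (auto simp: move_def)
    then show ?case using IH by (meson converse_rtrancl_into_rtrancl)
  next
    case (sym x a y w)
    then obtain u' where u': "u \<in> verts G" "(u, a, u') \<in> edges G" "has_path G u' w v" by (auto simp: has_path_Cons)
    then have "((Suc u, x), (Suc u', y)) \<in> move (edges G)" using sym(1) by (auto simp: move_def)
    then show ?case using sym.IH[OF u'(3)] u'(1) by (meson converse_rtrancl_into_rtrancl)
  qed
  then show "\<exists>w\<in>langs x. has_path G u w v \<Longrightarrow> ((Suc u, x), (Suc v, [])) \<in> (move (edges G))\<^sup>* \<and> u \<in> verts G"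
    by (auto simp: acc_iff)
qed

section \<open>Automata as edge templates\<close>

type_synonym 's raw = "nat option \<times> endpoint \<times> 's \<times> endpoint \<times> 's"

definition raw_rel :: "'s raw set \<Rightarrow> (nat \<times> nat \<times> nat) set \<Rightarrow> ((nat \<times> 's) \<times> (nat \<times> 's)) set" where
  "raw_rel R Es = {((pick a (Suc u) (Suc w), x), (pick b (Suc u) (Suc w), y)) | l a x b y u c w.
     (l, a, x, b, y) \<in> R \<and> (u, c, w) \<in> Es \<and> (l = None \<or> l = Some c)}"

definition flip :: "'s raw \<Rightarrow> 's raw" where
  "flip = (\<lambda>(l, a, x, b, y). (l, b, y, a, x))"

lemma raw_rel_flip: "raw_rel (flip ` R) Es = (raw_rel R Es)\<inverse>"
  unfolding raw_rel_def flip_def by (auto; force)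

text \<open>Templates are instantiated per edge, so a step without input is offered at both end
  points. As every vertex has an incident edge, it becomes available everywhere.\<close>

definition nfa :: "nat rexp \<Rightarrow> nat rexp list raw set" where
  "nfa r = {(l, a, x, b, y). x \<in> conts r \<and> step x l y \<and>
    ((\<exists>c. l = Some c) \<and> a = Src \<and> b = Tgt \<or> l = None \<and> (a = Src \<and> b = Src \<or> a = Tgt \<and> b = Tgt))}"

lemma nfa_iff: "(l, a, x, b, y) \<in> nfa r \<longleftrightarrow> x \<in> conts r \<and> step x l y \<and>
    ((\<exists>c. l = Some c) \<and> a = Src \<and> b = Tgt \<or> l = None \<and> (a = Src \<and> b = Src \<or> a = Tgt \<and> b = Tgt))"
  by (simp add: nfa_def)

lemma finite_nfa: "finite (nfa r)"
proof (rule finite_subset)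
  show "nfa r \<subseteq> label ` conts r \<times> {Src, Tgt} \<times> conts r \<times> {Src, Tgt} \<times> conts r"
    using step_label conts_step by (auto simp: nfa_def)
  show "finite (label ` conts r \<times> {Src, Tgt} \<times> conts r \<times> {Src, Tgt} \<times> conts r)"
    using conts_basic[of r] by simp
qed

lemma raw_rel_nfa: "((v, x), (w, y)) \<in> raw_rel (nfa r) Es \<longleftrightarrow> x \<in> conts r \<and> ((v, x), (w, y)) \<in> move Es"
proof
  assume "((v, x), (w, y)) \<in> raw_rel (nfa r) Es"
  then obtain l a b u c w' where *: "(l, a, x, b, y) \<in> nfa r" "(u, c, w') \<in> Es" "l = None \<or> l = Some c"
    "v = pick a (Suc u) (Suc w')" "w = pick b (Suc u) (Suc w')" by (auto simp: raw_rel_def)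
  have "Suc u \<in> endpoints Es" "Suc w' \<in> endpoints Es" using *(2) by (force simp: endpoints_def)+
  then show "x \<in> conts r \<and> ((v, x), (w, y)) \<in> move Es" using * unfolding nfa_iff move_def by auto
next
  assume "x \<in> conts r \<and> ((v, x), (w, y)) \<in> move Es"
  then have x: "x \<in> conts r" and "((v, x), (w, y)) \<in> move Es" by auto
  then consider u u' a where "v = Suc u" "w = Suc u'" "(u, a, u') \<in> Es" "step x (Some a) y"
    | "v = w" "v \<in> endpoints Es" "step x None y" by (auto simp: move_def)
  then show "((v, x), (w, y)) \<in> raw_rel (nfa r) Es"
  proof cases
    case 1
    then have "(Some a, Src, x, Tgt, y) \<in> nfa r" using x by (simp add: nfa_iff)
    then show ?thesis using 1 unfolding raw_rel_def by force
  next
    case 2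
    then obtain u c u' where e: "(u, c, u') \<in> Es" "v = Suc u \<or> v = Suc u'" by (auto simp: endpoints_def)
    have "(None, Src, x, Src, y) \<in> nfa r" "(None, Tgt, x, Tgt, y) \<in> nfa r" using 2 x by (simp_all add: nfa_iff)
    then show ?thesis using e 2 unfolding raw_rel_def by force
  qed
qed

lemma raw_rel_nfa_rtrancl:
  assumes "x \<in> conts r"
  shows "((v, x), q) \<in> (raw_rel (nfa r) Es)\<^sup>* \<longleftrightarrow> ((v, x), q) \<in> (move Es)\<^sup>*"
proof
  have "raw_rel (nfa r) Es \<subseteq> move Es" using raw_rel_nfa by auto
  then show "((v, x), q) \<in> (raw_rel (nfa r) Es)\<^sup>* \<Longrightarrow> ((v, x), q) \<in> (move Es)\<^sup>*" using rtrancl_mono by blast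
  assume "((v, x), q) \<in> (move Es)\<^sup>*"
  then have "((v, x), q) \<in> (raw_rel (nfa r) Es)\<^sup>* \<and> snd q \<in> conts r"
  proof (induction rule: rtrancl_induct)
    case base
    then show ?case using assms by simp
  next
    case (step p q)
    obtain a b c d where pq: "p = (a, b)" "q = (c, d)" by (cases p; cases q)
    have "Submission.step b None d \<or> (\<exists>l. Submission.step b (Some l) d)" using step(2) unfolding move_def pq by auto
    then have "d \<in> conts r" using conts_step step(3) pq by auto
    moreover have "(p, q) \<in> raw_rel (nfa r) Es" using step(2,3) raw_rel_nfa pq by auto
    ultimately show ?case using step(3) pq by (auto intro: rtrancl_into_rtrancl)
  qed
  then show "((v, x), q) \<in> (raw_rel (nfa r) Es)\<^sup>*" by blast
qed

lemma nfa_path: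
  assumes "\<And>u. u \<in> verts G \<longleftrightarrow> Suc u \<in> endpoints (edges G)" "u \<in> verts G"
  shows "((Suc u, [r]), (Suc v, [])) \<in> (raw_rel (nfa r) (edges G))\<^sup>* \<longleftrightarrow> (\<exists>w\<in>lang r. has_path G u w v)"
  using move_path[OF assms(1), of u "[r]" v] assms(2) conts_basic[of r] by (simp add: raw_rel_nfa_rtrancl)

text \<open>A step of \<open>A\<close> from the image of \<open>f\<close> is the image of a step of
  \<open>B\<close>, so no path of \<open>A\<close> that starts in the image can leave it.
  \<open>A\<close> may contain further edges elsewhere, here those of the other automata.\<close>

lemma rtrancl_embed:
  assumes emb: "\<And>a z. P a \<Longrightarrow> (f a, z) \<in> A \<longleftrightarrow> (\<exists>b. (a, b) \<in> B \<and> z = f b)" and P: "\<And>a b. (a, b) \<in> B \<Longrightarrow> P b"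
    and inj: "\<And>a b. P a \<Longrightarrow> P b \<Longrightarrow> f a = f b \<Longrightarrow> a = b" and ab: "P a" "P b"
  shows "(f a, f b) \<in> A\<^sup>* \<longleftrightarrow> (a, b) \<in> B\<^sup>*"
proof
  have "(f a, z) \<in> A\<^sup>* \<Longrightarrow> \<exists>c. z = f c \<and> (a, c) \<in> B\<^sup>* \<and> P c" for z
  proof (induction rule: rtrancl_induct)
    case base
    then show ?case using ab by blast
  next
    case (step y z)
    then obtain c where c: "y = f c" "(a, c) \<in> B\<^sup>*" "P c" by blast
    then obtain d where "(c, d) \<in> B" "z = f d" using emb step(2) by blast
    then show ?case using c P rtrancl_into_rtrancl by metis
  qed
  then show "(f a, f b) \<in> A\<^sup>* \<Longrightarrow> (a, b) \<in> B\<^sup>*" using inj ab by metis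
  show "(a, b) \<in> B\<^sup>* \<Longrightarrow> (f a, f b) \<in> A\<^sup>*"
  proof -
    assume "(a, b) \<in> B\<^sup>*"
    then have "(f a, f b) \<in> A\<^sup>* \<and> P b"
    proof (induction rule: rtrancl_induct)
      case base
      then show ?case using ab by simp
    next
      case (step c d)
      then have "(f c, f d) \<in> A" using emb by blast
      then show ?case using step P by (meson rtrancl_into_rtrancl)
    qed
    then show ?thesis by blast
  qed
qed

text \<open>States are numbered together with the index of their constraint and a Boolean that
  separates the automaton from its reversal. As the codes are disjoint, no path in the joint product
  can switch from one automaton to another.\<close>

lemma coding:
  fixes R :: "nat \<Rightarrow> 's raw set" and b f :: "nat \<Rightarrow> 's"
  assumes fin: "\<And>i. finite (R i)"
  shows "\<exists>Q ts q t q' t'. 0 < Q \<and> (\<forall>(l, a, x, c, y)\<in>set ts. x < Q \<and> y < Q) \<and>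
    (\<forall>i\<in>{1..m}. q i < Q \<and> t i < Q \<and> q' i < Q \<and> t' i < Q) \<and>
    (\<forall>es. \<forall>i\<in>{1..m}. \<forall>v w.
      ((Q * v + q i, Q * w + t i) \<in> (product_edges Q ts es)\<^sup>* \<longleftrightarrow> ((v, b i), (w, f i)) \<in> (raw_rel (R i) (set es))\<^sup>*) \<and>
      ((Q * w + q' i, Q * v + t' i) \<in> (product_edges Q ts es)\<^sup>* \<longleftrightarrow> ((v, b i), (w, f i)) \<in> (raw_rel (R i) (set es))\<^sup>*))"
proof -
  define X where "X = (\<Union>i\<in>{1..m}. {b i, f i} \<union> (\<Union>(l, a, x, c, y)\<in>R i. {x, y}))"
  have "finite X" unfolding X_def using fin by auto
  then have "finite ({1..m} \<times> (UNIV :: bool set) \<times> X)" by simp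
  from ex_bij_betw_finite_nat[OF this] obtain code where
    bij: "bij_betw code ({1..m} \<times> (UNIV :: bool set) \<times> X) {0..<card ({1..m} \<times> (UNIV :: bool set) \<times> X)}" by blast
  \<comment> \<open>\<open>Suc\<close> keeps \<open>Q\<close> positive even if there are no states
    at all, as for a query without atoms.\<close>
  define Q where "Q = Suc (card ({1..m} \<times> (UNIV :: bool set) \<times> X))"
  have code: "code (i, d, x) < Q" if "i \<in> {1..m}" "x \<in> X" for i d x
    using bij that unfolding bij_betw_def Q_def by (metis SigmaI UNIV_I atLeastLessThan_iff imageI less_SucI)
  have code_inj: "i = i' \<and> d = d' \<and> x = x'"
    if "code (i, d, x) = code (i', d', x')" "i \<in> {1..m}" "x \<in> X" "i' \<in> {1..m}" "x' \<in> X" for i d x i' d' x'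
  proof -
    have "inj_on code ({1..m} \<times> UNIV \<times> X)" using bij by (simp add: bij_betw_def)
    then have "(i, d, x) = (i', d', x')" using that(1) by (rule inj_onD) (use that in auto)
    then show ?thesis by simp
  qed
  have RX: "x \<in> X \<and> y \<in> X" if "(l, a, x, c, y) \<in> R i" "i \<in> {1..m}" for l a x c y i
    using that unfolding X_def by (auto; force)
  have bf: "b i \<in> X" "f i \<in> X" if "i \<in> {1..m}" for i using that unfolding X_def by auto
  define TS where "TS = (\<Union>i\<in>{1..m}. (\<lambda>(l, a, x, c, y). (l, a, code (i, True, x), c, code (i, True, y))) ` R i \<union>
     (\<lambda>(l, a, x, c, y). (l, c, code (i, False, y), a, code (i, False, x))) ` R i)"
  have "finite TS" unfolding TS_def using fin by auto
  then obtain ts where ts: "set ts = TS" using finite_list by blast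
  have bound: "x < Q \<and> y < Q" if "(l, a, x, c, y) \<in> set ts" for l a x c y
    using that RX code unfolding ts TS_def by fastforce
  have pe: "(z, z') \<in> product_edges Q ts es \<longleftrightarrow> (\<exists>l a x c y u d w. (l, a, x, c, y) \<in> TS \<and> (u, d, w) \<in> set es \<and>
      (l = None \<or> l = Some d) \<and> z = Q * pick a (Suc u) (Suc w) + x \<and> z' = Q * pick c (Suc u) (Suc w) + y)" for z z' es
  proof -
    have m: "matches (l, a, x, c, y) d \<longleftrightarrow> l = None \<or> l = Some d" for l a x c y d
      by (auto split: option.splits)
    have "(z, z') \<in> product_edges Q ts es \<longleftrightarrow>
        (\<exists>e\<in>set es. \<exists>T\<in>TS. matches T (fst (snd e)) \<and> (z, z') = link Q T e)"
      unfolding product_edges_def links_of_def ts by blast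
    also have "\<dots> \<longleftrightarrow> (\<exists>l a x c y u d w. (u, d, w) \<in> set es \<and> (l, a, x, c, y) \<in> TS \<and> matches (l, a, x, c, y) d \<and>
        (z, z') = link Q (l, a, x, c, y) (u, d, w))"
      unfolding Bex_def split_paired_Ex fst_conv snd_conv by blast
    finally show ?thesis unfolding m link.simps prod.inject by blast
  qed
  have fwd: "(Q * v + code (i, True, x), z) \<in> product_edges Q ts es \<longleftrightarrow>
      (\<exists>w y. ((v, x), (w, y)) \<in> raw_rel (R i) (set es) \<and> z = Q * w + code (i, True, y))" (is "?l \<longleftrightarrow> ?r")
    if i: "i \<in> {1..m}" "x \<in> X" for i v x z es
  proof
    assume ?l
    then obtain l a x' c y' u d w where *: "(l, a, x', c, y') \<in> TS" "(u, d, w) \<in> set es" "l = None \<or> l = Some d"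
      "Q * v + code (i, True, x) = Q * pick a (Suc u) (Suc w) + x'" "z = Q * pick c (Suc u) (Suc w) + y'"
      unfolding pe by blast
    have "x' < Q" using bound *(1) unfolding ts by blast
    then have vx: "v = pick a (Suc u) (Suc w)" "code (i, True, x) = x'"
      using address_inject[OF code[OF i] _ *(4)] by auto
    from *(1) obtain j l' a' x1 c' y1 where j: "j \<in> {1..m}" "(l', a', x1, c', y1) \<in> R j"
      "(l, a, x', c, y') = (l', a', code (j, True, x1), c', code (j, True, y1)) \<or>
       (l, a, x', c, y') = (l', c', code (j, False, y1), a', code (j, False, x1))"
      unfolding TS_def by auto
    note rx = RX[OF j(2,1)]
    from j(3) have "i = j \<and> x = x1 \<and> (l, a, c, y') = (l', a', c', code (j, True, y1))"
    proof
      assume "(l, a, x', c, y') = (l', a', code (j, True, x1), c', code (j, True, y1))"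
      then show ?thesis using code_inj[of i True x j True x1] vx(2) i j(1) rx by auto
    next
      assume "(l, a, x', c, y') = (l', c', code (j, False, y1), a', code (j, False, x1))"
      then show ?thesis using code_inj[of i True x j False y1] vx(2) i j(1) rx by auto
    qed
    then have "(l, a, x, c, y1) \<in> R i" "y' = code (i, True, y1)" using j(2) by auto
    then show ?r using * vx unfolding raw_rel_def by blast
  next
    assume ?r
    then obtain w y where wy: "((v, x), (w, y)) \<in> raw_rel (R i) (set es)" "z = Q * w + code (i, True, y)" by blast
    then obtain l a c u d w' where *: "(l, a, x, c, y) \<in> R i" "(u, d, w') \<in> set es" "l = None \<or> l = Some d"
      "v = pick a (Suc u) (Suc w')" "w = pick c (Suc u) (Suc w')" unfolding raw_rel_def by auto
    have "(l, a, code (i, True, x), c, code (i, True, y)) \<in> TS" using *(1) i(1) unfolding TS_def by force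
    then show ?l unfolding pe using * wy(2) by blast
  qed
  have bwd: "(Q * v + code (i, False, x), z) \<in> product_edges Q ts es \<longleftrightarrow>
      (\<exists>w y. ((w, y), (v, x)) \<in> raw_rel (R i) (set es) \<and> z = Q * w + code (i, False, y))" (is "?l \<longleftrightarrow> ?r")
    if i: "i \<in> {1..m}" "x \<in> X" for i v x z es
  proof
    assume ?l
    then obtain l a x' c y' u d w where *: "(l, a, x', c, y') \<in> TS" "(u, d, w) \<in> set es" "l = None \<or> l = Some d"
      "Q * v + code (i, False, x) = Q * pick a (Suc u) (Suc w) + x'" "z = Q * pick c (Suc u) (Suc w) + y'"
      unfolding pe by blast
    have "x' < Q" using bound *(1) unfolding ts by blast
    then have vx: "v = pick a (Suc u) (Suc w)" "code (i, False, x) = x'"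
      using address_inject[OF code[OF i] _ *(4)] by auto
    from *(1) obtain j l' a' x1 c' y1 where j: "j \<in> {1..m}" "(l', a', x1, c', y1) \<in> R j"
      "(l, a, x', c, y') = (l', a', code (j, True, x1), c', code (j, True, y1)) \<or>
       (l, a, x', c, y') = (l', c', code (j, False, y1), a', code (j, False, x1))"
      unfolding TS_def by auto
    note rx = RX[OF j(2,1)]
    from j(3) have "i = j \<and> x = y1 \<and> (l, a, c, y') = (l', c', a', code (j, False, x1))"
    proof
      assume "(l, a, x', c, y') = (l', a', code (j, True, x1), c', code (j, True, y1))"
      then show ?thesis using code_inj[of i False x j True x1] vx(2) i j(1) rx by auto
    next
      assume "(l, a, x', c, y') = (l', c', code (j, False, y1), a', code (j, False, x1))"
      then show ?thesis using code_inj[of i False x j False y1] vx(2) i j(1) rx by auto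
    qed
    then have "(l, c, x1, a, x) \<in> R i" "y' = code (i, False, x1)" using j(2) by auto
    then show ?r using * vx unfolding raw_rel_def by blast
  next
    assume ?r
    then obtain w y where wy: "((w, y), (v, x)) \<in> raw_rel (R i) (set es)" "z = Q * w + code (i, False, y)" by blast
    then obtain l a c u d w' where *: "(l, a, y, c, x) \<in> R i" "(u, d, w') \<in> set es" "l = None \<or> l = Some d"
      "w = pick a (Suc u) (Suc w')" "v = pick c (Suc u) (Suc w')" unfolding raw_rel_def by auto
    have "(l, c, code (i, False, x), a, code (i, False, y)) \<in> TS" using *(1) i(1) unfolding TS_def by force
    then show ?l unfolding pe using * wy(2) by blast
  qed
  have relX: "x \<in> X \<and> y \<in> X" if "((v, x), (w, y)) \<in> raw_rel (R i) Es" "i \<in> {1..m}" for v x w y i Es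
    using that RX unfolding raw_rel_def by blast
  have main: "((Q * v + code (i, True, b i), Q * w + code (i, True, f i)) \<in> (product_edges Q ts es)\<^sup>* \<longleftrightarrow>
      ((v, b i), (w, f i)) \<in> (raw_rel (R i) (set es))\<^sup>*) \<and>
    ((Q * w + code (i, False, f i), Q * v + code (i, False, b i)) \<in> (product_edges Q ts es)\<^sup>* \<longleftrightarrow>
      ((v, b i), (w, f i)) \<in> (raw_rel (R i) (set es))\<^sup>*)" if i: "i \<in> {1..m}" for i v w es
  proof
    let ?P = "\<lambda>p. snd p \<in> X"
    let ?f = "\<lambda>d p. Q * fst p + code (i, d, snd p)"
    have inj: "p = p'" if "?P p" "?P p'" "?f d p = ?f d p'" for d p p'
      using address_inject[OF code[OF i that(1)] code[OF i that(2)] that(3)] code_inj[OF _ i that(1) i that(2)]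
      by (auto intro: prod_eqI)
    have "(?f True (v, b i), ?f True (w, f i)) \<in> (product_edges Q ts es)\<^sup>* \<longleftrightarrow> ((v, b i), (w, f i)) \<in> (raw_rel (R i) (set es))\<^sup>*"
    proof (rule rtrancl_embed[where P = ?P])
      show "(?f True p, z) \<in> product_edges Q ts es \<longleftrightarrow> (\<exists>p'. (p, p') \<in> raw_rel (R i) (set es) \<and> z = ?f True p')"
        if "?P p" for p z using fwd[OF i that, of "fst p" z es] by auto
      show "?P p'" if "(p, p') \<in> raw_rel (R i) (set es)" for p p'
        using relX[of "fst p" "snd p" "fst p'" "snd p'"] that i by simp
    qed (use bf[OF i] inj in auto)
    then show "(Q * v + code (i, True, b i), Q * w + code (i, True, f i)) \<in> (product_edges Q ts es)\<^sup>* \<longleftrightarrow>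
      ((v, b i), (w, f i)) \<in> (raw_rel (R i) (set es))\<^sup>*" by simp
    have "(?f False (w, f i), ?f False (v, b i)) \<in> (product_edges Q ts es)\<^sup>* \<longleftrightarrow>
      ((w, f i), (v, b i)) \<in> ((raw_rel (R i) (set es))\<inverse>)\<^sup>*"
    proof (rule rtrancl_embed[where P = ?P])
      show "(?f False p, z) \<in> product_edges Q ts es \<longleftrightarrow> (\<exists>p'. (p, p') \<in> (raw_rel (R i) (set es))\<inverse> \<and> z = ?f False p')"
        if "?P p" for p z using bwd[OF i that, of "fst p" z es] by auto
      show "?P p'" if "(p, p') \<in> (raw_rel (R i) (set es))\<inverse>" for p p'
        using relX[of "fst p'" "snd p'" "fst p" "snd p"] that i by simp
    qed (use bf[OF i] inj in auto)
    then show "(Q * w + code (i, False, f i), Q * v + code (i, False, b i)) \<in> (product_edges Q ts es)\<^sup>* \<longleftrightarrow>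
      ((v, b i), (w, f i)) \<in> (raw_rel (R i) (set es))\<^sup>*" by (simp add: rtrancl_converse)
  qed
  show ?thesis
  proof (intro exI conjI)
    show "0 < Q" by (simp add: Q_def)
    show "\<forall>(l, a, x, c, y)\<in>set ts. x < Q \<and> y < Q" using bound by blast
    show "\<forall>i\<in>{1..m}. code (i, True, b i) < Q \<and> code (i, True, f i) < Q \<and> code (i, False, f i) < Q \<and> code (i, False, b i) < Q"
      using code bf by blast
    show "\<forall>es. \<forall>i\<in>{1..m}. \<forall>v w.
      ((Q * v + code (i, True, b i), Q * w + code (i, True, f i)) \<in> (product_edges Q ts es)\<^sup>* \<longleftrightarrow>
        ((v, b i), (w, f i)) \<in> (raw_rel (R i) (set es))\<^sup>*) \<and>
      ((Q * w + code (i, False, f i), Q * v + code (i, False, b i)) \<in> (product_edges Q ts es)\<^sup>* \<longleftrightarrow>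
        ((v, b i), (w, f i)) \<in> (raw_rel (R i) (set es))\<^sup>*)"
      using main by blast
  qed
qed

section \<open>Queries as tree-shaped constraints\<close>

text \<open>The edges from the virtual vertex 0 to all vertices: roots of the forest become its children.\<close>

definition root_raw :: "nat rexp list raw set" where
  "root_raw = {(None, Root, [], Src, [REps]), (None, Root, [], Tgt, [REps])}"

lemma root_raw_rtrancl: "((0, []), (w, [REps])) \<in> (raw_rel root_raw Es)\<^sup>* \<longleftrightarrow> w \<in> endpoints Es"
proof
  assume "((0, []), (w, [REps])) \<in> (raw_rel root_raw Es)\<^sup>*"
  then obtain p where "(p, (w, [REps])) \<in> raw_rel root_raw Es" by (auto elim: rtranclE)
  then obtain u c x where "(u, c, x) \<in> Es" "w = Suc u \<or> w = Suc x" by (auto simp: raw_rel_def root_raw_def)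
  then show "w \<in> endpoints Es" by (force simp: endpoints_def)
next
  assume "w \<in> endpoints Es"
  then obtain u c x where "(u, c, x) \<in> Es" "w = Suc u \<or> w = Suc x" by (auto simp: endpoints_def)
  then have "((0, []), (w, [REps])) \<in> raw_rel root_raw Es" unfolding raw_rel_def root_raw_def by force
  then show "((0, []), (w, [REps])) \<in> (raw_rel root_raw Es)\<^sup>*" by (rule r_into_rtrancl)
qed

lemma finite_query_output: "finite (verts G) \<Longrightarrow> finite (free Q) \<Longrightarrow> finite (query_output Q G)"
  by (rule finite_subset[OF _ finite_PiE[of "free Q" "\<lambda>_. verts G"]]) (auto simp: query_output_def)

locale indexed_query =
  fixes Q :: "('x, nat) crpq" and m :: nat and vx :: "nat \<Rightarrow> 'x" and par :: "nat \<Rightarrow> nat"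
  assumes crpq: "is_crpq Q" and acyclic: "acyclic_crpq Q"
    and bij: "bij_betw vx {1..m} (vars Q)" and par: "i \<in> {1..m} \<Longrightarrow> par i < i"
    and L: "links (query_graph Q) = {{vx i, vx (par i)} | i. i \<in> {1..m} \<and> par i \<noteq> 0}"
    and F: "i \<in> {1..m} \<Longrightarrow> vx i \<in> free Q \<Longrightarrow> par i \<noteq> 0 \<Longrightarrow> vx (par i) \<in> free Q"
begin

definition idx :: "'x \<Rightarrow> nat" where "idx = inv_into {1..m} vx"

lemma idx: "X \<in> vars Q \<Longrightarrow> idx X \<in> {1..m} \<and> vx (idx X) = X"
  using bij inv_into_into[of X vx "{1..m}"] f_inv_into_f[of X vx "{1..m}"]
  unfolding idx_def bij_betw_def by simp

lemma idx_vx: "i \<in> {1..m} \<Longrightarrow> idx (vx i) = i"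
  using bij by (simp add: idx_def bij_betw_def inv_into_f_f)

lemma vx_in: "i \<in> {1..m} \<Longrightarrow> vx i \<in> vars Q"
  using bij by (auto simp: bij_betw_def)

lemma par_in: "i \<in> {1..m} \<Longrightarrow> par i \<noteq> 0 \<Longrightarrow> par i \<in> {1..m}"
  using par[of i] by auto

definition atom :: "nat \<Rightarrow> 'x \<times> nat rexp \<times> 'x" where
  "atom i = (SOME A. A \<in> set (body Q) \<and> (case A of (X, r, Y) \<Rightarrow> {X, Y} = {vx i, vx (par i)}))"

lemma atom:
  assumes "i \<in> {1..m}" "par i \<noteq> 0"
  shows "atom i \<in> set (body Q) \<and> (case atom i of (X, r, Y) \<Rightarrow> {X, Y} = {vx i, vx (par i)})"
proof -
  have "{vx i, vx (par i)} \<in> links (query_graph Q)" using L assms by blast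
  then obtain A where "A \<in> set (body Q) \<and> (case A of (X, r, Y) \<Rightarrow> {X, Y} = {vx i, vx (par i)})"
    by (force simp: query_graph_def)
  then show ?thesis unfolding atom_def by (rule someI)
qed

text \<open>Without parallel edges the end points determine the atom, so the choice made by
  \<open>atom\<close> misses none.\<close>

lemma atom_cover:
  assumes A: "A \<in> set (body Q)"
  shows "\<exists>i\<in>{1..m}. par i \<noteq> 0 \<and> atom i = A"
proof -
  let ?f = "\<lambda>(X, r, Y). {X, Y}"
  have "?f A \<in> links (query_graph Q)" using A by (simp add: query_graph_def)
  then obtain i where i: "?f A = {vx i, vx (par i)}" "i \<in> {1..m}" "par i \<noteq> 0" unfolding L by blast
  have "?f (atom i) = {vx i, vx (par i)}" using atom[OF i(2,3)] by (auto split: prod.splits)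
  then have eq: "?f (atom i) = ?f A" by (simp only: i(1))
  have "inj_on ?f (set (body Q))" using acyclic by (simp add: acyclic_crpq_def distinct_map)
  from inj_onD[OF this eq conjunct1[OF atom[OF i(2,3)]] A] have "atom i = A" .
  then show ?thesis using i by blast
qed

definition forward :: "nat \<Rightarrow> bool" where
  "forward i \<longleftrightarrow> fst (atom i) = vx (par i)"

definition expr :: "nat \<Rightarrow> nat rexp" where "expr i = fst (snd (atom i))"

lemma atom_eq:
  assumes "i \<in> {1..m}" "par i \<noteq> 0"
  shows "atom i = (if forward i then (vx (par i), expr i, vx i) else (vx i, expr i, vx (par i)))"
proof -
  obtain X r Y where A: "atom i = (X, r, Y)" by (cases "atom i") auto
  then have XY: "{X, Y} = {vx i, vx (par i)}" using atom[OF assms] by simp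
  have "vx i \<noteq> vx (par i)"
    using idx_vx[OF assms(1)] idx_vx[OF par_in[OF assms]] par[OF assms(1)] by auto
  then show ?thesis using A XY by (auto simp: forward_def expr_def doubleton_eq_iff)
qed

text \<open>Constraints lead from parent to child. An atom written in the opposite direction uses
  the flipped automaton, with its initial and final state exchanged in \<open>st\<close> and
  \<open>fn\<close>.\<close>

definition Rw :: "nat \<Rightarrow> nat rexp list raw set" where
  "Rw i = (if par i = 0 then root_raw else if forward i then nfa (expr i) else flip ` nfa (expr i))"

definition st :: "nat \<Rightarrow> nat rexp list" where
  "st i = (if par i = 0 then [] else if forward i then [expr i] else [])"

definition fn :: "nat \<Rightarrow> nat rexp list" where
  "fn i = (if par i = 0 then [REps] else if forward i then [] else [expr i])"

lemma finite_Rw: "finite (Rw i)"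
  by (simp add: Rw_def root_raw_def finite_nfa)

definition holds :: "(nat, nat) lgraph \<Rightarrow> ('x \<Rightarrow> nat) \<Rightarrow> bool" where
  "holds G \<mu> \<longleftrightarrow> (\<forall>(X, r, Y)\<in>set (body Q). \<exists>w\<in>lang r. has_path G (\<mu> X) w (\<mu> Y))"

lemma holds_iff: "holds G \<mu> \<longleftrightarrow> (\<forall>i\<in>{1..m}. par i \<noteq> 0 \<longrightarrow>
    (\<exists>w\<in>lang (expr i). if forward i then has_path G (\<mu> (vx (par i))) w (\<mu> (vx i))
       else has_path G (\<mu> (vx i)) w (\<mu> (vx (par i)))))" (is "_ \<longleftrightarrow> ?r")
proof
  assume h: "holds G \<mu>"
  have "\<exists>w\<in>lang (expr i). if forward i then has_path G (\<mu> (vx (par i))) w (\<mu> (vx i))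
       else has_path G (\<mu> (vx i)) w (\<mu> (vx (par i)))" if i: "i \<in> {1..m}" "par i \<noteq> 0" for i
    using h atom[OF i] atom_eq[OF i] unfolding holds_def by (cases "forward i") fastforce+
  then show ?r by blast
next
  assume r: ?r
  have "case A of (X, r, Y) \<Rightarrow> \<exists>w\<in>lang r. has_path G (\<mu> X) w (\<mu> Y)" if A: "A \<in> set (body Q)" for A
  proof -
    obtain i where i: "i \<in> {1..m}" "par i \<noteq> 0" "atom i = A" using atom_cover[OF A] by blast
    show ?thesis using r[rule_format, OF i(1,2)] atom_eq[OF i(1,2)] i(3) by (cases "forward i") auto
  qed
  then show "holds G \<mu>" by (simp add: holds_def)
qed

lemma raw_path:
  assumes G: "edge_labeled_graph G" and i: "i \<in> {1..m}" "par i \<noteq> 0" and uv: "u \<in> verts G" "v \<in> verts G"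
    and V: "\<And>u. u \<in> verts G \<longleftrightarrow> Suc u \<in> endpoints (edges G)"
  shows "((Suc u, st i), (Suc v, fn i)) \<in> (raw_rel (Rw i) (edges G))\<^sup>* \<longleftrightarrow>
    (\<exists>w\<in>lang (expr i). if forward i then has_path G u w v else has_path G v w u)"
proof (cases "forward i")
  case True
  then show ?thesis using nfa_path[OF V uv(1), of "expr i" v] i(2) by (simp add: st_def fn_def Rw_def)
next
  case False
  have "((Suc u, []), (Suc v, [expr i])) \<in> (raw_rel (flip ` nfa (expr i)) (edges G))\<^sup>* \<longleftrightarrow>
      ((Suc v, [expr i]), (Suc u, [])) \<in> (raw_rel (nfa (expr i)) (edges G))\<^sup>*"
    by (simp add: raw_rel_flip rtrancl_converse)
  then show ?thesis using False nfa_path[OF V uv(2), of "expr i" u] i(2) by (simp add: st_def fn_def Rw_def)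
qed

definition free_idx :: "nat list" where
  "free_idx = sorted_list_of_set {i \<in> {1..m}. vx i \<in> free Q}"

lemma set_free_idx: "set free_idx = {i \<in> {1..m}. vx i \<in> free Q}"
  by (simp add: free_idx_def)

lemma sorted_free_idx: "sorted_wrt (<) free_idx"
  by (simp add: free_idx_def)

lemma evaluation:
  assumes Xs: "distinct Xs" "set Xs = free Q"
  shows "\<exists>(p :: prog) (C :: nat). \<forall>G. edge_labeled_graph G \<longrightarrow> (\<forall>es. distinct es \<and> set es = edges G \<longrightarrow>
     (\<exists>t. computes_output p Q Xs G es t \<and>
       (\<forall>d\<ge>1. (\<forall>c. c * c \<le> 4 * OUT\<^sub>c Q G \<longrightarrow> c \<le> d) \<longrightarrow> t \<le> C * (d * (length es + 1) + OUT Q G + 1))))"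
proof -
  from coding[of Rw m st fn, OF finite_Rw] obtain K ts q t q' t' where K0: "0 < K"
    and K1: "\<forall>(l, a, x, c, y)\<in>set ts. x < K \<and> y < K"
    and K2: "\<forall>i\<in>{1..m}. q i < K \<and> t i < K \<and> q' i < K \<and> t' i < K"
    and codes: "\<forall>es. \<forall>i\<in>{1..m}. \<forall>v w.
      ((K * v + q i, K * w + t i) \<in> (product_edges K ts es)\<^sup>* \<longleftrightarrow> ((v, st i), (w, fn i)) \<in> (raw_rel (Rw i) (set es))\<^sup>*) \<and>
      ((K * w + q' i, K * v + t' i) \<in> (product_edges K ts es)\<^sup>* \<longleftrightarrow> ((v, st i), (w, fn i)) \<in> (raw_rel (Rw i) (set es))\<^sup>*)"
    by (elim exE conjE) (rule that)
  note code = codes[rule_format]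
  define xs where "xs = map idx Xs"
  have freeV: "free Q \<subseteq> vars Q" using crpq by (simp add: is_crpq_def)
  have finF: "finite (free Q)" using Xs(2) by (metis finite_set)
  have set_xs: "set xs = set free_idx"
  proof (intro equalityI subsetI)
    fix i assume "i \<in> set xs"
    then obtain Y where "Y \<in> free Q" "i = idx Y" using Xs(2) by (auto simp: xs_def)
    then show "i \<in> set free_idx" using idx[of Y] freeV by (auto simp: set_free_idx)
  next
    fix i assume "i \<in> set free_idx"
    then have "vx i \<in> set Xs" "i = idx (vx i)" using idx_vx Xs(2) by (auto simp: set_free_idx)
    then show "i \<in> set xs" by (simp add: xs_def)
  qed
  have closed: "par i \<in> insert 0 (set free_idx)" if "i \<in> set free_idx" for i
    using that F par_in unfolding set_free_idx by blast
  have sub: "set free_idx \<subseteq> {1..m}" by (auto simp: set_free_idx)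
  let ?p = "whole K m par q t q' t' ts free_idx xs"
  let ?p' = "Seq boot (ccm (22 + 2 * m) ?p)"
  let ?cc = "ccost (22 + 2 * m) ?p"
  let ?A = "(2 * m + 5 * length ts + 20) + (2 * m * (4 * K + 140) + m * (30 * K + 800) + 6) * (length ts + 4 * K + 1)"
  let ?C = "7 + ?cc * (?A + (6 * m + 1))"
  have "\<exists>T. computes_output ?p' Q Xs G es T \<and>
       (\<forall>d\<ge>1. (\<forall>c. c * c \<le> 4 * OUT\<^sub>c Q G \<longrightarrow> c \<le> d) \<longrightarrow> T \<le> ?C * (d * (length es + 1) + OUT Q G + 1))"
    if G: "edge_labeled_graph G" and es: "distinct es" "set es = edges G" for G es
  proof -
    let ?X = "endpoints (set es)"
    have V: "u \<in> verts G \<longleftrightarrow> Suc u \<in> endpoints (edges G)" for u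
    proof
      assume "u \<in> verts G"
      then obtain x a y where "(x, a, y) \<in> edges G" "u = x \<or> u = y" using G unfolding edge_labeled_graph_def by blast
      then show "Suc u \<in> endpoints (edges G)" by (force simp: endpoints_def)
    next
      assume "Suc u \<in> endpoints (edges G)"
      then show "u \<in> verts G" using G by (auto simp: endpoints_def edge_labeled_graph_def)
    qed
    have X: "?X = Suc ` verts G"
    proof (intro equalityI subsetI)
      fix y assume y: "y \<in> ?X"
      then obtain u where "y = Suc u" by (auto simp: endpoints_def)
      then show "y \<in> Suc ` verts G" using y V[of u] es(2) by simp
    qed (use V es(2) in auto)
    have conv: "(K * v + q i, K * w + t i) \<in> (product_edges K ts es)\<^sup>* \<longleftrightarrow> (K * w + q' i, K * v + t' i) \<in> (product_edges K ts es)\<^sup>*"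
      if "i \<in> {1..m}" for i v w using code[OF that] by blast
    let ?conn = "linked K ts q t es"
    interpret tr: tree m par ?X ?conn
      by unfold_locales (use par in \<open>auto simp: linked_def\<close>)
    let ?S = "{a. tr.sat a}"
    have sat: "tr.sat a \<longleftrightarrow> a 0 = 0 \<and> (\<exists>\<mu>\<in>vars Q \<rightarrow>\<^sub>E verts G. holds G \<mu> \<and> (\<forall>i\<in>{1..m}. a i = Suc (\<mu> (vx i))))" for a
    proof
      assume s: "tr.sat a"
      then have a0: "a 0 = 0" and c: "\<And>i. i \<in> {1..m} \<Longrightarrow> ?conn i (a (par i)) (a i)" by (auto simp: tr.sat_def)
      have aX: "\<exists>u\<in>verts G. a i = Suc u" if "i \<in> {1..m}" for i
        using c[OF that] X by (auto simp: linked_def)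
      define \<mu> where "\<mu> = restrict (\<lambda>Y. a (idx Y) - 1) (vars Q)"
      have \<mu>: "a i = Suc (\<mu> (vx i))" "\<mu> (vx i) \<in> verts G" if "i \<in> {1..m}" for i
        using aX[OF that] idx_vx[OF that] vx_in[OF that] by (auto simp: \<mu>_def)
      have "\<mu> Y \<in> verts G" if "Y \<in> vars Q" for Y
        using \<mu>(2)[of "idx Y"] idx[OF that] by simp
      then have "\<mu> \<in> vars Q \<rightarrow>\<^sub>E verts G" by (auto simp: \<mu>_def)
      moreover have "holds G \<mu>" unfolding holds_iff
      proof (intro ballI impI)
        fix i assume i: "i \<in> {1..m}" "par i \<noteq> 0"
        have "((Suc (\<mu> (vx (par i))), st i), (Suc (\<mu> (vx i)), fn i)) \<in> (raw_rel (Rw i) (edges G))\<^sup>*"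
          using c[OF i(1)] code[OF i(1), of "a (par i)" "a i" es] es(2) \<mu>(1)[OF i(1)] \<mu>(1)[OF par_in[OF i]]
          by (simp add: linked_def)
        then show "\<exists>w\<in>lang (expr i). if forward i then has_path G (\<mu> (vx (par i))) w (\<mu> (vx i))
          else has_path G (\<mu> (vx i)) w (\<mu> (vx (par i)))"
          using raw_path[OF G i \<mu>(2)[OF par_in[OF i]] \<mu>(2)[OF i(1)] V] by blast
      qed
      ultimately show "a 0 = 0 \<and> (\<exists>\<mu>\<in>vars Q \<rightarrow>\<^sub>E verts G. holds G \<mu> \<and> (\<forall>i\<in>{1..m}. a i = Suc (\<mu> (vx i))))"
        using a0 \<mu>(1) by blast
    next
      assume "a 0 = 0 \<and> (\<exists>\<mu>\<in>vars Q \<rightarrow>\<^sub>E verts G. holds G \<mu> \<and> (\<forall>i\<in>{1..m}. a i = Suc (\<mu> (vx i))))"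
      then obtain \<mu> where a0: "a 0 = 0" and \<mu>: "\<mu> \<in> vars Q \<rightarrow>\<^sub>E verts G" "holds G \<mu>" "\<forall>i\<in>{1..m}. a i = Suc (\<mu> (vx i))"
        by blast
      have mv: "\<mu> (vx i) \<in> verts G" if "i \<in> {1..m}" for i using \<mu>(1) vx_in[OF that] by auto
      have "?conn i (a (par i)) (a i)" if i: "i \<in> {1..m}" for i
      proof -
        have aX: "a j \<in> ?X" if "j \<in> {1..m}" for j using \<mu>(3) mv that X by auto
        have "((a (par i), st i), (a i, fn i)) \<in> (raw_rel (Rw i) (set es))\<^sup>*"
        proof (cases "par i = 0")
          case True
          then show ?thesis using root_raw_rtrancl aX[OF i] a0 by (simp add: st_def fn_def Rw_def)
        next
          case False
          have h: "\<exists>w\<in>lang (expr i). if forward i then has_path G (\<mu> (vx (par i))) w (\<mu> (vx i))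
            else has_path G (\<mu> (vx i)) w (\<mu> (vx (par i)))"
            using \<mu>(2) i False unfolding holds_iff by blast
          then have "((Suc (\<mu> (vx (par i))), st i), (Suc (\<mu> (vx i)), fn i)) \<in> (raw_rel (Rw i) (edges G))\<^sup>*"
            using raw_path[OF G i False mv[OF par_in[OF i False]] mv[OF i] V] by blast
          then show ?thesis using \<mu>(3) i par_in[OF i False] es(2) by simp
        qed
        then have "(K * a (par i) + q i, K * a i + t i) \<in> (product_edges K ts es)\<^sup>*" using code[OF i] by blast
        moreover have "a (par i) \<in> insert 0 ?X" using a0 aX par_in[OF i] by (cases "par i = 0") auto
        ultimately show ?thesis using aX[OF i] by (simp add: linked_def)
      qed
      then show "tr.sat a" using a0 by (simp add: tr.sat_def)
    qed
    have out: "query_output Q G = (\<lambda>\<mu>. restrict \<mu> (free Q)) ` {\<mu> \<in> vars Q \<rightarrow>\<^sub>E verts G. holds G \<mu>}"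
    proof (intro equalityI subsetI)
      fix \<mu> assume "\<mu> \<in> query_output Q G"
      then obtain \<mu>' where m: "\<mu> \<in> free Q \<rightarrow>\<^sub>E verts G" "\<mu>' \<in> vars Q \<rightarrow>\<^sub>E verts G" "\<forall>X\<in>free Q. \<mu>' X = \<mu> X" "holds G \<mu>'"
        unfolding query_output_def holds_def by blast
      have "\<mu> = restrict \<mu>' (free Q)"
      proof
        fix Y show "\<mu> Y = restrict \<mu>' (free Q) Y"
          using bspec[OF m(3), of Y] PiE_arb[OF m(1), of Y] by (cases "Y \<in> free Q") simp_all
      qed
      then show "\<mu> \<in> (\<lambda>\<mu>. restrict \<mu> (free Q)) ` {\<mu> \<in> vars Q \<rightarrow>\<^sub>E verts G. holds G \<mu>}" using m by blast
    next
      fix \<mu> assume "\<mu> \<in> (\<lambda>\<mu>. restrict \<mu> (free Q)) ` {\<mu> \<in> vars Q \<rightarrow>\<^sub>E verts G. holds G \<mu>}"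
      then obtain \<mu>' where m: "\<mu> = restrict \<mu>' (free Q)" "\<mu>' \<in> vars Q \<rightarrow>\<^sub>E verts G" "holds G \<mu>'" by blast
      then have "\<mu> \<in> free Q \<rightarrow>\<^sub>E verts G" using freeV by auto
      then show "\<mu> \<in> query_output Q G" using m unfolding query_output_def holds_def by auto
    qed
    have lift: "\<exists>a. tr.sat a \<and> (\<forall>i\<in>{1..m}. a i = Suc (\<mu> (vx i)))" if "\<mu> \<in> vars Q \<rightarrow>\<^sub>E verts G" "holds G \<mu>" for \<mu>
      using that unfolding sat by (intro exI[of _ "\<lambda>i. if i = 0 then 0 else Suc (\<mu> (vx i))"]) auto
    have tuple: "map (\<lambda>i. a i - 1) xs = map (restrict \<mu> (free Q)) Xs" if "\<forall>i\<in>{1..m}. a i = Suc (\<mu> (vx i))" for a \<mu>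
    proof -
      have "a (idx Y) - 1 = restrict \<mu> (free Q) Y" if "Y \<in> set Xs" for Y
      proof -
        have "Y \<in> vars Q" "Y \<in> free Q" using that Xs(2) freeV by auto
        then show ?thesis using idx[of Y] \<open>\<forall>i\<in>{1..m}. a i = Suc (\<mu> (vx i))\<close> by simp
      qed
      then show ?thesis by (simp add: xs_def)
    qed
    have res: "(\<lambda>a. map (\<lambda>i. a i - 1) xs) ` ?S = (\<lambda>\<mu>. map \<mu> Xs) ` query_output Q G"
    proof (intro equalityI subsetI)
      fix y assume "y \<in> (\<lambda>a. map (\<lambda>i. a i - 1) xs) ` ?S"
      then obtain a where a: "tr.sat a" "y = map (\<lambda>i. a i - 1) xs" by blast
      then obtain \<mu> where "\<mu> \<in> vars Q \<rightarrow>\<^sub>E verts G" "holds G \<mu>" "\<forall>i\<in>{1..m}. a i = Suc (\<mu> (vx i))" unfolding sat by blast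
      then show "y \<in> (\<lambda>\<mu>. map \<mu> Xs) ` query_output Q G" unfolding out using tuple[of a \<mu>] a(2) by blast
    next
      fix y assume "y \<in> (\<lambda>\<mu>. map \<mu> Xs) ` query_output Q G"
      then obtain \<mu> where m: "\<mu> \<in> vars Q \<rightarrow>\<^sub>E verts G" "holds G \<mu>" "y = map (restrict \<mu> (free Q)) Xs" unfolding out by blast
      from lift[OF m(1,2)] obtain a where a: "tr.sat a" "\<forall>i\<in>{1..m}. a i = Suc (\<mu> (vx i))" by blast
      show "y \<in> (\<lambda>a. map (\<lambda>i. a i - 1) xs) ` ?S"
        by (rule image_eqI[of _ _ a]) (use a tuple[OF a(2)] m(3) in simp_all)
    qed
    have "inj_on (\<lambda>\<mu>. map \<mu> Xs) (query_output Q G)"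
    proof (rule inj_onI)
      fix \<mu> \<nu> assume m: "\<mu> \<in> query_output Q G" "\<nu> \<in> query_output Q G" "map \<mu> Xs = map \<nu> Xs"
      then have "\<forall>X\<in>free Q. \<mu> X = \<nu> X" using Xs(2) by auto
      moreover have "\<mu> \<in> free Q \<rightarrow>\<^sub>E verts G" "\<nu> \<in> free Q \<rightarrow>\<^sub>E verts G" using m(1,2) unfolding query_output_def by blast+
      ultimately show "\<mu> = \<nu>" by (intro PiE_ext) auto
    qed
    then have card: "card ((\<lambda>a. map (\<lambda>i. a i - 1) xs) ` ?S) = OUT Q G"
      unfolding res OUT_def by (rule card_image)
    have finO: "finite (query_output Q G)" using finite_query_output finF G by (auto simp: edge_labeled_graph_def)
    \<comment> \<open>The values at \<open>i\<close> and its parent can be read off the calibrated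
      tuple of an atom that contains both, and both are free. For a root the parent contributes the
      constant 0, and any atom that mentions the variable will do.\<close>
    have pairs: "card ((\<lambda>a. (a (par i), a i)) ` ?S) \<le> OUT\<^sub>c Q G" if i: "i \<in> set free_idx" for i
    proof -
      have im: "i \<in> {1..m}" "vx i \<in> free Q" using i by (auto simp: set_free_idx)
      obtain A where A: "A \<in> set (body Q)" "vx i \<in> (case A of (X, r, Y) \<Rightarrow> {X, Y})"
        "par i \<noteq> 0 \<Longrightarrow> vx (par i) \<in> (case A of (X, r, Y) \<Rightarrow> {X, Y})"
      proof (cases "par i = 0")
        case True
        have "vx i \<in> vars Q" using vx_in[OF im(1)] .
        then show ?thesis using that True unfolding vars_def by blast
      next
        case False
        show ?thesis using that[of "atom i"] atom[OF im(1) False] by (auto split: prod.splits)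
      qed
      obtain X r Y where XY: "A = (X, r, Y)" by (cases A) auto
      let ?B = "free Q \<inter> {X, Y}"
      have B: "vx i \<in> ?B" "par i \<noteq> 0 \<Longrightarrow> vx (par i) \<in> ?B" using A(2,3) XY im F by auto
      then have cal: "calibrated_output Q G A = (\<lambda>\<mu>. restrict \<mu> ?B) ` query_output Q G"
        unfolding calibrated_output_def XY by auto
      let ?g = "\<lambda>\<nu>. (if par i = 0 then 0 else Suc (\<nu> (vx (par i))), Suc (\<nu> (vx i)))"
      have "(\<lambda>a. (a (par i), a i)) ` ?S \<subseteq> ?g ` calibrated_output Q G A"
      proof
        fix y assume "y \<in> (\<lambda>a. (a (par i), a i)) ` ?S"
        then obtain a where a: "tr.sat a" "y = (a (par i), a i)" by blast
        then obtain \<mu> where m: "\<mu> \<in> vars Q \<rightarrow>\<^sub>E verts G" "holds G \<mu>" "\<forall>i\<in>{1..m}. a i = Suc (\<mu> (vx i))" "a 0 = 0"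
          unfolding sat by blast
        let ?\<nu> = "restrict (restrict \<mu> (free Q)) ?B"
        have "?\<nu> \<in> calibrated_output Q G A" unfolding cal out using m by blast
        moreover have "y = ?g ?\<nu>" using a(2) m(3,4) im(1) par_in[OF im(1)] B by (cases "par i = 0") auto
        ultimately show "y \<in> ?g ` calibrated_output Q G A" by blast
      qed
      moreover have finC: "finite (calibrated_output Q G A)" unfolding cal using finO by simp
      ultimately have "card ((\<lambda>a. (a (par i), a i)) ` ?S) \<le> card (?g ` calibrated_output Q G A)"
        by (intro card_mono) auto
      also have "\<dots> \<le> card (calibrated_output Q G A)" using finC by (rule card_image_le)
      also have "\<dots> \<le> OUT\<^sub>c Q G" unfolding OUT\<^sub>c_def using A(1) by (intro Max_ge) auto
      finally show ?thesis .
    qed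
    let ?w = "encode_edges es"
    have ts: "x < K \<and> y < K" if "(l, a, x, c, y) \<in> set ts" for l a x c y using bspec[OF K1 that] by simp
    have len: "length ?w = 3 * hd ?w + 1" using length_encode_edges[of es] by (simp add: encode_edges_def)
    have states: "q i < K \<and> t i < K \<and> q' i < K \<and> t' i < K" if "i \<in> {1..m}" for i using bspec[OF K2 that] .
    obtain T s and a :: st where fin: "exec ?p' (initial ?w) T s" "out s = ou a" "T \<le> 7 + ?cc * tm a"
      "distinct (ou a)" "set (ou a) = (\<lambda>a. map (\<lambda>i. a i - 1) xs) ` ?S"
      "\<forall>d\<ge>1. (\<forall>i\<in>set free_idx. \<forall>c. c * c \<le> 4 * card ((\<lambda>a. (a (par i), a i)) ` ?S) \<longrightarrow> c \<le> d) \<longrightarrow>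
         tm a \<le> ?A * (d * (length es + 1)) + (6 * m + 1) * card ((\<lambda>a. map (\<lambda>i. a i - 1) xs) ` ?S)"
      by (rule exE[OF exec_compiled[OF len wf_whole[OF par sub] wp_whole[where q = q and t = t and q' = q' and t' = t',
            OF K0 ts states par sorted_free_idx sub closed set_xs conv]]])
        (assumption+, elim exE conjE, rule that)
    have "computes_output ?p' Q Xs G es T"
      unfolding computes_output_def by (rule exI[of _ s]) (use fin(1,2,4,5) res in simp)
    moreover have "T \<le> ?C * (d * (length es + 1) + OUT Q G + 1)"
      if d: "d \<ge> 1" "\<forall>c. c * c \<le> 4 * OUT\<^sub>c Q G \<longrightarrow> c \<le> d" for d
    proof -
      have "\<forall>i\<in>set free_idx. \<forall>c. c * c \<le> 4 * card ((\<lambda>a. (a (par i), a i)) ` ?S) \<longrightarrow> c \<le> d"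
        using pairs d(2) by (meson le_trans mult_le_mono2)
      then have "tm a \<le> ?A * (d * (length es + 1)) + (6 * m + 1) * OUT Q G" using fin(6) d(1) card by simp
      also have "\<dots> \<le> (?A + (6 * m + 1)) * (d * (length es + 1) + OUT Q G + 1)"
      proof -
        have "A * x + B * y \<le> (A + B) * (x + y + 1)" for A B x y :: nat by (simp add: algebra_simps)
        then show ?thesis by blast
      qed
      finally have "?cc * tm a \<le> ?cc * ((?A + (6 * m + 1)) * (d * (length es + 1) + OUT Q G + 1))"
        by (rule mult_le_mono2)
      moreover have "7 + x * (y * z) \<le> (7 + x * y) * z" if "1 \<le> z" for x y z :: nat
        using that by (simp add: algebra_simps)
      then have "7 + ?cc * ((?A + (6 * m + 1)) * (d * (length es + 1) + OUT Q G + 1)) \<le> ?C * (d * (length es + 1) + OUT Q G + 1)"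
        by (simp only: le_add2)
      ultimately show ?thesis using fin(3) by linarith
    qed
    ultimately show ?thesis by blast
  qed
  then show ?thesis by blast
qed

end

theorem proposition3:
  shows
    "(\<forall>Q :: ('x, 'a) crpq. is_crpq Q \<and> free_connex Q \<longrightarrow> cw Q = 0) \<and>
     (\<forall>Q :: ('x, nat) crpq. is_crpq Q \<and> free_connex Q \<longrightarrow>
       (\<forall>Xs. distinct Xs \<and> set Xs = free Q \<longrightarrow>
         (\<exists>(p :: prog) (c :: real).
           \<forall>G :: (nat, nat) lgraph. edge_labeled_graph G \<longrightarrow>
             (\<forall>es. distinct es \<and> set es = edges G \<longrightarrow>
               (\<exists>t. computes_output p Q Xs G es t \<and>
                 (edges G \<noteq> {} \<longrightarrow>
                   real t \<le> c * (real (card (edges G))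
                               + real (card (edges G)) * sqrt (real (OUT\<^sub>c Q G))
                               + real (OUT Q G))))))))"
proof (intro conjI allI impI)
  show "cw Q = 0" if "is_crpq Q \<and> free_connex Q" for Q :: "('x, 'a) crpq"
    using cw_zero that by blast
next
  fix Q :: "('x, nat) crpq" and Xs
  assume Q: "is_crpq Q \<and> free_connex Q" and Xs: "distinct Xs \<and> set Xs = free Q"
  note facts = query_graph_facts[of Q, OF conjunct2[OF Q] conjunct1[OF Q]]
  obtain m :: nat and vx par where bij: "bij_betw vx {1..m} (nodes (query_graph Q))" and par: "\<And>i. i \<in> {1..m} \<Longrightarrow> par i < i"
    and L: "links (query_graph Q) = {{vx i, vx (par i)} | i. i \<in> {1..m} \<and> par i \<noteq> 0}"
    and F: "\<And>i. i \<in> {1..m} \<Longrightarrow> vx i \<in> free Q \<Longrightarrow> par i \<noteq> 0 \<Longrightarrow> vx (par i) \<in> free Q"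
    by (rule forest_parents[OF facts(1-5)]) (assumption | rule that)+
  interpret indexed_query Q m vx par
    by unfold_locales (use Q bij par L F in \<open>auto simp: free_connex_def query_graph_def\<close>)
  from evaluation[of Xs] Xs obtain p :: prog and C :: nat where
    *: "\<And>G es. edge_labeled_graph G \<Longrightarrow> distinct es \<Longrightarrow> set es = edges G \<Longrightarrow>
      \<exists>t. computes_output p Q Xs G es t \<and>
       (\<forall>d\<ge>1. (\<forall>c. c * c \<le> 4 * OUT\<^sub>c Q G \<longrightarrow> c \<le> d) \<longrightarrow> t \<le> C * (d * (length es + 1) + OUT Q G + 1))"
    by blast
  show "\<exists>(p :: prog) (c :: real). \<forall>G :: (nat, nat) lgraph. edge_labeled_graph G \<longrightarrow>
     (\<forall>es. distinct es \<and> set es = edges G \<longrightarrow> (\<exists>t. computes_output p Q Xs G es t \<and>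
       (edges G \<noteq> {} \<longrightarrow> real t \<le> c * (real (card (edges G)) + real (card (edges G)) * sqrt (real (OUT\<^sub>c Q G))
          + real (OUT Q G)))))"
  proof (rule exI[of _ p], rule exI[of _ "real (5 * C)"], intro allI impI)
    fix G :: "(nat, nat) lgraph" and es assume G: "edge_labeled_graph G" and es: "distinct es \<and> set es = edges G"
    from *[OF G] es obtain t where t: "computes_output p Q Xs G es t"
      "\<forall>d\<ge>1. (\<forall>c. c * c \<le> 4 * OUT\<^sub>c Q G \<longrightarrow> c \<le> d) \<longrightarrow> t \<le> C * (d * (length es + 1) + OUT Q G + 1)" by blast
    let ?n = "card (edges G)" and ?s = "sqrt (real (OUT\<^sub>c Q G))"
    have "real t \<le> real (5 * C) * (real ?n + real ?n * ?s + real (OUT Q G))" if ne: "edges G \<noteq> {}"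
    proof -
      have n: "length es = ?n" using es distinct_card[of es] by simp
      have n1: "1 \<le> ?n" using ne es n by (cases es) auto
      \<comment> \<open>Any integer whose square is at most four times \<open>OUT\<^sub>c\<close> is
        at most \<open>2 * ?s\<close>; the summand 1 makes \<open>d\<close> positive also when
        \<open>OUT\<^sub>c\<close> is 0.\<close>
      define d where "d = nat \<lfloor>1 + 2 * ?s\<rfloor>"
      have d1: "1 \<le> d" unfolding d_def by (simp add: le_nat_iff le_floor_iff)
      have d2: "real d \<le> 1 + 2 * ?s" unfolding d_def by (simp add: of_nat_nat)
      have "c \<le> d" if "c * c \<le> 4 * OUT\<^sub>c Q G" for c
      proof -
        have "real c * real c \<le> 4 * real (OUT\<^sub>c Q G)" using that by (metis of_nat_le_iff of_nat_mult of_nat_numeral)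
        then have "real c \<le> sqrt (4 * real (OUT\<^sub>c Q G))" by (intro real_le_rsqrt) (simp add: power2_eq_square)
        also have "\<dots> = 2 * ?s" by (simp add: real_sqrt_mult)
        finally have "int c \<le> \<lfloor>1 + 2 * ?s\<rfloor>" unfolding le_floor_iff by simp
        then show ?thesis unfolding d_def by simp
      qed
      then have "t \<le> C * (d * (?n + 1) + OUT Q G + 1)" using t(2) d1 n by auto
      then have "real t \<le> real (C * (d * (?n + 1) + OUT Q G + 1))" by (simp only: of_nat_le_iff)
      also have "\<dots> = real C * (real d * (real ?n + 1) + real (OUT Q G) + 1)" by (simp add: algebra_simps)
      \<comment> \<open>A non-empty edge set absorbs the constants through
        \<open>?n + 1 \<le> 2 * ?n\<close> and \<open>1 \<le> ?n\<close>. Expanding gives the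
        coefficients 3, 4 and 1, all below the final factor 5.\<close>
      also have "\<dots> \<le> real C * ((1 + 2 * ?s) * (2 * real ?n) + real (OUT Q G) + real ?n)"
      proof (intro mult_left_mono add_mono mult_mono d2)
        show "0 \<le> 1 + 2 * ?s" by simp
      qed (use n1 in auto)
      also have "\<dots> \<le> real C * (5 * (real ?n + real ?n * ?s + real (OUT Q G)))"
        by (intro mult_left_mono) (auto simp: algebra_simps)
      finally show ?thesis by (simp add: algebra_simps)
    qed
    then show "\<exists>t. computes_output p Q Xs G es t \<and>
       (edges G \<noteq> {} \<longrightarrow> real t \<le> real (5 * C) * (real ?n + real ?n * ?s + real (OUT Q G)))"
      using t(1) by blast
  qed
qed

end
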